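(* Let $\Phi$ be an irreducible crystallographic reduced root system of rank $n$ with simple roots $\alpha_1,\dots,\alpha_n$, and let $G\le\mathrm{Aut}(\Phi)$ be a subgroup. A flasque resolution of $\mathbb{Z}\Phi$ as a $G$-lattice is given by $$0\to\mathbb{Z}\Phi\xrightarrow{\ \mathrm{div}\ }\mathrm{Div}_\Phi\to\mathrm{Pic}(X(\Phi))\to 0,$$ where $\mathrm{Div}_\Phi=\bigoplus_{j=1}^n\bigoplus_{\lambda\in E_j(\Phi)}\mathbb{Z}D_\lambda$ and $\mathrm{div}(\alpha_i)=\sum_{j=1}^n\sum_{\lambda\in E_j(\Phi)}\langle\alpha_i,\lambda\rangle D_\lambda$ for all $i=1,\dots,n$.
   Context: $\mathbb{Z}\Phi$ is the root lattice, $\mathrm{Aut}(\Phi)$ the group of linear automorphisms of $\mathbb{R}\Phi$ preserving $\Phi$, $W(\Phi)$ the Weyl group. The fundamental coweights $\omega_1^\vee,\dots,\omega_n^\vee$ are the basis of the dual lattice $(\mathbb{Z}\Phi)^0=\mathrm{Hom}(\mathbb{Z}\Phi,\mathbb{Z})$ dual to $\alpha_1,\dots,\alpha_n$ under the natural pairing $\langle\cdot,\cdot\rangle$. $E_j(\Phi)=W(\Phi)\cdot\omega_j^\vee$ is the Weyl orbit of $\omega_j^\vee$. $X(\Phi)$ is the toric variety of the root system: the (smooth projective) toric variety, over a field $L$, of the fan in $(\mathbb{Z}\Phi)^0\otimes\mathbb{R}$ consisting of the closed Weyl chambers of $\Phi$ (the cones $w\,\mathrm{Cone}(\omega_1^\vee,\dots,\omega_n^\vee)$,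 $w\in W(\Phi)$) and all their faces; its torus has character lattice $\mathbb{Z}\Phi$. The rays of this fan are generated by the $\lambda\in\bigcup_jE_j(\Phi)$, and $D_\lambda$ is the torus-invariant prime divisor corresponding to the ray of $\lambda$. $\mathrm{Aut}(\Phi)$ acts on the fan, hence on $\mathrm{Div}_\Phi$ by $gD_\lambda=D_{g\lambda}$ and on $\mathrm{Pic}(X(\Phi))$. A $G$-lattice $F$ is flasque if $H^1(H,F^0)=0$ for all subgroups $H\le G$, with $F^0=\mathrm{Hom}(F,\mathbb{Z})$. A flasque resolution of a $G$-lattice $M$ is an exact sequence of $G$-lattices $0\to M\to P\to F\to0$ with $P$ a permutation lattice and $F$ flasque. *)

theory Defs
  imports
    "HOL-Analysis.Analysis"
    "HOL-Algebra.Free_Abelian_Groups"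
    "HOL-Algebra.Generated_Groups"
    "HOL-Algebra.Ideal"
    "HOL-Computational_Algebra.Fraction_Field"
begin

section \<open>Root systems\<close>

definition refl_in :: "'a::real_inner \<Rightarrow> 'a \<Rightarrow> 'a" where
  "refl_in \<alpha> v = v - (2 * (v \<bullet> \<alpha>) / (\<alpha> \<bullet> \<alpha>)) *\<^sub>R \<alpha>"

text \<open>Crystallographic reduced root systems; the ambient space is the span of the roots.\<close>

definition root_system :: "'a::euclidean_space set \<Rightarrow> bool" where
  "root_system \<Phi> \<longleftrightarrow>
     finite \<Phi> \<and> 0 \<notin> \<Phi> \<and> span \<Phi> = UNIV \<and>
     (\<forall>\<alpha>\<in>\<Phi>. refl_in \<alpha> ` \<Phi> = \<Phi>) \<and>
     (\<forall>\<alpha>\<in>\<Phi>. \<forall>\<beta>\<in>\<Phi>. 2 * (\<beta> \<bullet> \<alpha>) / (\<alpha> \<bullet> \<alpha>) \<in> \<int>) \<and>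
     (\<forall>\<alpha>\<in>\<Phi>. \<forall>c. c *\<^sub>R \<alpha> \<in> \<Phi> \<longrightarrow> c = 1 \<or> c = -1)"

definition irreducible_root_system :: "'a::euclidean_space set \<Rightarrow> bool" where
  "irreducible_root_system \<Phi> \<longleftrightarrow>
     root_system \<Phi> \<and> \<Phi> \<noteq> {} \<and>
     \<not> (\<exists>A B. A \<noteq> {} \<and> B \<noteq> {} \<and> A \<union> B = \<Phi> \<and> A \<inter> B = {} \<and> (\<forall>\<alpha>\<in>A. \<forall>\<beta>\<in>B. \<alpha> \<bullet> \<beta> = 0))"

text \<open>Since the roots span the space, so do the simple roots; hence \<open>n\<close> is the rank.\<close>

definition simple_roots :: "'a::euclidean_space set \<Rightarrow> nat \<Rightarrow> (nat \<Rightarrow> 'a) \<Rightarrow> bool" where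
  "simple_roots \<Phi> n \<alpha> \<longleftrightarrow>
     inj_on \<alpha> {1..n} \<and> \<alpha> ` {1..n} \<subseteq> \<Phi> \<and> independent (\<alpha> ` {1..n}) \<and>
     (\<forall>\<beta>\<in>\<Phi>. \<exists>c :: nat \<Rightarrow> int. \<beta> = (\<Sum>i=1..n. of_int (c i) *\<^sub>R \<alpha> i) \<and>
        ((\<forall>i\<in>{1..n}. 0 \<le> c i) \<or> (\<forall>i\<in>{1..n}. c i \<le> 0)))"

definition root_lattice :: "'a::euclidean_space set \<Rightarrow> 'a set" where
  "root_lattice \<Phi> = {v. \<exists>c :: 'a \<Rightarrow> int. v = (\<Sum>\<beta>\<in>\<Phi>. of_int (c \<beta>) *\<^sub>R \<beta>)}"

definition root_lattice_group :: "'a::euclidean_space set \<Rightarrow> 'a monoid" where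
  "root_lattice_group \<Phi> = \<lparr>carrier = root_lattice \<Phi>, monoid.mult = (+), one = 0\<rparr>"

definition Aut_roots :: "'a::euclidean_space set \<Rightarrow> ('a \<Rightarrow> 'a) monoid" where
  "Aut_roots \<Phi> =
     \<lparr>carrier = {g. linear g \<and> bij g \<and> g ` \<Phi> = \<Phi>}, monoid.mult = (\<circ>), one = id\<rparr>"

definition Weyl_group :: "'a::euclidean_space set \<Rightarrow> ('a \<Rightarrow> 'a) set" where
  "Weyl_group \<Phi> = generate (Aut_roots \<Phi>) (refl_in ` \<Phi>)"

text \<open>
  The dual space is identified with the space itself through the inner product: \<open>\<lambda>\<close> stands for
  the functional \<open>m \<mapsto> m \<bullet> \<lambda>\<close>, and the dual lattice for the vectors pairing integrally with the
  roots. On pairs from the two lattices the floor in \<open>pairing\<close> is therefore exact. The automorphism \<open>g\<close>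
  acts contragrediently, so that \<open>g m \<bullet> coact g \<lambda> = m \<bullet> \<lambda>\<close>.
\<close>

definition pairing :: "'a::euclidean_space \<Rightarrow> 'a \<Rightarrow> int" where
  "pairing m l = \<lfloor>m \<bullet> l\<rfloor>"

definition coact :: "('a::euclidean_space \<Rightarrow> 'a) \<Rightarrow> 'a \<Rightarrow> 'a" where
  "coact g = adjoint (inv_into UNIV g)"

definition fund_coweight :: "nat \<Rightarrow> (nat \<Rightarrow> 'a::euclidean_space) \<Rightarrow> nat \<Rightarrow> 'a" where
  "fund_coweight n \<alpha> j = (THE v. \<forall>i\<in>{1..n}. \<alpha> i \<bullet> v = (if i = j then 1 else 0))"

definition coweight_orbit ::
  "'a::euclidean_space set \<Rightarrow> nat \<Rightarrow> (nat \<Rightarrow> 'a) \<Rightarrow> nat \<Rightarrow> 'a set" where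
  "coweight_orbit \<Phi> n \<alpha> j = {coact w (fund_coweight n \<alpha> j) | w. w \<in> Weyl_group \<Phi>}"

definition ray_generators :: "'a::euclidean_space set \<Rightarrow> nat \<Rightarrow> (nat \<Rightarrow> 'a) \<Rightarrow> 'a set" where
  "ray_generators \<Phi> n \<alpha> = (\<Union>j\<in>{1..n}. coweight_orbit \<Phi> n \<alpha> j)"

definition Weyl_fan :: "'a::euclidean_space set \<Rightarrow> nat \<Rightarrow> (nat \<Rightarrow> 'a) \<Rightarrow> 'a set set" where
  "Weyl_fan \<Phi> n \<alpha> =
     {\<tau>. \<tau> \<noteq> {} \<and> (\<exists>w\<in>Weyl_group \<Phi>.
        \<tau> face_of (coact w ` (convex_cone hull (fund_coweight n \<alpha> ` {1..n}))))}"


section \<open>G-lattices and flasque resolutions\<close>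

text \<open>Abelian groups are written multiplicatively, as records.\<close>

definition Z_basis :: "('a, 'b) monoid_scheme \<Rightarrow> 'a set \<Rightarrow> bool" where
  "Z_basis A B \<longleftrightarrow> finite B \<and> B \<subseteq> carrier A \<and>
     bij_betw (\<lambda>c. finprod A (\<lambda>b. b [^]\<^bsub>A\<^esub> (c b :: int)) B) (B \<rightarrow>\<^sub>E UNIV) (carrier A)"

definition G_lattice ::
  "('g, 'x) monoid_scheme \<Rightarrow> ('a, 'b) monoid_scheme \<Rightarrow> ('g \<Rightarrow> 'a \<Rightarrow> 'a) \<Rightarrow> bool" where
  "G_lattice G A act \<longleftrightarrow>
     group G \<and> comm_group A \<and> (\<exists>B. Z_basis A B) \<and>
     (\<forall>g\<in>carrier G. act g \<in> hom A A) \<and>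
     (\<forall>a\<in>carrier A. act \<one>\<^bsub>G\<^esub> a = a) \<and>
     (\<forall>g\<in>carrier G. \<forall>h\<in>carrier G. \<forall>a\<in>carrier A. act (g \<otimes>\<^bsub>G\<^esub> h) a = act g (act h a))"

definition permutation_lattice ::
  "('g, 'x) monoid_scheme \<Rightarrow> ('a, 'b) monoid_scheme \<Rightarrow> ('g \<Rightarrow> 'a \<Rightarrow> 'a) \<Rightarrow> bool" where
  "permutation_lattice G A act \<longleftrightarrow>
     G_lattice G A act \<and> (\<exists>B. Z_basis A B \<and> (\<forall>g\<in>carrier G. act g ` B = B))"

definition dual_lattice :: "('a, 'b) monoid_scheme \<Rightarrow> ('a \<Rightarrow> int) monoid" where
  "dual_lattice A =
     \<lparr>carrier = hom A integer_group \<inter> extensional (carrier A),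
      monoid.mult = (\<lambda>f h. \<lambda>a\<in>carrier A. f a + h a), one = (\<lambda>a\<in>carrier A. 0)\<rparr>"

definition dual_act ::
  "('g, 'x) monoid_scheme \<Rightarrow> ('a, 'b) monoid_scheme \<Rightarrow> ('g \<Rightarrow> 'a \<Rightarrow> 'a) \<Rightarrow>
     'g \<Rightarrow> ('a \<Rightarrow> int) \<Rightarrow> ('a \<Rightarrow> int)" where
  "dual_act G A act g f = (\<lambda>a\<in>carrier A. f (act (inv\<^bsub>G\<^esub> g) a))"

definition cocycles1 ::
  "('g, 'x) monoid_scheme \<Rightarrow> ('a, 'b) monoid_scheme \<Rightarrow> ('g \<Rightarrow> 'a \<Rightarrow> 'a) \<Rightarrow> ('g \<Rightarrow> 'a) monoid" where
  "cocycles1 G A act =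
     \<lparr>carrier = {c \<in> carrier G \<rightarrow>\<^sub>E carrier A.
        \<forall>g\<in>carrier G. \<forall>h\<in>carrier G. c (g \<otimes>\<^bsub>G\<^esub> h) = c g \<otimes>\<^bsub>A\<^esub> act g (c h)},
      monoid.mult = (\<lambda>c d. \<lambda>g\<in>carrier G. c g \<otimes>\<^bsub>A\<^esub> d g), one = (\<lambda>g\<in>carrier G. \<one>\<^bsub>A\<^esub>)\<rparr>"

definition coboundaries1 ::
  "('g, 'x) monoid_scheme \<Rightarrow> ('a, 'b) monoid_scheme \<Rightarrow> ('g \<Rightarrow> 'a \<Rightarrow> 'a) \<Rightarrow> ('g \<Rightarrow> 'a) set" where
  "coboundaries1 G A act = {\<lambda>g\<in>carrier G. act g a \<otimes>\<^bsub>A\<^esub> inv\<^bsub>A\<^esub> a | a. a \<in> carrier A}"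

definition H1 ::
  "('g, 'x) monoid_scheme \<Rightarrow> ('a, 'b) monoid_scheme \<Rightarrow> ('g \<Rightarrow> 'a \<Rightarrow> 'a) \<Rightarrow> ('g \<Rightarrow> 'a) set monoid" where
  "H1 G A act = cocycles1 G A act Mod coboundaries1 G A act"

definition flasque ::
  "('g, 'x) monoid_scheme \<Rightarrow> ('a, 'b) monoid_scheme \<Rightarrow> ('g \<Rightarrow> 'a \<Rightarrow> 'a) \<Rightarrow> bool" where
  "flasque G A act \<longleftrightarrow>
     G_lattice G A act \<and>
     (\<forall>H. subgroup H G \<longrightarrow>
        trivial_group (H1 (G\<lparr>carrier := H\<rparr>) (dual_lattice A) (dual_act G A act)))"

definition flasque_resolution ::
  "('g, 'x) monoid_scheme \<Rightarrow>
   ('m, 'y) monoid_scheme \<Rightarrow> ('g \<Rightarrow> 'm \<Rightarrow> 'm) \<Rightarrow>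
   ('p, 'z) monoid_scheme \<Rightarrow> ('g \<Rightarrow> 'p \<Rightarrow> 'p) \<Rightarrow>
   ('f, 'w) monoid_scheme \<Rightarrow> ('g \<Rightarrow> 'f \<Rightarrow> 'f) \<Rightarrow>
   ('m \<Rightarrow> 'p) \<Rightarrow> ('p \<Rightarrow> 'f) \<Rightarrow> bool" where
  "flasque_resolution G M actM P actP F actF i q \<longleftrightarrow>
     G_lattice G M actM \<and> permutation_lattice G P actP \<and> flasque G F actF \<and>
     i \<in> mon M P \<and> q \<in> epi P F \<and> i ` carrier M = kernel P F q \<and>
     (\<forall>g\<in>carrier G. \<forall>m\<in>carrier M. i (actM g m) = actP g (i m)) \<and>
     (\<forall>g\<in>carrier G. \<forall>p\<in>carrier P. q (actP g p) = actF g (q p))"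


section \<open>Integral schemes as sets of local rings\<close>

text \<open>
  A separated integral scheme glued from affine charts \<open>Spec A\<close>, where the domains \<open>A\<close> are subrings
  of a field with a common field of fractions, is determined by its points viewed as local
  subrings of that field: the points of \<open>Spec A\<close> are the localizations of \<open>A\<close> at its prime ideals,
  two charts are glued along the local rings they share, and the distinguished open subsets
  of the charts form a basis of the topology. In the definitions below \<open>X\<close> is the set of the
  coordinate rings of the charts.
\<close>

definition ring_on :: "'k::field set \<Rightarrow> 'k ring" where
  "ring_on A = \<lparr>carrier = A, monoid.mult = (*), one = 1, zero = 0, add = (+)\<rparr>"

definition localization_at :: "'k::field set \<Rightarrow> 'k set \<Rightarrow> 'k set" where
  "localization_at A P = {a / s | a s. a \<in> A \<and> s \<in> A - P}"

definition spec_points :: "'k::field set \<Rightarrow> 'k set set" where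
  "spec_points A = {localization_at A P | P. primeideal P (ring_on A)}"

definition points :: "'k::field set set \<Rightarrow> 'k set set" where
  "points X = (\<Union>A\<in>X. spec_points A)"

definition zariski :: "'k::field set set \<Rightarrow> 'k set topology" where
  "zariski X = topology_generated_by
     {{x \<in> spec_points A. f \<in> Units (ring_on x)} | A f. A \<in> X \<and> f \<in> A}"

definition function_field :: "'k::field set set \<Rightarrow> 'k set" where
  "function_field X = (\<Union>A\<in>X. {a / b | a b. a \<in> A \<and> b \<in> A \<and> b \<noteq> 0})"

text \<open>
  Cartier divisors are the global sections of the sheaf of nonzero rational functions modulo
  units: a section assigns to each point \<open>x\<close> a coset \<open>f \<cdot> x\<^sup>\<times>\<close> (its value in the stalk), locally
  with a constant representative \<open>f\<close>.
\<close>

definition unit_coset :: "'k::field \<Rightarrow> 'k set \<Rightarrow> 'k set" where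
  "unit_coset f x = (\<lambda>u. f * u) ` Units (ring_on x)"

definition cartier_group :: "'k::field set set \<Rightarrow> ('k set \<Rightarrow> 'k set) monoid" where
  "cartier_group X =
     \<lparr>carrier = {C \<in> extensional (points X). \<forall>x\<in>points X. \<exists>U f.
        openin (zariski X) U \<and> x \<in> U \<and> f \<in> function_field X \<and> f \<noteq> 0 \<and> (\<forall>y\<in>U. C y = unit_coset f y)},
      monoid.mult = (\<lambda>C D. \<lambda>x\<in>points X. {a * b | a b. a \<in> C x \<and> b \<in> D x}),
      one = (\<lambda>x\<in>points X. Units (ring_on x))\<rparr>"

definition principal_divisors :: "'k::field set set \<Rightarrow> ('k set \<Rightarrow> 'k set) set" where
  "principal_divisors X = {\<lambda>x\<in>points X. unit_coset f x | f. f \<in> function_field X \<and> f \<noteq> 0}"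

definition Pic :: "'k::field set set \<Rightarrow> ('k set \<Rightarrow> 'k set) set monoid" where
  "Pic X = cartier_group X Mod principal_divisors X"

text \<open>
  The ideal sheaf of the integral closed subscheme with generic point \<open>z\<close>, by its stalks: a germ
  at a point \<open>x\<close> of the subscheme lies in the ideal iff it lies in the maximal ideal of \<open>z\<close>. For a
  prime divisor on a locally factorial scheme these ideals are principal, and their generators
  are the local equations of the prime divisor, regarded as a Cartier divisor.
\<close>

definition ideal_stalk :: "'k::field set set \<Rightarrow> 'k set \<Rightarrow> 'k set \<Rightarrow> 'k set" where
  "ideal_stalk X z x =
     (if x \<in> (zariski X) closure_of {z} then x \<inter> (z - Units (ring_on z)) else x)"

definition prime_divisor :: "'k::field set set \<Rightarrow> 'k set \<Rightarrow> ('k set \<Rightarrow> 'k set)" where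
  "prime_divisor X z =
     (\<lambda>x\<in>points X. {f \<in> function_field X. f \<noteq> 0 \<and> (\<lambda>u. f * u) ` x = ideal_stalk X z x})"

text \<open>
  The class of the divisor \<open>D = \<Sum> a\<^sub>l Z\<^sub>l\<close>, where \<open>z l\<close> is the generic point of the prime divisor \<open>Z\<^sub>l\<close>.
\<close>

definition divisor_class ::
  "'k::field set set \<Rightarrow> ('l \<Rightarrow> 'k set) \<Rightarrow> ('l \<Rightarrow>\<^sub>0 int) \<Rightarrow> ('k set \<Rightarrow> 'k set) set" where
  "divisor_class X z D =
     principal_divisors X #>\<^bsub>cartier_group X\<^esub>
       finprod (cartier_group X)
         (\<lambda>l. prime_divisor X (z l) [^]\<^bsub>cartier_group X\<^esub> Poly_Mapping.lookup D l)
         (Poly_Mapping.keys D)"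

text \<open>
  An automorphism of the field of functions permuting the charts induces an automorphism of the
  scheme, taking the local ring \<open>x\<close> to its image; divisors are pushed forward.
\<close>

definition cartier_act ::
  "'k::field set set \<Rightarrow> ('k \<Rightarrow> 'k) \<Rightarrow> ('k set \<Rightarrow> 'k set) \<Rightarrow> ('k set \<Rightarrow> 'k set)" where
  "cartier_act X \<phi> C = (\<lambda>x\<in>points X. \<phi> ` C (\<phi> -` x))"

definition pic_act ::
  "'k::field set set \<Rightarrow> ('k \<Rightarrow> 'k) \<Rightarrow> ('k set \<Rightarrow> 'k set) set \<Rightarrow> ('k set \<Rightarrow> 'k set) set" where
  "pic_act X \<phi> c = cartier_act X \<phi> ` c"


section \<open>Group algebras\<close>

text \<open>
  The group algebra of the additive group of a real inner product space. It is a copy of the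
  finitely supported functions with convolution, which the library makes an integral domain
  only for linearly ordered monoids of exponents. The coordinate rings of toric charts are the
  subrings with restricted exponents.
\<close>

typedef (overloaded) ('a, 'k) group_algebra = "UNIV :: ('a \<Rightarrow>\<^sub>0 'k::zero) set"
  morphisms ga_coeffs Abs_ga by simp

setup_lifting type_definition_group_algebra

instantiation group_algebra :: (comm_monoid_add, comm_ring_1) comm_ring_1
begin

lift_definition zero_group_algebra :: "('a, 'b) group_algebra" is 0 .
lift_definition one_group_algebra :: "('a, 'b) group_algebra" is 1 .
lift_definition plus_group_algebra ::
  "('a, 'b) group_algebra \<Rightarrow> ('a, 'b) group_algebra \<Rightarrow> ('a, 'b) group_algebra" is "(+)" .
lift_definition minus_group_algebra ::
  "('a, 'b) group_algebra \<Rightarrow> ('a, 'b) group_algebra \<Rightarrow> ('a, 'b) group_algebra" is "(-)" .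
lift_definition uminus_group_algebra ::
  "('a, 'b) group_algebra \<Rightarrow> ('a, 'b) group_algebra" is uminus .
lift_definition times_group_algebra ::
  "('a, 'b) group_algebra \<Rightarrow> ('a, 'b) group_algebra \<Rightarrow> ('a, 'b) group_algebra" is "(*)" .

instance
  by standard (transfer; simp add: algebra_simps)+

end

text \<open>
  A farthest point from the origin of a sumset \<open>A + B\<close> has a unique representation as a sum.
\<close>

lemma farthest_sum_unique:
  fixes a b a' b' :: "'a::real_inner"
  assumes "a' + b' = a + b"
    and "norm (a + b') \<le> norm (a + b)" and "norm (a' + b) \<le> norm (a + b)"
  shows "a' = a \<and> b' = b"
proof -
  define z u v where "z = a + b" and "u = a + b'" and "v = a' + b"
  have uv: "u + v = 2 *\<^sub>R z"
    using assms(1) by (simp add: z_def u_def v_def scaleR_2 algebra_simps)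
  have le: "u \<bullet> u \<le> z \<bullet> z" "v \<bullet> v \<le> z \<bullet> z"
    using assms(2,3) by (simp_all add: z_def u_def v_def norm_le)
  have v: "v = 2 *\<^sub>R z - u"
    using uv by (simp add: algebra_simps)
  have "(u - z) \<bullet> (u - z) * 2 = u \<bullet> u + v \<bullet> v - 2 * (z \<bullet> z)"
    unfolding v by (simp add: inner_diff_left inner_diff_right inner_commute)
  also have "\<dots> \<le> 0"
    using le by simp
  finally have "(u - z) \<bullet> (u - z) \<le> 0"
    by simp
  then have "u = z"
    by (metis eq_iff_diff_eq_0 inner_ge_zero inner_eq_zero_iff order_antisym)
  then have "b' = b"
    by (simp add: u_def z_def)
  then show ?thesis
    using assms(1) by simp
qed

lemma poly_mapping_times_nonzero:
  fixes p q :: "'a::real_inner \<Rightarrow>\<^sub>0 'k::idom"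
  assumes "p \<noteq> 0" and "q \<noteq> 0"
  shows "p * q \<noteq> 0"
proof -
  let ?A = "Poly_Mapping.keys p" and ?B = "Poly_Mapping.keys q"
  have "?A \<times> ?B \<noteq> {}" "finite (?A \<times> ?B)"
    using assms by auto
  then have "Max ((\<lambda>cd. norm (fst cd + snd cd)) ` (?A \<times> ?B)) \<in> (\<lambda>cd. norm (fst cd + snd cd)) ` (?A \<times> ?B)"
    by (intro Max_in) blast+
  then obtain ab where ab: "ab \<in> ?A \<times> ?B"
    and "Max ((\<lambda>cd. norm (fst cd + snd cd)) ` (?A \<times> ?B)) = norm (fst ab + snd ab)"
    by blast
  then have max: "norm (fst cd + snd cd) \<le> norm (fst ab + snd ab)" if "cd \<in> ?A \<times> ?B" for cd
    using that \<open>finite (?A \<times> ?B)\<close> by (metis (mono_tags, lifting) Max_ge finite_imageI imageI)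
  obtain a b where [simp]: "ab = (a, b)"
    by (cases ab)
  have "a \<in> ?A" "b \<in> ?B"
    using ab by auto
  have uniq: "a' = a \<and> b' = b" if "a' \<in> ?A" "b' \<in> ?B" "a' + b' = a + b" for a' b'
    using farthest_sum_unique[OF that(3)] max[of "(a, b')"] max[of "(a', b)"] that ab by simp
  have "(\<Sum>b'. Poly_Mapping.lookup q b' when a + b = a' + b') =
      (Poly_Mapping.lookup q b when a' = a)" if "a' \<in> ?A" for a'
  proof -
    have "(Poly_Mapping.lookup q b' when a + b = a' + b') =
        ((Poly_Mapping.lookup q b when a' = a) when b' = b)" for b'
    proof (cases "b' \<in> ?B \<and> a + b = a' + b'")
      case True
      then have "a' = a \<and> b' = b"
        using uniq[of a' b'] that by simp
      then show ?thesis
        by simp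
    next
      case False
      then show ?thesis
        by (auto simp: when_def in_keys_iff)
    qed
    then show ?thesis
      by simp
  qed
  then have "Poly_Mapping.lookup p a' * (\<Sum>b'. Poly_Mapping.lookup q b' when a + b = a' + b') =
      (Poly_Mapping.lookup p a * Poly_Mapping.lookup q b when a' = a)" for a'
    by (cases "a' \<in> ?A") (auto simp: when_def in_keys_iff)
  then have "Poly_Mapping.lookup (p * q) (a + b) = Poly_Mapping.lookup p a * Poly_Mapping.lookup q b"
    by (simp add: lookup_mult)
  also have "\<dots> \<noteq> 0"
    using \<open>a \<in> ?A\<close> \<open>b \<in> ?B\<close> by (simp add: in_keys_iff)
  finally show ?thesis
    by auto
qed

instance group_algebra :: (real_inner, idom) idom
  by standard (transfer; simp add: poly_mapping_times_nonzero)


section \<open>Toric varieties\<close>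

text \<open>
  For a set \<open>S\<close> of exponents closed under addition: the algebra \<open>L[S]\<close> inside the field of fractions
  of the group algebra.
\<close>

definition monoid_algebra ::
  "'a::real_inner set \<Rightarrow> ('a, 'k::field) group_algebra fract set" where
  "monoid_algebra S = {Fract p 1 | p. Poly_Mapping.keys (ga_coeffs p) \<subseteq> S}"

definition dual_monoid :: "'a::real_inner set \<Rightarrow> 'a set \<Rightarrow> 'a set" where
  "dual_monoid M \<sigma> = {m \<in> M. \<forall>v\<in>\<sigma>. 0 \<le> m \<bullet> v}"

text \<open>The toric variety of a fan, with character lattice \<open>M\<close>, as the set of its affine charts.\<close>

definition toric_variety ::
  "'a::real_inner set \<Rightarrow> 'a set set \<Rightarrow> ('a, 'k::field) group_algebra fract set set" where
  "toric_variety M \<Sigma> = (\<lambda>\<sigma>. monoid_algebra (dual_monoid M \<sigma>)) ` \<Sigma>"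

text \<open>
  The generic point of the divisor \<open>D\<^sub>\<lambda>\<close>, the closure of the torus orbit of the ray of \<open>\<lambda>\<close>: in the
  chart of the ray, the orbit is cut out by the characters pairing positively with \<open>\<lambda>\<close>.
\<close>

definition ray_divisor_point ::
  "'a::real_inner set \<Rightarrow> 'a \<Rightarrow> ('a, 'k::field) group_algebra fract set" where
  "ray_divisor_point M l =
     (let S = dual_monoid M (convex_cone hull {l})
      in localization_at (monoid_algebra S) (monoid_algebra {m \<in> S. 0 < m \<bullet> l}))"

text \<open>The action \<open>g \<chi>\<^sup>m = \<chi>\<^bsup>g m\<^esup>\<close> on the group algebra and on its field of fractions.\<close>

definition ga_act ::
  "('a \<Rightarrow> 'a) \<Rightarrow> ('a, 'k::zero) group_algebra \<Rightarrow> ('a, 'k) group_algebra" where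
  "ga_act g p = Abs_ga (Poly_Mapping.map_key (inv_into UNIV g) (ga_coeffs p))"

definition fract_act ::
  "('a \<Rightarrow> 'a) \<Rightarrow> ('a::real_inner, 'k::field) group_algebra fract \<Rightarrow> ('a, 'k) group_algebra fract" where
  "fract_act g y =
     (let (p, q) = (SOME (p, q). q \<noteq> 0 \<and> y = Fract p q) in Fract (ga_act g p) (ga_act g q))"


section \<open>The toric variety of a root system\<close>

definition root_toric_variety ::
  "'a::euclidean_space set \<Rightarrow> nat \<Rightarrow> (nat \<Rightarrow> 'a) \<Rightarrow> ('a, 'k::field) group_algebra fract set set" where
  "root_toric_variety \<Phi> n \<alpha> = toric_variety (root_lattice \<Phi>) (Weyl_fan \<Phi> n \<alpha>)"

definition Div_roots ::
  "'a::euclidean_space set \<Rightarrow> nat \<Rightarrow> (nat \<Rightarrow> 'a) \<Rightarrow> ('a \<Rightarrow>\<^sub>0 int) monoid" where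
  "Div_roots \<Phi> n \<alpha> = free_Abelian_group (ray_generators \<Phi> n \<alpha>)"

definition Div_act ::
  "('a::euclidean_space \<Rightarrow> 'a) \<Rightarrow> ('a \<Rightarrow>\<^sub>0 int) \<Rightarrow> ('a \<Rightarrow>\<^sub>0 int)" where
  "Div_act g = frag_extend (\<lambda>l. frag_of (coact g l))"

definition div_map ::
  "'a::euclidean_space set \<Rightarrow> nat \<Rightarrow> (nat \<Rightarrow> 'a) \<Rightarrow> 'a \<Rightarrow> ('a \<Rightarrow>\<^sub>0 int)" where
  "div_map \<Phi> n \<alpha> m = (\<Sum>l\<in>ray_generators \<Phi> n \<alpha>. frag_cmul (pairing m l) (frag_of l))"

end

theory Submission
  imports Defs
begin

text \<open>
  The sequence is the exact sequence \<open>0 \<longrightarrow> M \<longrightarrow> Div \<longrightarrow> Pic X \<longrightarrow> 0\<close> of the smooth toric variety \<open>X\<close>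
  of the Weyl fan, with \<open>M\<close> the root lattice and \<open>Div\<close> the permutation lattice on the rays.
  There are three things to see: that it is exact, that it is equivariant, and that \<open>Pic X\<close> is
  flasque.

  Exactness holds for every smooth toric variety whose maximal cones are full-dimensional. The
  chart of a maximal cone is the spectrum of a polynomial ring, which has greatest common
  divisors (\<open>gcd_ring_polys_on\<close>, \<open>gcd_ring_monoid_algebra\<close>), and on such a spectrum every
  Cartier divisor is principal (\<open>locally_principal_gcd_ring\<close>). Two equations of the same Cartier
  divisor on two charts differ by a unit on the torus, and such a unit is a scalar times a
  character (\<open>unit_is_monomial\<close>). Hence, after division by its equation on one chart, a Cartier
  divisor has characters as its local equations, and is a combination of the divisors of the
  rays (\<open>cartier_class_toric\<close>). For the same reason a combination of the divisors of the rays is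
  principal only if it is the divisor of a character (\<open>cls_eq_one_iff\<close>).

  For equivariance, and to recognize the chambers as a fan, the combinatorics of the Weyl group
  is needed: every vector is conjugate to a dominant one, only one element of an orbit is
  dominant (\<open>dominant_fixed\<close>), and every automorphism of the root system is the product of a
  Weyl group element and a permutation of the simple roots (\<open>Aut_decomposition\<close>).

  For flasqueness let \<open>H\<close> be a subgroup. Dualizing the sequence, which splits over the integers,
  gives \<open>0 \<longrightarrow> (Pic X)\<^sup>0 \<longrightarrow> Div\<^sup>0 \<longrightarrow> M\<^sup>0 \<longrightarrow> 0\<close>. The cohomology of the permutation lattice \<open>Div\<^sup>0\<close>
  vanishes in degree one, so it must be shown that an \<open>H\<close>-invariant element of \<open>M\<^sup>0\<close> comes from
  an \<open>H\<close>-invariant element of \<open>Div\<^sup>0\<close> (\<open>H1_dual_trivial\<close>). The fan provides this lift: an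
  invariant vector lies in the relative interior of a unique cone, it is in a unique way a
  combination of the generators of this cone, with integer coefficients by smoothness, and \<open>H\<close>
  permutes the generators and preserves the coefficients (\<open>invariant_lift\<close>).
\<close>

section \<open>Greatest common divisors in polynomial rings\<close>

definition subring_on :: "'r::comm_ring_1 set \<Rightarrow> bool" where
  "subring_on A \<longleftrightarrow> 0 \<in> A \<and> 1 \<in> A \<and> (\<forall>a\<in>A. \<forall>b\<in>A. a - b \<in> A \<and> a * b \<in> A)"

lemma subring_onD:
  assumes "subring_on A"
  shows "0 \<in> A" "1 \<in> A" "a \<in> A \<Longrightarrow> b \<in> A \<Longrightarrow> a - b \<in> A" "a \<in> A \<Longrightarrow> b \<in> A \<Longrightarrow> a * b \<in> A"
    "a \<in> A \<Longrightarrow> - a \<in> A" "a \<in> A \<Longrightarrow> b \<in> A \<Longrightarrow> a + b \<in> A" "a \<in> A \<Longrightarrow> a ^ k \<in> A"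
proof -
  show *: "0 \<in> A" "1 \<in> A" "\<And>a b. a \<in> A \<Longrightarrow> b \<in> A \<Longrightarrow> a - b \<in> A" "\<And>a b. a \<in> A \<Longrightarrow> b \<in> A \<Longrightarrow> a * b \<in> A"
    using assms by (auto simp: subring_on_def)
  show m: "a \<in> A \<Longrightarrow> - a \<in> A" for a
    using *(3)[OF *(1), of a] by simp
  show "a \<in> A \<Longrightarrow> b \<in> A \<Longrightarrow> a + b \<in> A"
    using *(3)[of a "- b"] m by simp
  show "a \<in> A \<Longrightarrow> a ^ k \<in> A"
    by (induction k) (use * in auto)
qed

lemma subring_on_sum:
  assumes "subring_on A" "\<And>i. i \<in> I \<Longrightarrow> f i \<in> A"
  shows "sum f I \<in> A"
  using assms by (induction I rule: infinite_finite_induct) (auto intro: subring_onD)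

lemma subring_on_prod:
  assumes "subring_on A" "\<And>i. i \<in> I \<Longrightarrow> f i \<in> A"
  shows "prod f I \<in> A"
  using assms by (induction I rule: infinite_finite_induct) (auto intro: subring_onD)

text \<open>
  Divisibility is relative to the subring \<open>A\<close>. The surrounding ring serves for computing only;
  it may be larger than the field of fractions of \<open>A\<close>.
\<close>

definition dvd_on :: "'r::comm_ring_1 set \<Rightarrow> 'r \<Rightarrow> 'r \<Rightarrow> bool" where
  "dvd_on A e a \<longleftrightarrow> (\<exists>r\<in>A. a = e * r)"

text \<open>
  A greatest common divisor is described by its divisors, which avoids a choice among associates
  and covers the case \<open>a = b = 0\<close>.
\<close>

definition gcd_ring :: "'r::idom set \<Rightarrow> bool" where
  "gcd_ring A \<longleftrightarrow> subring_on A \<and>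
     (\<forall>a\<in>A. \<forall>b\<in>A. \<exists>d\<in>A. \<forall>e\<in>A. dvd_on A e d \<longleftrightarrow> dvd_on A e a \<and> dvd_on A e b)"

lemma dvd_on_refl [simp]: "subring_on A \<Longrightarrow> dvd_on A e e"
  by (auto simp: dvd_on_def intro!: bexI[of _ 1] subring_onD)

lemma dvd_on_zero [simp]: "subring_on A \<Longrightarrow> dvd_on A e 0"
  by (auto simp: dvd_on_def intro!: bexI[of _ 0] subring_onD)

lemma dvd_on_trans: "subring_on A \<Longrightarrow> dvd_on A a b \<Longrightarrow> dvd_on A b c \<Longrightarrow> dvd_on A a c"
  by (auto simp: dvd_on_def mult.assoc intro!: subring_onD(4))

lemma dvd_on_mult: "subring_on A \<Longrightarrow> dvd_on A e a \<Longrightarrow> r \<in> A \<Longrightarrow> dvd_on A e (a * r)"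
  by (auto simp: dvd_on_def mult.assoc intro!: subring_onD(4))

lemma dvd_on_mult_mono: "subring_on A \<Longrightarrow> dvd_on A a b \<Longrightarrow> dvd_on A (c * a) (c * b)"
  by (auto simp: dvd_on_def mult.assoc)

lemma dvd_on_add: "subring_on A \<Longrightarrow> dvd_on A e a \<Longrightarrow> dvd_on A e b \<Longrightarrow> dvd_on A e (a + b)"
  by (auto simp: dvd_on_def distrib_left[symmetric] intro!: subring_onD(6))

lemma dvd_on_diff: "subring_on A \<Longrightarrow> dvd_on A e a \<Longrightarrow> dvd_on A e b \<Longrightarrow> dvd_on A e (a - b)"
  by (auto simp: dvd_on_def right_diff_distrib[symmetric] intro!: subring_onD(3))

lemma dvd_on_cancel:
  fixes c :: "'r::idom"
  shows "c \<noteq> 0 \<Longrightarrow> dvd_on A (c * a) (c * b) \<longleftrightarrow> dvd_on A a b"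
  by (auto simp: dvd_on_def mult.assoc)

lemma gcd_ring_subring: "gcd_ring A \<Longrightarrow> subring_on A"
  by (simp add: gcd_ring_def)

lemma gcd_ringE:
  assumes "gcd_ring A" "a \<in> A" "b \<in> A"
  obtains d where "d \<in> A" "\<And>e. e \<in> A \<Longrightarrow> dvd_on A e d \<longleftrightarrow> dvd_on A e a \<and> dvd_on A e b"
  using assms unfolding gcd_ring_def by blast

lemma gcd_ring_finite:
  assumes A: "gcd_ring A" and "finite S" "S \<subseteq> A"
  shows "\<exists>d\<in>A. \<forall>e\<in>A. dvd_on A e d \<longleftrightarrow> (\<forall>s\<in>S. dvd_on A e s)"
  using assms(2,3)
proof (induction S)
  case empty
  then show ?case
    using gcd_ring_subring[OF A] by (auto intro!: bexI[of _ 0] subring_onD)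
next
  case (insert s S)
  then obtain d where "d \<in> A" "\<forall>e\<in>A. dvd_on A e d \<longleftrightarrow> (\<forall>s\<in>S. dvd_on A e s)"
    by auto
  moreover from this obtain d'
    where "d' \<in> A" "\<And>e. e \<in> A \<Longrightarrow> dvd_on A e d' \<longleftrightarrow> dvd_on A e s \<and> dvd_on A e d"
    using gcd_ringE[OF A, of s d] insert.prems by auto
  ultimately show ?case
    by (intro bexI[of _ d']) auto
qed

text \<open>
  Scaling a family scales its greatest common divisor \<open>d\<close>: a greatest common divisor of the
  scaled family has the form \<open>c * (d * u)\<close>, and after cancelling \<open>c\<close> one sees that \<open>d * u\<close>
  divides the original family, so that \<open>u\<close> is a unit.
\<close>

lemma gcd_scaled:
  assumes A: "gcd_ring A" and "finite S" "S \<subseteq> A" "c \<in> A"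
    and d: "d \<in> A" "\<forall>e\<in>A. dvd_on A e d \<longleftrightarrow> (\<forall>s\<in>S. dvd_on A e s)"
    and e: "e \<in> A" "\<And>s. s \<in> S \<Longrightarrow> dvd_on A e (c * s)"
  shows "dvd_on A e (c * d)"
proof (cases "c = 0")
  case False
  note sub = gcd_ring_subring[OF A]
  obtain g where g: "g \<in> A" "\<forall>e\<in>A. dvd_on A e g \<longleftrightarrow> (\<forall>s\<in>(*) c ` S. dvd_on A e s)"
  proof -
    have "(*) c ` S \<subseteq> A"
      using \<open>S \<subseteq> A\<close> \<open>c \<in> A\<close> subring_onD(4)[OF sub] by blast
    from gcd_ring_finite[OF A finite_imageI[OF \<open>finite S\<close>] this] show ?thesis
      using that by blast
  qed
  have "dvd_on A (c * d) (c * s)" if "s \<in> S" for s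
    using d sub that by (intro dvd_on_mult_mono) auto
  then have "dvd_on A (c * d) g"
    using g(2) d(1) \<open>c \<in> A\<close> subring_onD(4)[OF sub] by blast
  then obtain u where u: "u \<in> A" "g = c * (d * u)"
    by (auto simp: dvd_on_def mult.assoc)
  have "dvd_on A g (c * s)" if "s \<in> S" for s
    using g that sub by auto
  then have "dvd_on A (d * u) s" if "s \<in> S" for s
    using that u False by (auto simp: dvd_on_cancel)
  then have "dvd_on A (d * u) d"
    using d u sub by (auto intro: subring_onD)
  then have "dvd_on A g (c * d)"
    unfolding u by (rule dvd_on_mult_mono[OF sub])
  moreover have "dvd_on A e g"
    using e g by auto
  ultimately show ?thesis
    using dvd_on_trans[OF sub] by blast
qed (use gcd_ring_subring[OF A] in auto)

text \<open>
  As 1 is a greatest common divisor of \<open>e\<close> and \<open>a\<close>, scaling shows that \<open>b\<close> is one of \<open>b * e\<close> and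
  \<open>b * a\<close>.
\<close>

lemma coprime_dvd_on_mult:
  assumes A: "gcd_ring A" and "a \<in> A" "b \<in> A" "e \<in> A"
    and cop: "\<And>f. f \<in> A \<Longrightarrow> dvd_on A f e \<Longrightarrow> dvd_on A f a \<Longrightarrow> dvd_on A f 1"
    and "dvd_on A e (a * b)"
  shows "dvd_on A e b"
proof -
  note sub = gcd_ring_subring[OF A]
  have "dvd_on A f 1 \<longleftrightarrow> (\<forall>s\<in>{e,a}. dvd_on A f s)" if "f \<in> A" for f
    using cop that dvd_on_mult[OF sub, of f 1] assms by fastforce
  moreover have "dvd_on A e (b * e)"
    using assms dvd_on_mult[OF sub, of e e b] sub by (simp add: mult.commute)
  ultimately have "dvd_on A e (b * 1)"
    using assms sub by (intro gcd_scaled[OF A, of "{e,a}" b 1 e]) (auto simp: mult.commute subring_onD(2))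
  then show ?thesis by simp
qed

subsection \<open>Contents and the lemma of Gauss\<close>

definition polys_on :: "'r::idom set \<Rightarrow> 'r poly set" where
  "polys_on A = {P. \<forall>i. coeff P i \<in> A}"

lemma subring_polys_on:
  assumes "subring_on A" shows "subring_on (polys_on A)"
  using assms unfolding subring_on_def[of "polys_on A"]
  by (auto simp: polys_on_def coeff_mult coeff_1 intro!: subring_on_sum intro: subring_onD)

definition primitive_on :: "'r::idom set \<Rightarrow> 'r poly \<Rightarrow> bool" where
  "primitive_on A P \<longleftrightarrow> P \<in> polys_on A \<and> (\<forall>e\<in>A. (\<forall>i. dvd_on A e (coeff P i)) \<longrightarrow> dvd_on A e 1)"

text \<open>
  The coefficients of \<open>P\<close> have greatest common divisor 1, so those of \<open>c P\<close> have greatest common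
  divisor \<open>c\<close>.
\<close>

lemma primitive_content:
  assumes A: "gcd_ring A" and P: "primitive_on A P" and "c \<in> A" "e \<in> A"
    and dvd: "\<And>i. dvd_on A e (c * coeff P i)"
  shows "dvd_on A e c"
proof -
  note sub = gcd_ring_subring[OF A]
  let ?S = "coeff P ` {..degree P}"
  have S: "(\<forall>s\<in>?S. dvd_on A f s) \<longleftrightarrow> (\<forall>i. dvd_on A f (coeff P i))"
    if "f \<in> A" for f
  proof -
    have "dvd_on A f (coeff P i)" if "\<forall>s\<in>?S. dvd_on A f s" for i
      using that sub by (cases "i \<le> degree P") (auto simp: coeff_eq_0)
    then show ?thesis by blast
  qed
  have "dvd_on A e (c * 1)"
  proof (rule gcd_scaled[OF A, of ?S])
    show "?S \<subseteq> A" using P by (auto simp: primitive_on_def polys_on_def)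
    show "\<forall>e\<in>A. dvd_on A e 1 = (\<forall>s\<in>?S. dvd_on A e s)"
      using S P sub dvd_on_mult[OF sub, of _ 1] unfolding primitive_on_def polys_on_def
      by (metis (mono_tags, lifting) mem_Collect_eq mult_1)
  qed (use assms sub in \<open>auto intro: subring_onD\<close>)
  then show ?thesis by simp
qed

lemma content_primitive:
  assumes A: "gcd_ring A" and P: "P \<in> polys_on A" "P \<noteq> 0"
  obtains c R where "c \<in> A" "c \<noteq> 0" "primitive_on A R" "P = smult c R" "degree R = degree P"
proof -
  note sub = gcd_ring_subring[OF A]
  let ?S = "coeff P ` {..degree P}"
  obtain c where c: "c \<in> A" "\<forall>e\<in>A. dvd_on A e c \<longleftrightarrow> (\<forall>s\<in>?S. dvd_on A e s)"
    using gcd_ring_finite[OF A, of ?S] P by (auto simp: polys_on_def)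
  then have "\<forall>i. dvd_on A c (coeff P i)"
    using sub by (metis atMost_iff coeff_eq_0 dvd_on_refl dvd_on_zero image_eqI not_le)
  then obtain r where r: "\<And>i. r i \<in> A" "\<And>i. coeff P i = c * r i"
    unfolding dvd_on_def by metis
  have "c \<noteq> 0"
    using r(2)[of "degree P"] P by auto
  have fin: "\<forall>\<^sub>\<infinity>i. r i = 0"
    using r(2) \<open>c \<noteq> 0\<close> by (intro MOST_mono[OF MOST_coeff_eq_0[of P]]) auto
  define R where "R = Abs_poly r"
  have R: "coeff R i = r i" for i
    unfolding R_def using Abs_poly_inverse[of r] fin by (simp)
  have P': "P = smult c R"
    by (rule poly_eqI) (simp add: R r(2))
  have "primitive_on A R"
    unfolding primitive_on_def
  proof (intro conjI ballI impI)
    show "R \<in> polys_on A" by (simp add: polys_on_def R r)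
    fix e assume e: "e \<in> A" "\<forall>i. dvd_on A e (coeff R i)"
    then have "dvd_on A (c * e) (coeff P i)" for i
      by (simp add: R r(2) dvd_on_mult_mono[OF sub])
    then have "dvd_on A (c * e) c"
      using c e sub by (auto intro: subring_onD)
    then show "dvd_on A e 1"
      using dvd_on_cancel[OF \<open>c \<noteq> 0\<close>, of A e 1] by simp
  qed
  then show ?thesis
    using that[of c R] c(1) \<open>c \<noteq> 0\<close> P' by simp
qed

text \<open>
  The lemma of Gauss, without prime elements. Let \<open>e\<close> divide all coefficients of \<open>P * Q\<close>, and
  let \<open>f\<close> divide \<open>e\<close> and the leading coefficient of \<open>P\<close>. Then \<open>f\<close> divides the coefficients of
  \<open>P' * Q\<close>, where \<open>P'\<close> is \<open>P\<close> without its leading term; by induction it divides the content of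
  \<open>P'\<close>, hence all coefficients of \<open>P\<close>, and is a unit. So \<open>e\<close> is coprime to the leading
  coefficient of \<open>P\<close>, likewise to that of \<open>Q\<close>, and divides their product.
\<close>

lemma primitive_mult:
  assumes A: "gcd_ring A" and "primitive_on A P" "primitive_on A Q"
  shows "primitive_on A (P * Q)"
  using assms(2,3)
proof (induction "degree P + degree Q" arbitrary: P Q rule: less_induct)
  case (less P Q)
  note sub = gcd_ring_subring[OF A]
  have PQ: "P \<in> polys_on A" "Q \<in> polys_on A" "P * Q \<in> polys_on A"
    using less.prems subring_polys_on[OF sub] by (auto simp: primitive_on_def intro: subring_onD)
  have step: "dvd_on A f 1"
    if R: "primitive_on A R" and Q: "primitive_on A Q" and deg: "degree R + degree Q = degree P0 + degree Q0"
      and IH: "\<And>P Q. degree P + degree Q < degree P0 + degree Q0 \<Longrightarrow> primitive_on A P \<Longrightarrow> primitive_on A Q \<Longrightarrow> primitive_on A (P * Q)"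
      and f: "f \<in> A" "\<And>i. dvd_on A f (coeff (R * Q) i)" "dvd_on A f (lead_coeff R)" for R Q P0 Q0 f
  proof -
    define R' where "R' = R - monom (lead_coeff R) (degree R)"
    have RA: "R \<in> polys_on A" and QA: "Q \<in> polys_on A"
      using R Q by (auto simp: primitive_on_def)
    have R'A: "R' \<in> polys_on A"
      using RA sub by (auto simp: R'_def polys_on_def intro: subring_onD)
    have "dvd_on A f (coeff (monom (lead_coeff R) (degree R) * Q) i)" for i
      using f(3) QA sub by (auto simp: coeff_monom_mult polys_on_def intro: dvd_on_mult)
    then have fR'Q: "dvd_on A f (coeff (R' * Q) i)" for i
      using f(2) sub by (auto simp: R'_def left_diff_distrib intro: dvd_on_diff)
    have R'_dvd: "dvd_on A f (coeff R' i)" for i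
    proof (cases "R' = 0")
      case False
      have "degree R' < degree R"
      proof -
        have "coeff R' i = 0" if "i \<ge> degree R" for i
          using that by (auto simp: R'_def coeff_eq_0)
        then show ?thesis
          using False by (metis leading_coeff_neq_0 not_le)
      qed
      obtain k S where k: "k \<in> A" "primitive_on A S" "R' = smult k S" "degree S = degree R'"
        using content_primitive[OF A R'A False] by metis
      have "primitive_on A (S * Q)"
        using IH[of S Q] k Q deg \<open>degree R' < degree R\<close> by simp
      moreover have "dvd_on A f (k * coeff (S * Q) i)" for i
        using fR'Q[of i] by (simp add: k(3))
      ultimately have "dvd_on A f k"
        using primitive_content[OF A _ k(1) f(1)] by blast
      then show ?thesis
        using k sub by (auto simp: primitive_on_def polys_on_def intro: dvd_on_mult)
    qed (use sub in auto)
    then have "dvd_on A f (coeff R i)" for i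
    proof -
      have "coeff R i = coeff R' i + coeff (monom (lead_coeff R) (degree R)) i"
        by (simp add: R'_def)
      moreover have "dvd_on A f (coeff (monom (lead_coeff R) (degree R)) i)"
        using f(3) sub by (cases "i = degree R") auto
      ultimately show ?thesis
        using dvd_on_add[OF sub R'_dvd] by metis
    qed
    then show ?thesis
      using R f(1) by (auto simp: primitive_on_def)
  qed
  show ?case
    unfolding primitive_on_def
  proof (intro conjI ballI impI)
    fix e assume e: "e \<in> A" "\<forall>i. dvd_on A e (coeff (P * Q) i)"
    have IH: "\<And>P' Q'. degree P' + degree Q' < degree P + degree Q \<Longrightarrow> primitive_on A P' \<Longrightarrow> primitive_on A Q' \<Longrightarrow> primitive_on A (P' * Q')"
      using less.hyps by blast
    have 1: "dvd_on A f 1" if "f \<in> A" "dvd_on A f e" "dvd_on A f (lead_coeff P)" for f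
      by (rule step[OF less.prems(1,2) refl IH]) (use that e sub in \<open>auto intro: dvd_on_trans\<close>)
    have 2: "dvd_on A f 1" if "f \<in> A" "dvd_on A f e" "dvd_on A f (lead_coeff Q)" for f
      by (rule step[OF less.prems(2,1) add.commute IH])
         (use that e sub in \<open>auto simp: mult.commute[of Q P] intro: dvd_on_trans\<close>)
    have "dvd_on A e (lead_coeff P * lead_coeff Q)"
      using e(2) by (metis coeff_mult_degree_sum)
    moreover have "lead_coeff P \<in> A" "lead_coeff Q \<in> A"
      using PQ by (simp_all add: polys_on_def)
    ultimately have "dvd_on A e (lead_coeff Q)"
      using coprime_dvd_on_mult[OF A _ _ e(1) 1] by blast
    then show "dvd_on A e 1"
      using 2[OF e(1) dvd_on_refl[OF sub]] by blast
  qed (rule PQ(3))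
qed

lemma smult_primitive_dvd:
  assumes A: "gcd_ring A" and "s \<in> A" "u \<in> A" "P \<in> polys_on A" "primitive_on A R" "smult s P = smult u R"
  shows "dvd_on A s u"
proof (rule primitive_content[OF A assms(5,3,2)])
  fix i
  have "u * coeff R i = s * coeff P i"
    using assms(6) by (metis coeff_smult)
  then show "dvd_on A s (u * coeff R i)"
    using assms(4) by (auto simp: dvd_on_def polys_on_def)
qed

text \<open>
  Division with remainder works over any subring once the dividend is multiplied by powers of
  the leading coefficient of \<open>H\<close>, which are collected in \<open>s\<close>.
\<close>

lemma pseudo_division:
  assumes "subring_on A" "H \<in> polys_on A" "H \<noteq> 0" "P \<in> polys_on A"
  shows "\<exists>s\<in>A. \<exists>U\<in>polys_on A. s \<noteq> 0 \<and> (smult s P - H * U = 0 \<or> degree (smult s P - H * U) < degree H)"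
  using assms(4)
proof (induction "degree P" arbitrary: P rule: less_induct)
  case (less P)
  note sub = assms(1) and subP = subring_polys_on[OF assms(1)]
  show ?case
  proof (cases "degree P < degree H \<or> P = 0")
    case True
    then show ?thesis
      using sub by (intro bexI[of _ 1] bexI[of _ 0]) (auto simp: polys_on_def intro: subring_onD)
  next
    case False
    let ?M = "monom (lead_coeff P) (degree P - degree H)"
    define P' where "P' = smult (lead_coeff H) P - H * ?M"
    have MA: "?M \<in> polys_on A"
      using less.prems sub by (auto simp: polys_on_def intro: subring_onD)
    have sm: "smult c Q \<in> polys_on A" if "c \<in> A" "Q \<in> polys_on A" for c Q
      using that sub by (auto simp: polys_on_def intro: subring_onD)
    have lA: "lead_coeff H \<in> A"
      using assms(2) by (simp add: polys_on_def)
    have P'A: "P' \<in> polys_on A"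
      unfolding P'_def using MA sm[OF lA less.prems] assms(2) subP by (intro subring_onD(3,4)[OF subP])
    have deg: "P' = 0 \<or> degree P' < degree P"
    proof -
      have "coeff P' i = 0" if "i \<ge> degree P" for i
      proof (cases "i = degree P")
        case True
        have "coeff (H * ?M) (degree H + (degree P - degree H)) = lead_coeff H * lead_coeff P"
          using coeff_mult_degree_sum[of H ?M] False by (simp add: degree_monom_eq)
        then show ?thesis
          using True False by (simp add: P'_def)
      next
        case False
        moreover have "coeff (H * ?M) i = 0"
          by (subst mult.commute)
             (use False that \<open>\<not> (degree P < degree H \<or> P = 0)\<close> in \<open>auto simp: coeff_monom_mult coeff_eq_0\<close>)
        ultimately show ?thesis
          using that by (simp add: P'_def coeff_eq_0)
      qed
      then show ?thesis
        by (metis leading_coeff_neq_0 not_le)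
    qed
    have l0: "lead_coeff H \<noteq> 0" using assms(3) by simp
    show ?thesis
    proof (cases "P' = 0")
      case True
      then show ?thesis
        using lA MA l0 by (intro bexI[of _ "lead_coeff H"] bexI[of _ ?M]) (auto simp: P'_def)
    next
      case P'0: False
      then obtain s U where sU: "s \<in> A" "U \<in> polys_on A" "s \<noteq> 0"
        "smult s P' - H * U = 0 \<or> degree (smult s P' - H * U) < degree H"
        using less.hyps[of P'] deg P'A by blast
      have eq: "smult s P' - H * U = smult (s * lead_coeff H) P - H * (smult s ?M + U)"
        by (simp add: P'_def smult_diff_right algebra_simps)
      show ?thesis
        using sU lA l0 sm[OF sU(1) MA] unfolding eq
        by (intro bexI[of _ "s * lead_coeff H"] bexI[of _ "smult s ?M + U"])
           (auto intro: subring_onD(4)[OF sub] subring_onD(6)[OF subP])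
    qed
  qed
qed

text \<open>
  By the lemma of Gauss \<open>s\<close> divides the content of \<open>U\<close>, so the scalar cancels.
\<close>

lemma primitive_dvd_of_scaled:
  assumes A: "gcd_ring A" and E: "primitive_on A E" and U: "U \<in> polys_on A" and P: "primitive_on A P"
    and s: "s \<in> A" "s \<noteq> 0" "smult s P = E * U"
  shows "dvd_on (polys_on A) E P"
proof -
  note sub = gcd_ring_subring[OF A]
  have "P \<noteq> 0"
  proof
    assume "P = 0"
    then have "dvd_on A 0 1"
      using P sub by (auto simp: primitive_on_def intro: subring_onD)
    then show False by (auto simp: dvd_on_def)
  qed
  then have "U \<noteq> 0" using s by auto
  then obtain u V where u: "u \<in> A" "primitive_on A V" "U = smult u V"
    using content_primitive[OF A U] by metis
  have EV: "primitive_on A (E * V)"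
    using primitive_mult[OF A E u(2)] .
  have eq: "smult s P = smult u (E * V)"
    using s(3) u(3) by simp
  have "dvd_on A s u"
    using smult_primitive_dvd[OF A s(1) u(1) _ EV eq] P by (simp add: primitive_on_def)
  then obtain t where t: "t \<in> A" "u = s * t"
    by (auto simp: dvd_on_def)
  have "smult s P = smult s (smult t (E * V))"
    using eq t by simp
  then have "P = E * smult t V"
    using s(2) smult_eq_0_iff[of s "P - smult t (E * V)"] by (simp add: smult_diff_right)
  moreover have "smult t V \<in> polys_on A"
    using t(1) u(2) sub by (auto simp: polys_on_def primitive_on_def intro: subring_onD)
  ultimately show ?thesis
    unfolding dvd_on_def by (intro bexI[of _ "smult t V"]) simp_all
qed

text \<open>
  Write the two polynomials as \<open>p P1\<close> and \<open>q Q1\<close> with primitive \<open>P1\<close> and \<open>Q1\<close>, and let \<open>H1\<close> be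
  the primitive part of a nonzero combination \<open>H\<close> of \<open>P1\<close> and \<open>Q1\<close> of least degree.
  Pseudo-division by \<open>H\<close> leaves no remainder, by minimality, so \<open>H1\<close> divides \<open>P1\<close> and \<open>Q1\<close>; and
  every primitive common divisor of these divides the combination. Hence \<open>d H1\<close>, where \<open>d\<close> is a
  greatest common divisor of \<open>p\<close> and \<open>q\<close>, is one of the two polynomials.
\<close>

theorem gcd_ring_polys_on:
  assumes A: "gcd_ring A"
  shows "gcd_ring (polys_on A)"
  unfolding gcd_ring_def
proof (intro conjI ballI)
  note sub = gcd_ring_subring[OF A]
  show subP: "subring_on (polys_on A)" using subring_polys_on[OF sub] .
  let ?B = "polys_on A"
  have sm: "smult c Q \<in> ?B" if "c \<in> A" "Q \<in> ?B" for c Q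
    using that sub by (auto simp: polys_on_def intro: subring_onD)
  fix P Q assume P: "P \<in> ?B" and Q: "Q \<in> ?B"
  show "\<exists>D\<in>?B. \<forall>E\<in>?B. dvd_on ?B E D \<longleftrightarrow> dvd_on ?B E P \<and> dvd_on ?B E Q"
  proof (cases "P = 0 \<or> Q = 0")
    case True
    then show ?thesis
    proof
      assume "P = 0"
      then show ?thesis using Q dvd_on_zero[OF subP] by (intro bexI[of _ Q]) auto
    next
      assume "Q = 0"
      then show ?thesis using P dvd_on_zero[OF subP] by (intro bexI[of _ P]) auto
    qed
  next
    case False
    obtain p P1 where p: "p \<in> A" "p \<noteq> 0" "primitive_on A P1" "P = smult p P1"
      using content_primitive[OF A P] False by metis
    obtain q Q1 where q: "q \<in> A" "q \<noteq> 0" "primitive_on A Q1" "Q = smult q Q1"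
      using content_primitive[OF A Q] False by metis
    obtain d where d: "d \<in> A" "\<forall>e\<in>A. dvd_on A e d \<longleftrightarrow> dvd_on A e p \<and> dvd_on A e q"
      using gcd_ringE[OF A p(1) q(1)] by metis
    have P1Q1: "P1 \<in> ?B" "Q1 \<in> ?B" using p q by (auto simp: primitive_on_def)
    have P10: "P1 \<noteq> 0" using p False by auto
    define I where "I = {H. H \<noteq> 0 \<and> (\<exists>U\<in>?B. \<exists>V\<in>?B. H = P1 * U + Q1 * V)}"
    have "P1 \<in> I"
      unfolding I_def using P10 subring_onD(1,2)[OF subP] by force
    then obtain H where H: "H \<in> I"
      and Hmin: "\<And>K. K \<in> I \<Longrightarrow> degree H \<le> degree K"
      using arg_min_nat_lemma[of "\<lambda>H. H \<in> I" P1 degree] by auto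
    obtain U0 V0 where UV: "U0 \<in> ?B" "V0 \<in> ?B" "H = P1 * U0 + Q1 * V0" and H0: "H \<noteq> 0"
      using H by (auto simp: I_def)
    have HB: "H \<in> ?B"
      using UV P1Q1 subP by (auto intro: subring_onD)
    obtain h H1 where h: "h \<in> A" "h \<noteq> 0" "primitive_on A H1" "H = smult h H1"
      using content_primitive[OF A HB H0] by metis
    have key: "dvd_on ?B H1 R" if R: "primitive_on A R" "R = P1 \<or> R = Q1" for R
    proof -
      have RB: "R \<in> ?B" using R by (auto simp: primitive_on_def)
      obtain s U where sU: "s \<in> A" "U \<in> ?B" "s \<noteq> 0" "smult s R - H * U = 0 \<or> degree (smult s R - H * U) < degree H"
        using pseudo_division[OF sub HB H0 RB] by blast
      have "smult s R - H * U = 0"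
      proof (rule ccontr)
        assume n0: "smult s R - H * U \<noteq> 0"
        have "\<exists>U'\<in>?B. \<exists>V'\<in>?B. smult s R - H * U = P1 * U' + Q1 * V'"
          using R(2)
        proof
          assume "R = P1"
          then have "smult s R - H * U = P1 * ([:s:] - U0 * U) + Q1 * (- (V0 * U))"
            by (simp add: UV(3) algebra_simps)
          moreover have "[:s:] - U0 * U \<in> ?B" "- (V0 * U) \<in> ?B"
            using sm[of s 1] sU UV by (auto intro!: subring_onD(3,4,5)[OF subP] intro: subring_onD(2)[OF subP])
          ultimately show ?thesis by blast
        next
          assume "R = Q1"
          then have "smult s R - H * U = P1 * (- (U0 * U)) + Q1 * ([:s:] - V0 * U)"
            by (simp add: UV(3) algebra_simps)
          moreover have "[:s:] - V0 * U \<in> ?B" "- (U0 * U) \<in> ?B"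
            using sm[of s 1] sU UV by (auto intro!: subring_onD(3,4,5)[OF subP] intro: subring_onD(2)[OF subP])
          ultimately show ?thesis by blast
        qed
        then show False
          using Hmin[of "smult s R - H * U"] sU(4) n0 by (auto simp: I_def)
      qed
      then have "smult s R = H1 * smult h U"
        using h(4) by simp
      then show ?thesis
        using primitive_dvd_of_scaled[OF A h(3) sm[OF h(1) sU(2)] R(1) sU(1,3)] by blast
    qed
    have H1B: "H1 \<in> ?B" using h by (simp add: primitive_on_def)
    show ?thesis
    proof (intro bexI[of _ "smult d H1"] ballI iffI)
      fix E assume E: "E \<in> ?B" "dvd_on ?B E (smult d H1)"
      have dvd: "dvd_on ?B E (smult r R)" if "r = p \<and> R = P1 \<or> r = q \<and> R = Q1" for r R
      proof -
        have "dvd_on A d r"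
          using that d(2)[rule_format, OF d(1)] dvd_on_refl[OF sub, of d] by blast
        then obtain t where t: "t \<in> A" "r = d * t" by (auto simp: dvd_on_def)
        have "dvd_on ?B H1 R" using key[of R] that p(3) q(3) by metis
        then obtain W where W: "W \<in> ?B" "R = H1 * W" by (auto simp: dvd_on_def)
        have "smult r R = smult d H1 * smult t W" by (simp add: t W mult.commute)
        then show ?thesis
          using E(2) dvd_on_mult[OF subP E(2) sm[OF t(1) W(1)]] by simp
      qed
      show "dvd_on ?B E P \<and> dvd_on ?B E Q"
        using dvd p(4) q(4) by simp
    next
      fix E assume E: "E \<in> ?B" "dvd_on ?B E P \<and> dvd_on ?B E Q"
      have "E \<noteq> 0" using E False by (auto simp: dvd_on_def)
      then obtain e E1 where e: "e \<in> A" "e \<noteq> 0" "primitive_on A E1" "E = smult e E1"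
        using content_primitive[OF A E(1)] by metis
      have E1B: "E1 \<in> ?B" using e by (simp add: primitive_on_def)
      have both: "dvd_on A e r \<and> dvd_on ?B E1 R"
        if r: "r \<in> A" "r \<noteq> 0" "primitive_on A R" "dvd_on ?B E (smult r R)" for r R
      proof -
        obtain F where F: "F \<in> ?B" "smult r R = E * F" using r by (auto simp: dvd_on_def)
        have "smult e (E1 * F) = smult r R" using F e by simp
        then have "dvd_on A e r"
          using smult_primitive_dvd[OF A e(1) r(1) subring_onD(4)[OF subP E1B F(1)] r(3)] by simp
        moreover have "dvd_on ?B E1 R"
          using primitive_dvd_of_scaled[OF A e(3) sm[OF e(1) F(1)] r(3,1,2)] F e by simp
        ultimately show ?thesis by simp
      qed
      have "dvd_on A e d" and E1: "dvd_on ?B E1 P1" "dvd_on ?B E1 Q1"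
        using both[OF p(1-3)] both[OF q(1-3)] E(2) d e(1) p(4) q(4) by auto
      have "dvd_on ?B E1 H"
        unfolding UV(3) using E1 UV subP by (auto intro: dvd_on_add dvd_on_mult)
      then obtain W where W: "W \<in> ?B" "smult h H1 = E1 * W"
        using h(4) by (auto simp: dvd_on_def)
      have "dvd_on ?B E1 H1"
        using primitive_dvd_of_scaled[OF A e(3) W(1) h(3,1,2) W(2)] .
      then obtain W' where W': "W' \<in> ?B" "H1 = E1 * W'" by (auto simp: dvd_on_def)
      obtain t where t: "t \<in> A" "d = e * t" using \<open>dvd_on A e d\<close> by (auto simp: dvd_on_def)
      have "smult d H1 = E * smult t W'" by (simp add: e(4) t W'(2) mult.commute)
      then show "dvd_on ?B E (smult d H1)"
        using sm[OF t(1) W'(1)] unfolding dvd_on_def by (intro bexI[of _ "smult t W'"])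
    qed (use sm d(1) H1B in auto)
  qed
qed

lemma gcd_ring_image:
  fixes f :: "'r::idom \<Rightarrow> 's::idom"
  assumes A: "gcd_ring A" and inj: "inj_on f A"
    and f: "\<And>a b. a \<in> A \<Longrightarrow> b \<in> A \<Longrightarrow> f (a - b) = f a - f b"
      "\<And>a b. a \<in> A \<Longrightarrow> b \<in> A \<Longrightarrow> f (a * b) = f a * f b" "f 1 = 1"
  shows "gcd_ring (f ` A)"
proof -
  note sub = gcd_ring_subring[OF A]
  have f0: "f 0 = 0"
    using f(1)[of 0 0] subring_onD(1)[OF sub] by simp
  have dvd: "dvd_on (f ` A) (f e) (f a) \<longleftrightarrow> dvd_on A e a" if "e \<in> A" "a \<in> A" for e a
  proof -
    have "f a = f e * f r \<longleftrightarrow> a = e * r" if "r \<in> A" for r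
      using that \<open>e \<in> A\<close> \<open>a \<in> A\<close> f(2)[of e r] subring_onD(4)[OF sub, of e r] inj_on_eq_iff[OF inj, of a "e * r"] by simp
    then show ?thesis by (auto simp: dvd_on_def)
  qed
  have "subring_on (f ` A)"
    unfolding subring_on_def
  proof (intro conjI ballI)
    show "0 \<in> f ` A" "1 \<in> f ` A"
      using f0 f(3) subring_onD(1,2)[OF sub] by (metis imageI)+
    fix x y assume "x \<in> f ` A" "y \<in> f ` A"
    then obtain a b where "a \<in> A" "b \<in> A" "x = f a" "y = f b" by auto
    then show "x - y \<in> f ` A" "x * y \<in> f ` A"
      using f(1)[of a b] f(2)[of a b] subring_onD(3,4)[OF sub, of a b] by (metis imageI)+
  qed
  moreover have "\<exists>d\<in>f ` A. \<forall>e\<in>f ` A. dvd_on (f ` A) e d \<longleftrightarrow> dvd_on (f ` A) e x \<and> dvd_on (f ` A) e y"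
    if "x \<in> f ` A" "y \<in> f ` A" for x y
  proof -
    obtain a b where ab: "a \<in> A" "b \<in> A" "x = f a" "y = f b"
      using \<open>x \<in> f ` A\<close> \<open>y \<in> f ` A\<close> by auto
    then obtain d where "d \<in> A" "\<forall>e\<in>A. dvd_on A e d \<longleftrightarrow> dvd_on A e a \<and> dvd_on A e b"
      using gcd_ringE[OF A ab(1,2)] by metis
    then show ?thesis using ab dvd by auto
  qed
  ultimately show ?thesis by (simp add: gcd_ring_def)
qed

section \<open>Divisors on affine schemes\<close>

abbreviation units_in :: "'k::field set \<Rightarrow> 'k set" where
  "units_in x \<equiv> Units (ring_on x)"

lemma units_in_iff: "u \<in> units_in x \<longleftrightarrow> u \<noteq> 0 \<and> u \<in> x \<and> inverse u \<in> (x :: 'k::field set)"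
proof -
  have "u \<in> units_in x \<longleftrightarrow> u \<in> x \<and> (\<exists>v\<in>x. v * u = 1)"
    by (auto simp: Units_def ring_on_def mult.commute)
  also have "\<dots> \<longleftrightarrow> u \<noteq> 0 \<and> u \<in> x \<and> inverse u \<in> x"
    by (metis inverse_unique left_inverse mult.commute mult_zero_right zero_neq_one)
  finally show ?thesis .
qed

lemma units_in_mult: "subring_on x \<Longrightarrow> u \<in> units_in x \<Longrightarrow> v \<in> units_in x \<Longrightarrow> u * v \<in> units_in x"
  by (auto simp: units_in_iff intro: subring_onD)

lemma units_in_inverse: "u \<in> units_in x \<Longrightarrow> inverse u \<in> units_in x"
  by (auto simp: units_in_iff)

lemma units_in_one: "subring_on x \<Longrightarrow> 1 \<in> units_in x"
  by (auto simp: units_in_iff intro: subring_onD)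

lemma units_in_power: "subring_on x \<Longrightarrow> u \<in> units_in x \<Longrightarrow> u ^ k \<in> units_in x"
  by (induction k) (auto intro: units_in_one units_in_mult)

lemma units_in_divide: "subring_on x \<Longrightarrow> u \<in> units_in x \<Longrightarrow> v \<in> units_in x \<Longrightarrow> u / v \<in> units_in x"
  by (simp add: divide_inverse units_in_inverse units_in_mult)

lemma units_in_mono: "x \<subseteq> y \<Longrightarrow> u \<in> units_in x \<Longrightarrow> u \<in> units_in y"
  by (auto simp: units_in_iff)

lemma units_in_factor:
  assumes "subring_on x" "a \<in> x" "b \<in> x" "a * b \<in> units_in x"
  shows "a \<in> units_in x"
proof -
  have "inverse a = b * inverse (a * b)" "a \<noteq> 0"
    using assms(4) by (auto simp: units_in_iff)
  then show ?thesis
    using assms subring_onD(4)[OF assms(1), of b "inverse (a * b)"] unfolding units_in_iff by metis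
qed

lemma units_in_divide_mem: "subring_on x \<Longrightarrow> a \<in> x \<Longrightarrow> s \<in> units_in x \<Longrightarrow> a / s \<in> x"
  by (auto simp: units_in_iff divide_inverse intro: subring_onD)

definition local_on :: "'k::field set \<Rightarrow> bool" where
  "local_on x \<longleftrightarrow> subring_on x \<and> (\<forall>a\<in>x. \<forall>b\<in>x. a + b \<in> units_in x \<longrightarrow> a \<in> units_in x \<or> b \<in> units_in x)"

definition ideal_on :: "'k::field set \<Rightarrow> 'k set \<Rightarrow> bool" where
  "ideal_on A P \<longleftrightarrow> P \<subseteq> A \<and> 0 \<in> P \<and> (\<forall>a\<in>P. \<forall>b\<in>P. a + b \<in> P) \<and> (\<forall>a\<in>A. \<forall>b\<in>P. a * b \<in> P)"

definition prime_on :: "'k::field set \<Rightarrow> 'k set \<Rightarrow> bool" where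
  "prime_on A P \<longleftrightarrow> ideal_on A P \<and> 1 \<notin> P \<and> (\<forall>a\<in>A. \<forall>b\<in>A. a * b \<in> P \<longrightarrow> a \<in> P \<or> b \<in> P)"

lemma cring_ring_on:
  assumes "subring_on A" shows "cring (ring_on A)"
proof (rule cringI)
  show "abelian_group (ring_on A)"
    by (rule abelian_groupI)
       (auto simp: ring_on_def add.assoc add.commute intro: subring_onD[OF assms]
             intro!: bexI[of _ "- x" for x] subring_onD(5)[OF assms])
  show "comm_monoid (ring_on A)"
    by (rule comm_monoidI) (auto simp: ring_on_def mult.assoc mult.commute intro: subring_onD[OF assms])
qed (auto simp: ring_on_def distrib_right)

lemma primeideal_ring_on:
  assumes A: "subring_on A"
  shows "primeideal P (ring_on A) \<longleftrightarrow> prime_on A P"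
proof
  assume "primeideal P (ring_on A)"
  then interpret primeideal P "ring_on A" .
  have "1 \<notin> P"
    using one_imp_carrier I_notcarr by (auto simp: ring_on_def)
  then show "prime_on A P"
    using a_subset I_l_closed I_prime additive_subgroup.a_closed[OF additive_subgroup_axioms]
      additive_subgroup.zero_closed[OF additive_subgroup_axioms]
    by (auto simp: prime_on_def ideal_on_def ring_on_def)
next
  assume P: "prime_on A P"
  interpret cring "ring_on A" using cring_ring_on[OF A] .
  have neg: "- a \<in> P" if "a \<in> P" for a
    using P that subring_onD(5)[OF A subring_onD(2)[OF A]]
    by (auto simp: prime_on_def ideal_on_def dest!: bspec[of A _ "- 1"])
  have sub: "subgroup P (add_monoid (ring_on A))"
  proof (rule group.subgroupI)
    show "group (add_monoid (ring_on A))" using a_group .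
    fix a assume "a \<in> P"
    have "a \<in> A" using P \<open>a \<in> P\<close> by (auto simp: prime_on_def ideal_on_def)
    have "inv\<^bsub>add_monoid (ring_on A)\<^esub> a = - a"
    proof (rule group.inv_equality[OF a_group])
      show "- a \<otimes>\<^bsub>add_monoid (ring_on A)\<^esub> a = \<one>\<^bsub>add_monoid (ring_on A)\<^esub>"
        by (simp add: ring_on_def)
    qed (use \<open>a \<in> A\<close> subring_onD(5)[OF A] in \<open>auto simp: ring_on_def\<close>)
    then show "inv\<^bsub>add_monoid (ring_on A)\<^esub> a \<in> P" using neg[OF \<open>a \<in> P\<close>]
      by simp
  qed (use P in \<open>auto simp: prime_on_def ideal_on_def ring_on_def\<close>)
  have "a * x \<in> P \<and> x * a \<in> P" if "a \<in> P" "x \<in> A" for a x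
    using P that unfolding prime_on_def ideal_on_def by (metis mult.commute)
  then have idl: "ideal P (ring_on A)"
    by (intro idealI[OF local.ring_axioms sub]) (simp_all add: ring_on_def)
  show "primeideal P (ring_on A)"
    by (rule primeidealI[OF idl local.cring_axioms])
       (use P subring_onD(2)[OF A] in \<open>auto simp: prime_on_def ring_on_def\<close>)
qed

lemma localization_units:
  assumes A: "subring_on A" and P: "prime_on A P" and "a \<in> A" "s \<in> A - P"
  shows "a / s \<in> units_in (localization_at A P) \<longleftrightarrow> a \<notin> P"
proof
  have P': "0 \<in> P" "\<And>a b. a \<in> A \<Longrightarrow> b \<in> P \<Longrightarrow> a * b \<in> P" "\<And>a b. a \<in> A \<Longrightarrow> b \<in> A \<Longrightarrow> a * b \<in> P \<Longrightarrow> a \<in> P \<or> b \<in> P"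
    using P by (auto simp: prime_on_def ideal_on_def)
  assume "a / s \<in> units_in (localization_at A P)"
  then obtain b t where bt: "b \<in> A" "t \<in> A - P" "inverse (a / s) = b / t" "a \<noteq> 0" "s \<noteq> 0"
    by (auto simp: units_in_iff localization_at_def)
  have "t \<noteq> 0" using bt P' by auto
  then have "b * a = s * t"
    using bt by (simp add: field_simps)
  moreover have "s * t \<notin> P"
    using P'(3)[of s t] bt assms(4) by auto
  ultimately show "a \<notin> P"
    using P'(2)[of b a] bt by auto
next
  assume "a \<notin> P"
  then have "a \<noteq> 0" "s \<noteq> 0"
    using P assms(4) by (auto simp: prime_on_def ideal_on_def)
  then show "a / s \<in> units_in (localization_at A P)"
    using \<open>a \<notin> P\<close> assms(3,4) by (auto simp: units_in_iff localization_at_def)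
qed

text \<open>
  For a local ring \<open>z\<close> this says that \<open>z\<close> is a localization of \<open>A\<close>; for the coordinate ring \<open>z\<close>
  of another chart it says that this chart is contained in the spectrum of \<open>A\<close>.
\<close>

definition fractions_over :: "'k::field set \<Rightarrow> 'k set \<Rightarrow> bool" where
  "fractions_over A z \<longleftrightarrow> A \<subseteq> z \<and> (\<forall>y\<in>z. \<exists>a\<in>A. \<exists>s\<in>A. s \<in> units_in z \<and> y = a / s)"

text \<open>
  The prime ideal is recovered as the set of those elements of \<open>A\<close> that are not units of \<open>z\<close>.
  With this description, points of different charts can be compared without mentioning prime
  ideals.
\<close>

lemma spec_points_iff:
  assumes A: "subring_on A"
  shows "z \<in> spec_points A \<longleftrightarrow> local_on z \<and> fractions_over A z"
proof
  assume "z \<in> spec_points A"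
  then obtain P where z: "z = localization_at A P" and P: "prime_on A P"
    by (auto simp: spec_points_def primeideal_ring_on[OF A])
  have P': "P \<subseteq> A" "0 \<in> P" "1 \<notin> P" "\<And>a b. a \<in> P \<Longrightarrow> b \<in> P \<Longrightarrow> a + b \<in> P"
    "\<And>a b. a \<in> A \<Longrightarrow> b \<in> P \<Longrightarrow> a * b \<in> P" "\<And>a b. a \<in> A \<Longrightarrow> b \<in> A \<Longrightarrow> a * b \<in> P \<Longrightarrow> a \<in> P \<or> b \<in> P"
    using P by (auto simp: prime_on_def ideal_on_def)
  have mem: "a / s \<in> z" if "a \<in> A" "s \<in> A - P" for a s
    using that by (auto simp: z localization_at_def)
  have rep: "\<exists>a s. y = a / s \<and> a \<in> A \<and> s \<in> A - P" if "y \<in> z" for y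
    using that by (auto simp: z localization_at_def)
  have ss: "s * t \<in> A - P" if "s \<in> A - P" "t \<in> A - P" for s t
    using that P'(6) by (auto intro: subring_onD[OF A])
  have Az: "A \<subseteq> z"
    using mem[of _ 1] P'(3) subring_onD(2)[OF A] by auto
  have sub: "subring_on z"
    unfolding subring_on_def
  proof (intro conjI ballI)
    show "0 \<in> z" "1 \<in> z" using Az subring_onD(1,2)[OF A] by auto
    fix x y assume "x \<in> z" "y \<in> z"
    then obtain a s b t where *: "x = a / s" "y = b / t" "a \<in> A" "b \<in> A" "s \<in> A - P" "t \<in> A - P"
      using rep by metis
    then have "s \<noteq> 0" "t \<noteq> 0" using P' by auto
    then have "x - y = (a * t - b * s) / (s * t)" "x * y = (a * b) / (s * t)"
      using * by (simp_all add: diff_frac_eq)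
    moreover have "a * t - b * s \<in> A" "a * b \<in> A"
      using * by (auto intro!: subring_onD(3,4)[OF A])
    ultimately show "x - y \<in> z" "x * y \<in> z"
      using mem[OF _ ss] * by metis+
  qed
  have "local_on z"
    unfolding local_on_def
  proof (intro conjI sub ballI impI)
    fix x y assume "x \<in> z" "y \<in> z" and u: "x + y \<in> units_in z"
    then obtain a s b t where *: "x = a / s" "y = b / t" "a \<in> A" "b \<in> A" "s \<in> A - P" "t \<in> A - P"
      using rep by metis
    then have "s \<noteq> 0" "t \<noteq> 0" using P' by auto
    then have xy: "x + y = (t * a + s * b) / (s * t)"
      using * by (simp add: add_frac_eq mult.commute)
    have "t * a + s * b \<in> A"
      using * by (auto intro!: subring_onD(6,4)[OF A])
    then have "t * a + s * b \<notin> P"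
      using localization_units[OF A P _ ss[OF *(5,6)]] u unfolding xy z by blast
    then have "a \<notin> P \<or> b \<notin> P"
      using P'(4,5) * by blast
    then show "x \<in> units_in z \<or> y \<in> units_in z"
      using localization_units[OF A P *(3,5)] localization_units[OF A P *(4,6)] * z by simp
  qed
  moreover have "\<exists>a\<in>A. \<exists>s\<in>A. s \<in> units_in z \<and> y = a / s" if "y \<in> z" for y
  proof -
    obtain a s where as: "y = a / s" "a \<in> A" "s \<in> A - P" using rep[OF \<open>y \<in> z\<close>]
      by blast
    moreover have "1 \<in> A - P" using P'(3) subring_onD(2)[OF A] by simp
    ultimately have "s \<in> units_in z"
      using localization_units[OF A P, of s 1] z by simp
    then show ?thesis using as by blast
  qed
  ultimately show "local_on z \<and> fractions_over A z"
    using Az by (simp add: fractions_over_def)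
next
  assume z: "local_on z \<and> fractions_over A z"
  then have sub: "subring_on z" and Az: "A \<subseteq> z"
    and loc: "\<And>a b. a \<in> z \<Longrightarrow> b \<in> z \<Longrightarrow> a + b \<in> units_in z \<Longrightarrow> a \<in> units_in z \<or> b \<in> units_in z"
    and fr: "\<And>y. y \<in> z \<Longrightarrow> \<exists>a\<in>A. \<exists>s\<in>A. s \<in> units_in z \<and> y = a / s"
    by (auto simp: local_on_def fractions_over_def)
  define P where "P = {a\<in>A. a \<notin> units_in z}"
  have "ideal_on A P"
    unfolding ideal_on_def
  proof (intro conjI ballI)
    fix a b assume "a \<in> P" "b \<in> P"
    then show "a + b \<in> P"
      using loc[of a b] Az subring_onD(6)[OF A] by (auto simp: P_def)
  next
    fix a b assume "a \<in> A" "b \<in> P"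
    then show "a * b \<in> P"
      using units_in_factor[OF sub, of b a] Az subring_onD(4)[OF A, of a b] by (auto simp: P_def mult.commute)
  qed (auto simp: P_def units_in_iff subring_onD(1)[OF A])
  then have P: "prime_on A P"
    unfolding prime_on_def using units_in_one[OF sub] units_in_mult[OF sub] subring_onD(4)[OF A]
    by (auto simp: P_def)
  have "z = localization_at A P"
  proof
    show "z \<subseteq> localization_at A P"
      using fr unfolding localization_at_def P_def by blast
    show "localization_at A P \<subseteq> z"
      using Az units_in_divide_mem[OF sub] unfolding localization_at_def P_def by blast
  qed
  then show "z \<in> spec_points A"
    using P primeideal_ring_on[OF A] unfolding spec_points_def by blast
qed

lemma spec_pointsD:
  assumes "subring_on A" "z \<in> spec_points A"
  shows "subring_on z" "A \<subseteq> z" "local_on z" "y \<in> z \<Longrightarrow> \<exists>a\<in>A. \<exists>s\<in>A. s \<in> units_in z \<and> y = a / s"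
  using assms spec_points_iff[OF assms(1)] by (auto simp: local_on_def fractions_over_def)

lemma spec_points_intermediate:
  assumes "subring_on A" "subring_on B" "z \<in> spec_points A" "A \<subseteq> B" "B \<subseteq> z"
  shows "z \<in> spec_points B"
  unfolding spec_points_iff[OF assms(2)] fractions_over_def
  using spec_pointsD(3,4)[OF assms(1,3)] assms(4,5) by blast

text \<open>
  A localization of the localization \<open>x\<close> of \<open>A\<close> is again a localization of \<open>A\<close>. That \<open>z\<close> is a
  localization of \<open>x\<close> can be seen in any other chart \<open>B\<close>.
\<close>

lemma spec_points_generization:
  assumes A: "subring_on A" and B: "subring_on B"
    and "x \<in> spec_points A" "z \<in> spec_points B" "x \<subseteq> z" "B \<subseteq> x"
  shows "z \<in> spec_points A"
  unfolding spec_points_iff[OF A] fractions_over_def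
proof (intro conjI ballI)
  show "local_on z" using spec_pointsD(3)[OF B assms(4)] .
  show "A \<subseteq> z" using spec_pointsD(2)[OF A assms(3)] \<open>x \<subseteq> z\<close> by simp
  fix y assume "y \<in> z"
  then obtain c t where c: "c \<in> x" "t \<in> x" "t \<in> units_in z" "y = c / t"
    using spec_pointsD(4)[OF B assms(4)] \<open>B \<subseteq> x\<close> by blast
  obtain a s where a: "a \<in> A" "s \<in> A" "s \<in> units_in x" "c = a / s"
    using spec_pointsD(4)[OF A assms(3) c(1)] by blast
  obtain a' s' where a': "a' \<in> A" "s' \<in> A" "s' \<in> units_in x" "t = a' / s'"
    using spec_pointsD(4)[OF A assms(3) c(2)] by blast
  note subz = spec_pointsD(1)[OF B assms(4)]
  have s: "s \<in> units_in z" "s' \<in> units_in z"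
    using a a' units_in_mono[OF \<open>x \<subseteq> z\<close>] by blast+
  then have "a' \<in> units_in z"
    using units_in_mult[OF subz c(3) s(2)] a'(4) by (simp add: units_in_iff)
  then have "s * a' \<in> units_in z" using s units_in_mult[OF subz] by blast
  moreover have "y = (a * s') / (s * a')"
    using c a a' s \<open>a' \<in> units_in z\<close> by (simp add: units_in_iff)
  ultimately show "\<exists>a\<in>A. \<exists>s\<in>A. s \<in> units_in z \<and> y = a / s"
    using a a' subring_onD(4)[OF A] by blast
qed

lemma spec_points_localization:
  assumes A: "subring_on A" and B: "subring_on B" and "fractions_over A B" "z \<in> spec_points B"
  shows "z \<in> spec_points A"
  unfolding spec_points_iff[OF A] fractions_over_def
proof (intro conjI ballI)
  note subz = spec_pointsD(1)[OF B assms(4)]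
  have Bz: "B \<subseteq> z" using spec_pointsD(2)[OF B assms(4)] .
  show "local_on z" using spec_pointsD(3)[OF B assms(4)] .
  show "A \<subseteq> z" using Bz assms(3) by (auto simp: fractions_over_def)
  fix y assume "y \<in> z"
  then obtain c t where c: "c \<in> B" "t \<in> B" "t \<in> units_in z" "y = c / t"
    using spec_pointsD(4)[OF B assms(4)] by blast
  obtain a s a' s' where a: "a \<in> A" "s \<in> A" "s \<in> units_in B" "c = a / s"
    and a': "a' \<in> A" "s' \<in> A" "s' \<in> units_in B" "t = a' / s'"
    using assms(3) c(1,2) unfolding fractions_over_def by meson
  have s: "s \<in> units_in z" "s' \<in> units_in z"
    using a a' units_in_mono[OF Bz] by blast+
  then have "a' \<in> units_in z"
    using units_in_mult[OF subz c(3) s(2)] a'(4) by (simp add: units_in_iff)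
  then have "s * a' \<in> units_in z" using s units_in_mult[OF subz] by blast
  moreover have "y = (a * s') / (s * a')"
    using c a a' s \<open>a' \<in> units_in z\<close> by (simp add: units_in_iff)
  ultimately show "\<exists>a\<in>A. \<exists>s\<in>A. s \<in> units_in z \<and> y = a / s"
    using a a' subring_onD(4)[OF A] by blast
qed

text \<open>
  An ideal that is maximal among those avoiding the powers of \<open>h\<close> is prime, and exists by the
  lemma of Zorn.
\<close>

lemma prime_avoiding_powers:
  assumes A: "subring_on A" and I: "ideal_on A I" and h: "h \<in> A" "\<And>k. h ^ k \<notin> I"
  obtains P where "prime_on A P" "I \<subseteq> P" "\<And>k. h ^ k \<notin> P"
proof -
  define \<J> where "\<J> = {J. ideal_on A J \<and> I \<subseteq> J \<and> (\<forall>k. h ^ k \<notin> J)}"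
  have "I \<in> \<J>" using assms by (auto simp: \<J>_def)
  moreover have "\<Union>\<C> \<in> \<J>" if "\<C> \<noteq> {}" and ch: "subset.chain \<J> \<C>" for \<C>
  proof -
    have C: "\<And>J. J \<in> \<C> \<Longrightarrow> J \<in> \<J>"
      and lin: "\<And>J K. J \<in> \<C> \<Longrightarrow> K \<in> \<C> \<Longrightarrow> J \<subseteq> K \<or> K \<subseteq> J"
      using ch by (auto simp: subset_chain_def)
    have "ideal_on A (\<Union>\<C>)"
      unfolding ideal_on_def
    proof (intro conjI ballI)
      fix a b assume "a \<in> \<Union>\<C>" "b \<in> \<Union>\<C>"
      then obtain J where J: "J \<in> \<C>" "a \<in> J" "b \<in> J" using lin by blast
      then have "a + b \<in> J" using C[OF J(1)] by (simp add: \<J>_def ideal_on_def)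
      then show "a + b \<in> \<Union>\<C>" using J(1) by blast
    next
      fix a b assume "a \<in> A" "b \<in> \<Union>\<C>"
      then obtain J where J: "J \<in> \<C>" "b \<in> J" by blast
      then have "a * b \<in> J" using C[OF J(1)] \<open>a \<in> A\<close> by (simp add: \<J>_def ideal_on_def)
      then show "a * b \<in> \<Union>\<C>" using J(1) by blast
    next
      show "\<Union>\<C> \<subseteq> A" using C by (simp add: \<J>_def ideal_on_def Union_least)
      obtain J where "J \<in> \<C>" using \<open>\<C> \<noteq> {}\<close> by blast
      then show "0 \<in> \<Union>\<C>" using C[of J] by (auto simp: \<J>_def ideal_on_def)
    qed
    then show ?thesis using C \<open>\<C> \<noteq> {}\<close> by (auto simp: \<J>_def)
  qed
  ultimately obtain M where M: "M \<in> \<J>"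
    and max: "\<And>X. X \<in> \<J> \<Longrightarrow> M \<subseteq> X \<Longrightarrow> X = M"
    using subset_Zorn_nonempty[of \<J>] by blast
  have Mi: "M \<subseteq> A" "0 \<in> M" "\<And>a b. a \<in> M \<Longrightarrow> b \<in> M \<Longrightarrow> a + b \<in> M" "\<And>a b. a \<in> A \<Longrightarrow> b \<in> M \<Longrightarrow> a * b \<in> M"
    and Mh: "\<And>k. h ^ k \<notin> M" "I \<subseteq> M"
    using M by (auto simp: \<J>_def ideal_on_def)
  have pow: "\<exists>k. \<exists>m\<in>M. \<exists>r\<in>A. h ^ k = m + r * a"
    if a: "a \<in> A" "a \<notin> M" for a
  proof (rule ccontr)
    assume no: "\<not> ?thesis"
    define J where "J = {m + r * a | m r. m \<in> M \<and> r \<in> A}"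
    have "ideal_on A J"
      unfolding ideal_on_def
    proof (intro conjI ballI)
      show "J \<subseteq> A" using Mi a subring_onD(4,6)[OF A] by (auto simp: J_def)
      show "0 \<in> J" using Mi subring_onD(1)[OF A] unfolding J_def by force
    next
      fix x y assume "x \<in> J" "y \<in> J"
      then obtain m r m' r' where "x = m + r * a" "y = m' + r' * a" "m \<in> M" "m' \<in> M" "r \<in> A" "r' \<in> A"
        by (auto simp: J_def)
      then have "x + y = (m + m') + (r + r') * a" "m + m' \<in> M" "r + r' \<in> A"
        using Mi subring_onD(6)[OF A] by (auto simp: algebra_simps)
      then show "x + y \<in> J" unfolding J_def by blast
    next
      fix c x assume "c \<in> A" "x \<in> J"
      then obtain m r where "x = m + r * a" "m \<in> M" "r \<in> A" by (auto simp: J_def)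
      then have "c * x = c * m + (c * r) * a" "c * m \<in> M" "c * r \<in> A"
        using Mi subring_onD(4)[OF A] \<open>c \<in> A\<close> by (auto simp: algebra_simps)
      then show "c * x \<in> J" unfolding J_def by blast
    qed
    moreover have MJ: "M \<subseteq> J"
    proof
      fix m assume "m \<in> M"
      then have "m = m + 0 * a \<and> m \<in> M \<and> 0 \<in> A" using subring_onD(1)[OF A] by simp
      then show "m \<in> J" unfolding J_def by blast
    qed
    moreover have "\<forall>k. h ^ k \<notin> J" using no by (auto simp: J_def)
    ultimately have "J = M" using Mh(2) by (intro max) (auto simp: \<J>_def)
    moreover have "a = 0 + 1 * a \<and> 0 \<in> M \<and> 1 \<in> A" using Mi subring_onD(2)[OF A] by simp
    then have "a \<in> J" unfolding J_def by blast
    ultimately show False using a by simp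
  qed
  have "prime_on A M"
    unfolding prime_on_def
  proof (intro conjI ballI impI)
    show "ideal_on A M" using M by (simp add: \<J>_def)
    show "1 \<notin> M" using Mh(1)[of 0] by simp
    fix a b assume ab: "a \<in> A" "b \<in> A" "a * b \<in> M"
    show "a \<in> M \<or> b \<in> M"
    proof (rule ccontr)
      assume "\<not> ?thesis"
      then obtain k m r l m' r' where *: "h ^ k = m + r * a" "m \<in> M" "r \<in> A"
        "h ^ l = m' + r' * b" "m' \<in> M" "r' \<in> A"
        using pow ab(1,2) by metis
      have "h ^ (k + l) = m' * m + (r * a) * m' + (r' * b) * m + (r * r') * (a * b)"
        by (simp add: power_add * algebra_simps)
      moreover have "m' * m \<in> M" "(r * a) * m' \<in> M" "(r' * b) * m \<in> M" "(r * r') * (a * b) \<in> M"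
        using * ab Mi subring_onD(4)[OF A] by auto
      ultimately show False using Mh Mi(3) by metis
    qed
  qed
  then show ?thesis using that Mh by blast
qed

lemma point_avoiding_powers:
  assumes A: "subring_on A" and I: "ideal_on A I" and h: "h \<in> A" "\<And>k. h ^ k \<notin> I"
  obtains z where "z \<in> spec_points A" "h \<in> units_in z" "\<And>a. a \<in> I \<Longrightarrow> a \<notin> units_in z"
proof -
  obtain P where P: "prime_on A P" "I \<subseteq> P" "\<And>k. h ^ k \<notin> P"
    using prime_avoiding_powers[OF assms] by metis
  have one: "1 \<in> A - P" using P(1) subring_onD(2)[OF A] by (auto simp: prime_on_def)
  have "localization_at A P \<in> spec_points A"
    using P(1) primeideal_ring_on[OF A] by (auto simp: spec_points_def)
  moreover have "h \<in> units_in (localization_at A P)"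
    using localization_units[OF A P(1) h(1) one] P(3)[of 1] by simp
  moreover have "a \<notin> units_in (localization_at A P)" if "a \<in> I" for a
    using localization_units[OF A P(1) _ one, of a] that I P(2) by (auto simp: ideal_on_def)
  ultimately show ?thesis using that by blast
qed

text \<open>
  Otherwise there is a prime ideal that contains all denominators of \<open>y\<close> and does not contain
  \<open>h\<close>; at this point \<open>y\<close> is not regular.
\<close>

lemma regular_on_basic_open:
  assumes A: "subring_on A" and h: "h \<in> A"
    and y: "\<And>z. z \<in> spec_points A \<Longrightarrow> h \<in> units_in z \<Longrightarrow> y \<in> z"
  shows "\<exists>k. h ^ k * y \<in> A"
proof (rule ccontr)
  assume no: "\<nexists>k. h ^ k * y \<in> A"
  define I where "I = {s\<in>A. s * y \<in> A}"
  have "ideal_on A I"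
    by (auto simp: ideal_on_def I_def distrib_right mult.assoc intro: subring_onD[OF A])
  moreover have "h ^ k \<notin> I" for k using no by (auto simp: I_def)
  ultimately obtain z where z: "z \<in> spec_points A" "h \<in> units_in z" "\<And>a. a \<in> I \<Longrightarrow> a \<notin> units_in z"
    using point_avoiding_powers[OF A _ h] by metis
  then obtain a s where "a \<in> A" "s \<in> A" "s \<in> units_in z" "y = a / s"
    using y spec_pointsD(4)[OF A] by metis
  then show False using z(3)[of s] by (auto simp: I_def units_in_iff)
qed

lemma regular_everywhere:
  assumes A: "subring_on A" and y: "\<And>z. z \<in> spec_points A \<Longrightarrow> y \<in> z"
  shows "y \<in> A"
  using regular_on_basic_open[OF A subring_onD(2)[OF A], of y] y by auto

text \<open>
  Quasi-compactness of the spectrum: the ideal generated by \<open>H\<close> is contained in no prime ideal,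
  hence it contains 1, and 1 is a combination of finitely many elements of \<open>H\<close>.
\<close>

lemma basic_open_cover:
  assumes A: "subring_on A" and H: "H \<subseteq> A" "\<And>z. z \<in> spec_points A \<Longrightarrow> \<exists>h\<in>H. h \<in> units_in z"
  obtains T c where "finite T" "T \<subseteq> H" "\<And>h. c h \<in> A" "(\<Sum>h\<in>T. c h * h) = 1"
proof -
  define I where "I = {\<Sum>h\<in>T. c h * h | T c. finite T \<and> T \<subseteq> H \<and> (\<forall>h. c h \<in> A)}"
  have "ideal_on A I"
    unfolding ideal_on_def
  proof (intro conjI ballI)
    show "I \<subseteq> A" using H(1) by (auto simp: I_def intro!: subring_on_sum[OF A] subring_onD(4)[OF A])
    show "0 \<in> I"
      using subring_onD(1)[OF A] unfolding I_def
      by (intro CollectI exI[of _ "{}"] exI[of _ "\<lambda>_. 0"]) auto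
  next
    fix x y assume "x \<in> I" "y \<in> I"
    then obtain T c T' c' where *: "x = (\<Sum>h\<in>T. c h * h)" "finite T" "T \<subseteq> H" "\<And>h. c h \<in> A"
      "y = (\<Sum>h\<in>T'. c' h * h)" "finite T'" "T' \<subseteq> H" "\<And>h. c' h \<in> A"
      by (auto simp: I_def)
    let ?c = "\<lambda>h. (if h \<in> T then c h else 0) + (if h \<in> T' then c' h else 0)"
    have "x = (\<Sum>h\<in>T \<union> T'. (if h \<in> T then c h else 0) * h)"
      unfolding * by (intro sum.mono_neutral_cong_left) (use * in auto)
    moreover have "y = (\<Sum>h\<in>T \<union> T'. (if h \<in> T' then c' h else 0) * h)"
      unfolding * by (intro sum.mono_neutral_cong_left) (use * in auto)
    ultimately have "x + y = (\<Sum>h\<in>T \<union> T'. ?c h * h)"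
      by (simp only: sum.distrib[symmetric] distrib_right)
    moreover have "\<forall>h. ?c h \<in> A" using * subring_onD(1,6)[OF A] by auto
    ultimately show "x + y \<in> I" using * unfolding I_def
      by (intro CollectI exI[of _ "T \<union> T'"] exI[of _ ?c]) auto
  next
    fix a x assume "a \<in> A" "x \<in> I"
    then obtain T c where "x = (\<Sum>h\<in>T. c h * h)" "finite T" "T \<subseteq> H" "\<And>h. c h \<in> A"
      by (auto simp: I_def)
    then show "a * x \<in> I"
      unfolding I_def using subring_onD(4)[OF A \<open>a \<in> A\<close>]
      by (intro CollectI exI[of _ T] exI[of _ "\<lambda>h. a * c h"]) (auto simp: sum_distrib_left mult.assoc)
  qed
  moreover have "H \<subseteq> I"
  proof
    fix h assume "h \<in> H"
    then show "h \<in> I" unfolding I_def using subring_onD(2)[OF A]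
      by (intro CollectI exI[of _ "{h}"] exI[of _ "\<lambda>_. 1"]) auto
  qed
  ultimately have "1 \<in> I"
    using point_avoiding_powers[OF A, of I 1] H(2) subring_onD(2)[OF A]
    by (metis power_one subsetD)
  then show ?thesis using that unfolding I_def by (smt (verit) mem_Collect_eq)
qed

lemma local_sum_unit:
  assumes "local_on z" "finite T" "\<And>h. h \<in> T \<Longrightarrow> f h \<in> z" "sum f T \<in> units_in z"
  shows "\<exists>h\<in>T. f h \<in> units_in z"
  using assms(2,3,4)
proof (induction T)
  case empty
  then show ?case by (simp add: units_in_iff)
next
  case (insert h T)
  have "sum f T \<in> z"
    using assms(1) insert.prems by (auto simp: local_on_def intro: subring_on_sum)
  then show ?case
    using insert assms(1) by (auto simp: local_on_def)
qed

lemma unit_coset_eq_iff: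
  assumes y: "subring_on y" and "f \<noteq> 0" "g \<noteq> 0"
  shows "unit_coset f y = unit_coset g y \<longleftrightarrow> f / g \<in> units_in y"
proof
  assume "unit_coset f y = unit_coset g y"
  then have "f * 1 \<in> unit_coset g y"
    using units_in_one[OF y] unfolding unit_coset_def by blast
  then show "f / g \<in> units_in y"
    using assms by (auto simp: unit_coset_def)
next
  assume *: "f / g \<in> units_in y"
  have sub: "unit_coset f y \<subseteq> unit_coset g y"
    if "f / g \<in> units_in y" "f \<noteq> 0" "g \<noteq> 0" for f g
  proof
    fix a assume "a \<in> unit_coset f y"
    then obtain u where u: "u \<in> units_in y" "a = f * u" by (auto simp: unit_coset_def)
    then have "a = g * (f / g * u)" using that by simp
    then show "a \<in> unit_coset g y"
      using units_in_mult[OF y that(1) u(1)] unfolding unit_coset_def by blast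
  qed
  show "unit_coset f y = unit_coset g y"
    using sub[OF *] sub[of g f] units_in_inverse[OF *] assms(2,3) by auto
qed

text \<open>
  Choose finitely many basic open sets \<open>D(h)\<close>, \<open>h \<in> T\<close>, that cover the spectrum and carry
  equations \<open>g h / B\<close> with a common denominator. On the overlap \<open>D(h) \<inter> D(h')\<close> the quotient of
  two of them is regular, so \<open>g h\<close> divides \<open>(h * h') ^ N * g h'\<close>. Let \<open>d\<close> be a greatest common
  divisor of the elements \<open>h ^ N * g h\<close>. Then \<open>d / B\<close> is an equation everywhere: on \<open>D(h)\<close> the
  element \<open>d\<close> divides \<open>g h\<close>, and \<open>g h\<close> divides \<open>h ^ N * d\<close> because greatest common divisors are
  compatible with scaling.
\<close>

theorem locally_principal_gcd_ring:
  fixes A :: "'k::field set"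
  assumes gcd: "gcd_ring A"
    and C: "\<And>x. x \<in> spec_points A \<Longrightarrow> \<exists>h\<in>A. h \<in> units_in x \<and> (\<exists>a\<in>A. \<exists>b\<in>A. a \<noteq> 0 \<and> b \<noteq> 0 \<and>
       (\<forall>y\<in>spec_points A. h \<in> units_in y \<longrightarrow> C y = unit_coset (a / b) y))"
  shows "\<exists>a\<in>A. \<exists>b\<in>A. a \<noteq> 0 \<and> b \<noteq> 0 \<and> (\<forall>y\<in>spec_points A. C y = unit_coset (a / b) y)"
proof -
  note A = gcd_ring_subring[OF gcd]
  define Q where "Q h a b \<longleftrightarrow> a \<in> A \<and> b \<in> A \<and> a \<noteq> 0 \<and> b \<noteq> 0 \<and>
       (\<forall>y\<in>spec_points A. h \<in> units_in y \<longrightarrow> C y = unit_coset (a / b) y)" for h a b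
  define H where "H = {h\<in>A. \<exists>a b. Q h a b}"
  have "\<exists>h\<in>H. h \<in> units_in z" if "z \<in> spec_points A" for z
  proof -
    obtain h a b where "h \<in> A" "h \<in> units_in z" "Q h a b"
      using C[OF \<open>z \<in> spec_points A\<close>] unfolding Q_def by metis
    then show ?thesis unfolding H_def by blast
  qed
  then obtain T c where T: "finite T" "T \<subseteq> H" "\<And>h. c h \<in> A" "(\<Sum>h\<in>T. c h * h) = 1"
    using basic_open_cover[OF A, of H] unfolding H_def by blast
  have TA: "h \<in> A" if "h \<in> T" for h using T(2) that by (auto simp: H_def)
  obtain a b where ab: "\<And>h. h \<in> T \<Longrightarrow> Q h (a h) (b h)"
  proof -
    have "\<forall>h\<in>T. \<exists>ab. Q h (fst ab) (snd ab)"
      using T(2) unfolding H_def by auto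
    then obtain f where "\<forall>h\<in>T. Q h (fst (f h)) (snd (f h))" by metis
    then show ?thesis using that[of "\<lambda>h. fst (f h)" "\<lambda>h. snd (f h)"] by simp
  qed
  define B where "B = prod b T"
  define g where "g h = a h * prod b (T - {h})" for h
  have B: "B \<in> A" "B \<noteq> 0"
    using ab T(1) unfolding B_def Q_def by (auto intro!: subring_on_prod[OF A])
  have gA: "g h \<in> A" "g h \<noteq> 0"
    and gC: "\<And>y. y \<in> spec_points A \<Longrightarrow> h \<in> units_in y \<Longrightarrow> C y = unit_coset (g h / B) y"
    if h: "h \<in> T" for h
  proof -
    have "prod b (T - {h}) \<in> A" "prod b (T - {h}) \<noteq> 0"
      using ab T(1) unfolding Q_def by (auto intro!: subring_on_prod[OF A])
    then show "g h \<in> A" "g h \<noteq> 0"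
      using ab[OF h] subring_onD(4)[OF A] by (auto simp: g_def Q_def)
    have "B = b h * prod b (T - {h})"
      unfolding B_def using prod.remove[OF T(1) h] .
    then have "g h / B = a h / b h"
      using \<open>prod b (T - {h}) \<noteq> 0\<close> by (simp add: g_def)
    then show "\<And>y. y \<in> spec_points A \<Longrightarrow> h \<in> units_in y \<Longrightarrow> C y = unit_coset (g h / B) y"
      using ab[OF h] by (simp add: Q_def)
  qed
  have "\<exists>k. (h * h') ^ k * (g h' / g h) \<in> A" if h: "h \<in> T" "h' \<in> T" for h h'
  proof (rule regular_on_basic_open[OF A])
    show "h * h' \<in> A" using TA h subring_onD(4)[OF A] by blast
    fix z assume z: "z \<in> spec_points A" "h * h' \<in> units_in z"
    note subz = spec_pointsD(1)[OF A z(1)]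
    have "h \<in> units_in z" "h' \<in> units_in z"
      using units_in_factor[OF subz, of h h'] units_in_factor[OF subz, of h' h] z h TA
        spec_pointsD(2)[OF A z(1)] by (auto simp: mult.commute)
    then have "unit_coset (g h' / B) z = unit_coset (g h / B) z"
      using gC h z(1) by metis
    then show "g h' / g h \<in> z"
      using unit_coset_eq_iff[OF subz, of "g h' / B" "g h / B"] gA h B by (simp add: units_in_iff)
  qed
  then obtain k where k: "\<And>h h'. h \<in> T \<Longrightarrow> h' \<in> T \<Longrightarrow> (h * h') ^ k h h' * (g h' / g h) \<in> A"
    by metis
  define N where "N = Max ((\<lambda>(h, h'). k h h') ` (T \<times> T))"
  have N: "(h * h') ^ N * (g h' / g h) \<in> A" if h: "h \<in> T" "h' \<in> T" for h h'
  proof -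
    have "k h h' \<in> (\<lambda>(h, h'). k h h') ` (T \<times> T)" using h by force
    then have "k h h' \<le> N"
      unfolding N_def using T(1) by (intro Max_ge) auto
    then have "(h * h') ^ N * (g h' / g h) = (h * h') ^ (N - k h h') * ((h * h') ^ k h h' * (g h' / g h))"
      by (simp add: mult.assoc[symmetric] power_add[symmetric])
    then show ?thesis
      using k[OF h] subring_onD(4,7)[OF A] TA h by metis
  qed
  let ?S = "(\<lambda>h. h ^ N * g h) ` T"
  have SA: "?S \<subseteq> A" using gA TA by (auto intro!: subring_onD(4,7)[OF A])
  obtain d where d: "d \<in> A" "\<forall>e\<in>A. dvd_on A e d \<longleftrightarrow> (\<forall>s\<in>?S. dvd_on A e s)"
    using gcd_ring_finite[OF gcd _ SA] T(1) by blast
  have dS: "dvd_on A d (h ^ N * g h)" if "h \<in> T" for h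
    using d(2)[rule_format, OF d(1)] dvd_on_refl[OF A, of d] that by blast
  have "d \<noteq> 0"
  proof -
    have "\<exists>h\<in>T. h \<noteq> 0"
      using T(4) by (metis mult_zero_right sum.neutral zero_neq_one)
    then show ?thesis using dS gA by (auto simp: dvd_on_def)
  qed
  have gd: "dvd_on A (g h) (h ^ N * d)" if h: "h \<in> T" for h
  proof (rule gcd_scaled[OF gcd _ SA _ d])
    fix s assume "s \<in> ?S"
    then obtain h' where h': "h' \<in> T" "s = h' ^ N * g h'" by auto
    have "h ^ N * s = g h * ((h * h') ^ N * (g h' / g h))"
      using gA[OF h] by (simp add: h' power_mult_distrib)
    then show "dvd_on A (g h) (h ^ N * s)"
      using N[OF h h'(1)] unfolding dvd_on_def by blast
  qed (use T(1) gA TA h subring_onD(7)[OF A] in auto)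
  have "C y = unit_coset (d / B) y" if y: "y \<in> spec_points A" for y
  proof -
    note suby = spec_pointsD(1)[OF A y] and Ay = spec_pointsD(2)[OF A y]
    have cy: "c h * h \<in> y" if "h \<in> T" for h
      using T(3) TA[OF that] Ay subring_onD(4)[OF A] by blast
    obtain h where h: "h \<in> T" "c h * h \<in> units_in y"
      using local_sum_unit[OF spec_pointsD(3)[OF A y] T(1), of "\<lambda>h. c h * h"] cy
        T(4) units_in_one[OF suby] by auto
    have hu: "h \<in> units_in y"
      using units_in_factor[OF suby, of h "c h"] h T(3) TA[OF h(1)] Ay by (auto simp: mult.commute)
    then have hN: "h ^ N \<in> units_in y" using units_in_power[OF suby] by blast
    obtain r where r: "r \<in> A" "h ^ N * d = g h * r" using gd[OF h(1)] by (auto simp: dvd_on_def)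
    obtain r' where r': "r' \<in> A" "h ^ N * g h = d * r'" using dS[OF h(1)] by (auto simp: dvd_on_def)
    have h0: "h ^ N \<noteq> 0" using hN by (simp add: units_in_iff)
    have "g h / d = r' / h ^ N" "inverse (g h / d) = r / h ^ N"
      using r r' h0 gA[OF h(1)] \<open>d \<noteq> 0\<close> by (simp_all add: field_simps)
    then have "g h / d \<in> y" "inverse (g h / d) \<in> y"
      using units_in_divide_mem[OF suby _ hN] r(1) r'(1) Ay by (metis subsetD)+
    then have "g h / d \<in> units_in y"
      using gA[OF h(1)] \<open>d \<noteq> 0\<close> by (simp add: units_in_iff)
    then show ?thesis
      using unit_coset_eq_iff[OF suby, of "g h / B" "d / B"] gC[OF h(1) y hu] gA[OF h(1)] \<open>d \<noteq> 0\<close> B by simp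
  qed
  then show ?thesis using d B \<open>d \<noteq> 0\<close> by blast
qed

section \<open>Group algebras\<close>

definition monomial :: "'a \<Rightarrow> 'k \<Rightarrow> ('a::comm_monoid_add, 'k::comm_ring_1) group_algebra" where
  "monomial m c = Abs_ga (Poly_Mapping.single m c)"

abbreviation ga_lookup :: "('a, 'k::zero) group_algebra \<Rightarrow> 'a \<Rightarrow> 'k" where
  "ga_lookup p \<equiv> Poly_Mapping.lookup (ga_coeffs p)"

abbreviation ga_keys :: "('a, 'k::zero) group_algebra \<Rightarrow> 'a set" where
  "ga_keys p \<equiv> Poly_Mapping.keys (ga_coeffs p)"

definition algebra_over :: "'a set \<Rightarrow> ('a::real_inner, 'k::field) group_algebra set" where
  "algebra_over S = {p. ga_keys p \<subseteq> S}"

lemma ga_coeffs_simps [simp]: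
  "ga_coeffs 0 = 0" "ga_coeffs 1 = 1" "ga_coeffs (p + q) = ga_coeffs p + ga_coeffs q"
  "ga_coeffs (p - q) = ga_coeffs p - ga_coeffs q" "ga_coeffs (p * q) = ga_coeffs p * ga_coeffs q"
  "ga_coeffs (monomial m c) = Poly_Mapping.single m c"
  by (simp_all add: zero_group_algebra.rep_eq one_group_algebra.rep_eq plus_group_algebra.rep_eq
      minus_group_algebra.rep_eq times_group_algebra.rep_eq monomial_def Abs_ga_inverse)

lemma ga_coeffs_sum: "ga_coeffs (sum f I) = (\<Sum>i\<in>I. ga_coeffs (f i))"
  by (induction I rule: infinite_finite_induct) auto

lemma ga_eqI: "(\<And>k. ga_lookup p k = ga_lookup q k) \<Longrightarrow> p = q"
  by (metis ga_coeffs_inject poly_mapping_eqI)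

lemma monomial_mult: "monomial m c * monomial m' c' = monomial (m + m') (c * c')"
  by (rule ga_eqI) (simp add: mult_single)

lemma monomial_add: "monomial m (c + c') = monomial m c + monomial m c'"
  by (rule ga_eqI) (simp add: single_add)

lemma monomial_zero_one [simp]: "monomial 0 1 = 1" "monomial m 0 = 0"
  by (rule ga_eqI; simp)+

lemma monomial_power: "monomial m 1 ^ k = monomial (\<Sum>i<k. m) 1"
  by (induction k) (auto simp: monomial_mult add.commute)

lemma monomial_eq_0_iff [simp]: "monomial m c = 0 \<longleftrightarrow> c = 0"
  by (metis ga_coeffs_simps(1,6) lookup_single_eq lookup_zero monomial_zero_one(2))

lemma ga_sum_monomials: "p = (\<Sum>k\<in>ga_keys p. monomial k (ga_lookup p k))"
proof (rule ga_eqI)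
  fix m
  show "ga_lookup p m = ga_lookup (\<Sum>k\<in>ga_keys p. monomial k (ga_lookup p k)) m"
    by (simp add: ga_coeffs_sum lookup_sum lookup_single when_def in_keys_iff)
qed

text \<open>
  The monomials generate the group algebra as an additive group.
\<close>

lemma ga_additive_eqI:
  fixes f g :: "('a::comm_monoid_add, 'k::comm_ring_1) group_algebra \<Rightarrow> 'c::comm_monoid_add"
  assumes "\<And>p q. f (p + q) = f p + f q" "\<And>p q. g (p + q) = g p + g q" "f 0 = 0" "g 0 = 0"
    and "\<And>m c. f (monomial m c) = g (monomial m c)"
  shows "f p = g p"
proof -
  have "f (sum h I) = (\<Sum>i\<in>I. f (h i))" "g (sum h I) = (\<Sum>i\<in>I. g (h i))" for h
    and I :: "'a set"
    by (induction I rule: infinite_finite_induct) (auto simp: assms)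
  then show ?thesis
    by (subst (1 2) ga_sum_monomials) (simp add: assms(5))
qed

lemma subring_algebra_over:
  assumes "0 \<in> S" "\<And>a b. a \<in> S \<Longrightarrow> b \<in> S \<Longrightarrow> a + b \<in> S"
  shows "subring_on (algebra_over S)"
  unfolding subring_on_def
proof (intro conjI ballI)
  fix p q :: "('a, 'b) group_algebra" assume pq: "p \<in> algebra_over S" "q \<in> algebra_over S"
  have "ga_keys (p - q) \<subseteq> ga_keys p \<union> ga_keys q"
    by (auto simp: in_keys_iff lookup_minus)
  then show "p - q \<in> algebra_over S"
    using pq by (auto simp: algebra_over_def)
  show "p * q \<in> algebra_over S"
    using keys_mult[of "ga_coeffs p" "ga_coeffs q"] pq assms(2) by (fastforce simp: algebra_over_def)
qed (use assms(1) in \<open>auto simp: algebra_over_def\<close>)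

lemma monomial_in_algebra_over: "m \<in> S \<Longrightarrow> monomial m c \<in> algebra_over S"
  by (auto simp: algebra_over_def)

subsection \<open>Units\<close>

text \<open>
  The parts of \<open>p\<close> and \<open>q\<close> of highest degree in the direction \<open>v\<close> have a nonzero product, and
  its terms cannot cancel because all other products of terms have lower degree.
\<close>

lemma extreme_key:
  fixes p q :: "'a::real_inner \<Rightarrow>\<^sub>0 'k::idom"
  assumes "p \<noteq> 0" "q \<noteq> 0"
  shows "\<exists>k\<in>Poly_Mapping.keys (p * q). \<forall>a\<in>Poly_Mapping.keys p. \<forall>b\<in>Poly_Mapping.keys q. a \<bullet> v + b \<bullet> v \<le> k \<bullet> v"
proof -
  define top where "top p = Max ((\<lambda>k. k \<bullet> v) ` Poly_Mapping.keys p)"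
    for p :: "'a \<Rightarrow>\<^sub>0 'k"
  define T where "T p = (\<Sum>k | k \<in> Poly_Mapping.keys p \<and> k \<bullet> v = top p. Poly_Mapping.single k (Poly_Mapping.lookup p k))" for p :: "'a \<Rightarrow>\<^sub>0 'k"
  have le: "k \<bullet> v \<le> top p" if "k \<in> Poly_Mapping.keys p" for k p
    unfolding top_def using that by (intro Max_ge) auto
  have lookT: "Poly_Mapping.lookup (T p) k = (Poly_Mapping.lookup p k when k \<bullet> v = top p)" for p k
    unfolding T_def lookup_sum lookup_single
    by (subst when_def, subst sum.delta) (auto simp: when_def in_keys_iff)
  have keyT: "k \<bullet> v = top p" if "k \<in> Poly_Mapping.keys (T p)" for p k
    using that lookT[of p k] by (auto simp: in_keys_iff when_def split: if_splits)
  have keyR: "k \<bullet> v < top p" if "k \<in> Poly_Mapping.keys (p - T p)" for p k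
  proof -
    have "Poly_Mapping.lookup p k \<noteq> 0" "k \<bullet> v \<noteq> top p"
      using that lookT[of p k] by (auto simp: in_keys_iff lookup_minus when_def split: if_splits)
    then show ?thesis using le[of k p] by (simp add: in_keys_iff)
  qed
  have T0: "T p \<noteq> 0" if "p \<noteq> 0" for p
  proof -
    have "top p \<in> (\<lambda>k. k \<bullet> v) ` Poly_Mapping.keys p"
      unfolding top_def using that by (intro Max_in) auto
    then obtain k where "k \<in> Poly_Mapping.keys p" "k \<bullet> v = top p" by auto
    then show ?thesis using lookT[of p k] by (auto simp: in_keys_iff)
  qed
  have "T p * T q \<noteq> 0"
    using poly_mapping_times_nonzero T0 assms by blast
  then obtain k where k: "k \<in> Poly_Mapping.keys (T p * T q)"
    by (metis all_not_in_conv keys_eq_empty)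
  have kv: "k \<bullet> v = top p + top q"
    using keys_mult[of "T p" "T q"] k keyT by (fastforce simp: inner_add_left)
  have low: "Poly_Mapping.lookup (x * y) k = 0"
    if "\<And>a b. a \<in> Poly_Mapping.keys x \<Longrightarrow> b \<in> Poly_Mapping.keys y \<Longrightarrow> a \<bullet> v + b \<bullet> v < top p + top q" for x y :: "'a \<Rightarrow>\<^sub>0 'k"
  proof (rule ccontr)
    assume "Poly_Mapping.lookup (x * y) k \<noteq> 0"
    then have "k \<in> Poly_Mapping.keys (x * y)" by (simp add: in_keys_iff)
    then obtain a b where "k = a + b" "a \<in> Poly_Mapping.keys x" "b \<in> Poly_Mapping.keys y"
      using keys_mult[of x y] by blast
    then show False using that[of a b] kv by (simp add: inner_add_left)
  qed
  have "p * q = T p * T q + (p - T p) * q + T p * (q - T q)"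
    by (simp add: algebra_simps)
  moreover have "Poly_Mapping.lookup ((p - T p) * q) k = 0"
    using keyR le by (intro low) (meson add_less_le_mono)
  moreover have "Poly_Mapping.lookup (T p * (q - T q)) k = 0"
    using keyR keyT by (intro low) (auto intro!: add_le_less_mono)
  ultimately have "k \<in> Poly_Mapping.keys (p * q)"
    using k by (simp add: in_keys_iff lookup_add)
  then show ?thesis
    using kv le by (intro bexI[of _ k]) (auto intro: add_mono)
qed

text \<open>
  Two different exponents of \<open>p\<close> have different degrees in the direction of their difference.
  The product then has terms of different degrees as well, whereas 1 has only one term.
\<close>

lemma unit_is_monomial:
  fixes p q :: "('a::real_inner, 'k::field) group_algebra"
  assumes "p * q = 1"
  obtains m c where "c \<noteq> 0" "p = monomial m c" "q = monomial (- m) (inverse c)"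
proof -
  have one_key: "\<exists>m. ga_keys p = {m}" if pq: "p * q = 1" for p q :: "('a, 'k) group_algebra"
  proof -
    have prod: "ga_coeffs p * ga_coeffs q = 1"
      using pq by (metis ga_coeffs_simps(2,5))
    then have nz: "ga_coeffs p \<noteq> 0" "ga_coeffs q \<noteq> 0" by auto
    have "k1 = k2" if "k1 \<in> ga_keys p" "k2 \<in> ga_keys p" for k1 k2
    proof (rule ccontr)
      assume "k1 \<noteq> k2"
      obtain b where b: "b \<in> ga_keys q" using nz by (metis all_not_in_conv keys_eq_empty)
      have key0: "k = 0" if "k \<in> Poly_Mapping.keys (ga_coeffs p * ga_coeffs q)" for k
        using that unfolding prod by (simp add: keys_one)
      have "k1 \<bullet> (k1 - k2) + b \<bullet> (k1 - k2) \<le> 0"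
        using extreme_key[OF nz, of "k1 - k2"] key0 that b by (metis inner_zero_left)
      moreover have "k2 \<bullet> - (k1 - k2) + b \<bullet> - (k1 - k2) \<le> 0"
        using extreme_key[OF nz, of "- (k1 - k2)"] key0 that b by (metis inner_zero_left)
      ultimately have "(k1 - k2) \<bullet> (k1 - k2) \<le> 0"
        by (simp add: inner_diff_left inner_diff_right inner_commute)
      then show False using \<open>k1 \<noteq> k2\<close>
        by (metis eq_iff_diff_eq_0 inner_ge_zero inner_eq_zero_iff order_antisym)
    qed
    then show ?thesis using nz by (metis all_not_in_conv keys_eq_empty is_singletonI' is_singleton_def)
  qed
  obtain m where m: "ga_keys p = {m}" using one_key[OF assms] by blast
  define c where "c = ga_lookup p m"
  have c: "c \<noteq> 0" using m unfolding c_def by (metis in_keys_iff singletonI)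
  have p: "p = monomial m c"
    using ga_sum_monomials[of p] m by (simp add: c_def)
  have "p * monomial (- m) (inverse c) = 1"
    using c by (simp add: p monomial_mult)
  then have "q = monomial (- m) (inverse c)"
    using assms by (metis mult.commute mult.left_commute mult_1_right)
  then show ?thesis using that c p by blast
qed

subsection \<open>Algebras of free commutative monoids\<close>

lemma lookup_mult_monomial:
  fixes p :: "('a::real_inner, 'k::field) group_algebra"
  shows "ga_lookup (p * monomial m c) k = ga_lookup p (k - m) * c"
proof -
  have "(\<lambda>p. monomial k (ga_lookup (p * monomial m c) k)) p = (\<lambda>p. monomial k (ga_lookup p (k - m) * c)) p"
  proof (rule ga_additive_eqI[of _ _ p])
    fix m' c'
    have "m' + m = k \<longleftrightarrow> m' = k - m" by auto
    then show "monomial k (ga_lookup (monomial m' c' * monomial m c) k) = monomial k (ga_lookup (monomial m' c') (k - m) * c)"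
      by (simp add: mult_single lookup_single when_def)
  qed (auto simp: distrib_right lookup_add monomial_add)
  then have "ga_lookup (monomial k (ga_lookup (p * monomial m c) k)) k = ga_lookup (monomial k (ga_lookup p (k - m) * c)) k"
    by simp
  then show ?thesis by simp
qed

definition nat_span :: "('j \<Rightarrow> 'a::real_vector) \<Rightarrow> 'j set \<Rightarrow> 'a set" where
  "nat_span b J = {\<Sum>j\<in>J. real (a j) *\<^sub>R b j | a. True}"

lemma nat_span_add: "x \<in> nat_span b J \<Longrightarrow> y \<in> nat_span b J \<Longrightarrow> x + y \<in> nat_span b J"
  by (auto simp: nat_span_def sum.distrib[symmetric] scaleR_left_distrib[symmetric] of_nat_add[symmetric]
      simp del: of_nat_add)

lemma nat_span_0: "0 \<in> nat_span b J"
  unfolding nat_span_def by (intro CollectI exI[of _ "\<lambda>_. 0"]) auto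

lemma subring_nat_span: "subring_on (algebra_over (nat_span b J))"
  by (intro subring_algebra_over nat_span_0 nat_span_add)

text \<open>
  The degree in the direction \<open>e\<close> is the exponent of the new variable.
\<close>

lemma lookup_poly_monomial:
  fixes P :: "('a::real_inner, 'k::field) group_algebra poly"
  assumes P: "P \<in> polys_on (algebra_over S)"
    and S: "\<And>m. m \<in> S \<Longrightarrow> m \<bullet> e = 0" and b: "b \<bullet> e = 1"
      and m: "m \<bullet> e = 0"
  shows "ga_lookup (poly P (monomial b 1)) (m + real i *\<^sub>R b) = ga_lookup (coeff P i) m"
proof -
  have summand: "ga_lookup (coeff P j * monomial b 1 ^ j) (m + real i *\<^sub>R b) = (ga_lookup (coeff P i) m when j = i)" for j
  proof -
    have pow: "monomial b 1 ^ j = (monomial (real j *\<^sub>R b) 1 :: ('a, 'k) group_algebra)"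
      by (simp add: monomial_power sum_constant_scaleR)
    have "ga_lookup (coeff P j) (m + real i *\<^sub>R b - real j *\<^sub>R b) = 0" if "j \<noteq> i"
    proof -
      have "(m + real i *\<^sub>R b - real j *\<^sub>R b) \<bullet> e \<noteq> 0"
        using m b that by (simp add: inner_add_left inner_diff_left)
      then have "m + real i *\<^sub>R b - real j *\<^sub>R b \<notin> ga_keys (coeff P j)"
        using P S by (auto simp: polys_on_def algebra_over_def)
      then show ?thesis by (simp add: in_keys_iff)
    qed
    then show ?thesis
      unfolding pow lookup_mult_monomial by (cases "j = i") (simp_all add: when_def)
  qed
  have "ga_lookup (poly P (monomial b 1)) (m + real i *\<^sub>R b) = (\<Sum>j\<le>degree P. ga_lookup (coeff P i) m when j = i)"
    by (simp only: poly_altdef ga_coeffs_sum lookup_sum summand)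
  also have "\<dots> = ga_lookup (coeff P i) m"
    by (cases "i \<le> degree P") (auto simp: when_def coeff_eq_0)
  finally show ?thesis .
qed

text \<open>
  The algebra of a free commutative monoid is a polynomial ring: one more generator \<open>b j\<close> of the
  monoid is one more variable, since evaluation at its monomial is injective by the grading in
  the dual direction \<open>e j\<close>.
\<close>

lemma gcd_ring_nat_span:
  fixes b e :: "'j \<Rightarrow> 'a::real_inner"
  assumes "finite J" "\<And>i j. i \<in> J \<Longrightarrow> j \<in> J \<Longrightarrow> b i \<bullet> e j = (if i = j then 1 else 0)"
  shows "gcd_ring (algebra_over (nat_span b J) :: ('a, 'k::field) group_algebra set)"
  using assms
proof (induction J)
  case empty
  have "p = monomial 0 (ga_lookup p 0)" if "p \<in> algebra_over (nat_span b {})"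
    for p :: "('a, 'k) group_algebra"
    using that by (intro ga_eqI) (auto simp: algebra_over_def nat_span_def lookup_single when_def in_keys_iff)
  then have const: "\<exists>c. p = monomial 0 c" if "p \<in> algebra_over (nat_span b {})"
    for p :: "('a, 'k) group_algebra"
    using that by blast
  have "\<exists>d\<in>A. \<forall>e\<in>A. dvd_on A e d \<longleftrightarrow> dvd_on A e p \<and> dvd_on A e q"
    if A: "A = (algebra_over (nat_span b {}) :: ('a, 'k) group_algebra set)"
      and pq: "p \<in> A" "q \<in> A" for A p q
  proof -
    have sub: "subring_on A" unfolding A by (rule subring_nat_span)
    have dvd: "dvd_on A e r \<longleftrightarrow> r = 0 \<or> e \<noteq> 0" if er: "e \<in> A" "r \<in> A"
      for e r
    proof
      assume "dvd_on A e r" then show "r = 0 \<or> e \<noteq> 0" by (auto simp: dvd_on_def)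
    next
      assume *: "r = 0 \<or> e \<noteq> 0"
      obtain c c' where cc: "e = monomial 0 c" "r = monomial 0 c'" using const er A by metis
      show "dvd_on A e r"
      proof (cases "r = 0")
        case False
        then have "r = e * monomial 0 (c' / c)" using * cc by (simp add: monomial_mult)
        moreover have "monomial 0 (c' / c) \<in> A" unfolding A by (intro monomial_in_algebra_over nat_span_0)
        ultimately show ?thesis by (auto simp: dvd_on_def)
      qed (use sub in simp)
    qed
    have "(if p = 0 then q else p) \<in> A" using pq by auto
    then show ?thesis using dvd pq by (intro bexI[of _ "if p = 0 then q else p"]) auto
  qed
  then show ?case
    unfolding gcd_ring_def using subring_nat_span by blast
next
  case (insert j J)
  let ?A = "algebra_over (nat_span b J) :: ('a, 'k) group_algebra set"
  let ?B = "algebra_over (nat_span b (insert j J)) :: ('a, 'k) group_algebra set"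
  let ?x = "monomial (b j) 1 :: ('a, 'k) group_algebra"
  let ?f = "\<lambda>P. poly P ?x"
  have gcdA: "gcd_ring ?A" using insert by auto
  have bj: "b j \<bullet> e j = 1" using insert.prems by simp
  have orth: "m \<bullet> e j = 0" if "m \<in> nat_span b J" for m
  proof -
    obtain a where "m = (\<Sum>i\<in>J. real (a i) *\<^sub>R b i)"
      using \<open>m \<in> nat_span b J\<close> by (auto simp: nat_span_def)
    then have "m \<bullet> e j = (\<Sum>i\<in>J. real (a i) * (b i \<bullet> e j))"
      by (simp add: inner_sum_left)
    also have "\<dots> = 0" using insert by (intro sum.neutral) auto
    finally show ?thesis .
  qed
  have inj: "inj_on ?f (polys_on ?A)"
  proof (rule inj_onI)
    fix P Q assume PQ: "P \<in> polys_on ?A" "Q \<in> polys_on ?A" "?f P = ?f Q"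
    have "ga_lookup (coeff P i) m = ga_lookup (coeff Q i) m" for i m
    proof (cases "m \<bullet> e j = 0")
      case True
      then show ?thesis
        using lookup_poly_monomial[OF PQ(1) orth bj True, of i] lookup_poly_monomial[OF PQ(2) orth bj True, of i] PQ(3) by simp
    next
      case False
      then have "m \<notin> ga_keys (coeff P i)" "m \<notin> ga_keys (coeff Q i)"
        using PQ(1,2) orth[of m] unfolding polys_on_def algebra_over_def by blast+
      then show ?thesis by (simp add: in_keys_iff)
    qed
    then show "P = Q" by (intro poly_eqI ga_eqI)
  qed
  have subB: "subring_on ?B" by (rule subring_nat_span)
  have emb: "nat_span b J \<subseteq> nat_span b (insert j J)"
  proof
    fix m assume "m \<in> nat_span b J"
    then obtain a where "m = (\<Sum>i\<in>J. real (a i) *\<^sub>R b i)" by (auto simp: nat_span_def)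
    also have "\<dots> = (\<Sum>i\<in>J. real ((a(j := 0)) i) *\<^sub>R b i)" using insert.hyps
      by (intro sum.cong) auto
    also have "\<dots> = (\<Sum>i\<in>insert j J. real ((a(j := 0)) i) *\<^sub>R b i)" using insert.hyps
      by simp
    finally show "m \<in> nat_span b (insert j J)" unfolding nat_span_def by blast
  qed
  have bjin: "b j \<in> nat_span b (insert j J)"
    unfolding nat_span_def
    by (intro CollectI exI[of _ "\<lambda>i. if i = j then 1 else 0"]) (use insert.hyps in \<open>auto intro!: sum.neutral\<close>)
  have "?f ` polys_on ?A = ?B"
  proof
    show "?f ` polys_on ?A \<subseteq> ?B"
      using emb monomial_in_algebra_over[OF bjin, of 1]
      by (auto simp: poly_altdef polys_on_def algebra_over_def[of "nat_span b J"]
          intro!: subring_on_sum[OF subB] subring_onD(4,7)[OF subB])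
         (auto simp: algebra_over_def)
    show "?B \<subseteq> ?f ` polys_on ?A"
    proof
      fix p assume p: "p \<in> ?B"
      have "\<exists>m i. m \<in> nat_span b J \<and> k = m + real i *\<^sub>R b j" if "k \<in> ga_keys p"
        for k
      proof -
        obtain a where "k = (\<Sum>i\<in>insert j J. real (a i) *\<^sub>R b i)"
          using p \<open>k \<in> ga_keys p\<close> unfolding algebra_over_def nat_span_def by blast
        then have "k = (\<Sum>i\<in>J. real (a i) *\<^sub>R b i) + real (a j) *\<^sub>R b j"
          using insert.hyps by simp
        then show ?thesis unfolding nat_span_def by blast
      qed
      then obtain M I where MI: "\<And>k. k \<in> ga_keys p \<Longrightarrow> M k \<in> nat_span b J \<and> k = M k + real (I k) *\<^sub>R b j"
        by metis
      define P where "P = (\<Sum>k\<in>ga_keys p. monom (monomial (M k) (ga_lookup p k)) (I k))"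
      have "P \<in> polys_on ?A"
        unfolding P_def
        using MI by (intro subring_on_sum[OF subring_polys_on[OF subring_nat_span]])
          (auto simp: polys_on_def intro: monomial_in_algebra_over subring_onD(1)[OF subring_nat_span])
      moreover have "?f P = (\<Sum>k\<in>ga_keys p. monomial k (ga_lookup p k))"
        unfolding P_def poly_sum
      proof (intro sum.cong refl)
        fix k assume "k \<in> ga_keys p"
        then have k: "M k + real (I k) *\<^sub>R b j = k" using MI by metis
        have "?x ^ I k = monomial (real (I k) *\<^sub>R b j) 1"
          by (simp add: monomial_power sum_constant_scaleR)
        then have "poly (monom (monomial (M k) c) (I k)) ?x = monomial (M k + real (I k) *\<^sub>R b j) c"
          for c
          by (simp only: poly_monom monomial_mult mult_1_right)
        then show "poly (monom (monomial (M k) (ga_lookup p k)) (I k)) ?x = monomial k (ga_lookup p k)"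
          unfolding k .
      qed
      moreover from this have "p = ?f P" by (rule trans[OF ga_sum_monomials[of p] sym])
      ultimately show "p \<in> ?f ` polys_on ?A" by blast
    qed
  qed
  moreover have "gcd_ring (?f ` polys_on ?A)"
    by (rule gcd_ring_image[OF gcd_ring_polys_on[OF gcdA] inj]) simp_all
  ultimately show ?case by simp
qed

subsection \<open>The field of fractions\<close>

abbreviation embed :: "('a::real_inner, 'k::field) group_algebra \<Rightarrow> ('a, 'k) group_algebra fract" where
  "embed p \<equiv> Fract p 1"

lemma embed_simps: "embed (p - q) = embed p - embed q" "embed (p + q) = embed p + embed q"
  "embed (p * q) = embed p * embed q" "embed 1 = 1" "embed 0 = 0" "embed p = embed q \<longleftrightarrow> p = q"
  by (simp_all add: One_fract_def Zero_fract_def eq_fract)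

definition chi :: "'a \<Rightarrow> ('a::real_inner, 'k::field) group_algebra fract" where
  "chi m = embed (monomial m 1)"

lemma chi_add: "chi (m + m') = chi m * chi m'"
  by (simp add: chi_def embed_simps(3)[symmetric] monomial_mult)

lemma chi_0 [simp]: "chi 0 = 1"
  by (simp add: chi_def embed_simps(4))

lemma chi_nz [simp]: "chi m \<noteq> 0"
  using monomial_eq_0_iff[of m 1] by (simp add: chi_def embed_simps(5)[symmetric] embed_simps(6))

lemma chi_minus: "chi (- m) = inverse (chi m)"
  using chi_add[of m "- m"] by (metis chi_0 inverse_unique right_minus)

lemma chi_diff: "chi (m - m') = chi m / chi m'"
  using chi_add[of m "- m'"] by (simp add: chi_minus divide_inverse)

lemma chi_scale_nat: "chi (real k *\<^sub>R m) = chi m ^ k"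
  by (induction k) (auto simp: scaleR_left_distrib chi_add)

lemma chi_sum: "finite J \<Longrightarrow> chi (sum f J) = (\<Prod>j\<in>J. chi (f j))"
  by (induction J rule: finite_induct) (auto simp: chi_add)

lemma monoid_algebra_image: "monoid_algebra S = embed ` algebra_over S"
  by (auto simp: monoid_algebra_def algebra_over_def)

lemma chi_in_monoid_algebra_iff: "(chi m :: ('a::real_inner, 'k::field) group_algebra fract) \<in> monoid_algebra S \<longleftrightarrow> m \<in> S"
  by (auto simp: monoid_algebra_def chi_def embed_simps(6))

lemma subring_monoid_algebra:
  assumes "0 \<in> S" "\<And>a b. a \<in> S \<Longrightarrow> b \<in> S \<Longrightarrow> a + b \<in> S"
  shows "subring_on (monoid_algebra S)"
  unfolding subring_on_def
proof (intro conjI ballI)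
  note sub = subring_algebra_over[OF assms]
  show "0 \<in> monoid_algebra S" "1 \<in> monoid_algebra S"
    using subring_onD(1,2)[OF sub] embed_simps(4,5) unfolding monoid_algebra_image by (metis imageI)+
  fix x y :: "('a, 'b) group_algebra fract" assume "x \<in> monoid_algebra S" "y \<in> monoid_algebra S"
  then obtain p q where "p \<in> algebra_over S" "q \<in> algebra_over S" "x = embed p" "y = embed q"
    unfolding monoid_algebra_image by auto
  then show "x - y \<in> monoid_algebra S" "x * y \<in> monoid_algebra S"
    using subring_onD(3,4)[OF sub] embed_simps(1,3) unfolding monoid_algebra_image by (metis imageI)+
qed

lemma gcd_ring_monoid_algebra:
  fixes b e :: "'j \<Rightarrow> 'a::real_inner"
  assumes "finite J" "\<And>i j. i \<in> J \<Longrightarrow> j \<in> J \<Longrightarrow> b i \<bullet> e j = (if i = j then 1 else 0)"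
  shows "gcd_ring (monoid_algebra (nat_span b J) :: ('a, 'k::field) group_algebra fract set)"
  unfolding monoid_algebra_image
  by (rule gcd_ring_image[OF gcd_ring_nat_span[OF assms] inj_onI embed_simps(1,3,4)])
     (simp_all only: embed_simps(6))

lemma monoid_algebra_expand:
  assumes "y \<in> monoid_algebra S"
  obtains K c where "finite K" "K \<subseteq> S" "y = (\<Sum>k\<in>K. embed (monomial 0 (c k)) * chi k)"
proof -
  obtain p where p: "y = embed p" "ga_keys p \<subseteq> S" using assms by (auto simp: monoid_algebra_def)
  have es: "embed (sum f I) = (\<Sum>i\<in>I. embed (f i))"
    for f :: "'a \<Rightarrow> ('a, 'b) group_algebra" and I
    by (induction I rule: infinite_finite_induct) (auto simp: embed_simps)
  have "y = (\<Sum>k\<in>ga_keys p. embed (monomial k (ga_lookup p k)))"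
    unfolding p(1) es[symmetric] using ga_sum_monomials[of p] by simp
  also have "\<dots> = (\<Sum>k\<in>ga_keys p. embed (monomial 0 (ga_lookup p k)) * chi k)"
    by (simp add: chi_def embed_simps(3)[symmetric] monomial_mult)
  finally show ?thesis using that p(2) finite_keys by blast
qed

subsection \<open>Functoriality\<close>

lemma ga_lookup_act:
  assumes "bij g" shows "ga_lookup (ga_act g p) k = ga_lookup p (inv_into UNIV g k)"
  using bij_imp_bij_inv[OF assms] unfolding ga_act_def Abs_ga_inverse[OF UNIV_I]
  by (simp add: map_key.rep_eq bij_is_inj)

lemma ga_act_monomial: "bij g \<Longrightarrow> ga_act g (monomial m c) = monomial (g m) c"
  by (rule ga_eqI) (auto simp: ga_lookup_act lookup_single when_def bij_inv_eq_iff)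

lemma ga_act_add: "bij g \<Longrightarrow> ga_act g (p + q) = ga_act g p + ga_act g q"
  by (rule ga_eqI) (simp add: ga_lookup_act lookup_add)

lemma ga_act_0: "bij g \<Longrightarrow> ga_act g 0 = 0"
  by (rule ga_eqI) (simp add: ga_lookup_act)

lemma ga_act_mult:
  fixes g :: "'a::real_inner \<Rightarrow> 'a" and p q :: "('a, 'k::field) group_algebra"
  assumes g: "bij g" "linear g"
  shows "ga_act g (p * q) = ga_act g p * ga_act g q"
proof -
  have 1: "ga_act g (monomial m c * q) = ga_act g (monomial m c) * ga_act g q" for m c
    by (rule ga_additive_eqI[of "\<lambda>q. ga_act g (monomial m c * q)" "\<lambda>q. ga_act g (monomial m c) * ga_act g q" q])
       (simp_all add: distrib_left ga_act_add ga_act_0 ga_act_monomial monomial_mult linear_add[OF g(2)] g(1))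
  show ?thesis
    by (rule ga_additive_eqI[of "\<lambda>p. ga_act g (p * q)" "\<lambda>p. ga_act g p * ga_act g q" p])
       (simp_all add: distrib_right ga_act_add ga_act_0 g(1) 1)
qed

lemma ga_act_eq_0_iff: "bij g \<Longrightarrow> ga_act g p = 0 \<longleftrightarrow> p = 0"
proof
  assume g: "bij g" and "ga_act g p = 0"
  then have "ga_lookup p (inv_into UNIV g k) = 0" for k
    using ga_lookup_act[OF g, of p k] by simp
  then have "ga_lookup p k = 0" for k
    using g by (metis bij_inv_eq_iff)
  then show "p = 0" by (intro ga_eqI) simp
qed (simp add: ga_act_0)

text \<open>
  The definition of the action chooses a representing fraction; here the choice is seen to be
  irrelevant.
\<close>

lemma fract_act_Fract:
  fixes g :: "'a::real_inner \<Rightarrow> 'a" and p q :: "('a, 'k::field) group_algebra"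
  assumes g: "bij g" "linear g" and "q \<noteq> 0"
  shows "fract_act g (Fract p q) = Fract (ga_act g p) (ga_act g q)"
proof -
  define s where "s = (SOME (p', q'). q' \<noteq> 0 \<and> Fract p q = Fract p' q')"
  have "case s of (p', q') \<Rightarrow> q' \<noteq> 0 \<and> Fract p q = Fract p' q'"
    unfolding s_def by (rule someI[of _ "(p, q)"]) (use assms in simp)
  then have s: "snd s \<noteq> 0" "p * snd s = fst s * q"
    using assms(3) by (auto simp: case_prod_beta eq_fract)
  have "fract_act g (Fract p q) = Fract (ga_act g (fst s)) (ga_act g (snd s))"
    unfolding fract_act_def s_def[symmetric] by (simp add: case_prod_beta)
  also have "\<dots> = Fract (ga_act g p) (ga_act g q)"
    using s assms by (simp add: eq_fract ga_act_eq_0_iff ga_act_mult[symmetric])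
  finally show ?thesis .
qed

context
  fixes g :: "'a::real_inner \<Rightarrow> 'a"
  assumes g: "bij g" "linear g"
begin

lemma fract_act_mult: "fract_act g (x * y) = fract_act g x * (fract_act g y :: ('a, 'k::field) group_algebra fract)"
  by (cases x; cases y) (simp add: fract_act_Fract g ga_act_mult)

lemma fract_act_add: "fract_act g (x + y) = fract_act g x + (fract_act g y :: ('a, 'k::field) group_algebra fract)"
  by (cases x; cases y) (simp add: fract_act_Fract g ga_act_mult ga_act_add ga_act_eq_0_iff)

lemma fract_act_1: "fract_act g 1 = (1 :: ('a, 'k::field) group_algebra fract)"
proof -
  have "ga_act g 1 = (1 :: ('a, 'k) group_algebra)"
    using ga_act_monomial[OF g(1), of 0 1] linear_0[OF g(2)] by simp
  then show ?thesis by (simp add: One_fract_def fract_act_Fract g)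
qed

lemma fract_act_0: "fract_act g 0 = (0 :: ('a, 'k::field) group_algebra fract)"
  using fract_act_add[of 0 0] by (metis add_0 add_cancel_right_right)

lemma fract_act_diff: "fract_act g (x - y) = fract_act g x - (fract_act g y :: ('a, 'k::field) group_algebra fract)"
  using fract_act_add[of "x - y" y] by (simp add: eq_diff_eq)

lemma fract_act_eq_0_iff: "fract_act g x = 0 \<longleftrightarrow> x = (0 :: ('a, 'k::field) group_algebra fract)"
  using fract_act_mult[of x "inverse x"] fract_act_1 fract_act_0
  by (metis mult_zero_left right_inverse zero_neq_one)

lemma fract_act_inverse: "fract_act g (inverse x) = inverse (fract_act g x :: ('a, 'k::field) group_algebra fract)"
proof (cases "x = 0")
  case False
  then show ?thesis
    using fract_act_mult[of x "inverse x"] fract_act_1 by (metis inverse_unique right_inverse)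
qed (simp add: fract_act_0)

lemma fract_act_embed: "fract_act g (embed (p :: ('a, 'k::field) group_algebra)) = embed (ga_act g p)"
proof -
  have "ga_act g 1 = (1 :: ('a, 'k::field) group_algebra)"
    using ga_act_monomial[OF g(1), of 0 1] linear_0[OF g(2)] by simp
  then show ?thesis by (simp add: fract_act_Fract g)
qed

lemma fract_act_chi: "fract_act g (chi m) = chi (g m)"
  by (simp add: chi_def fract_act_embed ga_act_monomial g)

end

lemma fract_act_comp:
  fixes x :: "('a::real_inner, 'k::field) group_algebra fract"
  assumes "bij g" "linear g" "bij h" "linear h"
  shows "fract_act (g \<circ> h) x = fract_act g (fract_act h x)"
proof -
  have gh: "bij (g \<circ> h)" "linear (g \<circ> h)"
    using assms by (auto intro: bij_comp linear_compose)
  have "ga_act (g \<circ> h) p = ga_act g (ga_act h p)" for p :: "('a, 'k) group_algebra"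
    by (rule ga_eqI) (simp add: ga_lookup_act gh assms o_inv_distrib)
  then show ?thesis
    by (cases x) (simp add: fract_act_Fract gh assms ga_act_eq_0_iff)
qed

lemma fract_act_id: "fract_act id x = (x :: ('a::real_inner, 'k::field) group_algebra fract)"
proof -
  have "ga_act id p = p" for p :: "('a, 'k) group_algebra"
    by (rule ga_eqI) (simp add: ga_lookup_act inv_id)
  then show ?thesis by (cases x) (simp add: fract_act_Fract linear_id[unfolded id_def[symmetric]])
qed

lemma linear_inv_bij:
  assumes "bij g" "linear g"
  shows "linear (inv_into UNIV g)"
proof (rule linearI)
  fix x y c
  have r: "g (inv_into UNIV g v) = v" for v
    using assms(1) by (simp add: bij_is_surj surj_f_inv_f)
  have l: "inv_into UNIV g (g v) = v" for v
    using assms(1) by (simp add: bij_is_inj)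
  show "inv_into UNIV g (x + y) = inv_into UNIV g x + inv_into UNIV g y"
    using l[of "inv_into UNIV g x + inv_into UNIV g y"] by (simp add: linear_add[OF assms(2)] r)
  show "inv_into UNIV g (c *\<^sub>R x) = c *\<^sub>R inv_into UNIV g x"
    using l[of "c *\<^sub>R inv_into UNIV g x"] by (simp add: linear_cmul[OF assms(2)] r)
qed

lemma fract_act_monoid_algebra:
  fixes g :: "'a::real_inner \<Rightarrow> 'a"
  assumes g: "bij g" "linear g"
  shows "fract_act g ` (monoid_algebra S :: ('a, 'k::field) group_algebra fract set) = monoid_algebra (g ` S)"
proof -
  have sub: "fract_act g ` (monoid_algebra S :: ('a, 'k) group_algebra fract set) \<subseteq> monoid_algebra (g ` S)"
    if g: "bij g" "linear g" for g :: "'a \<Rightarrow> 'a" and S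
  proof -
    have "ga_keys (ga_act g p) \<subseteq> g ` S" if "ga_keys p \<subseteq> S"
      for p :: "('a, 'k) group_algebra"
    proof
      fix k assume "k \<in> ga_keys (ga_act g p)"
      then have "inv_into UNIV g k \<in> ga_keys p" by (simp add: in_keys_iff ga_lookup_act g)
      then show "k \<in> g ` S" using \<open>ga_keys p \<subseteq> S\<close> g(1)
        by (metis bij_inv_eq_iff imageI subsetD)
    qed
    then show ?thesis unfolding monoid_algebra_def using fract_act_embed[OF g] by blast
  qed
  have ginv: "bij (inv_into UNIV g)" "linear (inv_into UNIV g)"
    using g bij_imp_bij_inv linear_inv_bij by blast+
  show ?thesis
  proof
    show "monoid_algebra (g ` S) \<subseteq> fract_act g ` (monoid_algebra S :: ('a, 'k) group_algebra fract set)"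
    proof
      fix y :: "('a, 'k) group_algebra fract" assume "y \<in> monoid_algebra (g ` S)"
      then have "fract_act (inv_into UNIV g) y \<in> monoid_algebra (inv_into UNIV g ` g ` S)"
        using sub[OF ginv] by blast
      moreover have "inv_into UNIV g ` g ` S = S" using g(1) by (simp add: image_inv_f_f bij_is_inj)
      moreover have "y = fract_act g (fract_act (inv_into UNIV g) y)"
        using fract_act_comp[OF g ginv, of y] g(1)
        by (simp add: fract_act_id surj_iff[THEN iffD1, OF bij_is_surj])
      ultimately show "y \<in> fract_act g ` monoid_algebra S" by (metis imageI)
    qed
  qed (rule sub[OF g])
qed

section \<open>Charts of a smooth toric variety\<close>

text \<open>
  The maximal cones are indexed by \<open>I\<close>. The cone of \<open>i\<close> is generated by the vectors \<open>e i j\<close>, and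
  the dual vectors \<open>b i j\<close> form a basis of the character lattice \<open>M\<close>, which is smoothness. That
  distinct cones meet in faces enters in the form that a ray contained in a cone is one of its
  generators. The sets \<open>K\<close> run through the faces of a cone.
\<close>

locale smooth_fan =
  fixes M :: "'a::real_inner set" and I :: "'i set" and J :: "'j set"
    and b e :: "'i \<Rightarrow> 'j \<Rightarrow> 'a"
    and X :: "('a, 'k::field) group_algebra fract set set"
  assumes finJ: "finite J" and I_nonempty: "I \<noteq> {}"
    and finR: "finite (\<Union>i\<in>I. e i ` J)"
    and dual: "\<And>i j k. i \<in> I \<Longrightarrow> j \<in> J \<Longrightarrow> k \<in> J \<Longrightarrow> b i j \<bullet> e i k = (if j = k then 1 else 0)"
    and lattice: "\<And>i. i \<in> I \<Longrightarrow> M = {\<Sum>j\<in>J. of_int (a j) *\<^sub>R b i j | a. True}"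
    and fan: "\<And>i i' k. i \<in> I \<Longrightarrow> i' \<in> I \<Longrightarrow> k \<in> J \<Longrightarrow> (\<And>j. j \<in> J \<Longrightarrow> 0 \<le> b i j \<bullet> e i' k) \<Longrightarrow> e i' k \<in> e i ` J"
    and X: "X = {monoid_algebra {m\<in>M. \<forall>j\<in>K. 0 \<le> m \<bullet> e i j} | i K. i \<in> I \<and> K \<subseteq> J}"
begin

definition R :: "'a set" where "R = (\<Union>i\<in>I. e i ` J)"

text \<open>
  The coordinate ring of the chart of the face generated by the vectors \<open>e i j\<close> with \<open>j \<in> K\<close>.
\<close>

definition chart :: "'i \<Rightarrow> 'j set \<Rightarrow> ('a, 'k) group_algebra fract set" where
  "chart i K = monoid_algebra {m\<in>M. \<forall>j\<in>K. 0 \<le> m \<bullet> e i j}"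

definition ray_point :: "'a \<Rightarrow> ('a, 'k) group_algebra fract set" where
  "ray_point l = ray_divisor_point M l"

lemma finite_R: "finite R" using finR by (simp add: R_def)

lemma X_charts: "X = {chart i K | i K. i \<in> I \<and> K \<subseteq> J}"
  unfolding X chart_def ..

lemma coordinates:
  assumes i: "i \<in> I" and m: "m \<in> M"
  shows "m = (\<Sum>j\<in>J. (m \<bullet> e i j) *\<^sub>R b i j)"
    and "j \<in> J \<Longrightarrow> m \<bullet> e i j \<in> \<int>"
proof -
  obtain a where a: "m = (\<Sum>j\<in>J. of_int (a j) *\<^sub>R b i j)"
    using m lattice[OF i] by auto
  have "m \<bullet> e i k = of_int (a k)" if "k \<in> J" for k
  proof -
    have "m \<bullet> e i k = (\<Sum>j\<in>J. if j = k then of_int (a j) else 0)"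
      unfolding a inner_sum_left using dual[OF i _ that] by (intro sum.cong) auto
    then show ?thesis using that finJ by simp
  qed
  then show "m = (\<Sum>j\<in>J. (m \<bullet> e i j) *\<^sub>R b i j)" "j \<in> J \<Longrightarrow> m \<bullet> e i j \<in> \<int>"
    using a by auto
qed

lemma M_combination: "i \<in> I \<Longrightarrow> (\<Sum>j\<in>J. of_int (a j) *\<^sub>R b i j) \<in> M"
  using lattice by blast

lemma b_in_M: "i \<in> I \<Longrightarrow> j \<in> J \<Longrightarrow> b i j \<in> M"
  using M_combination[of i "\<lambda>k. if k = j then 1 else 0"] finJ
  by (simp add: if_distrib[of of_int] if_distrib[of "\<lambda>c. c *\<^sub>R _"] cong: if_cong)

lemma M_0: "0 \<in> M" and M_add: "m \<in> M \<Longrightarrow> m' \<in> M \<Longrightarrow> m + m' \<in> M" and M_minus: "m \<in> M \<Longrightarrow> - m \<in> M"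
proof -
  obtain i where i: "i \<in> I" using I_nonempty by blast
  show "0 \<in> M" using M_combination[OF i, of "\<lambda>_. 0"] by simp
  show "m + m' \<in> M" if m: "m \<in> M" and m': "m' \<in> M"
  proof -
    obtain a a' where "m = (\<Sum>j\<in>J. of_int (a j) *\<^sub>R b i j)" "m' = (\<Sum>j\<in>J. of_int (a' j) *\<^sub>R b i j)"
      using m m' lattice[OF i] by auto
    then show ?thesis
      using M_combination[OF i, of "\<lambda>j. a j + a' j"] by (simp add: scaleR_left_distrib sum.distrib)
  qed
  show "- m \<in> M" if m: "m \<in> M"
  proof -
    obtain a where "m = (\<Sum>j\<in>J. of_int (a j) *\<^sub>R b i j)" using m lattice[OF i] by auto
    then show ?thesis using M_combination[OF i, of "\<lambda>j. - a j"] by (simp add: sum_negf)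
  qed
qed

lemma M_diff: "m \<in> M \<Longrightarrow> m' \<in> M \<Longrightarrow> m - m' \<in> M"
  using M_add[of m "- m'"] M_minus by simp

lemma M_sum: "(\<And>x. x \<in> T \<Longrightarrow> f x \<in> M) \<Longrightarrow> sum f T \<in> M"
  by (induction T rule: infinite_finite_induct) (auto simp: M_0 M_add)

lemma M_scale: "m \<in> M \<Longrightarrow> real N *\<^sub>R m \<in> M"
  using M_sum[of "{..<N}" "\<lambda>_. m"] by (simp add: sum_constant_scaleR)

lemma subring_chart: "subring_on (chart i K)"
  unfolding chart_def
  by (intro subring_monoid_algebra) (auto simp: M_0 M_add inner_add_left)

lemma chart_mono: "K \<subseteq> K' \<Longrightarrow> chart i K' \<subseteq> chart i K"
  unfolding chart_def monoid_algebra_def by blast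

lemma chi_in_chart: "chi m \<in> chart i K \<longleftrightarrow> m \<in> M \<and> (\<forall>j\<in>K. 0 \<le> m \<bullet> e i j)"
  unfolding chart_def chi_in_monoid_algebra_iff by simp

lemma const_in_chart: "embed (monomial 0 c) \<in> chart i K"
  unfolding chart_def monoid_algebra_def using M_0 by (auto intro!: exI[of _ "monomial 0 c"] split: if_splits)

text \<open>
  By smoothness the dual cone of \<open>i\<close> is generated by the dual basis, so its chart is an affine
  space.
\<close>

lemma cone_monoid_nat_span:
  assumes i: "i \<in> I"
  shows "{m\<in>M. \<forall>j\<in>J. 0 \<le> m \<bullet> e i j} = nat_span (b i) J"
proof
  show "{m\<in>M. \<forall>j\<in>J. 0 \<le> m \<bullet> e i j} \<subseteq> nat_span (b i) J"
  proof
    fix m assume m: "m \<in> {m\<in>M. \<forall>j\<in>J. 0 \<le> m \<bullet> e i j}"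
    have "real (nat \<lfloor>m \<bullet> e i j\<rfloor>) = m \<bullet> e i j" if "j \<in> J" for j
      using coordinates(2)[OF i _ that, of m] m that by (auto elim!: Ints_cases)
    then have "(\<Sum>j\<in>J. real (nat \<lfloor>m \<bullet> e i j\<rfloor>) *\<^sub>R b i j) = (\<Sum>j\<in>J. (m \<bullet> e i j) *\<^sub>R b i j)"
      by (intro sum.cong) auto
    moreover have "m = (\<Sum>j\<in>J. (m \<bullet> e i j) *\<^sub>R b i j)" using coordinates(1)[OF i] m
      by blast
    ultimately have "m = (\<Sum>j\<in>J. real (nat \<lfloor>m \<bullet> e i j\<rfloor>) *\<^sub>R b i j)"
      by (rule trans[OF _ sym, rotated])
    then show "m \<in> nat_span (b i) J"
      unfolding nat_span_def by (intro CollectI exI[of _ "\<lambda>j. nat \<lfloor>m \<bullet> e i j\<rfloor>"] conjI TrueI)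
  qed
  show "nat_span (b i) J \<subseteq> {m\<in>M. \<forall>j\<in>J. 0 \<le> m \<bullet> e i j}"
  proof
    fix m assume "m \<in> nat_span (b i) J"
    then obtain a where a: "m = (\<Sum>j\<in>J. real (a j) *\<^sub>R b i j)" by (auto simp: nat_span_def)
    have "m \<in> M" using M_combination[OF i, of "\<lambda>j. int (a j)"] a by simp
    moreover have "0 \<le> m \<bullet> e i k" if "k \<in> J" for k
      unfolding a inner_sum_left using dual[OF i _ that] by (intro sum_nonneg) auto
    ultimately show "m \<in> {m\<in>M. \<forall>j\<in>J. 0 \<le> m \<bullet> e i j}" by blast
  qed
qed

lemma gcd_ring_chart: "i \<in> I \<Longrightarrow> gcd_ring (chart i J)"
  unfolding chart_def cone_monoid_nat_span
  using gcd_ring_monoid_algebra[OF finJ, of "b i" "e i"] dual[of i] by blast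

subsection \<open>Charts of faces are localizations\<close>

text \<open>
  The sum of the \<open>b i j\<close> with \<open>j \<notin> K\<close> vanishes on the rays of the face and is 1 on the other
  generators of the cone, so a multiple of it moves all exponents of \<open>y\<close> into the dual cone of
  \<open>i\<close>.
\<close>

lemma clear_denominator:
  assumes i: "i \<in> I" and "K \<subseteq> J" and y: "y \<in> chart i K"
  obtains N where "chi (real N *\<^sub>R (\<Sum>j\<in>J - K. b i j)) * y \<in> chart i J"
proof -
  let ?m = "\<Sum>j\<in>J - K. b i j"
  obtain T c where T: "finite T" "T \<subseteq> {m\<in>M. \<forall>j\<in>K. 0 \<le> m \<bullet> e i j}"
    and y: "y = (\<Sum>k\<in>T. embed (monomial 0 (c k)) * chi k)"
    using y unfolding chart_def by (rule monoid_algebra_expand)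
  have mM: "?m \<in> M" using b_in_M[OF i] by (intro M_sum) auto
  have me: "?m \<bullet> e i k = (if k \<in> K then 0 else 1)" if "k \<in> J" for k
  proof -
    have "?m \<bullet> e i k = (\<Sum>j\<in>J - K. if j = k then 1 else 0)"
      unfolding inner_sum_left using dual[OF i _ that] by (intro sum.cong) auto
    then show ?thesis using that finJ by simp
  qed
  define N where "N = (\<Sum>k\<in>T. \<Sum>j\<in>J. nat \<lceil>\<bar>k \<bullet> e i j\<bar>\<rceil>)"
  have "chi (real N *\<^sub>R ?m + k) \<in> chart i J" if k: "k \<in> T" for k
  proof -
    have "0 \<le> (real N *\<^sub>R ?m + k) \<bullet> e i j" if j: "j \<in> J" for j
    proof (cases "j \<in> K")
      case True
      then show ?thesis using T(2) k j me by (auto simp: inner_add_left)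
    next
      case False
      have "nat \<lceil>\<bar>k \<bullet> e i j\<bar>\<rceil> \<le> (\<Sum>j\<in>J. nat \<lceil>\<bar>k \<bullet> e i j\<bar>\<rceil>)"
        using finJ j by (intro member_le_sum) auto
      also have "\<dots> \<le> N"
        unfolding N_def using T(1) k
        by (intro member_le_sum[of k T "\<lambda>k. \<Sum>j\<in>J. nat \<lceil>\<bar>k \<bullet> e i j\<bar>\<rceil>"]) auto
      finally have "\<bar>k \<bullet> e i j\<bar> \<le> real N" by linarith
      then show ?thesis using me[OF j] False by (simp add: inner_add_left)
    qed
    moreover have "real N *\<^sub>R ?m + k \<in> M" using T(2) k M_scale[OF mM] by (auto intro: M_add)
    ultimately show ?thesis by (simp add: chi_in_chart)
  qed
  then have "embed (monomial 0 (c k)) * chi (real N *\<^sub>R ?m + k) \<in> chart i J" if "k \<in> T" for k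
    using that const_in_chart subring_onD(4)[OF subring_chart] by blast
  then have "(\<Sum>k\<in>T. embed (monomial 0 (c k)) * chi (real N *\<^sub>R ?m + k)) \<in> chart i J"
    by (intro subring_on_sum[OF subring_chart])
  also have "(\<Sum>k\<in>T. embed (monomial 0 (c k)) * chi (real N *\<^sub>R ?m + k)) = chi (real N *\<^sub>R ?m) * y"
    unfolding y sum_distrib_left by (intro sum.cong) (auto simp: chi_add mult.left_commute)
  finally show ?thesis by (rule that)
qed

lemma chi_face_unit:
  assumes i: "i \<in> I" and "K \<subseteq> J"
  shows "chi (real N *\<^sub>R (\<Sum>j\<in>J - K. b i j)) \<in> units_in (chart i K)"
    and "chi (real N *\<^sub>R (\<Sum>j\<in>J - K. b i j)) \<in> chart i J"
proof -
  let ?m = "real N *\<^sub>R (\<Sum>j\<in>J - K. b i j)"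
  have mM: "?m \<in> M" using b_in_M[OF i] by (intro M_scale M_sum) auto
  have me: "?m \<bullet> e i k = (if k \<in> K then 0 else real N)" if "k \<in> J" for k
  proof -
    have "(\<Sum>j\<in>J - K. b i j) \<bullet> e i k = (\<Sum>j\<in>J - K. if j = k then 1 else 0)"
      unfolding inner_sum_left using dual[OF i _ that] by (intro sum.cong) auto
    then show ?thesis using that finJ by simp
  qed
  show "chi ?m \<in> units_in (chart i K)"
    unfolding units_in_iff chi_minus[symmetric] chi_in_chart
    using mM me \<open>K \<subseteq> J\<close> M_minus[OF mM] by auto
  show "chi ?m \<in> chart i J" unfolding chi_in_chart using mM me by auto
qed

lemma fractions_over_chart:
  assumes i: "i \<in> I" and K: "K \<subseteq> J"
  shows "fractions_over (chart i J) (chart i K)"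
  unfolding fractions_over_def
proof (intro conjI ballI)
  fix y assume "y \<in> chart i K"
  then obtain N where N: "chi (real N *\<^sub>R (\<Sum>j\<in>J - K. b i j)) * y \<in> chart i J" (is "chi ?m * y \<in> _")
    using clear_denominator[OF i K] by metis
  have "y = (chi ?m * y) / chi ?m" by simp
  then show "\<exists>a\<in>chart i J. \<exists>s\<in>chart i J. s \<in> units_in (chart i K) \<and> y = a / s"
    using N chi_face_unit[OF i K] by blast
qed (rule chart_mono[OF K])

lemma spec_chart_subset: "i \<in> I \<Longrightarrow> K \<subseteq> J \<Longrightarrow> x \<in> spec_points (chart i K) \<Longrightarrow> x \<in> spec_points (chart i J)"
  by (rule spec_points_localization[OF subring_chart subring_chart fractions_over_chart])

lemma points_X: "points X = (\<Union>i\<in>I. spec_points (chart i J))"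
  unfolding points_def X_charts using spec_chart_subset by blast

text \<open>
  The chart of the face \<open>K\<close> is the open subset of the chart of the cone where the coordinates
  \<open>chi (b i j)\<close> with \<open>j \<notin> K\<close> are invertible.
\<close>

lemma spec_chart_of_units:
  assumes i: "i \<in> I" and K: "K \<subseteq> J" and x: "x \<in> spec_points (chart i J)"
    and u: "\<And>j. j \<in> J - K \<Longrightarrow> chi (b i j) \<in> units_in x"
  shows "x \<in> spec_points (chart i K)"
proof (rule spec_points_intermediate[OF subring_chart subring_chart x chart_mono[OF K]])
  note sub = spec_pointsD(1)[OF subring_chart x] and Ax = spec_pointsD(2)[OF subring_chart x]
  have mx: "chi (\<Sum>j\<in>J - K. b i j) \<in> units_in x"
  proof -
    have "(\<Prod>j\<in>T. chi (b i j)) \<in> units_in x" if "T \<subseteq> J - K" for T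
      using finite_subset[OF that] finJ that
      by (induction T rule: infinite_finite_induct) (auto intro: u units_in_mult[OF sub] units_in_one[OF sub])
    then show ?thesis using finJ by (simp add: chi_sum)
  qed
  show "chart i K \<subseteq> x"
  proof
    fix y assume "y \<in> chart i K"
    then obtain N where N: "chi (real N *\<^sub>R (\<Sum>j\<in>J - K. b i j)) * y \<in> chart i J" (is "chi ?m * y \<in> _")
      using clear_denominator[OF i K] by metis
    have "chi ?m \<in> units_in x"
      unfolding chi_scale_nat using mx by (rule units_in_power[OF sub])
    then have "(chi ?m * y) / chi ?m \<in> x"
      using N Ax by (intro units_in_divide_mem[OF sub]) auto
    then show "y \<in> x" by simp
  qed
qed

subsection \<open>Generic points of the boundary divisors\<close>

text \<open>
  The exponents of the functions that are regular on the chart of the ray of \<open>l\<close>.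
\<close>

definition half :: "'a \<Rightarrow> 'a set" where "half l = {m\<in>M. 0 \<le> m \<bullet> l}"

lemma dual_monoid_ray: "dual_monoid M (convex_cone hull {l}) = half l"
proof -
  have cc: "convex_cone {v. 0 \<le> m \<bullet> v}" for m :: 'a
    by (auto simp: convex_cone_def convex_def conic_def inner_add_right intro: exI[of _ 0])
  have "v \<in> {v. 0 \<le> m \<bullet> v}" if "0 \<le> m \<bullet> l" "v \<in> convex_cone hull {l}" for m v
    using hull_minimal[of "{l}" "{v. 0 \<le> m \<bullet> v}" convex_cone] cc that by auto
  then show ?thesis
    unfolding dual_monoid_def half_def by (auto simp: hull_inc)
qed

lemma ray_point_localization: "ray_point l = localization_at (monoid_algebra (half l)) (monoid_algebra {m\<in>half l. 0 < m \<bullet> l})"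
  unfolding ray_point_def ray_divisor_point_def dual_monoid_ray Let_def ..

lemma subring_half: "subring_on (monoid_algebra (half l))"
  by (intro subring_monoid_algebra) (auto simp: half_def M_0 M_add inner_add_left)

text \<open>
  If two functions have terms of degree 0 along \<open>l\<close>, so does their product: these are extreme
  terms in the direction \<open>- l\<close>.
\<close>

lemma prime_half:
  "prime_on (monoid_algebra (half l) :: ('a, 'k) group_algebra fract set) (monoid_algebra {m\<in>half l. 0 < m \<bullet> l})"
proof -
  let ?A = "monoid_algebra (half l) :: ('a, 'k) group_algebra fract set" 
  let ?P = "monoid_algebra {m\<in>half l. 0 < m \<bullet> l} :: ('a, 'k) group_algebra fract set"
  have memA: "embed p \<in> ?A \<longleftrightarrow> ga_keys p \<subseteq> half l"
    and memP: "embed p \<in> ?P \<longleftrightarrow> ga_keys p \<subseteq> {m\<in>half l. 0 < m \<bullet> l}"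
    for p :: "('a, 'k) group_algebra"
    by (auto simp: monoid_algebra_def embed_simps(6))
  have rep: "\<exists>p. x = embed p" if "x \<in> ?A" for x using that by (auto simp: monoid_algebra_def)
  have PA: "?P \<subseteq> ?A" unfolding monoid_algebra_def by blast
  show ?thesis
    unfolding prime_on_def ideal_on_def
  proof (intro conjI ballI impI)
    show "?P \<subseteq> ?A" by (rule PA)
    show "0 \<in> ?P" using memP[of 0] by (simp add: embed_simps(5))
    show "1 \<notin> ?P" using memP[of 1] by (simp add: embed_simps(4))
  next
    fix x y assume "x \<in> ?P" "y \<in> ?P"
    then obtain p q where pq: "x = embed p" "y = embed q" using rep PA by blast
    have "ga_keys (p + q) \<subseteq> ga_keys p \<union> ga_keys q" using keys_add by simp
    then show "x + y \<in> ?P"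
      using \<open>x \<in> ?P\<close> \<open>y \<in> ?P\<close>
      unfolding pq embed_simps(2)[symmetric] memP by blast
  next
    fix x y assume "x \<in> ?A" "y \<in> ?P"
    then obtain p q where pq: "x = embed p" "y = embed q" using rep PA by blast
    have "ga_keys (p * q) \<subseteq> {m\<in>half l. 0 < m \<bullet> l}"
    proof
      fix k assume "k \<in> ga_keys (p * q)"
      then obtain a c where "k = a + c" "a \<in> ga_keys p" "c \<in> ga_keys q"
        using keys_mult[of "ga_coeffs p" "ga_coeffs q"] by auto
      then show "k \<in> {m\<in>half l. 0 < m \<bullet> l}"
      proof -
        have "a \<in> half l" "c \<in> half l" "0 < c \<bullet> l"
          using \<open>x \<in> ?A\<close> \<open>y \<in> ?P\<close> \<open>a \<in> ga_keys p\<close> \<open>c \<in> ga_keys q\<close> unfolding pq memA memP by blast+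
        then show ?thesis using \<open>k = a + c\<close> by (simp add: half_def inner_add_left M_add)
      qed
    qed
    then show "x * y \<in> ?P" unfolding pq embed_simps(3)[symmetric] memP .
  next
    fix x y assume xy: "x \<in> ?A" "y \<in> ?A" "x * y \<in> ?P"
    then obtain p q where pq: "x = embed p" "y = embed q" using rep by blast
    show "x \<in> ?P \<or> y \<in> ?P"
    proof (rule ccontr)
      assume no: "\<not> ?thesis"
      have zero: "\<exists>a\<in>ga_keys p. a \<bullet> l \<le> 0"
        if "embed p \<in> ?A" "embed p \<notin> ?P" for p :: "('a, 'k) group_algebra"
        using that unfolding memA memP by force
      obtain a c where ac: "a \<in> ga_keys p" "a \<bullet> l \<le> 0" "c \<in> ga_keys q" "c \<bullet> l \<le> 0"
        using zero[of p] zero[of q] xy no pq by blast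
      then have "ga_coeffs p \<noteq> 0" "ga_coeffs q \<noteq> 0" by auto
      then obtain k where "k \<in> ga_keys (p * q)" "a \<bullet> - l + c \<bullet> - l \<le> k \<bullet> - l"
        using extreme_key[of "ga_coeffs p" "ga_coeffs q" "- l"] ac by auto
      then show False
        using xy(3) ac unfolding pq embed_simps(3)[symmetric] memP by force
    qed
  qed
qed

lemma ray_point_spec: "ray_point l \<in> spec_points (monoid_algebra (half l))"
  unfolding ray_point_localization spec_points_def using primeideal_ring_on[OF subring_half] prime_half
  by blast

lemma half_unit_ray_point:
  assumes "y \<in> monoid_algebra (half l)"
  shows "y \<in> units_in (ray_point l) \<longleftrightarrow> y \<notin> monoid_algebra {m\<in>half l. 0 < m \<bullet> l}"
  using localization_units[OF subring_half prime_half assms, of 1] subring_onD(2)[OF subring_half] prime_half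
  unfolding ray_point_localization by (auto simp: prime_on_def)

lemma subring_ray_point: "subring_on (ray_point l)"
  using spec_pointsD(1)[OF subring_half ray_point_spec] .

lemma half_subset_ray_point: "monoid_algebra (half l) \<subseteq> ray_point l"
  using spec_pointsD(2)[OF subring_half ray_point_spec] .

lemma chi_in_ray_point:
  assumes m: "m \<in> M" shows "chi m \<in> ray_point l \<longleftrightarrow> 0 \<le> m \<bullet> l"
proof
  assume "0 \<le> m \<bullet> l"
  then have "chi m \<in> monoid_algebra (half l)" using m by (simp add: chi_in_monoid_algebra_iff half_def)
  then show "chi m \<in> ray_point l" using half_subset_ray_point by blast
next
  assume "chi m \<in> ray_point l"
  then obtain a s where as: "a \<in> monoid_algebra (half l)" "s \<in> monoid_algebra (half l)" "s \<in> units_in (ray_point l)" "chi m = a / s"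
    using spec_pointsD(4)[OF subring_half ray_point_spec] by metis
  show "0 \<le> m \<bullet> l"
  proof (rule ccontr)
    assume neg: "\<not> 0 \<le> m \<bullet> l"
    have "inverse (chi m) \<in> monoid_algebra (half l)"
      and P: "inverse (chi m) \<in> monoid_algebra {m\<in>half l. 0 < m \<bullet> l}"
      using neg M_minus[OF m] by (simp_all add: chi_minus[symmetric] chi_in_monoid_algebra_iff half_def)
    then have "inverse (chi m) \<notin> units_in (ray_point l)" using half_unit_ray_point by blast
    moreover have "inverse (chi m) \<in> ray_point l"
      using \<open>inverse (chi m) \<in> monoid_algebra (half l)\<close> half_subset_ray_point by blast
    ultimately show False using \<open>chi m \<in> ray_point l\<close> by (simp add: units_in_iff)
  qed
qed

lemma chi_unit_ray_point: "m \<in> M \<Longrightarrow> chi m \<in> units_in (ray_point l) \<longleftrightarrow> m \<bullet> l = 0"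
  using chi_in_ray_point[of m l] chi_in_ray_point[OF M_minus, of m l] by (auto simp: units_in_iff chi_minus)

lemma half_chart: "monoid_algebra (half (e i j)) = chart i {j}"
  by (simp add: chart_def half_def)

lemma ray_point_spec_chart:
  assumes "i \<in> I" "j \<in> J" "j \<in> K" "K \<subseteq> J"
    shows "ray_point (e i j) \<in> spec_points (chart i K)"
proof -
  have "ray_point (e i j) \<in> spec_points (chart i {j})"
    using ray_point_spec[of "e i j"] by (simp add: half_chart)
  then have "ray_point (e i j) \<in> spec_points (chart i J)"
    using spec_chart_subset assms by blast
  moreover have "chart i K \<subseteq> ray_point (e i j)"
    using half_subset_ray_point[of "e i j"] chart_mono[of "{j}" K i] assms by (auto simp: half_chart)
  ultimately show ?thesis
    using spec_points_intermediate[OF subring_chart subring_chart _ chart_mono[OF assms(4)]] by blast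
qed

lemma e_in_R: "i \<in> I \<Longrightarrow> j \<in> J \<Longrightarrow> e i j \<in> R"
  by (auto simp: R_def)

text \<open>
  A chart contains the generic point of the divisor of \<open>l\<close> only if its cone contains \<open>l\<close>, as the
  coordinates \<open>chi (b i j)\<close> must be regular there.
\<close>

lemma ray_of_chart:
  assumes i: "i \<in> I" and l: "l \<in> R" and "chart i J \<subseteq> ray_point l"
  shows "l \<in> e i ` J"
proof -
  obtain i' k where ik: "i' \<in> I" "k \<in> J" "l = e i' k" using l by (auto simp: R_def)
  have "0 \<le> b i j \<bullet> l" if j: "j \<in> J" for j
  proof -
    have "chi (b i j) \<in> chart i J" using b_in_M[OF i j] dual[OF i j] by (simp add: chi_in_chart)
    then show ?thesis using assms(3) chi_in_ray_point[OF b_in_M[OF i j]] by blast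
  qed
  then show ?thesis using fan[OF i ik(1,2)] ik(3) by simp
qed

text \<open>
  In the chart of \<open>i\<close> the divisor of the ray \<open>e i j\<close> is cut out by the coordinate \<open>chi (b i j)\<close>:
  for a function that vanishes on it all exponents have positive, hence by integrality at least
  unit, degree along \<open>e i j\<close>.
\<close>

lemma chart_mult_ray:
  assumes i: "i \<in> I" and j: "j \<in> J"
    and y: "y \<in> chart i J" "y \<notin> units_in (ray_point (e i j))"
  shows "y / chi (b i j) \<in> chart i J"
proof -
  have "y \<in> monoid_algebra (half (e i j))" using chart_mono[of "{j}" J i] j y(1)
    by (auto simp: half_chart)
  then have "y \<in> monoid_algebra {m\<in>half (e i j). 0 < m \<bullet> e i j}"
    using half_unit_ray_point y(2) by blast
  then have y': "y \<in> monoid_algebra {m\<in>M. \<forall>k\<in>J. 0 \<le> (m - b i j) \<bullet> e i k}"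
  proof -
    obtain p where p: "y = embed p" "ga_keys p \<subseteq> {m\<in>half (e i j). 0 < m \<bullet> e i j}"
      using \<open>y \<in> monoid_algebra {m\<in>half (e i j). 0 < m \<bullet> e i j}\<close>
      by (auto simp: monoid_algebra_def)
    have pk: "ga_keys p \<subseteq> {m\<in>M. \<forall>j\<in>J. 0 \<le> m \<bullet> e i j}"
      using y(1) p(1) by (auto simp: chart_def monoid_algebra_def embed_simps(6))
    have "0 \<le> (m - b i j) \<bullet> e i k" if m: "m \<in> ga_keys p" and k: "k \<in> J" for m k
    proof (cases "k = j")
      case True
      have mM: "m \<in> M" using pk m by blast
      have "0 < m \<bullet> e i j" using p(2) m by blast
      moreover obtain z where "m \<bullet> e i j = of_int z" using coordinates(2)[OF i mM j]
        by (auto elim: Ints_cases)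
      ultimately have "1 \<le> m \<bullet> e i j" by simp
      then show ?thesis using True dual[OF i j j] by (simp add: inner_diff_left)
    next
      case False
      then show ?thesis using dual[OF i j k] pk m k by (auto simp: inner_diff_left)
    qed
    then show ?thesis using p(1) pk unfolding monoid_algebra_def by blast
  qed
  then obtain T c where T: "finite T" "T \<subseteq> {m\<in>M. \<forall>k\<in>J. 0 \<le> (m - b i j) \<bullet> e i k}"
    and yT: "y = (\<Sum>k\<in>T. embed (monomial 0 (c k)) * chi k)"
    by (rule monoid_algebra_expand)
  have "y / chi (b i j) = (\<Sum>k\<in>T. embed (monomial 0 (c k)) * chi (k - b i j))"
    unfolding yT sum_divide_distrib by (intro sum.cong) (auto simp: chi_diff)
  moreover have "embed (monomial 0 (c k)) * chi (k - b i j) \<in> chart i J" if "k \<in> T" for k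
  proof -
    have "chi (k - b i j) \<in> chart i J"
      using T(2) that M_diff[OF _ b_in_M[OF i j]] by (auto simp: chi_in_chart)
    then show ?thesis using subring_onD(4)[OF subring_chart const_in_chart] by blast
  qed
  ultimately show ?thesis by (simp add: subring_on_sum[OF subring_chart])
qed

text \<open>
  A denominator at \<open>x\<close> does not vanish on the divisor of \<open>e i j\<close>, since otherwise it would be a
  multiple of the nonunit \<open>chi (b i j)\<close>.
\<close>

lemma point_subset_ray_point:
  assumes i: "i \<in> I" and j: "j \<in> J" and x: "x \<in> spec_points (chart i J)"
    and nu: "chi (b i j) \<notin> units_in x"
  shows "x \<subseteq> ray_point (e i j)"
proof
  note sub = spec_pointsD(1)[OF subring_chart x] and Ax = spec_pointsD(2)[OF subring_chart x]
  fix y assume "y \<in> x"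
  then obtain a s where as: "a \<in> chart i J" "s \<in> chart i J" "s \<in> units_in x" "y = a / s"
    using spec_pointsD(4)[OF subring_chart x] by metis
  have "s \<in> units_in (ray_point (e i j))"
  proof (rule ccontr)
    assume "s \<notin> units_in (ray_point (e i j))"
    then have "s / chi (b i j) \<in> x" using chart_mult_ray[OF i j as(2)] Ax by blast
    moreover have "chi (b i j) \<in> x" using b_in_M[OF i j] dual[OF i j] Ax
      by (auto simp: chi_in_chart intro!: subsetD[OF Ax])
    moreover have "chi (b i j) * (s / chi (b i j)) = s" by simp
    ultimately have "chi (b i j) \<in> units_in x" using units_in_factor[OF sub] as(3) by metis
    then show False using nu by simp
  qed
  moreover have "a \<in> ray_point (e i j)"
    using as(1) spec_pointsD(2)[OF subring_chart ray_point_spec_chart[OF i j j]] by auto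
  ultimately show "y \<in> ray_point (e i j)"
    unfolding as(4) by (intro units_in_divide_mem[OF subring_ray_point])
qed

subsection \<open>The Zariski topology\<close>

lemma openin_zariski_basic:
  assumes "i \<in> I" "K \<subseteq> J" "f \<in> chart i K"
  shows "openin (zariski X) {x \<in> spec_points (chart i K). f \<in> units_in x}"
  unfolding zariski_def openin_topology_generated_by_iff
  using assms by (intro generate_topology_on.Basis) (auto simp: X_charts)

lemma openin_spec_chart: "i \<in> I \<Longrightarrow> K \<subseteq> J \<Longrightarrow> openin (zariski X) (spec_points (chart i K))"
proof -
  assume i: "i \<in> I" "K \<subseteq> J"
  have "{x \<in> spec_points (chart i K). 1 \<in> units_in x} = spec_points (chart i K)"
    using units_in_one spec_pointsD(1)[OF subring_chart] by blast
  then show ?thesis using openin_zariski_basic[OF i subring_onD(2)[OF subring_chart]] by simp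
qed

lemma topspace_zariski: "topspace (zariski X) = points X"
proof
  show "topspace (zariski X) \<subseteq> points X"
    unfolding zariski_def topology_generated_by_topspace points_def by blast
  show "points X \<subseteq> topspace (zariski X)"
    unfolding points_X using openin_subset[OF openin_spec_chart] by blast
qed

text \<open>
  The topology is given by a subbasis: a property of neighbourhoods of \<open>x\<close> that is inherited by
  finite intersections and by larger sets has to be checked on the subbasis only.
\<close>

lemma zariski_induct:
  assumes "openin (zariski X) U" "x \<in> U"
    and basic: "\<And>i K f. i \<in> I \<Longrightarrow> K \<subseteq> J \<Longrightarrow> f \<in> chart i K \<Longrightarrow> x \<in> spec_points (chart i K) \<Longrightarrow> f \<in> units_in x \<Longrightarrow>
       Q {y \<in> spec_points (chart i K). f \<in> units_in y}"
    and inter: "\<And>U V. Q U \<Longrightarrow> Q V \<Longrightarrow> Q (U \<inter> V)"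
      and upward: "\<And>U V. Q U \<Longrightarrow> U \<subseteq> V \<Longrightarrow> Q V"
  shows "Q U"
proof -
  have "generate_topology_on {{x \<in> spec_points A. f \<in> units_in x} | A f. A \<in> X \<and> f \<in> A} U"
    using assms(1) unfolding zariski_def openin_topology_generated_by_iff .
  then show ?thesis using \<open>x \<in> U\<close>
  proof (induction U rule: generate_topology_on.induct)
    case (UN K)
    then show ?case using upward by blast
  next
    case (Basis s)
    then show ?case using basic unfolding X_charts by blast
  qed (use inter in auto)
qed

text \<open>
  In the chart of \<open>i\<close>, the closure of the generic point of the divisor of \<open>l\<close> is the zero set of
  the coordinate dual to \<open>l\<close>, or empty if \<open>l\<close> does not belong to the cone. The left-hand side
  does not involve \<open>i\<close>, which makes this a means to compare charts.
\<close>

lemma closure_ray_point: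
  assumes i: "i \<in> I" and x: "x \<in> spec_points (chart i J)" and l: "l \<in> R"
  shows "x \<in> (zariski X) closure_of {ray_point l} \<longleftrightarrow> (\<exists>j\<in>J. l = e i j \<and> chi (b i j) \<notin> units_in x)"
proof
  assume cl: "x \<in> (zariski X) closure_of {ray_point l}"
  have nb: "ray_point l \<in> U" if "openin (zariski X) U" "x \<in> U" for U
    using cl that unfolding in_closure_of by blast
  have "ray_point l \<in> spec_points (chart i J)" using nb[OF openin_spec_chart[OF i] x] by simp
  then have "chart i J \<subseteq> ray_point l" by (rule spec_pointsD(2)[OF subring_chart])
  then obtain j where j: "j \<in> J" "l = e i j" using ray_of_chart[OF i l] by blast
  have cb: "chi (b i j) \<in> chart i J" using b_in_M[OF i j(1)] dual[OF i j(1)] by (simp add: chi_in_chart)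
  have "chi (b i j) \<notin> units_in x"
  proof
    assume "chi (b i j) \<in> units_in x"
    then have "chi (b i j) \<in> units_in (ray_point l)"
      using nb[OF openin_zariski_basic[OF i _ cb]] x by simp
    then show False using chi_unit_ray_point[OF b_in_M[OF i j(1)]] dual[OF i j(1) j(1)] j(2) by simp
  qed
  then show "\<exists>j\<in>J. l = e i j \<and> chi (b i j) \<notin> units_in x" using j by blast
next
  assume "\<exists>j\<in>J. l = e i j \<and> chi (b i j) \<notin> units_in x"
  then obtain j where j: "j \<in> J" "l = e i j" "chi (b i j) \<notin> units_in x" by blast
  have xl: "x \<subseteq> ray_point l" using point_subset_ray_point[OF i j(1) x j(3)] j(2) by simp
  have zi: "ray_point l \<in> spec_points (chart i J)" using ray_point_spec_chart[OF i j(1) j(1)] j(2) by simp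
  have "ray_point l \<in> U" if U: "openin (zariski X) U" "x \<in> U" for U
    using U
  proof (rule zariski_induct[where Q = "\<lambda>U. ray_point l \<in> U"])
    fix i' K f assume *: "i' \<in> I" "K \<subseteq> J" "f \<in> chart i' K" "x \<in> spec_points (chart i' K)" "f \<in> units_in x"
    then show "ray_point l \<in> {y \<in> spec_points (chart i' K). f \<in> units_in y}"
      using spec_points_generization[OF subring_chart subring_chart *(4) zi xl spec_pointsD(2)[OF subring_chart x]]
        units_in_mono[OF xl] by blast
  qed auto
  then show "x \<in> (zariski X) closure_of {ray_point l}"
    unfolding in_closure_of topspace_zariski points_X using i x by blast
qed

text \<open>
  The subbasic open sets come from the charts of all cones, so they must be compared with the
  chart of \<open>i\<close>. Let \<open>i'\<close> be another cone whose chart contains \<open>x\<close>. The rays whose divisors pass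
  through \<open>x\<close> generate a face of \<open>i\<close> and a face of \<open>i'\<close> with the same chart. This chart contains
  \<open>x\<close>, is contained in every chart that contains \<open>x\<close>, and is a basic open subset of the chart of
  \<open>i\<close>.
\<close>

lemma open_contains_basic:
  assumes i: "i \<in> I" and x: "x \<in> spec_points (chart i J)" and U: "openin (zariski X) U" "x \<in> U"
  shows "\<exists>h\<in>chart i J. h \<in> units_in x \<and> (\<forall>y\<in>spec_points (chart i J). h \<in> units_in y \<longrightarrow> y \<in> U)"
proof -
  note subx = spec_pointsD(1)[OF subring_chart x] and Ax = spec_pointsD(2)[OF subring_chart x]
  define nonu where "nonu i = {j\<in>J. chi (b i j) \<notin> units_in x}" for i
  have nJ: "nonu i \<subseteq> J" for i by (auto simp: nonu_def)
  have rays: "e i ` nonu i = {l\<in>R. x \<in> (zariski X) closure_of {ray_point l}}"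
    if "i \<in> I" "x \<in> spec_points (chart i J)" for i
    using closure_ray_point[OF that] e_in_R[OF that(1)] unfolding nonu_def by blast
  have chart_rays: "chart i K = monoid_algebra {m\<in>M. \<forall>l\<in>e i ` K. 0 \<le> m \<bullet> l}"
    for i K
    by (simp add: chart_def)
  from U show ?thesis
  proof (rule zariski_induct[where Q = "\<lambda>U. \<exists>h\<in>chart i J. h \<in> units_in x \<and> (\<forall>y\<in>spec_points (chart i J). h \<in> units_in y \<longrightarrow> y \<in> U)"])
    fix i' K f assume *: "i' \<in> I" "K \<subseteq> J" "f \<in> chart i' K" "x \<in> spec_points (chart i' K)" "f \<in> units_in x"
    have x': "x \<in> spec_points (chart i' J)" using spec_chart_subset[OF *(1,2,4)] .
    have same: "chart i (nonu i) = chart i' (nonu i')"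
      unfolding chart_rays rays[OF i x] rays[OF *(1) x'] ..
    have K'x: "chart i' K \<subseteq> x" using spec_pointsD(2)[OF subring_chart *(4)] .
    have sub: "chart i' K \<subseteq> chart i (nonu i)"
    proof -
      have "0 \<le> m \<bullet> e i j" if m: "m \<in> M" "\<forall>j\<in>K. 0 \<le> m \<bullet> e i' j"
        and j: "j \<in> nonu i" for m j
      proof -
        have "chi m \<in> x" using m K'x chi_in_chart[of m i' K] by blast
        then have "chi m \<in> ray_point (e i j)"
          using point_subset_ray_point[OF i _ x] j by (auto simp: nonu_def)
        then show ?thesis using chi_in_ray_point[OF m(1)] by simp
      qed
      then show ?thesis unfolding chart_def monoid_algebra_def by blast
    qed
    let ?m = "\<Sum>j\<in>J - nonu i. b i j"
    obtain N where N: "chi (real N *\<^sub>R ?m) * f \<in> chart i J"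
      using clear_denominator[OF i nJ] sub *(3) by (metis subsetD)
    have m1: "chi ?m \<in> chart i J" using chi_face_unit(2)[OF i nJ, of 1] by simp
    have mu: "chi ?m \<in> units_in y"
      if "\<And>j. j \<in> J - nonu i \<Longrightarrow> chi (b i j) \<in> units_in y" "subring_on y" for y
    proof -
      have "(\<Prod>j\<in>T. chi (b i j)) \<in> units_in y" if "T \<subseteq> J - nonu i" for T
        using finite_subset[OF that] finJ that \<open>\<And>j. j \<in> J - nonu i \<Longrightarrow> chi (b i j) \<in> units_in y\<close>
        by (induction T rule: infinite_finite_induct)
           (auto intro: units_in_mult[OF \<open>subring_on y\<close>] units_in_one[OF \<open>subring_on y\<close>])
      then show ?thesis using finJ by (simp add: chi_sum)
    qed
    define h where "h = chi ?m * (chi (real N *\<^sub>R ?m) * f)"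
    have "h \<in> chart i J" unfolding h_def by (rule subring_onD(4)[OF subring_chart m1 N])
    moreover have "chi ?m \<in> units_in x" by (rule mu[OF _ subx]) (auto simp: nonu_def)
    then have "h \<in> units_in x"
      unfolding h_def chi_scale_nat using *(5) by (intro units_in_mult[OF subx] units_in_power[OF subx])
    moreover have "y \<in> {y \<in> spec_points (chart i' K). f \<in> units_in y}"
      if y: "y \<in> spec_points (chart i J)" and hy: "h \<in> units_in y" for y
    proof -
      note suby = spec_pointsD(1)[OF subring_chart y] and Ay = spec_pointsD(2)[OF subring_chart y]
      have my: "chi ?m \<in> units_in y"
        using units_in_factor[OF suby _ _ hy[unfolded h_def]] m1 N Ay by blast
      have "chi (real N *\<^sub>R ?m) * f \<in> units_in y"
      proof (rule units_in_factor[OF suby])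
        show "(chi (real N *\<^sub>R ?m) * f) * chi ?m \<in> units_in y"
          using hy by (simp only: h_def mult.commute)
      qed (use m1 N Ay in blast)+
      then have "(chi (real N *\<^sub>R ?m) * f) / chi (real N *\<^sub>R ?m) \<in> units_in y"
        using units_in_power[OF suby my, of N] by (intro units_in_divide[OF suby]) (auto simp: chi_scale_nat)
      then have fy: "f \<in> units_in y" by simp
      have "chi (b i j) \<in> units_in y" if j: "j \<in> J - nonu i" for j
      proof -
        have mj: "?m = b i j + (\<Sum>j\<in>J - nonu i - {j}. b i j)"
          using finJ j by (subst sum.remove[of _ j]) auto
        have cj: "chi (b i j') \<in> chart i J" if "j' \<in> J" for j'
          using b_in_M[OF i that] dual[OF i that] by (simp add: chi_in_chart)
        have "(\<Prod>j\<in>J - nonu i - {j}. chi (b i j)) \<in> chart i J"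
          using cj by (intro subring_on_prod[OF subring_chart]) auto
        then have "chi (\<Sum>j\<in>J - nonu i - {j}. b i j) \<in> y"
          using Ay finJ by (auto simp: chi_sum)
        then show ?thesis
          using units_in_factor[OF suby, of "chi (b i j)"] my cj[of j] j Ay unfolding mj chi_add by blast
      qed
      then have "y \<in> spec_points (chart i (nonu i))"
        by (rule spec_chart_of_units[OF i nJ y])
      then have "y \<in> spec_points (chart i' J)" "chart i' K \<subseteq> y"
        using spec_chart_subset[OF *(1) nJ] spec_pointsD(2)[OF subring_chart] sub unfolding same by blast+
      then have "y \<in> spec_points (chart i' K)"
        using spec_points_intermediate[OF subring_chart subring_chart _ chart_mono[OF *(2)]] by blast
      then show ?thesis using fy by blast
    qed
    ultimately show "\<exists>h\<in>chart i J. h \<in> units_in x \<and>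
        (\<forall>y\<in>spec_points (chart i J). h \<in> units_in y \<longrightarrow> y \<in> {y \<in> spec_points (chart i' K). f \<in> units_in y})"
      by blast
  next
    fix U V
    assume "\<exists>h\<in>chart i J. h \<in> units_in x \<and> (\<forall>y\<in>spec_points (chart i J). h \<in> units_in y \<longrightarrow> y \<in> U)"
      and "\<exists>h\<in>chart i J. h \<in> units_in x \<and> (\<forall>y\<in>spec_points (chart i J). h \<in> units_in y \<longrightarrow> y \<in> V)"
    then obtain h h' where h: "h \<in> chart i J" "h \<in> units_in x" "h' \<in> chart i J" "h' \<in> units_in x"
      "\<And>y. y \<in> spec_points (chart i J) \<Longrightarrow> h \<in> units_in y \<Longrightarrow> y \<in> U"
      "\<And>y. y \<in> spec_points (chart i J) \<Longrightarrow> h' \<in> units_in y \<Longrightarrow> y \<in> V"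
      by blast
    have "y \<in> U \<inter> V" if y: "y \<in> spec_points (chart i J)" "h * h' \<in> units_in y" for y
    proof -
      note suby = spec_pointsD(1)[OF subring_chart y(1)] and Ay = spec_pointsD(2)[OF subring_chart y(1)]
      have "h \<in> units_in y" "h' \<in> units_in y"
        using units_in_factor[OF suby, of h h'] units_in_factor[OF suby, of h' h] y(2) h(1,3) Ay
        by (auto simp: mult.commute)
      then show ?thesis using h(5,6) y(1) by blast
    qed
    then show "\<exists>h\<in>chart i J. h \<in> units_in x \<and> (\<forall>y\<in>spec_points (chart i J). h \<in> units_in y \<longrightarrow> y \<in> U \<inter> V)"
      using subring_onD(4)[OF subring_chart h(1,3)] units_in_mult[OF subx h(2,4)] by blast
  qed blast
qed

end

section \<open>Cartier divisors of a smooth toric variety\<close>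

lemma unit_coset_1: "unit_coset 1 y = units_in y"
  by (simp add: unit_coset_def)

lemma unit_coset_mult:
  assumes "subring_on y"
  shows "{a * b | a b. a \<in> unit_coset f y \<and> b \<in> unit_coset g y} = unit_coset (f * g) y"
proof
  show "{a * b | a b. a \<in> unit_coset f y \<and> b \<in> unit_coset g y} \<subseteq> unit_coset (f * g) y"
  proof clarify
    fix a b assume "a \<in> unit_coset f y" "b \<in> unit_coset g y"
    then obtain u v where "a = f * u" "b = g * v" "u \<in> units_in y" "v \<in> units_in y"
      by (auto simp: unit_coset_def)
    then have "a * b = (f * g) * (u * v)" "u * v \<in> units_in y"
      using units_in_mult[OF assms] by auto
    then show "a * b \<in> unit_coset (f * g) y" unfolding unit_coset_def by blast
  qed
  show "unit_coset (f * g) y \<subseteq> {a * b | a b. a \<in> unit_coset f y \<and> b \<in> unit_coset g y}"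
  proof
    fix c assume "c \<in> unit_coset (f * g) y"
    then obtain u where u: "c = f * g * u" "u \<in> units_in y" by (auto simp: unit_coset_def)
    then have "c = (f * 1) * (g * u)" by simp
    moreover have "f * 1 \<in> unit_coset f y" "g * u \<in> unit_coset g y"
      using u units_in_one[OF assms] unfolding unit_coset_def by blast+
    ultimately show "c \<in> {a * b | a b. a \<in> unit_coset f y \<and> b \<in> unit_coset g y}" by blast
  qed
qed

lemma unit_coset_inverse: "inverse ` unit_coset f y = unit_coset (inverse f) y"
proof -
  have "inverse ` units_in y = units_in y"
    using units_in_inverse by (auto simp: image_iff) (metis inverse_inverse_eq)
  then show ?thesis by (simp add: unit_coset_def image_image) (metis (no_types, lifting) image_image image_cong)
qed

lemma lookup_sum_frag_of:
  "finite R \<Longrightarrow> Poly_Mapping.lookup (\<Sum>l\<in>R. frag_cmul (f l) (frag_of l)) k = (if k \<in> R then f k else 0)"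
  by (induction R rule: finite_induct) (auto simp: lookup_add lookup_single)

context smooth_fan
begin

subsection \<open>The function field\<close>

abbreviation K where "K \<equiv> function_field X"

lemma chart_empty: "chart i {} = monoid_algebra M"
  by (simp add: chart_def)

text \<open>
  All charts have the field of fractions of the coordinate ring of the torus.
\<close>

lemma function_field_chart:
  assumes i: "i \<in> I"
  shows "K = {a / c | a c. a \<in> chart i J \<and> c \<in> chart i J \<and> c \<noteq> 0}"
proof
  show "{a / c | a c. a \<in> chart i J \<and> c \<in> chart i J \<and> c \<noteq> 0} \<subseteq> K"
    unfolding function_field_def X_charts using i by blast
  show "K \<subseteq> {a / c | a c. a \<in> chart i J \<and> c \<in> chart i J \<and> c \<noteq> 0}"
  proof
    fix y assume "y \<in> K"
    then obtain i' L a c where "i' \<in> I" "L \<subseteq> J"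
      and ac: "y = a / c" "a \<in> chart i' L" "c \<in> chart i' L" "c \<noteq> 0"
      unfolding function_field_def X_charts by blast
    have ac': "a \<in> chart i {}" "c \<in> chart i {}"
      using chart_mono[of "{}" L i'] ac by (auto simp: chart_empty)
    let ?m = "\<lambda>N::nat. chi (real N *\<^sub>R (\<Sum>j\<in>J - {}. b i j)) :: ('a, 'k) group_algebra fract"
    obtain N1 N2 where N: "?m N1 * a \<in> chart i J" "?m N2 * c \<in> chart i J"
      using clear_denominator[OF i empty_subsetI ac'(1)] clear_denominator[OF i empty_subsetI ac'(2)] by metis
    have "?m N2 * (?m N1 * a) \<in> chart i J" "?m N1 * (?m N2 * c) \<in> chart i J" "?m N1 * (?m N2 * c) \<noteq> 0"
      using N chi_face_unit(2)[OF i empty_subsetI] subring_onD(4)[OF subring_chart] ac(4) by auto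
    moreover have "y = (?m N2 * (?m N1 * a)) / (?m N1 * (?m N2 * c))"
      using ac by (simp add: mult.left_commute)
    ultimately show "y \<in> {a / c | a c. a \<in> chart i J \<and> c \<in> chart i J \<and> c \<noteq> 0}" by blast
  qed
qed

lemma K_mult: "f \<in> K \<Longrightarrow> g \<in> K \<Longrightarrow> f * g \<in> K"
proof -
  obtain i where i: "i \<in> I" using I_nonempty by blast
  assume "f \<in> K" "g \<in> K"
  then obtain a c a' c' where *: "f = a / c" "g = a' / c'" "a \<in> chart i J" "c \<in> chart i J" "c \<noteq> 0"
    "a' \<in> chart i J" "c' \<in> chart i J" "c' \<noteq> 0"
    unfolding function_field_chart[OF i] by blast
  then have "f * g = (a * a') / (c * c')" "a * a' \<in> chart i J" "c * c' \<in> chart i J" "c * c' \<noteq> 0"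
    using subring_onD(4)[OF subring_chart] by auto
  then show "f * g \<in> K" unfolding function_field_chart[OF i] by blast
qed

lemma chart_subset_K: "i \<in> I \<Longrightarrow> L \<subseteq> J \<Longrightarrow> chart i L \<subseteq> K"
proof
  fix y assume "i \<in> I" "L \<subseteq> J" "y \<in> chart i L"
  moreover have "1 \<in> chart i L" using subring_onD(2)[OF subring_chart] .
  ultimately have "y \<in> {a / c | a c. a \<in> chart i L \<and> c \<in> chart i L \<and> c \<noteq> 0}"
    by (intro CollectI exI[of _ y] exI[of _ 1]) auto
  then show "y \<in> K" unfolding function_field_def X_charts
    using \<open>i \<in> I\<close> \<open>L \<subseteq> J\<close> by blast
qed

lemma K_1: "1 \<in> K"
  using chart_subset_K[of _ "{}"] I_nonempty subring_onD(2)[OF subring_chart] by blast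

lemma K_inverse: "f \<in> K \<Longrightarrow> inverse f \<in> K"
proof (cases "f = 0")
  case False
  obtain i where i: "i \<in> I" using I_nonempty by blast
  assume "f \<in> K"
  then obtain a c where *: "f = a / c" "a \<in> chart i J" "c \<in> chart i J" "c \<noteq> 0"
    unfolding function_field_chart[OF i] by blast
  then have "inverse f = c / a" "a \<noteq> 0" using False by auto
  then show "inverse f \<in> K" unfolding function_field_chart[OF i] using * by blast
qed simp

lemma K_divide: "f \<in> K \<Longrightarrow> g \<in> K \<Longrightarrow> f / g \<in> K"
  by (simp add: divide_inverse K_mult K_inverse)

lemma chi_in_K: "m \<in> M \<Longrightarrow> chi m \<in> K"
proof -
  assume m: "m \<in> M"
  obtain i where i: "i \<in> I" using I_nonempty by blast
  have "chi m \<in> chart i {}" using m by (simp add: chi_in_chart)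
  then show "chi m \<in> K" using chart_subset_K[OF i, of "{}"] by blast
qed

lemma point_in_chart: "x \<in> points X \<Longrightarrow> \<exists>i\<in>I. x \<in> spec_points (chart i J)"
  by (auto simp: points_X)

lemma spec_chart_point: "i \<in> I \<Longrightarrow> x \<in> spec_points (chart i J) \<Longrightarrow> x \<in> points X"
  by (auto simp: points_X)

lemma subring_point: "x \<in> points X \<Longrightarrow> subring_on x"
  using point_in_chart spec_pointsD(1)[OF subring_chart] by blast

lemma point_subset_K: "x \<in> points X \<Longrightarrow> x \<subseteq> K"
proof
  fix y assume "x \<in> points X" "y \<in> x"
  then obtain i a s where "i \<in> I" "a \<in> chart i J" "s \<in> chart i J" "s \<in> units_in x" "y = a / s"
    using point_in_chart spec_pointsD(4)[OF subring_chart] by metis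
  then show "y \<in> K" using K_divide chart_subset_K[of i J] by blast
qed

subsection \<open>Cartier divisors\<close>

abbreviation CG where "CG \<equiv> cartier_group X"

definition prin :: "('a, 'k) group_algebra fract \<Rightarrow> ('a, 'k) group_algebra fract set \<Rightarrow> ('a, 'k) group_algebra fract set" where
  "prin f = (\<lambda>x\<in>points X. unit_coset f x)"

lemma principal_divisors_prin: "principal_divisors X = {prin f | f. f \<in> K \<and> f \<noteq> 0}"
  by (simp add: principal_divisors_def prin_def)

lemma CG_simps:
  "C \<otimes>\<^bsub>CG\<^esub> D = (\<lambda>x\<in>points X. {a * b | a b. a \<in> C x \<and> b \<in> D x})"
  "\<one>\<^bsub>CG\<^esub> = (\<lambda>x\<in>points X. units_in x)"
  "C \<in> carrier CG \<longleftrightarrow> C \<in> extensional (points X) \<and> (\<forall>x\<in>points X. \<exists>U f.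
        openin (zariski X) U \<and> x \<in> U \<and> f \<in> K \<and> f \<noteq> 0 \<and> (\<forall>y\<in>U. C y = unit_coset f y))"
  by (simp_all add: cartier_group_def)

lemma CG_locally:
  assumes "C \<in> carrier CG" "x \<in> points X"
  obtains U f where "openin (zariski X) U" "x \<in> U" "f \<in> K" "f \<noteq> 0" "\<forall>y\<in>U. C y = unit_coset f y"
  using assms(2) assms(1)[unfolded CG_simps(3)] by metis

lemma CG_local:
  assumes "C \<in> carrier CG" "x \<in> points X"
  obtains f where "f \<in> K" "f \<noteq> 0" "C x = unit_coset f x"
  using CG_locally[OF assms] by metis

lemma CG_mult_apply:
  assumes "x \<in> points X" "C x = unit_coset f x" "D x = unit_coset g x"
  shows "(C \<otimes>\<^bsub>CG\<^esub> D) x = unit_coset (f * g) x"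
  using unit_coset_mult[OF subring_point[OF assms(1)]] assms by (simp add: CG_simps)

lemma CG_eqI:
  assumes "C \<in> carrier CG" "D \<in> carrier CG" "\<And>x. x \<in> points X \<Longrightarrow> C x = D x"
  shows "C = D"
  using assms unfolding CG_simps by (intro extensionalityI[of C "points X" D]) auto

lemma CG_mult_closed:
  assumes "C \<in> carrier CG" "D \<in> carrier CG"
  shows "C \<otimes>\<^bsub>CG\<^esub> D \<in> carrier CG"
  unfolding CG_simps(3)
proof (intro conjI ballI)
  fix x assume x: "x \<in> points X"
  obtain U f where U: "openin (zariski X) U" "x \<in> U" "f \<in> K" "f \<noteq> 0" "\<forall>y\<in>U. C y = unit_coset f y"
    by (rule CG_locally[OF assms(1) x])
  obtain V g where V: "openin (zariski X) V" "x \<in> V" "g \<in> K" "g \<noteq> 0" "\<forall>y\<in>V. D y = unit_coset g y"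
    by (rule CG_locally[OF assms(2) x])
  have "(C \<otimes>\<^bsub>CG\<^esub> D) y = unit_coset (f * g) y" if "y \<in> U \<inter> V" for y
    using CG_mult_apply[of y C f D g] U(5) V(5) that openin_subset[OF U(1)] by (auto simp: topspace_zariski)
  then show "\<exists>U f. openin (zariski X) U \<and> x \<in> U \<and> f \<in> K \<and> f \<noteq> 0 \<and> (\<forall>y\<in>U. (C \<otimes>\<^bsub>CG\<^esub> D) y = unit_coset f y)"
    using U V by (intro exI[of _ "U \<inter> V"] exI[of _ "f * g"]) (auto intro: K_mult)
qed (simp add: CG_simps)

lemma prin_in_CG:
  assumes "f \<in> K" "f \<noteq> 0" shows "prin f \<in> carrier CG"
  unfolding CG_simps(3)
proof (intro conjI ballI)
  show "prin f \<in> extensional (points X)" by (simp add: prin_def)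
  fix x assume "x \<in> points X"
  then show "\<exists>U g. openin (zariski X) U \<and> x \<in> U \<and> g \<in> K \<and> g \<noteq> 0 \<and> (\<forall>y\<in>U. prin f y = unit_coset g y)"
    using assms openin_topspace[of "zariski X"] unfolding topspace_zariski
    by (intro exI[of _ "points X"] exI[of _ f]) (auto simp: prin_def)
qed

lemma CG_one: "\<one>\<^bsub>CG\<^esub> = prin 1"
  by (simp add: CG_simps prin_def unit_coset_1)

lemma CG_inverse_closed:
  assumes "C \<in> carrier CG" shows "(\<lambda>x\<in>points X. inverse ` C x) \<in> carrier CG"
  unfolding CG_simps(3)
proof (intro conjI ballI)
  fix x assume x: "x \<in> points X"
  obtain U f where U: "openin (zariski X) U" "x \<in> U" "f \<in> K" "f \<noteq> 0" "\<forall>y\<in>U. C y = unit_coset f y"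
    by (rule CG_locally[OF assms x])
  have "U \<subseteq> points X" using openin_subset[OF U(1)] by (simp add: topspace_zariski)
  then show "\<exists>V f. openin (zariski X) V \<and> x \<in> V \<and> f \<in> K \<and> f \<noteq> 0 \<and>
      (\<forall>y\<in>V. (\<lambda>x\<in>points X. inverse ` C x) y = unit_coset f y)"
    using U by (intro exI[of _ U] exI[of _ "inverse f"]) (auto simp: unit_coset_inverse K_inverse)
qed simp

lemma comm_group_CG: "comm_group CG"
proof (rule comm_groupI)
  fix C D E assume CDE: "C \<in> carrier CG" "D \<in> carrier CG" "E \<in> carrier CG"
  show "C \<otimes>\<^bsub>CG\<^esub> D \<otimes>\<^bsub>CG\<^esub> E = C \<otimes>\<^bsub>CG\<^esub> (D \<otimes>\<^bsub>CG\<^esub> E)"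
  proof (rule CG_eqI)
    fix x assume x: "x \<in> points X"
    obtain f g h where *: "C x = unit_coset f x" "D x = unit_coset g x" "E x = unit_coset h x"
      using CG_local[OF CDE(1) x] CG_local[OF CDE(2) x] CG_local[OF CDE(3) x] by metis
    show "(C \<otimes>\<^bsub>CG\<^esub> D \<otimes>\<^bsub>CG\<^esub> E) x = (C \<otimes>\<^bsub>CG\<^esub> (D \<otimes>\<^bsub>CG\<^esub> E)) x"
      using CG_mult_apply[where C = "C \<otimes>\<^bsub>CG\<^esub> D" and D = E
      and x = x, OF x CG_mult_apply[where C = C and D = D and x = x, OF x *(1,2)] *(3)]
        CG_mult_apply[where C = C and D = "D \<otimes>\<^bsub>CG\<^esub> E"
          and x = x, OF x *(1) CG_mult_apply[where C = D and D = E and x = x, OF x *(2,3)]]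
            by (simp add: mult.assoc)
  qed (use CDE in \<open>auto intro!: CG_mult_closed\<close>)
next
  fix C D assume "C \<in> carrier CG" "D \<in> carrier CG"
  show "C \<otimes>\<^bsub>CG\<^esub> D = D \<otimes>\<^bsub>CG\<^esub> C"
  proof -
    have "{a * b | a b. a \<in> A \<and> b \<in> B} \<subseteq> {a * b | a b. a \<in> B \<and> b \<in> A}"
      for A B :: "('a, 'k) group_algebra fract set"
      using mult.commute by blast
    then have "{a * b | a b. a \<in> A \<and> b \<in> B} = {a * b | a b. a \<in> B \<and> b \<in> A}"
      for A B :: "('a, 'k) group_algebra fract set"
      by (intro equalityI)
    then show ?thesis unfolding CG_simps by simp
  qed
next
  fix C assume C: "C \<in> carrier CG"
  show "\<one>\<^bsub>CG\<^esub> \<otimes>\<^bsub>CG\<^esub> C = C"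
  proof (rule CG_eqI)
    fix x assume x: "x \<in> points X"
    obtain f where *: "C x = unit_coset f x" using CG_local[OF C x] by metis
    show "(\<one>\<^bsub>CG\<^esub> \<otimes>\<^bsub>CG\<^esub> C) x = C x"
      using CG_mult_apply[where C = "\<one>\<^bsub>CG\<^esub>" and D = C and f = 1, OF x _ *] * x
      by (simp add: CG_one prin_def)
  qed (use C in \<open>auto intro!: CG_mult_closed simp: CG_one prin_in_CG K_1\<close>)
  show "\<exists>D\<in>carrier CG. D \<otimes>\<^bsub>CG\<^esub> C = \<one>\<^bsub>CG\<^esub>"
  proof (rule bexI[OF _ CG_inverse_closed[OF C]], rule CG_eqI)
    fix x assume x: "x \<in> points X"
    obtain f where *: "f \<noteq> 0" "C x = unit_coset f x" using CG_local[OF C x] by metis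
    then have "(\<lambda>x\<in>points X. inverse ` C x) x = unit_coset (inverse f) x"
      using x by (simp add: unit_coset_inverse)
    from CG_mult_apply[where C = "\<lambda>x\<in>points X. inverse ` C x" and D = C, OF x this *(2)]
    show "((\<lambda>x\<in>points X. inverse ` C x) \<otimes>\<^bsub>CG\<^esub> C) x = \<one>\<^bsub>CG\<^esub> x"
      using * x by (simp add: CG_one prin_def)
  qed (use C CG_inverse_closed[OF C] in \<open>auto intro!: CG_mult_closed simp: CG_one prin_in_CG K_1\<close>)
qed (auto simp: CG_one prin_in_CG K_1 intro: CG_mult_closed)

lemma prin_mult: "prin (f * g) = prin f \<otimes>\<^bsub>CG\<^esub> prin g"
proof
  fix x
  show "prin (f * g) x = (prin f \<otimes>\<^bsub>CG\<^esub> prin g) x"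
  proof (cases "x \<in> points X")
    case True
    then show ?thesis using CG_mult_apply[of x "prin f" f "prin g" g] by (simp add: prin_def)
  qed (simp add: prin_def CG_simps)
qed

lemma subgroup_principal: "subgroup (principal_divisors X) CG"
proof (rule group.subgroupI)
  show "group CG" using comm_group_CG by (rule comm_group.axioms(2))
  show "principal_divisors X \<subseteq> carrier CG"
    unfolding principal_divisors_prin using prin_in_CG by blast
  show "principal_divisors X \<noteq> {}" unfolding principal_divisors_prin using K_1 by force
next
  fix D assume "D \<in> principal_divisors X"
  then obtain f where f: "f \<in> K" "f \<noteq> 0" "D = prin f" unfolding principal_divisors_prin by blast
  have "inv\<^bsub>CG\<^esub> D = prin (inverse f)"
    using f by (intro group.inv_equality comm_group.axioms(2)[OF comm_group_CG])
       (auto simp: prin_mult[symmetric] CG_one prin_in_CG K_inverse)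
  then show "inv\<^bsub>CG\<^esub> D \<in> principal_divisors X"
    unfolding principal_divisors_prin using f K_inverse by auto
next
  fix D E assume "D \<in> principal_divisors X" "E \<in> principal_divisors X"
  then obtain f g where "f \<in> K" "f \<noteq> 0" "D = prin f" "g \<in> K" "g \<noteq> 0" "E = prin g"
    unfolding principal_divisors_prin by blast
  then have "D \<otimes>\<^bsub>CG\<^esub> E = prin (f * g)" "f * g \<in> K" "f * g \<noteq> 0"
    by (auto simp: prin_mult K_mult)
  then show "D \<otimes>\<^bsub>CG\<^esub> E \<in> principal_divisors X"
    unfolding principal_divisors_prin by blast
qed

lemma normal_principal: "principal_divisors X \<lhd> CG"
  using comm_group.normal_iff_subgroup[OF comm_group_CG] subgroup_principal by blast

lemma comm_group_Pic: "comm_group (Pic X)"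
  unfolding Pic_def using comm_group.abelian_FactGroup[OF comm_group_CG subgroup_principal] .

subsection \<open>Torus-invariant divisors\<close>

text \<open>
  The exponent of the local equation on the chart of \<open>i\<close> of the divisor with multiplicities \<open>a\<close>.
\<close>

definition local_char :: "'i \<Rightarrow> ('a \<Rightarrow>\<^sub>0 int) \<Rightarrow> 'a" where
  "local_char i a = (\<Sum>j\<in>J. of_int (Poly_Mapping.lookup a (e i j)) *\<^sub>R b i j)"

lemma char_in_M: "i \<in> I \<Longrightarrow> local_char i a \<in> M"
  unfolding local_char_def by (rule M_combination)

lemma char_add: "local_char i (a + a') = local_char i a + local_char i a'"
  by (simp add: local_char_def lookup_add scaleR_left_distrib sum.distrib)

lemma char_minus: "local_char i (- a) = - local_char i a"
  by (simp add: local_char_def sum_negf)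

lemma char_0: "local_char i 0 = 0"
  by (simp add: local_char_def)

lemma char_e: "i \<in> I \<Longrightarrow> k \<in> J \<Longrightarrow> local_char i a \<bullet> e i k = of_int (Poly_Mapping.lookup a (e i k))"
proof -
  assume i: "i \<in> I" and k: "k \<in> J"
  have "local_char i a \<bullet> e i k = (\<Sum>j\<in>J. if j = k then of_int (Poly_Mapping.lookup a (e i j)) else 0)"
    unfolding local_char_def inner_sum_left using dual[OF i _ k] by (intro sum.cong) auto
  then show ?thesis using k finJ by simp
qed

lemma char_of_inner:
  assumes i: "i \<in> I" and m: "m \<in> M" "\<And>j. j \<in> J \<Longrightarrow> of_int (Poly_Mapping.lookup a (e i j)) = m \<bullet> e i j"
  shows "local_char i a = m"
  unfolding local_char_def using coordinates(1)[OF i m(1)] m(2) by simp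

text \<open>
  As the charts cover the variety, \<open>C\<close> is determined by \<open>a\<close>. This reduces identities between
  torus-invariant divisors to the additivity of \<open>local_char i\<close>.
\<close>

definition toric :: "('a \<Rightarrow>\<^sub>0 int) \<Rightarrow> (('a, 'k) group_algebra fract set \<Rightarrow> ('a, 'k) group_algebra fract set) \<Rightarrow> bool" where
  "toric a C \<longleftrightarrow> C \<in> extensional (points X) \<and> (\<forall>i\<in>I. \<forall>x\<in>spec_points (chart i J). C x = unit_coset (chi (local_char i a)) x)"

lemma toric_in_CG: "toric a C \<Longrightarrow> C \<in> carrier CG"
  unfolding CG_simps(3)
proof (intro conjI ballI)
  assume C: "toric a C"
  then show "C \<in> extensional (points X)" by (simp add: toric_def)
  fix x assume "x \<in> points X"
  then obtain i where i: "i \<in> I" "x \<in> spec_points (chart i J)" using point_in_chart by blast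
  then show "\<exists>U f. openin (zariski X) U \<and> x \<in> U \<and> f \<in> K \<and> f \<noteq> 0 \<and> (\<forall>y\<in>U. C y = unit_coset f y)"
    using C chi_in_K[OF char_in_M[OF i(1)]] openin_spec_chart[OF i(1), of J] unfolding toric_def
    by (intro exI[of _ "spec_points (chart i J)"] exI[of _ "chi (local_char i a)"]) simp
qed

lemma toric_unique:
  assumes "toric a C" "toric a D" shows "C = D"
proof (rule CG_eqI[OF toric_in_CG toric_in_CG])
  fix x assume "x \<in> points X"
  then obtain i where "i \<in> I" "x \<in> spec_points (chart i J)" using point_in_chart by blast
  then show "C x = D x" using assms by (simp add: toric_def)
qed (fact assms)+

lemma toric_mult: "toric a C \<Longrightarrow> toric a' D \<Longrightarrow> toric (a + a') (C \<otimes>\<^bsub>CG\<^esub> D)"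
  using CG_mult_apply[OF spec_chart_point] unfolding toric_def char_add chi_add
  by (auto simp: CG_simps(1) extensional_def)

lemma toric_one: "toric 0 \<one>\<^bsub>CG\<^esub>"
  using spec_chart_point by (auto simp: toric_def CG_one prin_def char_0)

lemma toric_inv:
  assumes C: "toric a C" shows "toric (- a) (inv\<^bsub>CG\<^esub> C)"
proof -
  let ?D = "\<lambda>x\<in>points X. inverse ` C x"
  have D: "toric (- a) ?D"
    using C spec_chart_point by (auto simp: toric_def unit_coset_inverse char_minus chi_minus)
  have "?D \<otimes>\<^bsub>CG\<^esub> C = \<one>\<^bsub>CG\<^esub>"
    using toric_unique[OF toric_mult[OF D C]] toric_one by simp
  then have "inv\<^bsub>CG\<^esub> C = ?D"
    using comm_group.axioms(2)[OF comm_group_CG] C D toric_in_CG by (intro group.inv_equality) auto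
  then show ?thesis using D by simp
qed

lemma toric_pow: "toric a C \<Longrightarrow> toric (frag_cmul k a) (C [^]\<^bsub>CG\<^esub> (k :: int))"
proof -
  assume C: "toric a C"
  interpret comm_group CG by (rule comm_group_CG)
  have nat: "toric (frag_cmul (int n) a) (C [^]\<^bsub>CG\<^esub> n)" for n :: nat
  proof (induction n)
    case (Suc n)
    then show ?case using toric_mult[OF Suc C] by (simp add: frag_cmul_distrib add.commute)
  qed (use toric_one in simp)
  show ?thesis
  proof (cases "k \<ge> 0")
    case True
    then obtain n where "k = int n" using nonneg_int_cases by blast
    then show ?thesis using nat by (simp add: int_pow_int)
  next
    case False
    then obtain n where k: "k = - int n" by (metis int_cases2 of_nat_0_le_iff)
    then show ?thesis
      using toric_inv[OF nat[of n]] toric_in_CG[OF C] by (simp add: int_pow_neg int_pow_int)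
  qed
qed

text \<open>
  At a point of the divisor in the chart of \<open>i\<close> the ideal stalk is generated by the coordinate
  \<open>chi (b i j)\<close> dual to \<open>l\<close>. At the other points the ideal stalk is the local ring, with
  equation 1; there \<open>l\<close> is no generator of the cone \<open>i\<close> or this coordinate is a unit.
\<close>

lemma prime_divisor_toric:
  assumes l: "l \<in> R" shows "toric (frag_of l) (prime_divisor X (ray_point l))"
  unfolding toric_def
proof (intro conjI ballI)
  show "prime_divisor X (ray_point l) \<in> extensional (points X)" by (simp add: prime_divisor_def)
  fix i x assume i: "i \<in> I" and x: "x \<in> spec_points (chart i J)"
  have xX: "x \<in> points X" using i x by (rule spec_chart_point)
  note subx = spec_pointsD(1)[OF subring_chart x] and Ax = spec_pointsD(2)[OF subring_chart x]
  have principal: "{f \<in> K. f \<noteq> 0 \<and> (\<lambda>u. f * u) ` x = (\<lambda>u. g * u) ` x} = unit_coset g x"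
    if g: "g \<in> K" "g \<noteq> 0" for g
  proof (intro equalityI subsetI)
    fix f assume "f \<in> {f \<in> K. f \<noteq> 0 \<and> (\<lambda>u. f * u) ` x = (\<lambda>u. g * u) ` x}"
    then have f: "f \<noteq> 0" "(\<lambda>u. f * u) ` x = (\<lambda>u. g * u) ` x" by auto
    have "f * 1 \<in> (\<lambda>u. f * u) ` x" "g * 1 \<in> (\<lambda>u. g * u) ` x"
      using subring_onD(2)[OF subx] by blast+
    then obtain u v where u: "u \<in> x" "f * 1 = g * u" and v: "v \<in> x" "g * 1 = f * v" using f(2)
      by blast
    have uv: "u \<in> x" "f = g * u" "v \<in> x" "g = f * v" using u v by simp_all
    have "g * (u * v) = g"
      unfolding mult.assoc[symmetric] uv(2)[symmetric] uv(4)[symmetric] ..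
    then have "u * v = 1" using g(2) by (metis mult_cancel_left2)
    then have "inverse u = v" by (rule inverse_unique)
    then have "u \<in> units_in x" using uv f(1) by (auto simp: units_in_iff)
    then show "f \<in> unit_coset g x" unfolding unit_coset_def uv(2) by blast
  next
    fix f assume "f \<in> unit_coset g x"
    then obtain u where u: "u \<in> units_in x" "f = g * u" by (auto simp: unit_coset_def)
    have u': "u \<noteq> 0" "u \<in> x" "inverse u \<in> x" using u by (auto simp: units_in_iff)
    have "(\<lambda>u. f * u) ` x = (\<lambda>u. g * u) ` x"
    proof (intro equalityI subsetI)
      fix y assume "y \<in> (\<lambda>u. f * u) ` x"
      then obtain v where "v \<in> x" "y = g * (u * v)" using u(2) by (auto simp: mult.assoc)
      then show "y \<in> (\<lambda>u. g * u) ` x" using subring_onD(4)[OF subx u'(2)] by blast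
    next
      fix y assume "y \<in> (\<lambda>u. g * u) ` x"
      then obtain v where "v \<in> x" "y = f * (inverse u * v)" using u(2) u'(1) by (auto simp: mult.assoc)
      then show "y \<in> (\<lambda>u. f * u) ` x" using subring_onD(4)[OF subx u'(3)] by blast
    qed
    moreover have "f \<in> K" unfolding u(2) using g(1) u'(2) point_subset_K[OF xX] by (intro K_mult) auto
    ultimately show "f \<in> {f \<in> K. f \<noteq> 0 \<and> (\<lambda>u. f * u) ` x = (\<lambda>u. g * u) ` x}"
      using u(2) u'(1) g(2) by simp
  qed
  have char0: "local_char i (frag_of l) = 0" if "l \<notin> e i ` J"
    unfolding local_char_def using that by (intro sum.neutral) (auto simp: lookup_single when_def)
  have charj: "local_char i (frag_of l) = b i j" if j: "j \<in> J" "l = e i j" for j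
  proof -
    have "e i k = e i j \<longleftrightarrow> k = j" if "k \<in> J" for k
      using dual[OF i that that] dual[OF i that j(1)] by (metis zero_neq_one)
    then have "local_char i (frag_of l) = (\<Sum>k\<in>J. if k = j then b i k else 0)"
      unfolding local_char_def j(2) by (intro sum.cong) (auto simp: lookup_single when_def)
    then show ?thesis using j(1) finJ by simp
  qed
  have trivial: "(\<lambda>u. 1 * u) ` x = x" by simp
  show "prime_divisor X (ray_point l) x = unit_coset (chi (local_char i (frag_of l))) x"
  proof (cases "x \<in> (zariski X) closure_of {ray_point l}")
    case True
    then obtain j where j: "j \<in> J" "l = e i j" "chi (b i j) \<notin> units_in x"
      using closure_ray_point[OF i x l] by blast
    have bx: "chi (b i j) \<in> x"
      using b_in_M[OF i j(1)] dual[OF i j(1)] by (intro subsetD[OF Ax]) (simp add: chi_in_chart)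
    have xz: "x \<subseteq> ray_point l" using point_subset_ray_point[OF i j(1) x j(3)] j(2) by simp
    have nub: "chi (b i j) \<notin> units_in (ray_point l)"
      using chi_unit_ray_point[OF b_in_M[OF i j(1)], of l] dual[OF i j(1) j(1)] j(2) by simp
    have "x \<inter> (ray_point l - units_in (ray_point l)) = (\<lambda>u. chi (b i j) * u) ` x"
    proof (intro equalityI subsetI)
      fix y assume y: "y \<in> x \<inter> (ray_point l - units_in (ray_point l))"
      then obtain a s where as: "a \<in> chart i J" "s \<in> chart i J" "s \<in> units_in x" "y = a / s"
        using spec_pointsD(4)[OF subring_chart x] by blast
      have "a \<notin> units_in (ray_point l)"
        using y units_in_divide[OF subring_ray_point _ units_in_mono[OF xz as(3)], of a] as(4) by blast
      then have "a / chi (b i j) \<in> x" using chart_mult_ray[OF i j(1) as(1)] j(2) Ax by blast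
      then have "(a / chi (b i j)) / s \<in> x" by (rule units_in_divide_mem[OF subx _ as(3)])
      moreover have "y = chi (b i j) * ((a / chi (b i j)) / s)" using as(4) by simp
      ultimately show "y \<in> (\<lambda>u. chi (b i j) * u) ` x" by blast
    next
      fix y assume "y \<in> (\<lambda>u. chi (b i j) * u) ` x"
      then obtain u where u: "u \<in> x" "y = chi (b i j) * u" by blast
      then have "y \<in> x" using bx subring_onD(4)[OF subx] by blast
      moreover have "y \<notin> units_in (ray_point l)"
        using nub u bx xz units_in_factor[OF subring_ray_point, where a = "chi (b i j)" and b = u] by blast
      ultimately show "y \<in> x \<inter> (ray_point l - units_in (ray_point l))" using xz by blast
    qed
    then show ?thesis
      using True xX principal[OF chi_in_K[OF b_in_M[OF i j(1)]] chi_nz] charj[OF j(1,2)]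
      by (simp add: prime_divisor_def ideal_stalk_def)
  next
    case False
    have "prime_divisor X (ray_point l) x = unit_coset 1 x"
      using False xX principal[OF K_1] trivial by (simp add: prime_divisor_def ideal_stalk_def)
    also have "\<dots> = unit_coset (chi (local_char i (frag_of l))) x"
    proof (cases "l \<in> e i ` J")
      case True
      then obtain j where j: "j \<in> J" "l = e i j" by blast
      then have "chi (b i j) \<in> units_in x" using False closure_ray_point[OF i x l] by blast
      then have "1 / chi (b i j) \<in> units_in x" by (intro units_in_divide[OF subx] units_in_one[OF subx])
      then show ?thesis
        unfolding charj[OF j] using unit_coset_eq_iff[OF subx, of 1 "chi (b i j)"] by simp
    qed (simp add: char0)
    finally show ?thesis .
  qed
qed

definition torus_div :: "('a \<Rightarrow>\<^sub>0 int) \<Rightarrow> ('a, 'k) group_algebra fract set \<Rightarrow> ('a, 'k) group_algebra fract set" where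
  "torus_div a = finprod CG (\<lambda>l. prime_divisor X (ray_point l) [^]\<^bsub>CG\<^esub> Poly_Mapping.lookup a l) (Poly_Mapping.keys a)"

lemma toric_tor:
  assumes "Poly_Mapping.keys a \<subseteq> R" shows "toric a (torus_div a)"
proof -
  interpret comm_group CG by (rule comm_group_CG)
  let ?f = "\<lambda>l. prime_divisor X (ray_point l) [^]\<^bsub>CG\<^esub> Poly_Mapping.lookup a l"
  have f: "toric (frag_cmul (Poly_Mapping.lookup a l) (frag_of l)) (?f l)" if "l \<in> R" for l
    using toric_pow[OF prime_divisor_toric[OF that]] .
  have "toric (\<Sum>l\<in>T. frag_cmul (Poly_Mapping.lookup a l) (frag_of l)) (finprod CG ?f T)"
    if "finite T" "T \<subseteq> R" for T
    using that
  proof (induction T)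
    case (insert l T)
    then have "finprod CG ?f (insert l T) = ?f l \<otimes>\<^bsub>CG\<^esub> finprod CG ?f T"
      using toric_in_CG[OF f] by (intro finprod_insert) auto
    then show ?case using insert toric_mult[OF f, of l] by simp
  qed (use toric_one in simp)
  from this[OF finite_keys assms] show ?thesis
    using frag_expansion[of a] by (simp add: torus_div_def frag_extend_def)
qed

lemma tor_add:
  assumes "Poly_Mapping.keys a \<subseteq> R" "Poly_Mapping.keys a' \<subseteq> R"
  shows "torus_div (a + a') = torus_div a \<otimes>\<^bsub>CG\<^esub> torus_div a'"
proof -
  have "Poly_Mapping.keys (a + a') \<subseteq> R" using keys_add[of a a'] assms by blast
  then show ?thesis using toric_unique toric_mult toric_tor assms by metis
qed

definition cls :: "('a \<Rightarrow>\<^sub>0 int) \<Rightarrow> (('a, 'k) group_algebra fract set \<Rightarrow> ('a, 'k) group_algebra fract set) set" where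
  "cls a = divisor_class X (ray_divisor_point M) a"

lemma cls_torus_div: "cls a = principal_divisors X #>\<^bsub>CG\<^esub> torus_div a"
  by (simp add: cls_def divisor_class_def torus_div_def ray_point_def)

lemma cls_hom: "cls \<in> hom (free_Abelian_group R) (Pic X)"
proof (rule homI)
  interpret normal "principal_divisors X" CG by (rule normal_principal)
  fix a assume "a \<in> carrier (free_Abelian_group R)"
  then have "torus_div a \<in> carrier CG" using toric_in_CG[OF toric_tor] by simp
  then show "cls a \<in> carrier (Pic X)"
    unfolding cls_torus_div Pic_def carrier_FactGroup by blast
  fix a' assume "a' \<in> carrier (free_Abelian_group R)"
  then have "torus_div a' \<in> carrier CG" using toric_in_CG[OF toric_tor] by simp
  then show "cls (a \<otimes>\<^bsub>free_Abelian_group R\<^esub> a') = cls a \<otimes>\<^bsub>Pic X\<^esub> cls a'"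
    using \<open>torus_div a \<in> carrier CG\<close> \<open>a \<in> _\<close> \<open>a' \<in> _\<close>
    by (simp add: cls_torus_div Pic_def tor_add rcos_sum FactGroup_def)
qed

lemma chart_unit:
  assumes "u \<in> chart i K'" "inverse u \<in> chart i K'" "u \<noteq> 0"
  obtains m c where "c \<noteq> 0" "u = embed (monomial 0 c) * chi m" "m \<in> M" "\<And>j. j \<in> K' \<Longrightarrow> m \<bullet> e i j = 0"
proof -
  obtain p q where pq: "u = embed p" "ga_keys p \<subseteq> {m\<in>M. \<forall>j\<in>K'. 0 \<le> m \<bullet> e i j}"
    "inverse u = embed q" "ga_keys q \<subseteq> {m\<in>M. \<forall>j\<in>K'. 0 \<le> m \<bullet> e i j}"
    using assms by (auto simp: chart_def monoid_algebra_def)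
  have "embed (p * q) = u * inverse u" unfolding embed_simps(3) pq(1,3)[symmetric] ..
  then have "embed (p * q) = embed 1" using assms(3) by (simp add: embed_simps(4))
  then have "p * q = 1" by (simp only: embed_simps(6))
  then obtain m c where mc: "c \<noteq> 0" "p = monomial m c" "q = monomial (- m) (inverse c)"
    by (rule unit_is_monomial)
  then have "m \<in> M" "m \<bullet> e i j = 0" if "j \<in> K'" for j
    using pq(2,4) that by force+
  moreover have "m \<in> M" using pq(2) mc by auto
  moreover have "u = embed (monomial 0 c) * chi m"
    unfolding pq(1) mc(2) chi_def embed_simps(3)[symmetric] monomial_mult by simp
  ultimately show ?thesis using that mc(1) by blast
qed

text \<open>
  The divisor of the character \<open>m\<close>. The pairing of a character with a ray is an integer, so the
  floor is exact.
\<close>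

definition ray_div :: "'a \<Rightarrow> ('a \<Rightarrow>\<^sub>0 int)" where
  "ray_div m = (\<Sum>l\<in>R. frag_cmul \<lfloor>m \<bullet> l\<rfloor> (frag_of l))"

lemma lookup_div: "Poly_Mapping.lookup (ray_div m) l = (if l \<in> R then \<lfloor>m \<bullet> l\<rfloor> else 0)"
  unfolding ray_div_def by (rule lookup_sum_frag_of[OF finite_R])

lemma keys_div: "Poly_Mapping.keys (ray_div m) \<subseteq> R"
  by (auto simp: in_keys_iff lookup_div split: if_splits)

lemma M_R_int: "m \<in> M \<Longrightarrow> l \<in> R \<Longrightarrow> of_int \<lfloor>m \<bullet> l\<rfloor> = m \<bullet> l"
proof -
  assume m: "m \<in> M" and "l \<in> R"
  then obtain i j where "i \<in> I" "j \<in> J" "l = e i j" by (auto simp: R_def)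
  then show "of_int \<lfloor>m \<bullet> l\<rfloor> = m \<bullet> l" using coordinates(2)[OF _ m, of i j]
    by simp
qed

lemma char_div: "i \<in> I \<Longrightarrow> m \<in> M \<Longrightarrow> local_char i (ray_div m) = m"
  by (rule char_of_inner) (simp_all add: lookup_div e_in_R M_R_int)

lemma toric_div: "m \<in> M \<Longrightarrow> toric (ray_div m) (prin (chi m))"
  using spec_chart_point by (auto simp: toric_def prin_def char_div)

lemma tor_div: "m \<in> M \<Longrightarrow> torus_div (ray_div m) = prin (chi m)"
  using toric_unique[OF toric_tor[OF keys_div] toric_div] .

text \<open>
  If \<open>f\<close> is an equation of the divisor, its quotient by the character of \<open>a\<close> on the chart of \<open>i\<close>
  is a unit on this chart. Units on an affine space are scalars. Since \<open>f\<close> is the same on all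
  charts, the characters on the different charts agree, and \<open>a\<close> is the divisor of their common
  value.
\<close>

lemma cls_eq_one_iff:
  assumes a: "Poly_Mapping.keys a \<subseteq> R"
  shows "cls a = \<one>\<^bsub>Pic X\<^esub> \<longleftrightarrow> a \<in> ray_div ` M"
proof -
  interpret comm_group CG by (rule comm_group_CG)
  have torC: "torus_div a \<in> carrier CG" using toric_in_CG[OF toric_tor[OF a]] .
  have "cls a = \<one>\<^bsub>Pic X\<^esub> \<longleftrightarrow> torus_div a \<in> principal_divisors X"
    using coset_join1[OF _ torC subgroup_principal] coset_join2[OF torC subgroup_principal]
    by (auto simp: cls_torus_div Pic_def FactGroup_def)
  also have "\<dots> \<longleftrightarrow> a \<in> ray_div ` M"
  proof
    assume "a \<in> ray_div ` M"
    then show "torus_div a \<in> principal_divisors X"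
      using chi_in_K unfolding principal_divisors_prin by (auto simp: tor_div)
  next
    assume "torus_div a \<in> principal_divisors X"
    then obtain f where f: "f \<in> K" "f \<noteq> 0" "torus_div a = prin f"
      unfolding principal_divisors_prin by blast
    have eq: "\<exists>c. f = embed (monomial (local_char i a) c) \<and> c \<noteq> 0" if i: "i \<in> I" for i
    proof -
      let ?u = "f / chi (local_char i a)"
      have u: "?u \<in> units_in x" if x: "x \<in> spec_points (chart i J)" for x
      proof -
        have "unit_coset f x = unit_coset (chi (local_char i a)) x"
          using toric_tor[OF a] i x spec_chart_point[OF i x] unfolding toric_def f(3) prin_def by force
        then show ?thesis
          using unit_coset_eq_iff[OF spec_pointsD(1)[OF subring_chart x] f(2) chi_nz] by blast
      qed
      have "?u \<in> chart i J" "inverse ?u \<in> chart i J" "?u \<noteq> 0"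
        using regular_everywhere[OF subring_chart] u f(2) unfolding units_in_iff by auto
      then obtain m c where mc: "c \<noteq> 0" "?u = embed (monomial 0 c) * chi m" "m \<in> M" "\<And>j. j \<in> J \<Longrightarrow> m \<bullet> e i j = 0"
        by (rule chart_unit) blast
      have "m = 0" using coordinates(1)[OF i mc(3)] mc(4) by simp
      then have "f = embed (monomial 0 c) * chi (local_char i a)" using mc(2) by (simp add: divide_eq_eq)
      also have "\<dots> = embed (monomial (local_char i a) c)"
        unfolding chi_def embed_simps(3)[symmetric] monomial_mult by simp
      finally show ?thesis using mc(1) by blast
    qed
    have same: "local_char i a = local_char i' a" if i: "i \<in> I" and i': "i' \<in> I" for i i'
    proof -
      obtain c c' where "monomial (local_char i a) c = (monomial (local_char i' a) c' :: ('a, 'k) group_algebra)" "c \<noteq> 0"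
        using eq[OF i] eq[OF i'] embed_simps(6) by metis
      then have "ga_lookup (monomial (local_char i' a) c' :: ('a, 'k) group_algebra) (local_char i a) \<noteq> 0"
        by (metis ga_coeffs_simps(6) lookup_single_eq)
      then show ?thesis by (auto simp: lookup_single when_def split: if_splits)
    qed
    obtain i where i: "i \<in> I" using I_nonempty by blast
    have "a = ray_div (local_char i a)"
    proof (rule poly_mapping_eqI)
      fix l show "Poly_Mapping.lookup a l = Poly_Mapping.lookup (ray_div (local_char i a)) l"
      proof (cases "l \<in> R")
        case True
        then obtain i' j where ij: "i' \<in> I" "j \<in> J" "l = e i' j" by (auto simp: R_def)
        then have "local_char i a \<bullet> l = of_int (Poly_Mapping.lookup a l)"
          using char_e[OF ij(1,2)] same[OF i ij(1)] by simp
        then show ?thesis using True by (simp add: lookup_div)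
      next
        case False
        then show ?thesis using a by (auto simp: lookup_div in_keys_iff)
      qed
    qed
    then show "a \<in> ray_div ` M" using char_in_M[OF i] by blast
  qed
  finally show ?thesis .
qed

lemma cartier_principal_on_chart:
  assumes C: "C \<in> carrier CG" and i: "i \<in> I"
  obtains g where "g \<in> K" "g \<noteq> 0" "\<And>y. y \<in> spec_points (chart i J) \<Longrightarrow> C y = unit_coset g y"
proof -
  have "\<exists>a\<in>chart i J. \<exists>c\<in>chart i J. a \<noteq> 0 \<and> c \<noteq> 0 \<and> (\<forall>y\<in>spec_points (chart i J). C y = unit_coset (a / c) y)"
  proof (rule locally_principal_gcd_ring[OF gcd_ring_chart[OF i]])
    fix x assume x: "x \<in> spec_points (chart i J)"
    obtain U f where U: "openin (zariski X) U" "x \<in> U" "f \<in> K" "f \<noteq> 0" "\<forall>y\<in>U. C y = unit_coset f y"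
      by (rule CG_locally[OF C spec_chart_point[OF i x]])
    obtain h where h: "h \<in> chart i J" "h \<in> units_in x" "\<And>y. y \<in> spec_points (chart i J) \<Longrightarrow> h \<in> units_in y \<Longrightarrow> y \<in> U"
      using open_contains_basic[OF i x U(1,2)] by blast
    obtain a c where ac: "f = a / c" "a \<in> chart i J" "c \<in> chart i J" "c \<noteq> 0"
      using U(3) unfolding function_field_chart[OF i] by blast
    then have "a \<noteq> 0" using U(4) by auto
    then show "\<exists>h\<in>chart i J. h \<in> units_in x \<and> (\<exists>a\<in>chart i J. \<exists>c\<in>chart i J. a \<noteq> 0 \<and> c \<noteq> 0 \<and>
       (\<forall>y\<in>spec_points (chart i J). h \<in> units_in y \<longrightarrow> C y = unit_coset (a / c) y))"
      using h U(5) ac by blast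
  qed
  then show ?thesis
    using that K_divide chart_subset_K[OF i order_refl] by (metis divide_eq_0_iff subsetD)
qed

text \<open>
  Let \<open>g i\<close> be an equation of \<open>C\<close> on the chart of \<open>i\<close>. On the torus \<open>g i / g i0\<close> is a unit, that
  is, a scalar times a character \<open>chi (m i)\<close>. At the generic point of the divisor of a ray \<open>l\<close>
  common to \<open>i\<close> and \<open>i'\<close> both equations differ by a unit, so \<open>m i\<close> and \<open>m i'\<close> have the same
  pairing with \<open>l\<close>. This common value is the multiplicity of \<open>l\<close> in a torus-invariant divisor
  that has the same local equations as \<open>C\<close> up to \<open>g i0\<close>.
\<close>

lemma cartier_class_toric:
  assumes C: "C \<in> carrier CG"
  shows "\<exists>a f. Poly_Mapping.keys a \<subseteq> R \<and> f \<in> K \<and> f \<noteq> 0 \<and> C = prin f \<otimes>\<^bsub>CG\<^esub> torus_div a"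
proof -
  have "\<forall>i\<in>I. \<exists>g. g \<in> K \<and> g \<noteq> 0 \<and> (\<forall>y\<in>spec_points (chart i J). C y = unit_coset g y)"
  proof
      fix i assume "i \<in> I"
    then show "\<exists>g. g \<in> K \<and> g \<noteq> 0 \<and> (\<forall>y\<in>spec_points (chart i J). C y = unit_coset g y)"
      by (rule cartier_principal_on_chart[OF C]) blast
  qed
  from bchoice[OF this] obtain g
    where g0: "\<forall>i\<in>I. g i \<in> K \<and> g i \<noteq> 0 \<and> (\<forall>y\<in>spec_points (chart i J). C y = unit_coset (g i) y)" ..
  have g: "g i \<in> K \<and> g i \<noteq> 0 \<and> (\<forall>y\<in>spec_points (chart i J). C y = unit_coset (g i) y)" if "i \<in> I" for i
    using g0 that by blast
  obtain i0 where i0: "i0 \<in> I" using I_nonempty by blast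
  have "\<exists>m c. c \<noteq> 0 \<and> g i / g i0 = embed (monomial 0 c) * chi m \<and> m \<in> M"
    if i: "i \<in> I" for i
  proof -
    let ?u = "g i / g i0"
    have u: "?u \<in> units_in x" if x: "x \<in> spec_points (chart i {})" for x
    proof -
      have "x \<in> spec_points (chart i J)" "x \<in> spec_points (chart i0 J)"
        using spec_chart_subset[OF i _ x] spec_chart_subset[OF i0, of "{}" x] x by (simp_all add: chart_empty)
      then have "unit_coset (g i) x = unit_coset (g i0) x" using g i i0 by metis
      then show ?thesis
        using unit_coset_eq_iff[OF spec_pointsD(1)[OF subring_chart x], of "g i" "g i0"] g i i0 by blast
    qed
    have "?u \<in> chart i {}" "inverse ?u \<in> chart i {}" "?u \<noteq> 0"
      using regular_everywhere[OF subring_chart, of i "{}"] u g i i0 unfolding units_in_iff by auto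
    then obtain m c where "c \<noteq> 0" "?u = embed (monomial 0 c) * chi m" "m \<in> M"
      by (rule chart_unit) blast
    then show ?thesis by blast
  qed
  then obtain m c where mc: "\<And>i. i \<in> I \<Longrightarrow> c i \<noteq> 0 \<and> g i / g i0 = embed (monomial 0 (c i)) * chi (m i) \<and> m i \<in> M"
    by metis
  have unit_of_mult: "x \<noteq> 0 \<and> inverse x = y" if "x * y = 1"
    for x y :: "('a, 'k) group_algebra fract"
    using that inverse_unique[OF that] by auto
  have const_unit: "embed (monomial 0 c) \<in> units_in x"
    if "c \<noteq> 0" "x \<in> spec_points (chart i L)" for c x i L
  proof -
    have "embed (monomial 0 c) * embed (monomial 0 (inverse c)) = (1 :: ('a, 'k) group_algebra fract)"
      using that(1) unfolding embed_simps(3)[symmetric] monomial_mult by (simp add: embed_simps(4))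
    then have "embed (monomial 0 c) \<noteq> (0 :: ('a, 'k) group_algebra fract)"
      "inverse (embed (monomial 0 c)) = (embed (monomial 0 (inverse c)) :: ('a, 'k) group_algebra fract)"
      using unit_of_mult by blast+
    moreover have "embed (monomial 0 d) \<in> x" for d
      using const_in_chart spec_pointsD(2)[OF subring_chart that(2)] by blast
    ultimately show ?thesis unfolding units_in_iff by metis
  qed
  have agree: "m i \<bullet> l = m i' \<bullet> l" if i: "i \<in> I" "i' \<in> I"
    and l: "l \<in> e i ` J" "l \<in> e i' ` J" for i i' l
  proof -
    have z: "ray_point l \<in> spec_points (chart i J)" "ray_point l \<in> spec_points (chart i' J)"
      using ray_point_spec_chart[OF i(1) _ _ order_refl] ray_point_spec_chart[OF i(2) _ _ order_refl] l
      by auto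
    note subz = spec_pointsD(1)[OF subring_chart z(1)]
    have "unit_coset (g i) (ray_point l) = unit_coset (g i') (ray_point l)" using g i z by metis
    then have gg: "g i / g i' \<in> units_in (ray_point l)"
      using unit_coset_eq_iff[OF subz, of "g i" "g i'"] g i by blast
    have cu: "embed (monomial 0 (c i)) \<in> units_in (ray_point l)" "embed (monomial 0 (c i')) \<in> units_in (ray_point l)"
      using const_unit[OF _ z(1)] mc i by blast+
    have quot: "(x / z) / (y / z) = x / y" if "z \<noteq> 0" for x y z :: "('a, 'k) group_algebra fract"
      using that by simp
    have "g i / g i' = (embed (monomial 0 (c i)) * chi (m i)) / (embed (monomial 0 (c i')) * chi (m i'))"
      using quot[of "g i0" "g i" "g i'"] mc[OF i(1)] mc[OF i(2)] g[OF i0] by metis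
    then have "g i / g i' = (embed (monomial 0 (c i)) / embed (monomial 0 (c i'))) * chi (m i - m i')"
      by (simp only: chi_diff times_divide_times_eq)
    moreover have "(embed (monomial 0 (c i')) / embed (monomial 0 (c i))) * ((embed (monomial 0 (c i)) / embed (monomial 0 (c i'))) * y) = (y :: ('a, 'k) group_algebra fract)" for y
      using cu unfolding units_in_iff
      by (metis (no_types, lifting) divide_divide_eq_right divide_self_if mult.assoc mult.commute mult_1 nonzero_eq_divide_eq times_divide_eq_right)
    ultimately have "chi (m i - m i') = (embed (monomial 0 (c i')) / embed (monomial 0 (c i))) * (g i / g i')"
      by metis
    then have "chi (m i - m i') \<in> units_in (ray_point l)"
      using units_in_mult[OF subz units_in_divide[OF subz cu(2,1)] gg] by metis
    then have "(m i - m i') \<bullet> l = 0"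
      using chi_unit_ray_point[of "m i - m i'" l] mc i M_diff by auto
    then show ?thesis by (simp add: inner_diff_left)
  qed
  define s where "s l = (SOME i. i \<in> I \<and> l \<in> e i ` J)" for l
  have s: "s l \<in> I \<and> l \<in> e (s l) ` J" if "l \<in> R" for l
    unfolding s_def using that
    by (intro someI_ex[of "\<lambda>i. i \<in> I \<and> l \<in> e i ` J"]) (auto simp: R_def)
  define a where "a = (\<Sum>l\<in>R. frag_cmul \<lfloor>m (s l) \<bullet> l\<rfloor> (frag_of l))"
  have look: "Poly_Mapping.lookup a l = (if l \<in> R then \<lfloor>m (s l) \<bullet> l\<rfloor> else 0)"
    for l
    unfolding a_def by (rule lookup_sum_frag_of[OF finite_R])
  have ka: "Poly_Mapping.keys a \<subseteq> R" by (auto simp: in_keys_iff look split: if_splits)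
  have chara: "local_char i a = m i" if i: "i \<in> I" for i
  proof (rule char_of_inner[OF i])
    show "m i \<in> M" using mc i by blast
    fix j assume j: "j \<in> J"
    have "m (s (e i j)) \<bullet> e i j = m i \<bullet> e i j"
      using agree s[OF e_in_R[OF i j]] i j by blast
    then show "of_int (Poly_Mapping.lookup a (e i j)) = m i \<bullet> e i j"
      using look e_in_R[OF i j] M_R_int \<open>m i \<in> M\<close> by simp
  qed
  have "C = prin (g i0) \<otimes>\<^bsub>CG\<^esub> torus_div a"
  proof (rule CG_eqI[OF C CG_mult_closed[OF prin_in_CG toric_in_CG[OF toric_tor[OF ka]]]])
    fix x assume xX: "x \<in> points X"
    then obtain i where i: "i \<in> I" and x: "x \<in> spec_points (chart i J)" using point_in_chart by blast
    have "torus_div a x = unit_coset (chi (m i)) x"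
      using toric_tor[OF ka] i x chara[OF i] by (simp add: toric_def)
    then have "(prin (g i0) \<otimes>\<^bsub>CG\<^esub> torus_div a) x = unit_coset (g i0 * chi (m i)) x"
      using xX by (intro CG_mult_apply) (simp_all add: prin_def)
    also have "\<dots> = unit_coset (g i) x"
    proof -
      have "g i / (g i0 * chi (m i)) = embed (monomial 0 (c i))"
        using mc[OF i] g[OF i0] chi_nz[of "m i"]
        by (metis divide_divide_eq_left nonzero_mult_div_cancel_right)
      then have "g i / (g i0 * chi (m i)) \<in> units_in x" using const_unit[OF _ x] mc[OF i] by metis
      then show ?thesis
        using unit_coset_eq_iff[OF subring_point[OF xX], of "g i" "g i0 * chi (m i)"] g[OF i] g[OF i0] by simp
    qed
    finally show "C x = (prin (g i0) \<otimes>\<^bsub>CG\<^esub> torus_div a) x" using g[OF i] x by simp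
  qed (use g[OF i0] in auto)
  then show ?thesis using ka g[OF i0] by blast
qed

theorem cls_epi: "cls \<in> epi (free_Abelian_group R) (Pic X)"
proof -
  interpret comm_group CG by (rule comm_group_CG)
  have "c \<in> cls ` carrier (free_Abelian_group R)" if "c \<in> carrier (Pic X)" for c
  proof -
    obtain C where C: "C \<in> carrier CG" "c = principal_divisors X #>\<^bsub>CG\<^esub> C"
      using \<open>c \<in> carrier (Pic X)\<close> unfolding Pic_def carrier_FactGroup by blast
    obtain a f where a: "Poly_Mapping.keys a \<subseteq> R" "f \<in> K" "f \<noteq> 0" "C = prin f \<otimes>\<^bsub>CG\<^esub> torus_div a"
      using cartier_class_toric[OF C(1)] by blast
    have "prin f \<in> principal_divisors X" unfolding principal_divisors_prin using a by blast
    then have "c = cls a"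
      using a coset_mult_assoc[of "principal_divisors X" "prin f" "torus_div a"] coset_join2[OF prin_in_CG subgroup_principal]
        toric_in_CG[OF toric_tor[OF a(1)]] prin_in_CG subgroup.subset[OF subgroup_principal]
      by (simp add: C(2) cls_torus_div)
    then show ?thesis using a(1) by simp
  qed
  then show ?thesis
    using cls_hom unfolding epi_def hom_def by blast
qed

theorem cls_kernel: "kernel (free_Abelian_group R) (Pic X) cls = ray_div ` M"
  using cls_eq_one_iff keys_div by (auto simp: kernel_def)

end

section \<open>Automorphisms of a fan\<close>

lemma bij_fract_act:
  fixes g :: "'a::real_inner \<Rightarrow> 'a"
  assumes g: "bij g" "linear g"
  shows "bij (fract_act g :: ('a, 'k::field) group_algebra fract \<Rightarrow> _)"
proof (rule o_bij)
  have ginv: "bij (inv_into UNIV g)" "linear (inv_into UNIV g)"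
    using g by (auto intro: bij_imp_bij_inv linear_inv_bij)
  have "inv_into UNIV g \<circ> g = id" using g(1) by (simp add: bij_is_inj)
  then show "fract_act (inv_into UNIV g) \<circ> fract_act g = (id :: ('a, 'k) group_algebra fract \<Rightarrow> _)"
    by (intro ext) (simp add: fract_act_comp[OF ginv g, symmetric] fract_act_id)
  have "g \<circ> inv_into UNIV g = id" using g(1) by (simp add: surj_iff[symmetric] bij_is_surj)
  then show "fract_act g \<circ> fract_act (inv_into UNIV g) = (id :: ('a, 'k) group_algebra fract \<Rightarrow> _)"
    by (intro ext) (simp add: fract_act_comp[OF g ginv, symmetric] fract_act_id)
qed

lemma spec_points_vimage:
  fixes \<phi> :: "'k::field \<Rightarrow> 'k"
  assumes \<phi>: "bij \<phi>" "\<And>a b. \<phi> (a - b) = \<phi> a - \<phi> b" "\<And>a b. \<phi> (a + b) = \<phi> a + \<phi> b" "\<And>a b. \<phi> (a * b) = \<phi> a * \<phi> b"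
      "\<phi> 0 = 0" "\<phi> 1 = 1" "\<And>a. \<phi> (inverse a) = inverse (\<phi> a)"
    and A: "subring_on A" "subring_on (\<phi> ` A)" and x: "x \<in> spec_points (\<phi> ` A)"
  shows "\<phi> -` x \<in> spec_points A" and "units_in (\<phi> -` x) = \<phi> -` units_in x"
proof -
  have inj: "\<phi> a = \<phi> b \<longleftrightarrow> a = b" for a b using \<phi>(1)
    by (simp add: bij_is_inj inj_eq)
  have z: "\<phi> a = 0 \<longleftrightarrow> a = 0" for a using inj[of a 0] \<phi>(5) by simp
  show u: "units_in (\<phi> -` x) = \<phi> -` units_in x"
    by (auto simp: units_in_iff z \<phi>(7))
  have uu: "a \<in> units_in (\<phi> -` x) \<longleftrightarrow> \<phi> a \<in> units_in x" for a using u
    by blast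
  note xD = spec_pointsD[OF A(2) x]
  have "subring_on (\<phi> -` x)"
    using xD(1) by (auto simp: subring_on_def \<phi>)
  then have "local_on (\<phi> -` x)"
    using xD(3) unfolding local_on_def by (auto simp: uu \<phi>(3))
  moreover have "\<exists>a\<in>A. \<exists>s\<in>A. s \<in> units_in (\<phi> -` x) \<and> y = a / s"
    if "y \<in> \<phi> -` x" for y
  proof -
    obtain a s where as: "a \<in> A" "s \<in> A" "\<phi> s \<in> units_in x" "\<phi> y = \<phi> a / \<phi> s"
      using xD(4)[of "\<phi> y"] \<open>y \<in> \<phi> -` x\<close> by auto
    have "\<phi> (a / s) = \<phi> a / \<phi> s" by (simp add: divide_inverse \<phi>(4,7))
    then have "y = a / s" using as(4) inj by metis
    then show ?thesis using as uu by blast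
  qed
  ultimately show "\<phi> -` x \<in> spec_points A"
    unfolding spec_points_iff[OF A(1)] fractions_over_def using xD(2) by blast
qed

lemma nat_span_linear:
  assumes "linear g" shows "nat_span (\<lambda>j. g (b j)) J = g ` nat_span b J"
proof -
  have "(\<Sum>j\<in>J. real (a j) *\<^sub>R g (b j)) = g (\<Sum>j\<in>J. real (a j) *\<^sub>R b j)" for a
    by (simp add: linear_sum[OF assms] linear_cmul[OF assms])
  then show ?thesis by (auto simp: nat_span_def)
qed

lemma lookup_frag_extend_inj:
  assumes "inj f"
  shows "Poly_Mapping.lookup (frag_extend (\<lambda>l. frag_of (f l)) a) (f l) = Poly_Mapping.lookup a l"
proof -
  have "Poly_Mapping.lookup (frag_extend (\<lambda>l. frag_of (f l)) a) (f l)
      = (\<Sum>k\<in>Poly_Mapping.keys a. if k = l then Poly_Mapping.lookup a k else 0)"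
    unfolding frag_extend_def lookup_sum using assms
    by (intro sum.cong) (auto simp: lookup_single when_def inj_eq)
  then show ?thesis by (auto simp: in_keys_iff)
qed

context smooth_fan
begin

text \<open>
  An automorphism \<open>g\<close> of the character lattice with its action \<open>gd\<close> on the rays, such that every
  cone is the image of another.
\<close>

context
  fixes g gd :: "'a \<Rightarrow> 'a"
  assumes g: "bij g" "linear g" and gd: "inj gd"
    and frames: "\<And>i. i \<in> I \<Longrightarrow> \<exists>i0\<in>I. \<forall>j\<in>J. b i j = g (b i0 j) \<and> e i j = gd (e i0 j)"
begin

abbreviation \<phi> :: "('a, 'k) group_algebra fract \<Rightarrow> ('a, 'k) group_algebra fract" where
  "\<phi> \<equiv> fract_act g"

abbreviation act :: "('a \<Rightarrow>\<^sub>0 int) \<Rightarrow> ('a \<Rightarrow>\<^sub>0 int)" where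
  "act \<equiv> frag_extend (\<lambda>l. frag_of (gd l))"

lemma gd_R: "gd ` R = R"
proof -
  have "R \<subseteq> gd ` R"
  proof
    fix l assume "l \<in> R"
    then obtain i j where ij: "i \<in> I" "j \<in> J" "l = e i j" by (auto simp: R_def)
    then obtain i0 where "i0 \<in> I" "e i j = gd (e i0 j)" using frames by blast
    then show "l \<in> gd ` R" using ij e_in_R by blast
  qed
  moreover have "card (gd ` R) = card R" using gd by (intro card_image) (auto intro: inj_on_subset)
  ultimately show ?thesis using finite_R by (metis card_subset_eq finite_imageI)
qed

lemma keys_act: "Poly_Mapping.keys a \<subseteq> R \<Longrightarrow> Poly_Mapping.keys (act a) \<subseteq> R"
  using keys_frag_extend[of "\<lambda>l. frag_of (gd l)" a] gd_R by fastforce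

lemma g_M: "g ` M = M"
proof -
  obtain i where i: "i \<in> I" using I_nonempty by blast
  then obtain i0 where i0: "i0 \<in> I" "\<And>j. j \<in> J \<Longrightarrow> b i j = g (b i0 j)"
    using frames by blast
  have "(\<Sum>j\<in>J. of_int (a j) *\<^sub>R b i j) = g (\<Sum>j\<in>J. of_int (a j) *\<^sub>R b i0 j)"
    for a
    using i0(2) by (simp add: linear_sum[OF g(2)] linear_cmul[OF g(2)])
  then have "g ` {\<Sum>j\<in>J. of_int (a j) *\<^sub>R b i0 j | a. True} = {\<Sum>j\<in>J. of_int (a j) *\<^sub>R b i j | a. True}"
    by auto
  then show ?thesis by (simp only: lattice[OF i, symmetric] lattice[OF i0(1), symmetric])
qed

lemma \<phi>_divide: "\<phi> (x / y) = \<phi> x / \<phi> y"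
  by (simp add: divide_inverse fract_act_mult[OF g] fract_act_inverse[OF g])

lemma K_torus: "K = {a / c | a c. a \<in> monoid_algebra M \<and> c \<in> monoid_algebra M \<and> c \<noteq> 0}"
proof -
  obtain i where i: "i \<in> I" using I_nonempty by blast
  show ?thesis
  proof
    show "K \<subseteq> {a / c | a c. a \<in> monoid_algebra M \<and> c \<in> monoid_algebra M \<and> c \<noteq> 0}"
      unfolding function_field_chart[OF i] using chart_mono[of "{}" J i] by (auto simp: chart_empty)
    show "{a / c | a c. a \<in> monoid_algebra M \<and> c \<in> monoid_algebra M \<and> c \<noteq> 0} \<subseteq> K"
      using K_divide chart_subset_K[OF i, of "{}"] by (auto simp: chart_empty)
  qed
qed

lemma \<phi>_K: "\<phi> ` K = K"
proof -
  have im: "\<phi> ` monoid_algebra M = monoid_algebra M"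
    unfolding fract_act_monoid_algebra[OF g] g_M ..
  have z: "\<phi> c = 0 \<longleftrightarrow> c = 0" for c by (rule fract_act_eq_0_iff[OF g])
  show ?thesis
  proof
    show "\<phi> ` K \<subseteq> K"
    proof
      fix y assume "y \<in> \<phi> ` K"
      then obtain a c where "a \<in> monoid_algebra M" "c \<in> monoid_algebra M" "c \<noteq> 0" "y = \<phi> a / \<phi> c"
        unfolding K_torus by (auto simp: \<phi>_divide)
      then show "y \<in> K" unfolding K_torus using im z by blast
    qed
    show "K \<subseteq> \<phi> ` K"
    proof
      fix y assume "y \<in> K"
      then obtain a c where ac: "a \<in> monoid_algebra M" "c \<in> monoid_algebra M" "c \<noteq> 0" "y = a / c"
        unfolding K_torus by blast
      then obtain a' c' where *: "a' \<in> monoid_algebra M" "a = \<phi> a'" "c' \<in> monoid_algebra M" "c = \<phi> c'"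
        using im by (metis imageE)
      then have "y = \<phi> (a' / c')" "a' / c' \<in> K"
        using ac z unfolding K_torus by (auto simp: \<phi>_divide)
      then show "y \<in> \<phi> ` K" by blast
    qed
  qed
qed

text \<open>
  The cone of \<open>i\<close> is the image under the automorphism of the cone of \<open>i0\<close>.
\<close>

lemma act_frame:
  assumes i: "i \<in> I"
  obtains i0 where "i0 \<in> I" "chart i J = \<phi> ` chart i0 J" "\<And>a. local_char i (act a) = g (local_char i0 a)"
proof -
  obtain i0 where i0: "i0 \<in> I" "\<And>j. j \<in> J \<Longrightarrow> b i j = g (b i0 j) \<and> e i j = gd (e i0 j)"
    using frames[OF i] by blast
  have "nat_span (b i) J = nat_span (\<lambda>j. g (b i0 j)) J"
    unfolding nat_span_def using i0(2) by auto
  then have "chart i J = \<phi> ` chart i0 J"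
    unfolding chart_def cone_monoid_nat_span[OF i] cone_monoid_nat_span[OF i0(1)] fract_act_monoid_algebra[OF g]
      nat_span_linear[OF g(2)] by simp
  moreover have "local_char i (act a) = g (local_char i0 a)" for a
    unfolding local_char_def using i0(2)
    by (simp add: linear_sum[OF g(2)] linear_cmul[OF g(2)] lookup_frag_extend_inj[OF gd])
  ultimately show ?thesis using that i0(1) by blast
qed

text \<open>
  The stalk at \<open>x\<close> of the divisor that is pushed forward is the image of the stalk at the
  preimage of \<open>x\<close>; so the automorphism carries the local character on the cone of \<open>i0\<close> to the
  one on its image.
\<close>

lemma cartier_act_toric:
  assumes a: "Poly_Mapping.keys a \<subseteq> R" and f: "f \<in> K" "f \<noteq> 0"
  shows "cartier_act X \<phi> (prin f \<otimes>\<^bsub>CG\<^esub> torus_div a) = prin (\<phi> f) \<otimes>\<^bsub>CG\<^esub> torus_div (act a)"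
proof
  fix x
  show "cartier_act X \<phi> (prin f \<otimes>\<^bsub>CG\<^esub> torus_div a) x = (prin (\<phi> f) \<otimes>\<^bsub>CG\<^esub> torus_div (act a)) x"
  proof (cases "x \<in> points X")
    case True
    then obtain i where i: "i \<in> I" "x \<in> spec_points (chart i J)" using point_in_chart by blast
    obtain i0 where i0: "i0 \<in> I" "chart i J = \<phi> ` chart i0 J" "local_char i (act a) = g (local_char i0 a)"
      using act_frame[OF i(1)] by metis
    note tr = spec_points_vimage[OF bij_fract_act[OF g] fract_act_diff[OF g] fract_act_add[OF g] fract_act_mult[OF g]
        fract_act_0[OF g] fract_act_1[OF g] fract_act_inverse[OF g] subring_chart]
    have x0: "\<phi> -` x \<in> spec_points (chart i0 J)"
      and ux: "units_in (\<phi> -` x) = \<phi> -` units_in x"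
      using tr[of i0 J x] i(2) subring_chart[of i J] unfolding i0(2) by auto
    have x0X: "\<phi> -` x \<in> points X" using spec_chart_point[OF i0(1) x0] .
    have "torus_div a (\<phi> -` x) = unit_coset (chi (local_char i0 a)) (\<phi> -` x)"
      using toric_tor[OF a] i0(1) x0 by (simp add: toric_def)
    then have "(prin f \<otimes>\<^bsub>CG\<^esub> torus_div a) (\<phi> -` x) = unit_coset (f * chi (local_char i0 a)) (\<phi> -` x)"
      using x0X by (intro CG_mult_apply) (simp_all add: prin_def)
    then have "cartier_act X \<phi> (prin f \<otimes>\<^bsub>CG\<^esub> torus_div a) x = \<phi> ` unit_coset (f * chi (local_char i0 a)) (\<phi> -` x)"
      using True by (simp add: cartier_act_def)
    also have "\<dots> = (\<lambda>u. \<phi> (f * chi (local_char i0 a)) * u) ` \<phi> ` (\<phi> -` units_in x)"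
      unfolding unit_coset_def ux image_image fract_act_mult[OF g] ..
    also have "\<phi> ` (\<phi> -` units_in x) = units_in x"
      using bij_fract_act[OF g] by (intro surj_image_vimage_eq bij_is_surj)
    also have "\<phi> (f * chi (local_char i0 a)) = \<phi> f * chi (local_char i (act a))"
      by (simp add: fract_act_mult[OF g] fract_act_chi[OF g] i0(3))
    also have "(\<lambda>u. \<phi> f * chi (local_char i (act a)) * u) ` units_in x = (prin (\<phi> f) \<otimes>\<^bsub>CG\<^esub> torus_div (act a)) x"
    proof -
      have "torus_div (act a) x = unit_coset (chi (local_char i (act a))) x"
        using toric_tor[OF keys_act[OF a]] i by (simp add: toric_def)
      then have "(prin (\<phi> f) \<otimes>\<^bsub>CG\<^esub> torus_div (act a)) x = unit_coset (\<phi> f * chi (local_char i (act a))) x"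
        using True by (intro CG_mult_apply) (simp_all add: prin_def)
      then show ?thesis by (simp add: unit_coset_def)
    qed
    finally show ?thesis .
  qed (simp add: cartier_act_def CG_simps)
qed

theorem pic_act_cls:
  assumes a: "Poly_Mapping.keys a \<subseteq> R"
  shows "pic_act X \<phi> (cls a) = cls (act a)"
proof -
  have coset: "cls a = {prin f \<otimes>\<^bsub>CG\<^esub> torus_div a | f. f \<in> K \<and> f \<noteq> 0}" for a
    unfolding cls_torus_div principal_divisors_prin r_coset_def by blast
  have "pic_act X \<phi> (cls a) = {prin (\<phi> f) \<otimes>\<^bsub>CG\<^esub> torus_div (act a) | f. f \<in> K \<and> f \<noteq> 0}"
    unfolding pic_act_def coset using cartier_act_toric[OF a] by (auto simp: image_iff) metis
  also have "\<dots> = {prin f \<otimes>\<^bsub>CG\<^esub> torus_div (act a) | f. f \<in> K \<and> f \<noteq> 0}"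
  proof (intro equalityI subsetI)
    fix C assume "C \<in> {prin (\<phi> f) \<otimes>\<^bsub>CG\<^esub> torus_div (act a) | f. f \<in> K \<and> f \<noteq> 0}"
    then show "C \<in> {prin f \<otimes>\<^bsub>CG\<^esub> torus_div (act a) | f. f \<in> K \<and> f \<noteq> 0}"
      using \<phi>_K fract_act_eq_0_iff[OF g] by blast
  next
    fix C assume "C \<in> {prin f \<otimes>\<^bsub>CG\<^esub> torus_div (act a) | f. f \<in> K \<and> f \<noteq> 0}"
    then obtain f where f: "C = prin f \<otimes>\<^bsub>CG\<^esub> torus_div (act a)" "f \<in> K" "f \<noteq> 0" by blast
    then obtain f' where "f' \<in> K" "f = \<phi> f'" using \<phi>_K by blast
    moreover from this have "f' \<noteq> 0" using f(3) fract_act_0[OF g] by auto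
    ultimately show "C \<in> {prin (\<phi> f) \<otimes>\<^bsub>CG\<^esub> torus_div (act a) | f. f \<in> K \<and> f \<noteq> 0}" using f(1) by blast
  qed
  also have "\<dots> = cls (act a)" by (rule coset[symmetric])
  finally show ?thesis .
qed

end

end

section \<open>Root systems and Weyl chambers\<close>

lemma adjoint_inv_pairing:
  fixes g :: "'a::euclidean_space \<Rightarrow> 'a"
  assumes "linear g" "bij g"
  shows "g m \<bullet> coact g l = m \<bullet> l"
proof -
  have "linear (inv_into UNIV g)"
    using assms by (simp add: inj_linear_imp_inv_linear bij_is_inj)
  then have "g m \<bullet> coact g l = inv_into UNIV g (g m) \<bullet> l"
    unfolding coact_def by (rule adjoint_works)
  then show ?thesis using assms by (simp add: bij_is_inj)
qed

lemma coact_unique: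
  fixes g :: "'a::euclidean_space \<Rightarrow> 'a"
  assumes "linear g" "bij g" "\<And>m. g m \<bullet> l' = m \<bullet> l"
  shows "coact g l = l'"
proof -
  have "v \<bullet> coact g l = v \<bullet> l'" for v
  proof -
    obtain m where "v = g m" using assms(2) by (metis bij_pointE)
    then show ?thesis using assms adjoint_inv_pairing[OF assms(1,2)] by simp
  qed
  then show ?thesis using vector_eq_ldot by blast
qed

lemma coact_isometry:
  fixes g :: "'a::euclidean_space \<Rightarrow> 'a"
  assumes "linear g" "bij g" "\<And>x y. g x \<bullet> g y = x \<bullet> y"
  shows "coact g = g"
  using coact_unique[OF assms(1,2)] assms(3) by blast

lemma refl_in_simps:
  "refl_in \<beta> (x + y) = refl_in \<beta> x + refl_in \<beta> y" "refl_in \<beta> (c *\<^sub>R x) = c *\<^sub>R refl_in \<beta> x"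
  by (simp_all add: refl_in_def inner_add_left algebra_simps add_divide_distrib)

lemma linear_refl_in: "linear (refl_in \<beta>)"
  by (rule linearI) (simp_all add: refl_in_simps)

lemma refl_in_isometry: "refl_in \<beta> x \<bullet> refl_in \<beta> y = x \<bullet> y"
proof (cases "\<beta> = 0")
  case False
  then show ?thesis
    by (simp add: refl_in_def inner_diff_left inner_diff_right inner_commute field_simps)
qed (simp add: refl_in_def)

lemma refl_in_invol: "refl_in \<beta> (refl_in \<beta> x) = x"
proof (cases "\<beta> = 0")
  case False
  then have "(refl_in \<beta> x \<bullet> \<beta>) = - (x \<bullet> \<beta>)"
    by (simp add: refl_in_def inner_diff_left)
  then show ?thesis
    by (simp add: refl_in_def[of \<beta> "refl_in \<beta> x"]) (simp add: refl_in_def)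
qed (simp add: refl_in_def)

lemma bij_refl_in: "bij (refl_in \<beta>)"
  by (rule involuntory_imp_bij) (rule refl_in_invol)

lemma refl_in_conj:
  assumes "linear g" "\<And>x y. g x \<bullet> g y = x \<bullet> y"
  shows "refl_in (g \<beta>) (g v) = g (refl_in \<beta> v)"
  by (simp add: refl_in_def assms(2) linear_diff[OF assms(1)] linear_cmul[OF assms(1)])

lemma linear_id_euclidean: "linear (id :: 'a::euclidean_space \<Rightarrow> 'a)"
  by (rule linearI) simp_all

lemma refl_in_uminus: "refl_in (- \<beta>) = refl_in \<beta>"
  by (rule ext) (simp add: refl_in_def)

lemma refl_in_self: "\<beta> \<noteq> 0 \<Longrightarrow> refl_in \<beta> \<beta> = - \<beta>"
  by (simp add: refl_in_def algebra_simps scaleR_2)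

locale root_data =
  fixes \<Phi> :: "'a::euclidean_space set" and n :: nat and \<alpha> :: "nat \<Rightarrow> 'a"
  assumes root_system: "root_system \<Phi>" and simple: "simple_roots \<Phi> n \<alpha>"
begin

definition J where "J = {1..n}"
abbreviation \<omega> where "\<omega> \<equiv> fund_coweight n \<alpha>"
abbreviation Aut where "Aut \<equiv> carrier (Aut_roots \<Phi>)"
abbreviation W where "W \<equiv> Weyl_group \<Phi>"
abbreviation s where "s i \<equiv> refl_in (\<alpha> i)"

lemma finite_J [simp]: "finite J" by (simp add: J_def)

lemma rs: "finite \<Phi>" "0 \<notin> \<Phi>" "span \<Phi> = UNIV" "\<beta> \<in> \<Phi> \<Longrightarrow> refl_in \<beta> ` \<Phi> = \<Phi>"
  "\<beta> \<in> \<Phi> \<Longrightarrow> c *\<^sub>R \<beta> \<in> \<Phi> \<Longrightarrow> c = 1 \<or> c = -1"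
  using root_system by (auto simp: root_system_def)

lemma \<alpha>_root: "i \<in> J \<Longrightarrow> \<alpha> i \<in> \<Phi>"
  using simple by (auto simp: simple_roots_def J_def)

lemma inj_\<alpha>: "i \<in> J \<Longrightarrow> j \<in> J \<Longrightarrow> \<alpha> i = \<alpha> j \<longleftrightarrow> i = j"
proof -
  have "inj_on \<alpha> J" using simple by (simp add: simple_roots_def J_def)
  then show "i \<in> J \<Longrightarrow> j \<in> J \<Longrightarrow> \<alpha> i = \<alpha> j \<longleftrightarrow> i = j" by (rule inj_on_eq_iff)
qed

lemma span_\<alpha>: "span (\<alpha> ` J) = UNIV"
proof -
  have "\<Phi> \<subseteq> span (\<alpha> ` J)"
  proof
    fix \<beta> assume "\<beta> \<in> \<Phi>"
    then obtain c :: "nat \<Rightarrow> int"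
      where c: "\<beta> = (\<Sum>i\<in>J. of_int (c i) *\<^sub>R \<alpha> i)"
      using simple unfolding simple_roots_def J_def[symmetric] by metis
    show "\<beta> \<in> span (\<alpha> ` J)"
      unfolding c by (intro span_sum span_scale span_base) auto
  qed
  then show ?thesis using rs(3) by (metis span_minimal subspace_span top.extremum_uniqueI)
qed

lemma \<omega>_exists: "\<exists>!v. \<forall>i\<in>J. \<alpha> i \<bullet> v = (if i = j then 1 else 0)"
proof -
  have ind: "independent (\<alpha> ` J)" using simple by (simp add: simple_roots_def J_def)
  from linear_independent_extend[OF ind, of "\<lambda>x. if \<exists>i\<in>J. x = \<alpha> i \<and> i = j then 1 else (0 :: real)"]
  obtain f :: "'a \<Rightarrow> real"
    where f: "linear f" "\<forall>x\<in>\<alpha> ` J. f x = (if \<exists>i\<in>J. x = \<alpha> i \<and> i = j then 1 else 0)"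
    by blast
  have "\<alpha> i \<bullet> adjoint f 1 = (if i = j then 1 else 0)" if "i \<in> J" for i
    using adjoint_works[OF f(1), of "\<alpha> i" 1] f(2) that inj_\<alpha> by auto
  moreover have "v = v'" if "\<forall>i\<in>J. \<alpha> i \<bullet> v = (if i = j then 1 else 0)" "\<forall>i\<in>J. \<alpha> i \<bullet> v' = (if i = j then 1 else 0)" for v v'
  proof -
    have z: "\<alpha> i \<bullet> (v - v') = 0" if "i \<in> J" for i
      using that \<open>\<forall>i\<in>J. \<alpha> i \<bullet> v = _\<close> \<open>\<forall>i\<in>J. \<alpha> i \<bullet> v' = _\<close> by (simp add: inner_diff_right)
    have "x \<bullet> (v - v') = 0" if "x \<in> span (\<alpha> ` J)" for x
      using that by (induction rule: span_induct_alt) (auto simp: inner_add_left z)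
    then have "(v - v') \<bullet> (v - v') = 0" by (simp add: span_\<alpha>)
    then show ?thesis by simp
  qed
  ultimately show ?thesis by blast
qed

lemma \<omega>_dual: "i \<in> J \<Longrightarrow> \<alpha> i \<bullet> \<omega> j = (if i = j then 1 else 0)"
  using theI'[OF \<omega>_exists[of j]] by (simp add: fund_coweight_def J_def)

lemma \<alpha>_expansion: "v = (\<Sum>i\<in>J. (v \<bullet> \<omega> i) *\<^sub>R \<alpha> i)"
proof -
  have "linear (\<lambda>v. \<Sum>i\<in>J. (v \<bullet> \<omega> i) *\<^sub>R \<alpha> i)"
    by (intro linearI) (simp_all add: inner_add_left scaleR_left_distrib sum.distrib scaleR_sum_right)
  moreover have "(\<Sum>i\<in>J. (x \<bullet> \<omega> i) *\<^sub>R \<alpha> i) = id x"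
    if "x \<in> \<alpha> ` J" for x
  proof -
    obtain k where k: "k \<in> J" "x = \<alpha> k" using \<open>x \<in> \<alpha> ` J\<close> by blast
    then have "(\<Sum>i\<in>J. (x \<bullet> \<omega> i) *\<^sub>R \<alpha> i) = (\<Sum>i\<in>J. if k = i then \<alpha> i else 0)"
      by (intro sum.cong) (auto simp: \<omega>_dual)
    then show ?thesis using k by simp
  qed
  ultimately have "(\<Sum>i\<in>J. (v \<bullet> \<omega> i) *\<^sub>R \<alpha> i) = id v"
    using linear_eq_on_span[OF _ linear_id_euclidean, of "\<lambda>v. \<Sum>i\<in>J. (v \<bullet> \<omega> i) *\<^sub>R \<alpha> i" "\<alpha> ` J" v] span_\<alpha>
    by blast
  then show ?thesis unfolding id_apply by (rule sym)
qed

lemma inner_expansion: "v \<bullet> x = (\<Sum>i\<in>J. (v \<bullet> \<omega> i) * (\<alpha> i \<bullet> x))"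
proof -
  have "v \<bullet> x = (\<Sum>i\<in>J. (v \<bullet> \<omega> i) *\<^sub>R \<alpha> i) \<bullet> x"
    using \<alpha>_expansion[of v] by simp
  then show ?thesis by (simp add: inner_sum_left)
qed

lemma eq_of_\<alpha>: "(\<And>i. i \<in> J \<Longrightarrow> \<alpha> i \<bullet> x = \<alpha> i \<bullet> y) \<Longrightarrow> x = y"
proof -
  assume "\<And>i. i \<in> J \<Longrightarrow> \<alpha> i \<bullet> x = \<alpha> i \<bullet> y"
  then have "v \<bullet> x = v \<bullet> y" for v by (subst (1 2) inner_expansion) simp
  then show "x = y" using vector_eq_ldot by blast
qed

lemma \<omega>_expansion: "v = (\<Sum>j\<in>J. (\<alpha> j \<bullet> v) *\<^sub>R \<omega> j)"
proof (rule eq_of_\<alpha>)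
  fix i assume i: "i \<in> J"
  have "\<alpha> i \<bullet> (\<Sum>j\<in>J. (\<alpha> j \<bullet> v) *\<^sub>R \<omega> j) = (\<Sum>j\<in>J. if i = j then \<alpha> j \<bullet> v else 0)"
    unfolding inner_sum_right using \<omega>_dual[OF i] by (intro sum.cong) auto
  then show "\<alpha> i \<bullet> v = \<alpha> i \<bullet> (\<Sum>j\<in>J. (\<alpha> j \<bullet> v) *\<^sub>R \<omega> j)" using i by simp
qed

lemma inj_\<omega>: "i \<in> J \<Longrightarrow> j \<in> J \<Longrightarrow> \<omega> i = \<omega> j \<Longrightarrow> i = j"
  using \<omega>_dual[of i i] \<omega>_dual[of i j] by (metis zero_neq_one)

definition positive :: "'a \<Rightarrow> bool"
  where "positive \<beta> \<longleftrightarrow> \<beta> \<in> \<Phi> \<and> (\<forall>i\<in>J. 0 \<le> \<beta> \<bullet> \<omega> i)"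

lemma combination_coeff: "k \<in> J \<Longrightarrow> (\<Sum>i\<in>J. c i *\<^sub>R \<alpha> i) \<bullet> \<omega> k = c k"
proof -
  assume k: "k \<in> J"
  have "(\<Sum>i\<in>J. c i *\<^sub>R \<alpha> i) \<bullet> \<omega> k = (\<Sum>i\<in>J. if i = k then c i else 0)"
    unfolding inner_sum_left using \<omega>_dual by (intro sum.cong) auto
  then show ?thesis using k by simp
qed

lemma root_coeffs:
  assumes "\<beta> \<in> \<Phi>"
  shows "i \<in> J \<Longrightarrow> \<beta> \<bullet> \<omega> i \<in> \<int>"
    and "positive \<beta> \<or> positive (- \<beta>)"
proof -
  obtain c :: "nat \<Rightarrow> int" where c: "\<beta> = (\<Sum>i\<in>J. of_int (c i) *\<^sub>R \<alpha> i)"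
    "(\<forall>i\<in>J. 0 \<le> c i) \<or> (\<forall>i\<in>J. c i \<le> 0)"
    using simple assms unfolding simple_roots_def J_def[symmetric] by metis
  have ci: "\<beta> \<bullet> \<omega> i = of_int (c i)" if "i \<in> J" for i
    unfolding c(1) using combination_coeff[OF that] .
  then show "i \<in> J \<Longrightarrow> \<beta> \<bullet> \<omega> i \<in> \<int>" by simp
  have "refl_in \<beta> \<beta> = - \<beta>" using assms rs(2) by (intro refl_in_self) auto
  then have "- \<beta> \<in> \<Phi>" using rs(4)[OF assms] assms by (metis imageI)
  then show "positive \<beta> \<or> positive (- \<beta>)"
    using c(2) ci assms by (auto simp: positive_def)
qed

lemma pos_\<alpha>: "i \<in> J \<Longrightarrow> positive (\<alpha> i)"
  using \<alpha>_root \<omega>_dual by (auto simp: positive_def)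

lemma pos_coeff: "positive \<beta> \<Longrightarrow> \<exists>i\<in>J. 0 < \<beta> \<bullet> \<omega> i"
proof (rule ccontr)
  assume p: "positive \<beta>" and no: "\<not> ?thesis"
  then have "\<beta> \<bullet> \<omega> i = 0" if "i \<in> J" for i using that by (force simp: positive_def)
  then have "\<beta> = 0" using \<alpha>_expansion[of \<beta>] by simp
  then show False using p rs(2) by (simp add: positive_def)
qed

lemma pos_of_coeff: "\<beta> \<in> \<Phi> \<Longrightarrow> i \<in> J \<Longrightarrow> 0 < \<beta> \<bullet> \<omega> i \<Longrightarrow> positive \<beta>"
proof -
  assume *: "\<beta> \<in> \<Phi>" "i \<in> J" "0 < \<beta> \<bullet> \<omega> i"
  then have "\<not> positive (- \<beta>)" unfolding positive_def
    by (metis inner_minus_left neg_0_le_iff_le not_le)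
  then show "positive \<beta>" using root_coeffs(2)[OF *(1)] by blast
qed

lemma not_pos_uminus: "positive \<beta> \<Longrightarrow> \<not> positive (- \<beta>)"
  using pos_coeff[of \<beta>] unfolding positive_def by (metis inner_minus_left neg_0_le_iff_le not_le)

lemma s_\<omega>: "i \<in> J \<Longrightarrow> k \<noteq> i \<Longrightarrow> s i \<beta> \<bullet> \<omega> k = \<beta> \<bullet> \<omega> k"
  by (simp add: refl_in_def inner_diff_left \<omega>_dual)

text \<open>
  Since the root system is reduced, a positive root other than \<open>\<alpha> i\<close> involves a further simple
  root. Its coefficient is positive and is not changed by the reflection.
\<close>

lemma pos_s:
  assumes "positive \<beta>" "i \<in> J" "\<beta> \<noteq> \<alpha> i"
  shows "positive (s i \<beta>)"
proof -
  have \<beta>: "\<beta> \<in> \<Phi>" using assms by (simp add: positive_def)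
  have "\<exists>k\<in>J. k \<noteq> i \<and> 0 < \<beta> \<bullet> \<omega> k"
  proof (rule ccontr)
    assume no: "\<not> ?thesis"
    then have z: "\<beta> \<bullet> \<omega> k = 0" if "k \<in> J" "k \<noteq> i" for k
      using that assms(1) by (force simp: positive_def)
    have "(\<Sum>k\<in>J. (\<beta> \<bullet> \<omega> k) *\<^sub>R \<alpha> k) = (\<Sum>k\<in>J. if k = i then (\<beta> \<bullet> \<omega> i) *\<^sub>R \<alpha> i else 0)"
      using z by (intro sum.cong) auto
    then have b: "\<beta> = (\<beta> \<bullet> \<omega> i) *\<^sub>R \<alpha> i"
      using \<alpha>_expansion[of \<beta>] assms(2) by simp
    then have "\<beta> \<bullet> \<omega> i = 1 \<or> \<beta> \<bullet> \<omega> i = -1"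
      using rs(5)[OF \<alpha>_root[OF assms(2)]] \<beta> by metis
    moreover have "0 \<le> \<beta> \<bullet> \<omega> i" using assms by (simp add: positive_def)
    ultimately have "\<beta> = \<alpha> i" using b by auto
    then show False using assms(3) by simp
  qed
  then obtain k where "k \<in> J" "k \<noteq> i" "0 < \<beta> \<bullet> \<omega> k" by blast
  moreover have "s i \<beta> \<in> \<Phi>" using rs(4)[OF \<alpha>_root[OF assms(2)]] \<beta> by blast
  ultimately show ?thesis using pos_of_coeff s_\<omega>[OF assms(2)] by metis
qed

subsection \<open>Words in simple reflections\<close>

definition word :: "nat list \<Rightarrow> 'a \<Rightarrow> 'a" where "word is = foldr (\<lambda>i. s i) is"

lemma word_simps [simp]: "word [] v = v" "word (i # is) v = s i (word is v)" "word (is @ js) v = word is (word js v)"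
  by (simp_all add: word_def)

lemma word_isometry: "word is x \<bullet> word is y = x \<bullet> y"
  by (induction "is") (auto simp: refl_in_isometry)

lemma word_linear: "linear (word is)"
proof (induction "is")
  case (Cons i "is")
  have "word (i # is) = s i \<circ> word is" by (rule ext) simp
  then show ?case using linear_compose[OF Cons linear_refl_in, of "\<alpha> i"] by (simp only:)
qed (simp add: word_def linear_iff)

lemma word_root: "set is \<subseteq> J \<Longrightarrow> \<beta> \<in> \<Phi> \<Longrightarrow> word is \<beta> \<in> \<Phi>"
  by (induction "is") (use rs(4) \<alpha>_root in auto)

lemma word_rev: "word (rev is) (word is v) = v"
  by (induction "is" arbitrary: v) (auto simp: refl_in_invol)

text \<open>
  Apply the letters of \<open>js\<close> to \<open>\<alpha> t\<close> from right to left. At the letter \<open>i\<close> where the root first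
  becomes negative it was \<open>\<alpha> i\<close>, as \<open>s i\<close> keeps all other positive roots positive. So \<open>s i\<close> is
  the conjugate of \<open>s t\<close> under the letters to the right of \<open>i\<close>, and both letters can be left
  out.
\<close>

lemma deletion:
  assumes "set js \<subseteq> J" "t \<in> J" "positive (- word js (\<alpha> t))"
  shows "\<exists>ks. set ks \<subseteq> J \<and> length ks < length js \<and> (\<forall>v. word js (s t v) = word ks v)"
  using assms
proof (induction js)
  case Nil
  then show ?case using not_pos_uminus[OF pos_\<alpha>[OF Nil(2)]] by simp
next
  case (Cons i js)
  let ?d = "word js (\<alpha> t)"
  have d: "?d \<in> \<Phi>" using Cons.prems by (intro word_root \<alpha>_root) auto
  show ?case
  proof (cases "positive ?d")
    case False
    then have "positive (- ?d)" using root_coeffs(2)[OF d] by blast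
    then obtain ks where ks: "set ks \<subseteq> J" "length ks < length js" "\<forall>v. word js (s t v) = word ks v"
      using Cons by auto
    then show ?thesis using Cons.prems by (intro exI[of _ "i # ks"]) auto
  next
    case True
    have i: "i \<in> J" using Cons.prems by simp
    have "\<not> positive (s i ?d)" using Cons.prems(3) not_pos_uminus by fastforce
    then have "?d = \<alpha> i" using pos_s[OF True i] by blast
    then have "word js (s t v) = s i (word js v)" for v
      using refl_in_conj[OF word_linear word_isometry, of js "\<alpha> t" v] by simp
    then have "word (i # js) (s t v) = word js v" for v by (simp add: refl_in_invol)
    then show ?thesis using Cons.prems by (intro exI[of _ js]) auto
  qed
qed

definition dominant :: "'a \<Rightarrow> bool"
  where "dominant v \<longleftrightarrow> (\<forall>i\<in>J. 0 \<le> \<alpha> i \<bullet> v)"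

lemma dominant_positive: "dominant v \<Longrightarrow> positive \<beta> \<Longrightarrow> 0 \<le> \<beta> \<bullet> v"
  by (subst inner_expansion) (auto simp: dominant_def positive_def intro!: sum_nonneg)

lemma dominant_\<omega>: "dominant (\<omega> j)"
  by (simp add: dominant_def \<omega>_dual)

text \<open>
  Induction on the length of the word. Consider the image of \<open>\<alpha> t\<close> for the last letter \<open>t\<close>. If
  \<open>word js\<close> maps it to a negative root, the word can be shortened. Otherwise the whole word maps
  it to a negative root, and comparing \<open>l\<close> with its dominant image shows that \<open>\<alpha> t\<close> is
  orthogonal to \<open>l\<close>, hence also to \<open>x\<close>, so that this letter acts trivially on both. For \<open>x = l\<close>
  the conclusion is that an orbit contains only one dominant vector.
\<close>

lemma dominant_word_fixed:
  assumes "set is \<subseteq> J" "dominant l" "dominant (word is l)"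
    and x: "\<And>i. i \<in> J \<Longrightarrow> \<alpha> i \<bullet> l = 0 \<Longrightarrow> \<alpha> i \<bullet> x = 0"
  shows "word is x = x"
  using assms(1,3)
proof (induction "length is" arbitrary: "is" rule: less_induct)
  case less
  show ?case
  proof (cases "is" rule: rev_exhaust)
    case (snoc js t)
    have t: "t \<in> J" "set js \<subseteq> J" using less.prems snoc by auto
    let ?g = "word js (\<alpha> t)"
    have g: "?g \<in> \<Phi>" using t by (intro word_root \<alpha>_root)
    show ?thesis
    proof (cases "positive ?g")
      case True
      have "\<alpha> t \<bullet> l = word is (\<alpha> t) \<bullet> word is l" by (simp add: word_isometry)
      also have "word is (\<alpha> t) = - ?g"
      proof -
        have "\<alpha> t \<noteq> 0" using rs(2) \<alpha>_root[OF t(1)] by metis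
        then have "s t (\<alpha> t) = - \<alpha> t" by (rule refl_in_self)
        then show ?thesis using linear_neg[OF word_linear, of js "\<alpha> t"] by (simp add: snoc)
      qed
      finally have "\<alpha> t \<bullet> l \<le> 0" using dominant_positive[OF less.prems(2) True] by simp
      then have z: "\<alpha> t \<bullet> l = 0" using assms(2) t(1) by (force simp: dominant_def)
      then have "s t l = l" "s t x = x" using x[OF t(1)] by (auto simp: refl_in_def inner_commute)
      then have eq: "word is l = word js l" "word is x = word js x" by (simp_all add: snoc)
      have "word js x = x" using less.hyps[of js] less.prems(2) t(2) eq(1) by (simp add: snoc)
      then show ?thesis using eq(2) by simp
    next
      case False
      then have "positive (- ?g)" using root_coeffs(2)[OF g] by blast
      then obtain ks where ks: "set ks \<subseteq> J" "length ks < length js" "\<forall>v. word js (s t v) = word ks v"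
        using deletion[OF t(2,1)] by blast
      then have "word is v = word ks v" for v by (simp add: snoc)
      then show ?thesis using less.hyps[of ks] ks less.prems(2) by (simp add: snoc)
    qed
  qed simp
qed

subsection \<open>The Weyl group\<close>

lemma Aut_iff: "g \<in> Aut \<longleftrightarrow> linear g \<and> bij g \<and> g ` \<Phi> = \<Phi>"
  by (simp add: Aut_roots_def)

lemma Aut_simps: "g \<otimes>\<^bsub>Aut_roots \<Phi>\<^esub> h = g \<circ> h" "\<one>\<^bsub>Aut_roots \<Phi>\<^esub> = id"
  by (simp_all add: Aut_roots_def)

lemma Aut_comp: "g \<in> Aut \<Longrightarrow> h \<in> Aut \<Longrightarrow> g \<circ> h \<in> Aut"
proof -
  assume gh: "g \<in> Aut" "h \<in> Aut"
  have "(g \<circ> h) ` \<Phi> = g ` (h ` \<Phi>)" by (rule image_comp[symmetric])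
  then show "g \<circ> h \<in> Aut" using gh
    by (simp add: Aut_iff linear_compose bij_comp del: o_apply image_comp)
qed

lemma Aut_inv_into:
  assumes "g \<in> Aut" shows "inv_into UNIV g \<in> Aut"
proof -
  have "inv_into UNIV g ` \<Phi> = inv_into UNIV g ` g ` \<Phi>" using assms by (simp add: Aut_iff)
  also have "\<dots> = \<Phi>" using assms unfolding Aut_iff by (intro image_inv_f_f) (simp add: bij_is_inj)
  finally have "inv_into UNIV g ` \<Phi> = \<Phi>" .
  then show ?thesis
    using assms by (simp add: Aut_iff bij_imp_bij_inv inj_linear_imp_inv_linear bij_is_inj)
qed

lemma Aut_inv_cancel:
  assumes "g \<in> Aut"
  shows "inv_into UNIV g \<circ> g = id" "g \<circ> inv_into UNIV g = id"
proof -
  have "bij g" using assms by (simp add: Aut_iff)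
  then show "inv_into UNIV g \<circ> g = id" "g \<circ> inv_into UNIV g = id"
    by (simp_all add: bij_is_inj bij_is_surj surj_iff[symmetric])
qed

lemma group_Aut: "group (Aut_roots \<Phi>)"
proof (rule groupI)
  show "\<one>\<^bsub>Aut_roots \<Phi>\<^esub> \<in> Aut"
    by (simp add: Aut_simps) (simp add: Aut_iff linear_id_euclidean)
  fix g assume g: "g \<in> Aut"
  show "\<exists>h\<in>Aut. h \<otimes>\<^bsub>Aut_roots \<Phi>\<^esub> g = \<one>\<^bsub>Aut_roots \<Phi>\<^esub>"
    using Aut_inv_into[OF g] Aut_inv_cancel(1)[OF g] by (auto simp: Aut_simps)
qed (auto simp: Aut_simps Aut_comp comp_assoc)

lemma Aut_id: "id \<in> Aut"
  using group.is_monoid[OF group_Aut, THEN monoid.one_closed] by (simp add: Aut_simps)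

lemma Aut_inv: "g \<in> Aut \<Longrightarrow> inv\<^bsub>Aut_roots \<Phi>\<^esub> g = inv_into UNIV g"
  by (intro group.inv_equality[OF group_Aut]) (auto simp: Aut_simps Aut_inv_cancel Aut_inv_into)

lemma finite_Aut: "finite Aut"
proof (rule inj_on_finite)
  show "inj_on (\<lambda>g. restrict g \<Phi>) Aut"
  proof (rule inj_onI)
    fix g h assume gh: "g \<in> Aut" "h \<in> Aut" "restrict g \<Phi> = restrict h \<Phi>"
    then have "g x = h x" if "x \<in> \<Phi>" for x using that by (metis restrict_apply')
    then have "g x = h x" for x
      using linear_eq_on_span[of g h \<Phi> x] gh by (simp add: Aut_iff rs(3))
    then show "g = h" by blast
  qed
  show "(\<lambda>g. restrict g \<Phi>) ` Aut \<subseteq> \<Phi> \<rightarrow>\<^sub>E \<Phi>"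
    using Aut_iff by fastforce
  show "finite (\<Phi> \<rightarrow>\<^sub>E \<Phi>)" using rs(1) by (intro finite_PiE) auto
qed

lemma refl_Aut: "\<beta> \<in> \<Phi> \<Longrightarrow> refl_in \<beta> \<in> Aut"
  by (simp add: Aut_iff linear_refl_in bij_refl_in rs(4))

lemma W_Aut: "w \<in> W \<Longrightarrow> w \<in> Aut"
  using group.generate_in_carrier[OF group_Aut] refl_Aut unfolding Weyl_group_def by blast

lemma W_comp: "w \<in> W \<Longrightarrow> w' \<in> W \<Longrightarrow> w \<circ> w' \<in> W"
  unfolding Weyl_group_def using generate.eng[of w "Aut_roots \<Phi>" _ w'] by (simp add: Aut_simps)

lemma W_id: "id \<in> W"
  unfolding Weyl_group_def using generate.one[of "Aut_roots \<Phi>"] by (simp add: Aut_simps)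

lemma W_refl: "\<beta> \<in> \<Phi> \<Longrightarrow> refl_in \<beta> \<in> W"
  unfolding Weyl_group_def by (intro generate.incl) auto

lemma W_inv: "w \<in> W \<Longrightarrow> inv_into UNIV w \<in> W"
  using group.generate_m_inv_closed[OF group_Aut] refl_Aut W_Aut Aut_inv unfolding Weyl_group_def
  by (metis image_subsetI)

text \<open>
  A positive root has a positive inner product with one of the simple roots that it involves;
  unless it is itself simple, reflecting in this simple root lowers its height and keeps it
  positive.
\<close>

lemma simple_conjugate:
  assumes "positive \<beta>"
    shows "\<exists>is. set is \<subseteq> J \<and> (\<exists>k\<in>J. word is \<beta> = \<alpha> k)"
  using assms
proof (induction "nat \<lfloor>\<Sum>k\<in>J. \<beta> \<bullet> \<omega> k\<rfloor>" arbitrary: \<beta> rule: less_induct)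
  case less
  have \<beta>: "\<beta> \<in> \<Phi>" using less.prems by (simp add: positive_def)
  show ?case
  proof (cases "\<beta> \<in> \<alpha> ` J")
    case True
    then show ?thesis by (intro exI[of _ "[]"]) auto
  next
    case False
    have "0 < \<beta> \<bullet> \<beta>" using \<beta> rs(2) by auto
    then have "\<exists>i\<in>J. 0 < (\<beta> \<bullet> \<omega> i) * (\<alpha> i \<bullet> \<beta>)"
      unfolding inner_expansion[of \<beta> \<beta>] by (meson not_le sum_nonpos)
    then obtain i where i: "i \<in> J" "0 < \<alpha> i \<bullet> \<beta>"
      using less.prems by (auto simp: positive_def zero_less_mult_iff)
    define c where "c = 2 * (\<beta> \<bullet> \<alpha> i) / (\<alpha> i \<bullet> \<alpha> i)"
    have "0 < \<alpha> i \<bullet> \<alpha> i" using \<alpha>_root[OF i(1)] rs(2) by auto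
    then have c: "0 < c" using i(2) by (simp add: c_def inner_commute)
    have sb: "s i \<beta> = \<beta> - c *\<^sub>R \<alpha> i" by (simp add: refl_in_def c_def)
    have ps: "positive (s i \<beta>)" using pos_s[OF less.prems i(1)] False i(1) by blast
    have ht: "(\<Sum>k\<in>J. s i \<beta> \<bullet> \<omega> k) = (\<Sum>k\<in>J. \<beta> \<bullet> \<omega> k) - c"
      using i(1) by (simp add: sb inner_diff_left sum_subtractf \<omega>_dual sum_distrib_left[symmetric])
    have int: "(\<Sum>k\<in>J. \<gamma> \<bullet> \<omega> k) \<in> \<int>" "0 \<le> (\<Sum>k\<in>J. \<gamma> \<bullet> \<omega> k)" if "positive \<gamma>" for \<gamma>
      using that root_coeffs(1)[of \<gamma>] by (auto simp: positive_def intro!: Ints_sum sum_nonneg)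
    have "nat \<lfloor>\<Sum>k\<in>J. s i \<beta> \<bullet> \<omega> k\<rfloor> < nat \<lfloor>\<Sum>k\<in>J. \<beta> \<bullet> \<omega> k\<rfloor>"
    proof -
      obtain a where a: "(\<Sum>k\<in>J. s i \<beta> \<bullet> \<omega> k) = of_int a" using int(1)[OF ps]
        by (rule Ints_cases)
      obtain a' where a': "(\<Sum>k\<in>J. \<beta> \<bullet> \<omega> k) = of_int a'"
        using int(1)[OF less.prems] by (rule Ints_cases)
      have "of_int a < (of_int a' :: real)" "0 \<le> (of_int a :: real)"
        using ht c int(2)[OF ps] unfolding a a' by simp_all
      then show ?thesis unfolding a a' by simp
    qed
    then obtain "is" k where "set is \<subseteq> J" "k \<in> J" "word is (s i \<beta>) = \<alpha> k"
      using less.hyps[OF _ ps] by blast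
    then show ?thesis using i(1) by (intro exI[of _ "is @ [i]"]) auto
  qed
qed

lemma refl_word:
  assumes "\<beta> \<in> \<Phi>" shows "\<exists>is. set is \<subseteq> J \<and> refl_in \<beta> = word is"
proof -
  have "\<exists>is. set is \<subseteq> J \<and> refl_in \<beta> = word is" if p: "positive \<beta>"
    for \<beta>
  proof -
    obtain "is" k where k: "set is \<subseteq> J" "k \<in> J" "word is \<beta> = \<alpha> k"
      using simple_conjugate[OF p] by blast
    have "refl_in \<beta> v = word (rev is @ [k] @ is) v" for v
    proof -
      have "word is (refl_in \<beta> v) = s k (word is v)"
        using refl_in_conj[OF word_linear word_isometry, of "is" \<beta> v] k(3) by simp
      then have "word (rev is) (s k (word is v)) = word (rev is) (word is (refl_in \<beta> v))" by simp
      then show ?thesis by (simp add: word_rev)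
    qed
    then show ?thesis using k(1,2) by (intro exI[of _ "rev is @ [k] @ is"]) auto
  qed
  then show ?thesis using root_coeffs(2)[OF assms] refl_in_uminus[of \<beta>] by metis
qed

lemma W_word: "w \<in> W \<Longrightarrow> \<exists>is. set is \<subseteq> J \<and> w = word is"
  unfolding Weyl_group_def
proof (induction rule: generate.induct)
  case one
  show ?case by (intro exI[of _ "[]"]) (auto simp: Aut_simps word_def)
next
  case (incl h)
  then show ?case using refl_word by auto
next
  case (inv h)
  then obtain \<beta> where \<beta>: "\<beta> \<in> \<Phi>" "h = refl_in \<beta>" by auto
  have "inv\<^bsub>Aut_roots \<Phi>\<^esub> h = h"
  proof (rule group.inv_equality[OF group_Aut])
    show "h \<otimes>\<^bsub>Aut_roots \<Phi>\<^esub> h = \<one>\<^bsub>Aut_roots \<Phi>\<^esub>"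
      unfolding Aut_simps \<beta>(2) by (rule ext) (simp add: refl_in_invol)
  qed (use \<beta> refl_Aut in simp)+
  then show ?case using refl_word \<beta> by simp
next
  case (eng h1 h2)
  then obtain is1 is2 where "set is1 \<subseteq> J" "h1 = word is1" "set is2 \<subseteq> J" "h2 = word is2" by blast
  then show ?case by (intro exI[of _ "is1 @ is2"]) (auto simp: Aut_simps)
qed

lemma W_isometry: "w \<in> W \<Longrightarrow> w x \<bullet> w y = x \<bullet> y"
  using W_word word_isometry by metis

lemma coact_W: "w \<in> W \<Longrightarrow> coact w = w"
  using W_Aut W_isometry by (intro coact_isometry) (auto simp: Aut_iff)

lemma dominant_fixed:
  assumes "w \<in> W" "dominant l" "dominant (w l)" "\<And>i. i \<in> J \<Longrightarrow> \<alpha> i \<bullet> l = 0 \<Longrightarrow> \<alpha> i \<bullet> x = 0"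
  shows "w x = x"
  using W_word[OF assms(1)] dominant_word_fixed[OF _ assms(2)] assms(3,4) by blast

lemma coact_Aut:
  assumes "g \<in> Aut"
  shows "g m \<bullet> coact g l = m \<bullet> l"
  using assms by (simp add: Aut_iff adjoint_inv_pairing)

lemma coact_comp: "g \<in> Aut \<Longrightarrow> h \<in> Aut \<Longrightarrow> coact (g \<circ> h) l = coact g (coact h l)"
  using Aut_comp[of g h] by (intro coact_unique) (auto simp: Aut_iff[of "g \<circ> h"] coact_Aut)

lemma coact_id: "coact id l = l"
  using linear_id_euclidean bij_id by (rule coact_unique) simp

lemma coact_inv: "g \<in> Aut \<Longrightarrow> coact (inv_into UNIV g) (coact g l) = l" "g \<in> Aut \<Longrightarrow> coact g (coact (inv_into UNIV g) l) = l"
  using coact_comp[of "inv_into UNIV g" g l] coact_comp[of g "inv_into UNIV g" l] Aut_inv_into Aut_inv_cancel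
  by (auto simp: coact_id)

lemma inj_coact: "g \<in> Aut \<Longrightarrow> inj (coact g)"
  using coact_inv(1) by (intro injI) metis

lemma linear_coact: "g \<in> Aut \<Longrightarrow> linear (coact g)"
  unfolding coact_def by (intro adjoint_linear) (use Aut_inv_into in \<open>auto simp: Aut_iff\<close>)

definition \<rho> where "\<rho> = (\<Sum>j\<in>J. \<omega> j)"

lemma \<alpha>_\<rho>: "i \<in> J \<Longrightarrow> \<alpha> i \<bullet> \<rho> = 1"
  by (simp add: \<rho>_def inner_sum_right \<omega>_dual)

lemma pos_\<rho>: "positive \<beta> \<Longrightarrow> 1 \<le> \<beta> \<bullet> \<rho>"
proof -
  assume p: "positive \<beta>"
  obtain i where i: "i \<in> J" "0 < \<beta> \<bullet> \<omega> i" using pos_coeff[OF p] by blast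
  then have "1 \<le> \<beta> \<bullet> \<omega> i" using root_coeffs(1)[of \<beta> i] p
    by (auto simp: positive_def elim!: Ints_cases)
  also have "\<beta> \<bullet> \<omega> i \<le> (\<Sum>j\<in>J. \<beta> \<bullet> \<omega> j)"
    using p i(1) by (intro member_le_sum) (auto simp: positive_def)
  finally show "1 \<le> \<beta> \<bullet> \<rho>" by (simp add: \<rho>_def inner_sum_right)
qed

text \<open>
  An element of the orbit with the greatest pairing with \<open>\<rho>\<close> is dominant, because a simple
  reflection at a negative pairing would increase it.
\<close>

lemma dominant_conjugate: "\<exists>w\<in>W. dominant (w v)"
proof -
  have fin: "finite W" using finite_Aut W_Aut by (meson finite_subset subsetI)
  have "Max ((\<lambda>w. w v \<bullet> \<rho>) ` W) \<in> (\<lambda>w. w v \<bullet> \<rho>) ` W"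
    using fin W_id by (intro Max_in) auto
  then obtain w where w: "w \<in> W" "w v \<bullet> \<rho> = Max ((\<lambda>w. w v \<bullet> \<rho>) ` W)"
    by auto
  have max: "w' v \<bullet> \<rho> \<le> w v \<bullet> \<rho>" if "w' \<in> W" for w'
    unfolding w(2) using fin that by (intro Max_ge) auto
  have "0 \<le> \<alpha> i \<bullet> w v" if i: "i \<in> J" for i
  proof (rule ccontr)
    assume neg: "\<not> ?thesis"
    have "0 < \<alpha> i \<bullet> \<alpha> i" using \<alpha>_root[OF i] rs(2) by auto
    then have "2 * (w v \<bullet> \<alpha> i) / (\<alpha> i \<bullet> \<alpha> i) < 0" using neg
      by (simp add: inner_commute divide_neg_pos)
    then have "w v \<bullet> \<rho> < s i (w v) \<bullet> \<rho>"
      by (simp add: refl_in_def inner_diff_left \<alpha>_\<rho>[OF i])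
    then show False using max[OF W_comp[OF W_refl[OF \<alpha>_root[OF i]] w(1)]] by simp
  qed
  then show ?thesis using w(1) by (auto simp: dominant_def)
qed

subsection \<open>Automorphisms permute the chambers\<close>

text \<open>
  The automorphism permutes the positive roots. Expanding \<open>u (\<alpha> i)\<close> in simple roots and applying
  the inverse of \<open>u\<close> writes \<open>\<alpha> i\<close>, which has height 1, as a sum of positive roots; so there is
  only one summand.
\<close>

lemma positive_automorphism:
  assumes u: "u \<in> Aut" and positive: "\<And>i. i \<in> J \<Longrightarrow> positive (u (\<alpha> i))"
  obtains p where "\<And>i. i \<in> J \<Longrightarrow> p i \<in> J \<and> u (\<alpha> i) = \<alpha> (p i)"
proof -
  let ?P = "{\<beta>. positive \<beta>}" and ?v = "inv_into UNIV u"
  have lin: "linear u" "bij u" "u ` \<Phi> = \<Phi>" using u by (auto simp: Aut_iff)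
  have "u \<beta> \<in> ?P" if "positive \<beta>" for \<beta>
  proof -
    have "u \<beta> = (\<Sum>i\<in>J. (\<beta> \<bullet> \<omega> i) *\<^sub>R u (\<alpha> i))"
      using arg_cong[OF \<alpha>_expansion[of \<beta>], of u]
      by (simp add: linear_sum[OF lin(1)] linear_cmul[OF lin(1)])
    then have "u \<beta> \<bullet> \<omega> k = (\<Sum>i\<in>J. (\<beta> \<bullet> \<omega> i) * (u (\<alpha> i) \<bullet> \<omega> k))" for k
      by (simp add: inner_sum_left)
    moreover have "0 \<le> (\<Sum>i\<in>J. (\<beta> \<bullet> \<omega> i) * (u (\<alpha> i) \<bullet> \<omega> k))" if "k \<in> J" for k
      using that \<open>positive \<beta>\<close> positive by (intro sum_nonneg) (auto simp: positive_def)
    moreover have "u \<beta> \<in> \<Phi>" using lin(3) \<open>positive \<beta>\<close>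
      by (auto simp: positive_def)
    ultimately show ?thesis by (simp add: positive_def)
  qed
  moreover have "finite ?P" using rs(1) by (auto simp: positive_def intro: finite_subset)
  ultimately have "u ` ?P = ?P"
    using lin(2) by (intro endo_inj_surj) (auto intro: inj_on_subset bij_is_inj)
  then have vP: "positive (?v \<beta>)" if "positive \<beta>" for \<beta>
    using that lin(2) by (metis (mono_tags, lifting) bij_is_inj imageE inv_f_f mem_Collect_eq)
  have vlin: "linear ?v" using Aut_inv_into[OF u] by (simp add: Aut_iff)
  have "\<exists>k\<in>J. u (\<alpha> i) = \<alpha> k" if i: "i \<in> J" for i
  proof -
    let ?c = "\<lambda>k. u (\<alpha> i) \<bullet> \<omega> k"
    have c0: "0 \<le> ?c k" "?c k \<in> \<int>" if "k \<in> J" for k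
      using positive[OF i] that root_coeffs(1)[of "u (\<alpha> i)" k] by (auto simp: positive_def)
    have "\<alpha> i = ?v (u (\<alpha> i))" using lin(2) by (simp add: bij_is_inj)
    also have "\<dots> = (\<Sum>k\<in>J. ?c k *\<^sub>R ?v (\<alpha> k))"
      using arg_cong[OF \<alpha>_expansion[of "u (\<alpha> i)"], of ?v]
      by (simp add: linear_sum[OF vlin] linear_cmul[OF vlin])
    finally have "\<alpha> i \<bullet> \<rho> = (\<Sum>k\<in>J. ?c k *\<^sub>R ?v (\<alpha> k)) \<bullet> \<rho>" by (rule arg_cong)
    then have "\<alpha> i \<bullet> \<rho> = (\<Sum>k\<in>J. ?c k * (?v (\<alpha> k) \<bullet> \<rho>))"
      by (simp add: inner_sum_left)
    moreover have "(\<Sum>k\<in>J. ?c k * (?v (\<alpha> k) \<bullet> \<rho>)) \<ge> (\<Sum>k\<in>J. ?c k)"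
    proof (rule sum_mono)
      fix k assume k: "k \<in> J"
      show "?c k \<le> ?c k * (?v (\<alpha> k) \<bullet> \<rho>)"
        using mult_left_mono[OF pos_\<rho>[OF vP[OF pos_\<alpha>[OF k]]] c0(1)[OF k]] by simp
    qed
    ultimately have le1: "(\<Sum>k\<in>J. ?c k) \<le> 1" using \<alpha>_\<rho>[OF i] by simp
    obtain k where k: "k \<in> J" "0 < ?c k" using pos_coeff[OF positive[OF i]] by blast
    then have "1 \<le> ?c k" using c0(2)[OF k(1)] by (auto elim!: Ints_cases)
    moreover have "(\<Sum>k\<in>J. ?c k) = ?c k + (\<Sum>j\<in>J - {k}. ?c j)" using k(1)
      by (intro sum.remove) auto
    moreover have "0 \<le> (\<Sum>j\<in>J - {k}. ?c j)" using c0(1) by (intro sum_nonneg) auto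
    ultimately have ck: "?c k = 1" "(\<Sum>j\<in>J - {k}. ?c j) = 0" using le1 by auto
    then have "?c j = 0" if "j \<in> J - {k}" for j
      using sum_nonneg_eq_0_iff[of "J - {k}" ?c] c0(1) that by auto
    then have "(\<Sum>j\<in>J. ?c j *\<^sub>R \<alpha> j) = (\<Sum>j\<in>J. if j = k then \<alpha> k else 0)"
      using ck(1) by (intro sum.cong) auto
    then have "u (\<alpha> i) = \<alpha> k" using \<alpha>_expansion[of "u (\<alpha> i)"] k(1) by simp
    then show ?thesis using k(1) by blast
  qed
  then show ?thesis using that by metis
qed

text \<open>
  Choose a Weyl group element that maps the image of \<open>\<rho>\<close> under \<open>g\<close> to a dominant vector. Its
  product with \<open>g\<close> maps the simple roots to positive roots, so it permutes the simple roots.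
\<close>

lemma Aut_decomposition:
  assumes g: "g \<in> Aut"
  obtains w p where "w \<in> W" "bij_betw p J J" "\<And>i. i \<in> J \<Longrightarrow> g (\<alpha> i) = w (\<alpha> (p i))"
    "\<And>j. j \<in> J \<Longrightarrow> coact g (\<omega> j) = w (\<omega> (p j))"
proof -
  obtain w where w: "w \<in> W" "dominant (w (coact g \<rho>))" using dominant_conjugate by blast
  let ?u = "w \<circ> g"
  have u: "?u \<in> Aut" using Aut_comp[OF W_Aut[OF w(1)] g] .
  have cu: "coact ?u l = w (coact g l)" for l
    using coact_comp[OF W_Aut[OF w(1)] g] coact_W[OF w(1)] by simp
  have "positive (?u (\<alpha> i))" if i: "i \<in> J" for i
  proof (rule ccontr)
    assume "\<not> positive (?u (\<alpha> i))"
    moreover have "?u (\<alpha> i) \<in> \<Phi>" using u \<alpha>_root[OF i] by (auto simp: Aut_iff)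
    ultimately have "positive (- ?u (\<alpha> i))" using root_coeffs(2) by blast
    then have "0 \<le> - ?u (\<alpha> i) \<bullet> coact ?u \<rho>" using dominant_positive w(2) cu by metis
    then show False using coact_Aut[OF u, of "\<alpha> i" \<rho>] \<alpha>_\<rho>[OF i] by simp
  qed
  then obtain p where p: "\<And>i. i \<in> J \<Longrightarrow> p i \<in> J \<and> ?u (\<alpha> i) = \<alpha> (p i)"
    using positive_automorphism[OF u] by blast
  have uinj: "inj ?u" using u by (simp add: Aut_iff bij_is_inj)
  have inj: "inj_on p J"
    using p inj_\<alpha> inj_eq[OF uinj] by (intro inj_onI) metis
  have bij: "bij_betw p J J"
    using inj endo_inj_surj[OF finite_J _ inj] p by (simp add: bij_betw_def image_subset_iff)
  let ?w = "inv_into UNIV w"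
  have wb: "bij w" using W_Aut[OF w(1)] by (simp add: Aut_iff)
  have *: "x = ?w (w x)" for x using wb by (simp add: bij_is_inj)
  have "coact ?u (\<omega> j) = \<omega> (p j)" if j: "j \<in> J" for j
  proof (rule eq_of_\<alpha>)
    fix k assume "k \<in> J"
    then obtain i where i: "i \<in> J" "k = p i" using bij by (auto simp: bij_betw_def)
    then have "\<alpha> k \<bullet> coact ?u (\<omega> j) = \<alpha> i \<bullet> \<omega> j"
      using p coact_Aut[OF u, of "\<alpha> i"] by auto
    also have "\<dots> = \<alpha> k \<bullet> \<omega> (p j)"
      using i j \<open>k \<in> J\<close> inj by (auto simp: \<omega>_dual dest: inj_onD)
    finally show "\<alpha> k \<bullet> coact ?u (\<omega> j) = \<alpha> k \<bullet> \<omega> (p j)" .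
  qed
  then have "coact g (\<omega> j) = ?w (\<omega> (p j))" if "j \<in> J" for j
    using cu * that by metis
  moreover have "g (\<alpha> i) = ?w (\<alpha> (p i))" if "i \<in> J" for i
    using p[OF that] * by (metis comp_apply)
  ultimately show ?thesis using that[OF W_inv[OF w(1)] bij] by blast
qed

definition rays :: "'a set" where "rays = (\<Union>h\<in>Aut. (\<lambda>j. coact h (\<omega> j)) ` J)"

lemma ray_generators_rays: "ray_generators \<Phi> n \<alpha> = rays"
proof
  show "ray_generators \<Phi> n \<alpha> \<subseteq> rays"
  proof
    fix l assume "l \<in> ray_generators \<Phi> n \<alpha>"
    then obtain j w where "j \<in> J" "w \<in> W" "l = coact w (\<omega> j)"
      unfolding ray_generators_def coweight_orbit_def J_def by blast
    then show "l \<in> rays" unfolding rays_def using W_Aut by blast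
  qed
  show "rays \<subseteq> ray_generators \<Phi> n \<alpha>"
  proof
    fix l assume "l \<in> rays"
    then obtain h j where h: "h \<in> Aut" "j \<in> J" "l = coact h (\<omega> j)" by (auto simp: rays_def)
    obtain w p where wp: "w \<in> W" "bij_betw p J J" "\<And>j. j \<in> J \<Longrightarrow> coact h (\<omega> j) = w (\<omega> (p j))"
      using Aut_decomposition[OF h(1)] by metis
    then have "l = coact w (\<omega> (p j))" "p j \<in> J" using h coact_W by (auto simp: bij_betw_def)
    then show "l \<in> ray_generators \<Phi> n \<alpha>"
      using wp(1) unfolding ray_generators_def coweight_orbit_def J_def by blast
  qed
qed

lemma finite_rays: "finite rays"
  unfolding rays_def using finite_Aut by auto

text \<open>
  The fundamental coweights are dominant, and an orbit contains only one dominant vector.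
\<close>

lemma coweight_orbits_disjoint:
  assumes "i \<in> J" "j \<in> J" "i \<noteq> j"
  shows "coweight_orbit \<Phi> n \<alpha> i \<inter> coweight_orbit \<Phi> n \<alpha> j = {}"
proof (rule ccontr)
  assume "\<not> ?thesis"
  then obtain w w' where ww: "w \<in> W" "w' \<in> W" "w (\<omega> i) = w' (\<omega> j)"
    using coact_W unfolding coweight_orbit_def by auto
  let ?v = "inv_into UNIV w' \<circ> w"
  have v: "?v \<in> W" using W_comp[OF W_inv[OF ww(2)] ww(1)] .
  have "?v (\<omega> i) = \<omega> j"
    using ww W_Aut[OF ww(2)] by (simp add: Aut_iff bij_is_inj)
  moreover from this have "?v (\<omega> i) = \<omega> i"
    using dominant_fixed[OF v dominant_\<omega>] dominant_\<omega> by metis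
  ultimately show False using inj_\<omega> assms by metis
qed

text \<open>
  After translation by \<open>h\<close>, the ray is a dominant vector in the Weyl orbit of a fundamental
  coweight, hence equal to it.
\<close>

lemma ray_in_chamber:
  assumes h: "h \<in> Aut" "h' \<in> Aut" and k: "k \<in> J"
    and nonneg: "\<And>j. j \<in> J \<Longrightarrow> 0 \<le> h (\<alpha> j) \<bullet> coact h' (\<omega> k)"
  shows "coact h' (\<omega> k) \<in> (\<lambda>j. coact h (\<omega> j)) ` J"
proof -
  let ?g = "inv_into UNIV h \<circ> h'"
  have g: "?g \<in> Aut" using Aut_comp[OF Aut_inv_into[OF h(1)] h(2)] .
  have eq: "coact h' (\<omega> k) = coact h (coact ?g (\<omega> k))"
    using coact_comp[OF Aut_inv_into[OF h(1)] h(2)] coact_inv(2)[OF h(1)] by metis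
  then have dg: "dominant (coact ?g (\<omega> k))"
    using nonneg coact_Aut[OF h(1)] by (simp add: dominant_def)
  obtain w p where wp: "w \<in> W" "bij_betw p J J" "\<And>j. j \<in> J \<Longrightarrow> coact ?g (\<omega> j) = w (\<omega> (p j))"
    using Aut_decomposition[OF g] by metis
  then have "w (\<omega> (p k)) = \<omega> (p k)"
    using dominant_fixed[OF wp(1) dominant_\<omega>, of "p k" "\<omega> (p k)"] dg k by metis
  then have "coact h' (\<omega> k) = coact h (\<omega> (p k))" using eq wp(3)[OF k] by simp
  moreover have "p k \<in> J" using wp(2) k by (auto simp: bij_betw_def)
  ultimately show ?thesis by blast
qed

text \<open>
  Write \<open>l\<close> as a combination of the generators \<open>e j\<close> of a chamber that contains it, and let \<open>a\<close>
  be the coefficients. An automorphism \<open>g\<close> that fixes \<open>l\<close> permutes the generators with nonzero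
  coefficients, and preserves the coefficients: after translation to the dominant chamber, \<open>g\<close>
  is \<open>w\<close> times a permutation of the coweights; the permutation maps the dominant vector to a
  dominant vector in the same orbit, hence to itself, and \<open>w\<close> then fixes this vector together
  with every fundamental coweight that occurs in it.
\<close>

lemma invariant_lift:
  assumes l: "\<And>i. i \<in> J \<Longrightarrow> \<alpha> i \<bullet> l \<in> \<int>"
    and H: "H \<subseteq> Aut" "\<And>g. g \<in> H \<Longrightarrow> inv_into UNIV g \<in> H" "\<And>g. g \<in> H \<Longrightarrow> coact g l = l"
  obtains a :: "'a \<Rightarrow> int"
    where "\<And>x. x \<notin> rays \<Longrightarrow> a x = 0" "\<And>g x. g \<in> H \<Longrightarrow> a (coact g x) = a x"
    "\<And>m. m \<bullet> l = (\<Sum>x\<in>rays. of_int (a x) * (m \<bullet> x))"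
proof -
  obtain v where v: "v \<in> W" "dominant (v l)" using dominant_conjugate by blast
  let ?h = "inv_into UNIV v"
  have h: "?h \<in> Aut" using W_Aut[OF W_inv[OF v(1)]] .
  define l0 where "l0 = v l"
  have lh: "coact ?h l0 = l" using coact_inv(1)[OF W_Aut[OF v(1)], of l] coact_W[OF v(1)]
    by (simp add: l0_def)
  have lW: "\<beta> \<bullet> l \<in> \<int>" if "\<beta> \<in> \<Phi>" for \<beta>
    using that root_coeffs(1) l by (subst inner_expansion) (intro Ints_sum Ints_mult)
  have int: "\<alpha> j \<bullet> l0 \<in> \<int>" if "j \<in> J" for j
  proof -
    have "\<alpha> j \<bullet> l0 = ?h (\<alpha> j) \<bullet> l"
      using coact_Aut[OF h, of "\<alpha> j" l0] lh by simp
    moreover have "?h (\<alpha> j) \<in> \<Phi>" using h \<alpha>_root[OF that] by (auto simp: Aut_iff)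
    ultimately show ?thesis using lW by simp
  qed
  define e where "e j = coact ?h (\<omega> j)" for j
  have einj: "inj_on e J" using inj_coact[OF h] inj_\<omega> by (auto simp: inj_on_def e_def dest: injD)
  define a where "a x = (\<Sum>j\<in>J. if e j = x then \<lfloor>\<alpha> j \<bullet> l0\<rfloor> else 0)"
    for x
  have ae: "a (e j) = \<lfloor>\<alpha> j \<bullet> l0\<rfloor>" if "j \<in> J" for j
  proof -
    have "a (e j) = (\<Sum>k\<in>J. if k = j then \<lfloor>\<alpha> k \<bullet> l0\<rfloor> else 0)"
      unfolding a_def using einj that by (intro sum.cong) (auto dest: inj_onD)
    then show ?thesis using that by simp
  qed
  have a0: "a x = 0" if "x \<notin> e ` J" for x
    unfolding a_def using that by (intro sum.neutral) auto
  have er: "e ` J \<subseteq> rays" using h unfolding rays_def e_def by blast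
  have main: "a (coact g x) = a x" if g: "g \<in> H" and ax: "a x \<noteq> 0" for g x
  proof -
    have gA: "g \<in> Aut" using g H by blast
    let ?g0 = "v \<circ> (g \<circ> ?h)"
    have g0: "?g0 \<in> Aut" using Aut_comp[OF W_Aut[OF v(1)] Aut_comp[OF gA h]] .
    have cg0: "coact ?g0 y = v (coact g (coact ?h y))" for y
      using coact_comp[OF W_Aut[OF v(1)] Aut_comp[OF gA h]] coact_comp[OF gA h] coact_W[OF v(1)] by simp
    have fix0: "coact ?g0 l0 = l0" unfolding cg0 lh H(3)[OF g] by (simp add: l0_def)
    obtain j where j: "j \<in> J" "x = e j" "\<alpha> j \<bullet> l0 \<noteq> 0"
      using ax a0 ae by (metis floor_zero imageE)
    obtain w p where wp: "w \<in> W" "bij_betw p J J" "\<And>j. j \<in> J \<Longrightarrow> coact ?g0 (\<omega> j) = w (\<omega> (p j))"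
      using Aut_decomposition[OF g0] by metis
    define l1 where "l1 = (\<Sum>j\<in>J. (\<alpha> j \<bullet> l0) *\<^sub>R \<omega> (p j))"
    have pJ: "p j \<in> J" if "j \<in> J" for j using wp(2) that by (auto simp: bij_betw_def)
    have l1: "\<alpha> (p i) \<bullet> l1 = \<alpha> i \<bullet> l0" if i: "i \<in> J" for i
    proof -
      have "\<alpha> (p i) \<bullet> l1 = (\<Sum>j\<in>J. if i = j then \<alpha> j \<bullet> l0 else 0)"
        unfolding l1_def inner_sum_right using wp(2) i
        by (intro sum.cong) (auto simp: \<omega>_dual[OF pJ[OF i]] bij_betw_def dest: inj_onD)
      then show ?thesis using i by simp
    qed
    have surj: "\<exists>i\<in>J. k = p i" if "k \<in> J" for k using wp(2) that by (auto simp: bij_betw_def)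
    have d1: "dominant l1" unfolding dominant_def
    proof
      fix k assume "k \<in> J"
      then obtain i where "i \<in> J" "k = p i" using surj by blast
      then show "0 \<le> \<alpha> k \<bullet> l1" using l1 v(2) by (simp add: dominant_def l0_def)
    qed
    have "coact ?g0 l0 = (\<Sum>j\<in>J. (\<alpha> j \<bullet> l0) *\<^sub>R coact ?g0 (\<omega> j))"
      using arg_cong[OF \<omega>_expansion[of l0], of "coact ?g0"]
      by (simp add: linear_sum[OF linear_coact[OF g0]] linear_cmul[OF linear_coact[OF g0]])
    also have "\<dots> = w l1"
      using W_Aut[OF wp(1)] wp(3) by (simp add: l1_def Aut_iff linear_sum linear_cmul)
    finally have wl1: "w l1 = l0" using fix0 by simp
    have dl0: "dominant l0" using v(2) by (simp add: l0_def)
    have l10: "l1 = l0" using dominant_fixed[OF wp(1) d1, of l1] wl1 dl0 by simp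
    have "w (\<omega> (p j)) = \<omega> (p j)"
    proof (rule dominant_fixed[OF wp(1) d1])
      show "dominant (w l1)" using wl1 dl0 by simp
      fix i assume i: "i \<in> J" "\<alpha> i \<bullet> l1 = 0"
      have "i \<noteq> p j" using i l1[OF j(1)] j(3) by auto
      then show "\<alpha> i \<bullet> \<omega> (p j) = 0" using \<omega>_dual[OF i(1)] by simp
    qed
    then have "v (coact g x) = \<omega> (p j)" using wp(3)[OF j(1)] cg0 by (simp add: j(2) e_def)
    then have "coact g x = e (p j)"
      using coact_inv(1)[OF W_Aut[OF v(1)], of "coact g x"] coact_W[OF v(1)] by (simp add: e_def)
    then show ?thesis using ae pJ[OF j(1)] ae[OF j(1)] j(2) l1[OF j(1)] l10 by simp
  qed
  show ?thesis
  proof (rule that)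
    show "a x = 0" if "x \<notin> rays" for x using a0 er that by blast
    show "a (coact g x) = a x" if g: "g \<in> H" for g x
    proof (cases "a x = 0")
      case True
      have "coact (inv_into UNIV g) (coact g x) = x" using coact_inv(1) g H(1) by blast
      then show ?thesis using main[OF H(2)[OF g], of "coact g x"] True by metis
    qed (rule main[OF g])
    show "m \<bullet> l = (\<Sum>x\<in>rays. of_int (a x) * (m \<bullet> x))" for m
    proof -
      have "(\<Sum>x\<in>rays. of_int (a x) * (m \<bullet> x)) = (\<Sum>x\<in>e ` J. of_int (a x) * (m \<bullet> x))"
        using a0 er finite_rays by (intro sum.mono_neutral_right) auto
      also have "\<dots> = (\<Sum>j\<in>J. of_int (a (e j)) * (m \<bullet> e j))" using einj
        by (simp add: sum.reindex)
      also have "\<dots> = (\<Sum>j\<in>J. (\<alpha> j \<bullet> l0) * (m \<bullet> e j))"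
        using ae int by (intro sum.cong) auto
      also have "\<dots> = m \<bullet> coact ?h (\<Sum>j\<in>J. (\<alpha> j \<bullet> l0) *\<^sub>R \<omega> j)"
        by (simp add: linear_sum[OF linear_coact[OF h]] linear_cmul[OF linear_coact[OF h]] inner_sum_right e_def)
      finally show ?thesis using \<omega>_expansion[of l0] lh by simp
    qed
  qed
qed

end

section \<open>The fan of Weyl chambers\<close>

lemma root_lattice_linear_image:
  fixes \<Phi> :: "'a::euclidean_space set"
  assumes "linear g" "inj g" "g ` \<Phi> = \<Phi>" "v \<in> root_lattice \<Phi>"
  shows "g v \<in> root_lattice \<Phi>"
proof -
  obtain c :: "'a \<Rightarrow> int"
    where c: "v = (\<Sum>\<beta>\<in>\<Phi>. of_int (c \<beta>) *\<^sub>R \<beta>)"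
    using assms(4) by (auto simp: root_lattice_def)
  have "(\<Sum>\<beta>\<in>\<Phi>. of_int (c (inv_into UNIV g \<beta>)) *\<^sub>R \<beta>) = (\<Sum>\<beta>\<in>g ` \<Phi>. of_int (c (inv_into UNIV g \<beta>)) *\<^sub>R \<beta>)"
    using assms(3) by simp
  also have "\<dots> = (\<Sum>\<beta>\<in>\<Phi>. of_int (c \<beta>) *\<^sub>R g \<beta>)"
    using assms(2) by (simp add: sum.reindex inj_on_subset)
  also have "\<dots> = g v"
    by (simp add: c linear_sum[OF assms(1)] linear_cmul[OF assms(1)])
  finally show ?thesis
    unfolding root_lattice_def
    by (intro CollectI exI[of _ "\<lambda>\<beta>. c (inv_into UNIV g \<beta>)"]) simp
qed

context root_data
begin

abbreviation M where "M \<equiv> root_lattice \<Phi>"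

lemma root_lattice_simple: "M = {\<Sum>j\<in>J. of_int (a j) *\<^sub>R \<alpha> j | a. True}"
proof (intro equalityI subsetI)
  fix v assume "v \<in> M"
  then obtain c :: "'a \<Rightarrow> int"
    where c: "v = (\<Sum>\<beta>\<in>\<Phi>. of_int (c \<beta>) *\<^sub>R \<beta>)"
    by (auto simp: root_lattice_def)
  have "v \<bullet> \<omega> j \<in> \<int>" if "j \<in> J" for j
    unfolding c inner_sum_left using root_coeffs(1) that by (auto intro!: Ints_sum)
  then have "(\<Sum>j\<in>J. of_int \<lfloor>v \<bullet> \<omega> j\<rfloor> *\<^sub>R \<alpha> j) = (\<Sum>j\<in>J. (v \<bullet> \<omega> j) *\<^sub>R \<alpha> j)"
    by (intro sum.cong) auto
  then have "v = (\<Sum>j\<in>J. of_int \<lfloor>v \<bullet> \<omega> j\<rfloor> *\<^sub>R \<alpha> j)"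
    using \<alpha>_expansion[of v] by metis
  then show "v \<in> {\<Sum>j\<in>J. of_int (a j) *\<^sub>R \<alpha> j | a. True}"
    by (intro CollectI exI[of _ "\<lambda>j. \<lfloor>v \<bullet> \<omega> j\<rfloor>"]) simp
next
  fix v assume "v \<in> {\<Sum>j\<in>J. of_int (a j) *\<^sub>R \<alpha> j | a. True}"
  then obtain a where a: "v = (\<Sum>j\<in>J. of_int (a j) *\<^sub>R \<alpha> j)" by blast
  have "(\<Sum>\<beta>\<in>\<Phi>. of_int (\<Sum>j\<in>J. if \<alpha> j = \<beta> then a j else 0) *\<^sub>R \<beta>)
      = (\<Sum>\<beta>\<in>\<Phi>. \<Sum>j\<in>J. if \<alpha> j = \<beta> then of_int (a j) *\<^sub>R \<alpha> j else 0)"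
    unfolding of_int_sum scaleR_sum_left by (intro sum.cong) auto
  also have "\<dots> = (\<Sum>j\<in>J. \<Sum>\<beta>\<in>\<Phi>. if \<alpha> j = \<beta> then of_int (a j) *\<^sub>R \<alpha> j else 0)" by (rule sum.swap)
  also have "\<dots> = v" unfolding a using \<alpha>_root rs(1) by (intro sum.cong) auto
  finally show "v \<in> M"
    unfolding root_lattice_def
    by (intro CollectI exI[of _ "\<lambda>\<beta>. \<Sum>j\<in>J. if \<alpha> j = \<beta> then a j else 0"]) simp
qed

lemma Aut_M: "g \<in> Aut \<Longrightarrow> v \<in> M \<Longrightarrow> g v \<in> M"
  using root_lattice_linear_image[of g \<Phi> v] by (simp add: Aut_iff bij_is_inj)

lemma root_lattice_frame:
  assumes h: "h \<in> Aut" shows "M = {\<Sum>j\<in>J. of_int (a j) *\<^sub>R h (\<alpha> j) | a. True}"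
proof -
  have lin: "linear h" using h by (simp add: Aut_iff)
  have sum: "h (\<Sum>j\<in>J. of_int (a j) *\<^sub>R \<alpha> j) = (\<Sum>j\<in>J. of_int (a j) *\<^sub>R h (\<alpha> j))" for a :: "nat \<Rightarrow> int"
    by (simp add: linear_sum[OF lin] linear_cmul[OF lin])
  have "M = h ` M"
  proof
    show "h ` M \<subseteq> M" using Aut_M[OF h] by blast
    show "M \<subseteq> h ` M"
    proof
      fix v assume "v \<in> M"
      then have "inv_into UNIV h v \<in> M" using Aut_M[OF Aut_inv_into[OF h]] by blast
      moreover have "v = h (inv_into UNIV h v)" using h by (simp add: Aut_iff bij_is_surj surj_f_inv_f)
      ultimately show "v \<in> h ` M" by blast
    qed
  qed
  also have "\<dots> = {\<Sum>j\<in>J. of_int (a j) *\<^sub>R h (\<alpha> j) | a. True}"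
    unfolding root_lattice_simple sum[symmetric] by blast
  finally show ?thesis .
qed

lemma frame_dual: "h \<in> Aut \<Longrightarrow> j \<in> J \<Longrightarrow> k \<in> J \<Longrightarrow> h (\<alpha> j) \<bullet> coact h (\<omega> k) = (if j = k then 1 else 0)"
  by (simp add: coact_Aut \<omega>_dual)

subsection \<open>Faces of the chambers\<close>

definition chamber :: "('a \<Rightarrow> 'a) \<Rightarrow> 'a set" where
  "chamber h = {v. \<forall>j\<in>J. 0 \<le> h (\<alpha> j) \<bullet> v}"

lemma chamber_expansion:
  assumes h: "h \<in> Aut"
  shows "v = (\<Sum>j\<in>J. (h (\<alpha> j) \<bullet> v) *\<^sub>R coact h (\<omega> j))"
proof -
  let ?l = "coact (inv_into UNIV h) v"
  have v: "v = coact h ?l" using coact_inv(2)[OF h] by simp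
  have "coact h ?l = (\<Sum>j\<in>J. (\<alpha> j \<bullet> ?l) *\<^sub>R coact h (\<omega> j))"
    using arg_cong[OF \<omega>_expansion[of ?l], of "coact h"]
    by (simp add: linear_sum[OF linear_coact[OF h]] linear_cmul[OF linear_coact[OF h]])
  moreover have "\<alpha> j \<bullet> ?l = h (\<alpha> j) \<bullet> v" for j
    using coact_Aut[OF h, of "\<alpha> j" ?l] v by simp
  ultimately show ?thesis using v by simp
qed

lemma fundamental_chamber: "convex_cone hull (\<omega> ` J) = {v. dominant v}"
proof
  show "convex_cone hull (\<omega> ` J) \<subseteq> {v. dominant v}"
  proof (rule hull_minimal)
    show "convex_cone {v. dominant v}"
      by (auto simp: convex_cone_def convex_def conic_def dominant_def inner_add_right intro!: exI[of _ 0])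
  qed (auto simp: dominant_\<omega>)
  show "{v. dominant v} \<subseteq> convex_cone hull (\<omega> ` J)"
  proof
    fix v assume "v \<in> {v. dominant v}"
    then have v: "\<And>j. j \<in> J \<Longrightarrow> 0 \<le> \<alpha> j \<bullet> v"
      by (simp add: dominant_def)
    have "(\<Sum>j\<in>S. (\<alpha> j \<bullet> v) *\<^sub>R \<omega> j) \<in> convex_cone hull (\<omega> ` J)" if "finite S" "S \<subseteq> J" for S
      using that
    proof (induction S)
      case empty
      then show ?case by (simp add: convex_cone_hull_contains_0)
    next
      case (insert j S)
      then show ?case
        using v[of j] convex_cone_hull_add[OF convex_cone_hull_mul[OF hull_inc[of "\<omega> j" "\<omega> ` J" convex_cone]]]
        by simp
    qed
    then show "v \<in> convex_cone hull (\<omega> ` J)" using \<omega>_expansion[of v]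
      by (metis finite_J order_refl)
  qed
qed

lemma coact_fundamental_chamber:
  assumes h: "h \<in> Aut"
  shows "coact h ` (convex_cone hull (\<omega> ` J)) = chamber h"
proof -
  have "v \<in> chamber h \<longleftrightarrow> dominant (coact (inv_into UNIV h) v)" for v
    using coact_Aut[OF h, of _ "coact (inv_into UNIV h) v"] coact_inv(2)[OF h]
    by (simp add: chamber_def dominant_def)
  moreover have "coact h v \<in> chamber h \<longleftrightarrow> dominant v" for v
    using coact_Aut[OF h] by (simp add: chamber_def dominant_def)
  ultimately show ?thesis
    unfolding fundamental_chamber using coact_inv(2)[OF h] by (auto simp: image_iff) metis
qed

text \<open>
  Every \<open>v\<close> with a positive coefficient at a generator lies in the interior of a segment that
  starts at the generator and stays in the chamber.
\<close>

lemma face_generators: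
  assumes h: "h \<in> Aut" and f: "\<tau> face_of chamber h" and v: "v \<in> \<tau>"
    and j: "j \<in> J" "0 < h (\<alpha> j) \<bullet> v"
  shows "coact h (\<omega> j) \<in> \<tau>"
proof -
  let ?e = "coact h (\<omega> j)" and ?c = "h (\<alpha> j) \<bullet> v"
  define u where "u = 1 - min ?c 1 / 2"
  have u: "0 < u" "u < 1" "1 - u \<le> ?c" using j(2) by (auto simp: u_def)
  define q where "q = (1 / u) *\<^sub>R (v - (1 - u) *\<^sub>R ?e)"
  have vq: "v = (1 - u) *\<^sub>R ?e + u *\<^sub>R q" using u by (simp add: q_def)
  have "v \<in> chamber h" using face_of_imp_subset[OF f] v by blast
  then have "0 \<le> h (\<alpha> k) \<bullet> (v - (1 - u) *\<^sub>R ?e)" if "k \<in> J" for k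
    using that u frame_dual[OF h that j(1)] by (auto simp: chamber_def inner_diff_right)
  then have q: "q \<in> chamber h" using u by (simp add: chamber_def q_def)
  have e: "?e \<in> chamber h" using frame_dual[OF h _ j(1)] by (simp add: chamber_def)
  show ?thesis
  proof (cases "q = ?e")
    case True
    then have "v = ?e" using vq by (simp add: scaleR_left_distrib[symmetric])
    then show ?thesis using v by simp
  next
    case False
    then have "v \<in> open_segment ?e q" using u vq by (auto simp: in_segment)
    then show ?thesis using face_ofD[OF f _ e q v] by blast
  qed
qed

text \<open>
  A face is generated by the generators of the chamber that it contains.
\<close>

lemma face_dual:
  assumes h: "h \<in> Aut" and f: "\<tau> face_of chamber h"
  shows "dual_monoid M \<tau> = {m\<in>M. \<forall>j\<in>{j\<in>J. coact h (\<omega> j) \<in> \<tau>}. 0 \<le> m \<bullet> coact h (\<omega> j)}"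
proof -
  have "0 \<le> m \<bullet> v"
    if m: "\<forall>j\<in>{j\<in>J. coact h (\<omega> j) \<in> \<tau>}. 0 \<le> m \<bullet> coact h (\<omega> j)" and v: "v \<in> \<tau>" for m v
  proof -
    have "0 \<le> (h (\<alpha> j) \<bullet> v) * (m \<bullet> coact h (\<omega> j))" if j: "j \<in> J" for j
    proof (cases "0 < h (\<alpha> j) \<bullet> v")
      case True
      then show ?thesis using face_generators[OF h f v j] m j by auto
    next
      case False
      moreover have "v \<in> chamber h" using face_of_imp_subset[OF f] v by blast
      ultimately have "h (\<alpha> j) \<bullet> v = 0" using j by (force simp: chamber_def)
      then show ?thesis by simp
    qed
    then have "0 \<le> m \<bullet> (\<Sum>j\<in>J. (h (\<alpha> j) \<bullet> v) *\<^sub>R coact h (\<omega> j))"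
      by (simp add: inner_sum_right sum_nonneg)
    then show ?thesis using chamber_expansion[OF h, of v] by simp
  qed
  then show ?thesis unfolding dual_monoid_def by blast
qed

text \<open>
  The face with the generators \<open>K\<close> is where the simple roots outside \<open>K\<close> vanish.
\<close>

lemma face_exists:
  assumes h: "h \<in> Aut" and K: "K \<subseteq> J"
  shows "\<exists>\<tau>. \<tau> face_of chamber h \<and> \<tau> \<noteq> {} \<and> {j\<in>J. coact h (\<omega> j) \<in> \<tau>} = K"
proof -
  let ?t = "{v \<in> chamber h. \<forall>j\<in>J - K. h (\<alpha> j) \<bullet> v = 0}"
  have "?t face_of chamber h"
    unfolding face_of_def
  proof (intro conjI ballI impI)
    show "convex ?t"
      by (auto simp: convex_def chamber_def inner_add_right)
    fix x y v assume xy: "x \<in> chamber h" "y \<in> chamber h" "v \<in> ?t" "v \<in> open_segment x y"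
    then obtain u where u: "0 < u" "u < 1" "v = (1 - u) *\<^sub>R x + u *\<^sub>R y"
      by (auto simp: in_segment)
    have "h (\<alpha> j) \<bullet> x = 0 \<and> h (\<alpha> j) \<bullet> y = 0" if j: "j \<in> J - K" for j
    proof -
      have "0 \<le> h (\<alpha> j) \<bullet> x" "0 \<le> h (\<alpha> j) \<bullet> y" using xy j
        by (auto simp: chamber_def)
      moreover have "(1 - u) * (h (\<alpha> j) \<bullet> x) + u * (h (\<alpha> j) \<bullet> y) = 0"
      proof -
        have "h (\<alpha> j) \<bullet> v = 0" using xy(3) j by simp
        then show ?thesis unfolding u(3) by (simp add: inner_add_right)
      qed
      ultimately have "(1 - u) * (h (\<alpha> j) \<bullet> x) = 0 \<and> u * (h (\<alpha> j) \<bullet> y) = 0"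
        using u add_nonneg_eq_0_iff[of "(1 - u) * (h (\<alpha> j) \<bullet> x)" "u * (h (\<alpha> j) \<bullet> y)"] by simp
      then show ?thesis using u by simp
    qed
    then show "x \<in> ?t" "y \<in> ?t" using xy by auto
  qed auto
  moreover have "0 \<in> ?t" by (simp add: chamber_def)
  moreover have "coact h (\<omega> j) \<in> ?t \<longleftrightarrow> j \<in> K" if j: "j \<in> J" for j
    using frame_dual[OF h _ j] j by (auto simp: chamber_def split: if_splits)
  ultimately show ?thesis using K by (intro exI[of _ ?t]) blast
qed

text \<open>
  The cones are indexed by all automorphisms instead of the Weyl group elements. By
  \<open>Aut_decomposition\<close> this gives the same charts, and the action of an automorphism on the
  charts becomes multiplication of indices.
\<close>

lemma root_toric_variety_charts:
  "(root_toric_variety \<Phi> n \<alpha> :: ('a, 'k::field) group_algebra fract set set) =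
     {monoid_algebra {m\<in>M. \<forall>j\<in>K. 0 \<le> m \<bullet> coact h (\<omega> j)} | h K. h \<in> Aut \<and> K \<subseteq> J}"
proof -
  have duals: "dual_monoid M ` Weyl_fan \<Phi> n \<alpha> = {{m\<in>M. \<forall>j\<in>K. 0 \<le> m \<bullet> coact h (\<omega> j)} | h K. h \<in> Aut \<and> K \<subseteq> J}"
    (is "?L = ?R")
  proof (intro equalityI subsetI)
    fix S assume "S \<in> ?L"
    then obtain \<tau> w where \<tau>: "S = dual_monoid M \<tau>" "w \<in> W" "\<tau> face_of chamber w"
      using coact_fundamental_chamber[OF W_Aut] unfolding Weyl_fan_def J_def by auto
    then show "S \<in> ?R"
      using face_dual[OF W_Aut[OF \<tau>(2)] \<tau>(3)] W_Aut[OF \<tau>(2)]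
      by (intro CollectI exI[of _ w] exI[of _ "{j\<in>J. coact w (\<omega> j) \<in> \<tau>}"]) auto
  next
    fix S assume "S \<in> ?R"
    then obtain h K where S: "h \<in> Aut" "K \<subseteq> J" "S = {m\<in>M. \<forall>j\<in>K. 0 \<le> m \<bullet> coact h (\<omega> j)}" by blast
    obtain w p where wp: "w \<in> W" "bij_betw p J J" "\<And>j. j \<in> J \<Longrightarrow> coact h (\<omega> j) = w (\<omega> (p j))"
      using Aut_decomposition[OF S(1)] by metis
    have wA: "w \<in> Aut" using W_Aut[OF wp(1)] .
    have "p ` K \<subseteq> J" using wp(2) S(2) by (auto simp: bij_betw_def)
    from face_exists[OF wA this]
    obtain \<tau> where \<tau>: "\<tau> face_of chamber w" "\<tau> \<noteq> {}" "{j\<in>J. coact w (\<omega> j) \<in> \<tau>} = p ` K"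
      by blast
    have "\<tau> \<in> Weyl_fan \<Phi> n \<alpha>"
      unfolding Weyl_fan_def J_def[symmetric]
      using \<tau>(1,2) wp(1) by (intro CollectI conjI bexI[of _ w]) (simp_all only: coact_fundamental_chamber[OF wA] not_False_eq_True)
    moreover have "coact h (\<omega> j) = coact w (\<omega> (p j))" if "j \<in> K" for j
      using wp(3) S(2) that coact_W[OF wp(1)] by auto
    then have "S = dual_monoid M \<tau>"
      unfolding face_dual[OF wA \<tau>(1)] \<tau>(3) S(3) by simp
    ultimately show "S \<in> ?L" by blast
  qed
  have "root_toric_variety \<Phi> n \<alpha> = (monoid_algebra ` ?L :: ('a, 'k) group_algebra fract set set)"
    by (simp add: root_toric_variety_def toric_variety_def image_image)
  then show ?thesis unfolding duals by blast
qed

end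

section \<open>Quotients of permutation lattices\<close>

lemma Z_basis_of_iso:
  fixes A :: "('a, 'b) monoid_scheme" and h :: "('t \<Rightarrow>\<^sub>0 int) \<Rightarrow> 'a"
  assumes A: "comm_group A" and T: "finite T" and h: "h \<in> hom (free_Abelian_group T) A"
    and bij: "bij_betw h (carrier (free_Abelian_group T)) (carrier A)"
  shows "Z_basis A ((\<lambda>t. h (frag_of t)) ` T)"
proof -
  interpret A: comm_group A by (rule A)
  interpret h: group_hom "free_Abelian_group T" A h
    using h A by (intro group_hom.intro group_hom_axioms.intro) (auto simp: comm_group_def)
  let ?f = "\<lambda>t. h (frag_of t)"
  have fT: "?f t \<in> carrier A" if "t \<in> T" for t using that by (intro h.hom_closed) simp
  have inj: "inj_on ?f T"
  proof (rule inj_onI)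
    fix t t' assume "t \<in> T" "t' \<in> T" "?f t = ?f t'"
    then have "frag_of t = frag_of t'"
      using inj_onD[OF bij_betw_imp_inj_on[OF bij], of "frag_of t" "frag_of t'"] by simp
    then show "t = t'" by (simp only: frag_of_eq)
  qed
  let ?g = "\<lambda>c. \<Sum>t\<in>T. frag_cmul (c (?f t)) (frag_of t)"
  have look: "Poly_Mapping.lookup (\<Sum>t\<in>S. frag_cmul (c t) (frag_of t)) k = (if k \<in> S then c k else 0)"
    if "finite S" for c :: "'t \<Rightarrow> int" and S k
    using that by (induction S rule: finite_induct) (auto simp: lookup_add lookup_single)
  have keys: "Poly_Mapping.keys (\<Sum>t\<in>S. frag_cmul (c t) (frag_of t)) \<subseteq> S" if "finite S"
    for c :: "'t \<Rightarrow> int" and S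
  proof
    fix k assume "k \<in> Poly_Mapping.keys (\<Sum>t\<in>S. frag_cmul (c t) (frag_of t))"
    then show "k \<in> S" using look[OF that, of c k] by (cases "k \<in> S") (simp_all add: in_keys_iff)
  qed
  have fin: "finprod A (\<lambda>b. b [^]\<^bsub>A\<^esub> c b) (?f ` T) = h (?g c)"
    for c :: "'a \<Rightarrow> int"
  proof -
    have "finprod A (\<lambda>b. b [^]\<^bsub>A\<^esub> c b) (?f ` S) = h (\<Sum>t\<in>S. frag_cmul (c (?f t)) (frag_of t))" if "finite S" "S \<subseteq> T" for S
      using that
    proof (induction S)
      case empty
      then show ?case using h.hom_one by simp
    next
      case (insert t S)
      have t: "t \<in> T" "S \<subseteq> T" using insert.prems by auto
      have nin: "?f t \<notin> ?f ` S" using inj insert.hyps t by (auto dest: inj_onD)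
      have "finprod A (\<lambda>b. b [^]\<^bsub>A\<^esub> c b) (?f ` insert t S)
          = ?f t [^]\<^bsub>A\<^esub> c (?f t) \<otimes>\<^bsub>A\<^esub> finprod A (\<lambda>b. b [^]\<^bsub>A\<^esub> c b) (?f ` S)"
        unfolding image_insert using insert.hyps nin fT t
        by (intro A.finprod_insert) (auto intro!: A.int_pow_closed)
      also have "?f t [^]\<^bsub>A\<^esub> c (?f t) = h (frag_cmul (c (?f t)) (frag_of t))"
        using h.hom_int_pow[of "frag_of t" "c (?f t)"] t(1) by simp
      also have "finprod A (\<lambda>b. b [^]\<^bsub>A\<^esub> c b) (?f ` S) = h (\<Sum>t\<in>S. frag_cmul (c (?f t)) (frag_of t))"
        using insert t by blast
      also have "h (frag_cmul (c (?f t)) (frag_of t)) \<otimes>\<^bsub>A\<^esub> \<dots> =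
          h (frag_cmul (c (?f t)) (frag_of t) + (\<Sum>t\<in>S. frag_cmul (c (?f t)) (frag_of t)))"
        using h.hom_mult[of "frag_cmul (c (?f t)) (frag_of t)" "\<Sum>t\<in>S. frag_cmul (c (?f t)) (frag_of t)"]
          order_trans[OF keys[OF insert.hyps(1), of "\<lambda>t. c (?f t)"] t(2)]
          order_trans[OF keys_cmul[of "c (?f t)" "frag_of t"], of T] t(1) by simp
      finally show ?case using insert.hyps by simp
    qed
    then show ?thesis using T by blast
  qed
  have gb: "bij_betw ?g (?f ` T \<rightarrow>\<^sub>E UNIV) (carrier (free_Abelian_group T))"
    unfolding bij_betw_def
  proof (intro conjI inj_onI equalityI subsetI)
    fix c d assume cd: "c \<in> ?f ` T \<rightarrow>\<^sub>E UNIV" "d \<in> ?f ` T \<rightarrow>\<^sub>E UNIV" "?g c = ?g d"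
    have "c (?f t) = d (?f t)" if "t \<in> T" for t
      using look[OF T, of "\<lambda>t. c (?f t)" t] look[OF T, of "\<lambda>t. d (?f t)" t] cd(3) that by simp
    then show "c = d" using cd(1,2) by (intro PiE_ext[OF cd(1,2)]) auto
  next
    fix a assume "a \<in> ?g ` (?f ` T \<rightarrow>\<^sub>E UNIV)"
    then obtain c where "a = ?g c" by blast
    then show "a \<in> carrier (free_Abelian_group T)" using keys[OF T, of "\<lambda>t. c (?f t)"] by simp
  next
    fix a assume a: "a \<in> carrier (free_Abelian_group T)"
    let ?c = "\<lambda>b\<in>?f ` T. Poly_Mapping.lookup a (inv_into T ?f b)"
    have "?c (?f t) = Poly_Mapping.lookup a t" if "t \<in> T" for t
      using that inv_into_f_f[OF inj that] by simp
    then have "?g ?c = (\<Sum>t\<in>T. frag_cmul (Poly_Mapping.lookup a t) (frag_of t))"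
      by (intro sum.cong) auto
    also have "\<dots> = a" using look[OF T] a by (intro poly_mapping_eqI) (auto simp: in_keys_iff)
    finally show "a \<in> ?g ` (?f ` T \<rightarrow>\<^sub>E UNIV)" by (intro image_eqI[of _ _ ?c]) auto
  qed
  have "bij_betw (h \<circ> ?g) (?f ` T \<rightarrow>\<^sub>E UNIV) (carrier A)"
    using gb bij by (rule bij_betw_trans)
  moreover have "(\<lambda>c. finprod A (\<lambda>b. b [^]\<^bsub>A\<^esub> (c b :: int)) (?f ` T)) = h \<circ> ?g"
    by (rule ext) (simp add: fin)
  ultimately show ?thesis
    using T fT unfolding Z_basis_def by auto
qed

subsection \<open>First cohomology\<close>

lemma dual_lattice_simps:
  "f \<in> carrier (dual_lattice A) \<longleftrightarrow> f \<in> hom A integer_group \<and> f \<in> extensional (carrier A)"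
  "f \<otimes>\<^bsub>dual_lattice A\<^esub> h = (\<lambda>a\<in>carrier A. f a + h a)" "\<one>\<^bsub>dual_lattice A\<^esub> = (\<lambda>a\<in>carrier A. 0)"
  by (simp_all add: dual_lattice_def)

lemma hom_integer_iff: "f \<in> hom A integer_group \<longleftrightarrow> (\<forall>a\<in>carrier A. \<forall>c\<in>carrier A. f (a \<otimes>\<^bsub>A\<^esub> c) = f a + f c)"
  by (auto simp: hom_def)

context
  fixes A :: "('a, 'b) monoid_scheme"
  assumes A: "comm_group A"
begin

interpretation A: comm_group A by (rule A)

lemma dual_uminus: "f \<in> carrier (dual_lattice A) \<Longrightarrow> (\<lambda>a\<in>carrier A. - f a) \<in> carrier (dual_lattice A)"
  by (auto simp: dual_lattice_simps hom_integer_iff)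

lemma comm_group_dual: "comm_group (dual_lattice A)"
proof (rule comm_groupI)
  fix f assume f: "f \<in> carrier (dual_lattice A)"
  show "\<exists>h\<in>carrier (dual_lattice A). h \<otimes>\<^bsub>dual_lattice A\<^esub> f = \<one>\<^bsub>dual_lattice A\<^esub>"
    using dual_uminus[OF f] by (rule bexI[rotated]) (auto simp: dual_lattice_simps)
  show "\<one>\<^bsub>dual_lattice A\<^esub> \<otimes>\<^bsub>dual_lattice A\<^esub> f = f"
    using f by (auto simp: dual_lattice_simps extensional_def fun_eq_iff)
qed (auto simp: dual_lattice_simps hom_integer_iff add.assoc add.commute)

lemma inv_dual: "f \<in> carrier (dual_lattice A) \<Longrightarrow> inv\<^bsub>dual_lattice A\<^esub> f = (\<lambda>a\<in>carrier A. - f a)"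
  using comm_group_dual dual_uminus
  by (intro group.inv_equality) (auto simp: comm_group_def dual_lattice_simps)

end

lemma group_cocycles1:
  assumes G: "group G" and A: "comm_group A"
    and act: "\<And>g. g \<in> carrier G \<Longrightarrow> act g \<in> hom A A"
  shows "group (cocycles1 G A act)"
proof -
  interpret G: group G by (rule G)
  interpret A: comm_group A by (rule A)
  have actc: "act g a \<in> carrier A" if "g \<in> carrier G" "a \<in> carrier A" for g a
    using act[OF that(1)] that(2) by (auto simp: hom_def)
  have actm: "act g (a \<otimes>\<^bsub>A\<^esub> c) = act g a \<otimes>\<^bsub>A\<^esub> act g c"
    if "g \<in> carrier G" "a \<in> carrier A" "c \<in> carrier A" for g a c
    using act[OF that(1)] that(2,3) by (auto simp: hom_def)
  have acthom: "group_hom A A (act g)" if "g \<in> carrier G" for g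
    using act[OF that] by (intro group_hom.intro group_hom_axioms.intro) auto
  let ?Z = "cocycles1 G A act"
  have Z: "c \<in> carrier ?Z \<longleftrightarrow> c \<in> carrier G \<rightarrow>\<^sub>E carrier A \<and>
      (\<forall>g\<in>carrier G. \<forall>h\<in>carrier G. c (g \<otimes>\<^bsub>G\<^esub> h) = c g \<otimes>\<^bsub>A\<^esub> act g (c h))" for c
    by (simp add: cocycles1_def)
  have Zs: "c \<otimes>\<^bsub>?Z\<^esub> d = (\<lambda>g\<in>carrier G. c g \<otimes>\<^bsub>A\<^esub> d g)" "\<one>\<^bsub>?Z\<^esub> = (\<lambda>g\<in>carrier G. \<one>\<^bsub>A\<^esub>)" for c d
    by (simp_all add: cocycles1_def)
  have cc: "c g \<in> carrier A" if "c \<in> carrier ?Z" "g \<in> carrier G" for c g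
    using that by (auto simp: Z)
  have cm: "c (g \<otimes>\<^bsub>G\<^esub> h) = c g \<otimes>\<^bsub>A\<^esub> act g (c h)"
    if "c \<in> carrier ?Z" "g \<in> carrier G" "h \<in> carrier G" for c g h
    using that by (auto simp: Z)
  show ?thesis
  proof (rule groupI)
    fix c d assume c: "c \<in> carrier ?Z" and d: "d \<in> carrier ?Z"
    have "c (g \<otimes>\<^bsub>G\<^esub> h) \<otimes>\<^bsub>A\<^esub> d (g \<otimes>\<^bsub>G\<^esub> h) = (c g \<otimes>\<^bsub>A\<^esub> d g) \<otimes>\<^bsub>A\<^esub> act g (c h \<otimes>\<^bsub>A\<^esub> d h)"
      if "g \<in> carrier G" "h \<in> carrier G" for g h
      using that cc[OF c] cc[OF d] by (simp add: cm[OF c] cm[OF d] actm actc A.m_ac)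
    then show "c \<otimes>\<^bsub>?Z\<^esub> d \<in> carrier ?Z"
      using cc[OF c] cc[OF d] by (auto simp: Z Zs)
  next
    show "\<one>\<^bsub>?Z\<^esub> \<in> carrier ?Z"
      using group_hom.hom_one[OF acthom] by (auto simp: Z Zs)
  next
    fix c d e assume "c \<in> carrier ?Z" "d \<in> carrier ?Z" "e \<in> carrier ?Z"
    then show "c \<otimes>\<^bsub>?Z\<^esub> d \<otimes>\<^bsub>?Z\<^esub> e = c \<otimes>\<^bsub>?Z\<^esub> (d \<otimes>\<^bsub>?Z\<^esub> e)"
      using cc by (auto simp: Zs A.m_assoc)
  next
    fix c assume c: "c \<in> carrier ?Z"
    show "\<one>\<^bsub>?Z\<^esub> \<otimes>\<^bsub>?Z\<^esub> c = c"
      using c cc[OF c] by (intro extensionalityI[of _ "carrier G"]) (auto simp: Zs Z PiE_def)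
    let ?d = "\<lambda>g\<in>carrier G. inv\<^bsub>A\<^esub> (c g)"
    have "?d \<in> carrier ?Z"
      using cc[OF c] cm[OF c] actc by (auto simp: Z A.inv_mult group_hom.hom_inv[OF acthom])
    moreover have "?d \<otimes>\<^bsub>?Z\<^esub> c = \<one>\<^bsub>?Z\<^esub>"
      using cc[OF c] by (auto simp: Zs)
    ultimately show "\<exists>d\<in>carrier ?Z. d \<otimes>\<^bsub>?Z\<^esub> c = \<one>\<^bsub>?Z\<^esub>" by blast
  qed
qed

lemma trivial_Mod_self:
  assumes "group Z" shows "trivial_group (Z Mod carrier Z)"
proof -
  interpret group Z by (rule assms)
  have "carrier Z \<lhd> Z" by (rule normal_self) 
  then have "group (Z Mod carrier Z)" by (rule normal.factorgroup_is_group)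
  moreover have "carrier (Z Mod carrier Z) = {carrier Z}"
    using coset_join2[OF _ subgroup_self] one_closed unfolding carrier_FactGroup by (auto simp: image_iff)
  ultimately show ?thesis
    by (simp add: trivial_group_def FactGroup_def)
qed

text \<open>
  A group acts on a finite set \<open>R\<close>, and \<open>F\<close> is an equivariant quotient of the permutation
  lattice on \<open>R\<close>. The axioms of an action on \<open>F\<close> follow from those on \<open>R\<close>.
\<close>

locale permutation_quotient =
  fixes G :: "('g, 'x) monoid_scheme" and R :: "'r set" and \<sigma> :: "'g \<Rightarrow> 'r \<Rightarrow> 'r"
    and F :: "('f, 'w) monoid_scheme" and actF :: "'g \<Rightarrow> 'f \<Rightarrow> 'f"
      and q :: "('r \<Rightarrow>\<^sub>0 int) \<Rightarrow> 'f"
  assumes G: "group G" "finite (carrier G)" and R: "finite R"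
    and \<sigma>: "\<And>g. g \<in> carrier G \<Longrightarrow> inj (\<sigma> g)" "\<And>g. g \<in> carrier G \<Longrightarrow> \<sigma> g ` R = R"
      "\<And>g h l. g \<in> carrier G \<Longrightarrow> h \<in> carrier G \<Longrightarrow> \<sigma> (g \<otimes>\<^bsub>G\<^esub> h) l = \<sigma> g (\<sigma> h l)"
      "\<And>l. \<sigma> \<one>\<^bsub>G\<^esub> l = l"
    and F: "comm_group F"
    and q: "q \<in> epi (free_Abelian_group R) F"
    and equivariant: "\<And>g a. g \<in> carrier G \<Longrightarrow> Poly_Mapping.keys a \<subseteq> R \<Longrightarrow>
      q (frag_extend (\<lambda>l. frag_of (\<sigma> g l)) a) = actF g (q a)"
begin

interpretation G: group G by (rule G(1))
interpretation F: comm_group F by (rule F)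
interpretation q: group_hom "free_Abelian_group R" F q
  using q by (intro group_hom.intro group_hom_axioms.intro) (auto simp: epi_def)

abbreviation act where "act g \<equiv> frag_extend (\<lambda>l. frag_of (\<sigma> g l))"

text \<open>
  The functions on \<open>R\<close> are the elements of the dual of the permutation lattice.
\<close>

definition dualpair :: "('r \<Rightarrow> int) \<Rightarrow> ('r \<Rightarrow>\<^sub>0 int) \<Rightarrow> int" where
  "dualpair b x = (\<Sum>l\<in>R. b l * Poly_Mapping.lookup x l)"

lemma q_surj: "y \<in> carrier F \<Longrightarrow> \<exists>x. Poly_Mapping.keys x \<subseteq> R \<and> q x = y"
proof -
  assume "y \<in> carrier F"
  then have "y \<in> q ` carrier (free_Abelian_group R)" using q by (simp add: epi_def)
  then obtain x where "x \<in> carrier (free_Abelian_group R)" "y = q x" by blast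
  then show "\<exists>x. Poly_Mapping.keys x \<subseteq> R \<and> q x = y" by (intro exI[of _ x]) simp
qed

lemma q_add: "Poly_Mapping.keys x \<subseteq> R \<Longrightarrow> Poly_Mapping.keys y \<subseteq> R \<Longrightarrow> q (x + y) = q x \<otimes>\<^bsub>F\<^esub> q y"
  using q.hom_mult[of x y] by simp

lemma q_closed: "Poly_Mapping.keys x \<subseteq> R \<Longrightarrow> q x \<in> carrier F"
  using q.hom_closed[of x] by simp

lemma keys_act: "g \<in> carrier G \<Longrightarrow> Poly_Mapping.keys x \<subseteq> R \<Longrightarrow> Poly_Mapping.keys (act g x) \<subseteq> R"
  using keys_frag_extend[of "\<lambda>l. frag_of (\<sigma> g l)" x] \<sigma>(2)[of g] by fastforce

lemma lookup_act: "g \<in> carrier G \<Longrightarrow> Poly_Mapping.lookup (act g x) (\<sigma> g l) = Poly_Mapping.lookup x l"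
proof -
  assume "g \<in> carrier G"
  then have "Poly_Mapping.lookup (act g x) (\<sigma> g l) = (\<Sum>k\<in>Poly_Mapping.keys x. if k = l then Poly_Mapping.lookup x k else 0)"
    unfolding frag_extend_def lookup_sum using \<sigma>(1)
    by (intro sum.cong) (auto simp: lookup_single when_def inj_eq)
  then show ?thesis by (auto simp: in_keys_iff)
qed

lemma act_add: "act g (x + y) = act g x + act g y"
  by (rule frag_extend_add)

lemma act_comp: "g \<in> carrier G \<Longrightarrow> h \<in> carrier G \<Longrightarrow> act (g \<otimes>\<^bsub>G\<^esub> h) x = act g (act h x)"
proof -
  assume gh: "g \<in> carrier G" "h \<in> carrier G"
  show ?thesis
  proof (rule poly_mapping_eqI)
    fix k
    have "k = \<sigma> g (\<sigma> (inv\<^bsub>G\<^esub> g) k)" for k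
      using \<sigma>(3)[of g "inv\<^bsub>G\<^esub> g" k] \<sigma>(4) gh by simp
    moreover have "k = \<sigma> h (\<sigma> (inv\<^bsub>G\<^esub> h) k)" for k
      using \<sigma>(3)[of h "inv\<^bsub>G\<^esub> h" k] \<sigma>(4) gh by simp
    ultimately obtain l where l: "k = \<sigma> g (\<sigma> h l)" by metis
    have "Poly_Mapping.lookup (act (g \<otimes>\<^bsub>G\<^esub> h) x) (\<sigma> (g \<otimes>\<^bsub>G\<^esub> h) l) = Poly_Mapping.lookup x l"
      using gh by (intro lookup_act) auto
    also have "\<dots> = Poly_Mapping.lookup (act g (act h x)) (\<sigma> g (\<sigma> h l))" using gh
      by (simp add: lookup_act)
    finally show "Poly_Mapping.lookup (act (g \<otimes>\<^bsub>G\<^esub> h) x) k = Poly_Mapping.lookup (act g (act h x)) k"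
      using l \<sigma>(3)[OF gh] by simp
  qed
qed

lemma act_one: "act \<one>\<^bsub>G\<^esub> x = x"
  using \<sigma>(4) frag_expansion[of x] by simp

lemma dualpair_act: "g \<in> carrier G \<Longrightarrow> dualpair b (act g x) = dualpair (\<lambda>l. b (\<sigma> g l)) x"
proof -
  assume g: "g \<in> carrier G"
  have "dualpair b (act g x) = (\<Sum>l\<in>\<sigma> g ` R. b l * Poly_Mapping.lookup (act g x) l)"
    using \<sigma>(2)[OF g] by (simp add: dualpair_def)
  also have "\<dots> = (\<Sum>l\<in>R. b (\<sigma> g l) * Poly_Mapping.lookup (act g x) (\<sigma> g l))"
    using \<sigma>(1)[OF g] by (intro sum.reindex_cong[of "\<sigma> g"]) (auto intro: inj_on_subset)
  finally show ?thesis using lookup_act[OF g] by (simp add: dualpair_def)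
qed

lemma dualpair_add: "dualpair b (x + y) = dualpair b x + dualpair b y"
  by (simp add: dualpair_def lookup_add distrib_left sum.distrib)

lemma dualpair_diff: "dualpair b (x - y) = dualpair b x - dualpair b y"
  by (simp add: dualpair_def lookup_minus right_diff_distrib sum_subtractf)

lemma dualpair_diff_left: "dualpair (\<lambda>l. b l - a l) x = dualpair b x - dualpair a x"
  by (simp add: dualpair_def left_diff_distrib sum_subtractf)

lemma permutation_lattice_Div: "permutation_lattice G (free_Abelian_group R) act"
proof -
  have bas: "Z_basis (free_Abelian_group R) (frag_of ` R)"
    using Z_basis_of_iso[OF abelian_free_Abelian_group R, of "\<lambda>x. x" R]
    by (simp add: hom_def bij_betw_def)
  have "act g ` frag_of ` R = frag_of ` R" if "g \<in> carrier G" for g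
  proof -
    have "act g ` frag_of ` R = frag_of ` (\<sigma> g ` R)" by (simp add: image_image)
    then show ?thesis using \<sigma>(2)[OF that] by simp
  qed
  moreover have "G_lattice G (free_Abelian_group R) act"
    unfolding G_lattice_def using G(1) bas keys_act act_add act_one act_comp
    by (auto simp: abelian_free_Abelian_group hom_def)
  ultimately show ?thesis using bas unfolding permutation_lattice_def by blast
qed

lemma G_lattice_quotient:
  assumes "Z_basis F B" shows "G_lattice G F actF"
  unfolding G_lattice_def
proof (intro conjI ballI)
  show "\<exists>B. Z_basis F B" using assms by blast
  fix g assume g: "g \<in> carrier G"
  show "actF g \<in> hom F F"
  proof (rule homI)
    fix y assume "y \<in> carrier F"
    then obtain x where x: "Poly_Mapping.keys x \<subseteq> R" "q x = y" using q_surj by blast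
    then show "actF g y \<in> carrier F" using equivariant[OF g x(1)] q_closed[OF keys_act[OF g x(1)]] by simp
    fix y' assume "y' \<in> carrier F"
    then obtain x' where x': "Poly_Mapping.keys x' \<subseteq> R" "q x' = y'" using q_surj by blast
    have "Poly_Mapping.keys (x + x') \<subseteq> R" using keys_add[of x x'] x x' by blast
    then have "actF g (y \<otimes>\<^bsub>F\<^esub> y') = q (act g (x + x'))"
      using equivariant[OF g] q_add[OF x(1) x'(1)] x x' by simp
    then show "actF g (y \<otimes>\<^bsub>F\<^esub> y') = actF g y \<otimes>\<^bsub>F\<^esub> actF g y'"
      using q_add[OF keys_act[OF g x(1)] keys_act[OF g x'(1)]] equivariant[OF g] x x' by (simp add: act_add)
  qed
next
  fix y assume "y \<in> carrier F"
  then obtain x where x: "Poly_Mapping.keys x \<subseteq> R" "q x = y" using q_surj by blast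
  then show "actF \<one>\<^bsub>G\<^esub> y = y" using equivariant[OF G.one_closed x(1)]
    by (simp add: act_one)
  fix g h assume gh: "g \<in> carrier G" "h \<in> carrier G"
  then show "actF (g \<otimes>\<^bsub>G\<^esub> h) y = actF g (actF h y)"
    using equivariant[OF G.m_closed[OF gh] x(1)] equivariant[OF gh(2) x(1)]
      equivariant[OF gh(1) keys_act[OF gh(2) x(1)]] x(2) act_comp[OF gh] by simp
qed (rule G(1), rule F)

text \<open>
  The dual of \<open>F\<close> consists of the functions on \<open>R\<close> that vanish on the kernel of \<open>q\<close>. A cocycle
  with values there is the coboundary of some function \<open>b\<close> on \<open>R\<close>, because the first cohomology
  of a permutation lattice vanishes. As a functional on the kernel \<open>b\<close> is then \<open>H\<close>-invariant. By
  the premise \<open>lift\<close> it agrees on the kernel with an invariant function \<open>a\<close>, and \<open>b - a\<close> lies in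
  the dual of \<open>F\<close> and has the same coboundary as \<open>b\<close>.
\<close>

theorem H1_dual_trivial:
  assumes H: "subgroup H G" and lat: "G_lattice G F actF"
    and lift: "\<And>b. (\<And>g x. g \<in> H \<Longrightarrow> x \<in> kernel (free_Abelian_group R) F q \<Longrightarrow> dualpair (\<lambda>l. b (\<sigma> g l)) x = dualpair b x) \<Longrightarrow>
       \<exists>a. (\<forall>g\<in>H. \<forall>l\<in>R. a (\<sigma> g l) = a l) \<and> (\<forall>x\<in>kernel (free_Abelian_group R) F q. dualpair a x = dualpair b x)"
  shows "trivial_group (H1 (G\<lparr>carrier := H\<rparr>) (dual_lattice F) (dual_act G F actF))"
proof -
  let ?G = "G\<lparr>carrier := H\<rparr>" and ?D = "dual_lattice F" and ?a = "dual_act G F actF"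
  have HG: "H \<subseteq> carrier G" using H by (rule subgroup.subset)
  have gH: "group ?G" using subgroup.subgroup_is_group[OF H G(1)] .
  have invH: "inv\<^bsub>G\<^esub> g \<in> H" if "g \<in> H" for g using subgroup.m_inv_closed[OF H that] .
  have actc: "actF g y \<in> carrier F"
    and actm: "\<And>y'. y' \<in> carrier F \<Longrightarrow> actF g (y \<otimes>\<^bsub>F\<^esub> y') = actF g y \<otimes>\<^bsub>F\<^esub> actF g y'"
    if "g \<in> carrier G" "y \<in> carrier F" for g y
    using lat that unfolding G_lattice_def hom_def by auto
  have dact: "?a g \<in> hom ?D ?D" if g: "g \<in> carrier ?G" for g
  proof -
    have gi: "inv\<^bsub>G\<^esub> g \<in> carrier G" using g HG by auto
    show ?thesis
      by (rule homI) (use actc[OF gi] actm[OF gi] in \<open>auto simp: dual_act_def dual_lattice_simps hom_integer_iff\<close>)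
  qed
  have Z: "group (cocycles1 ?G ?D ?a)"
    by (rule group_cocycles1[OF gH comm_group_dual[OF F] dact])
  have cob: "c \<in> coboundaries1 ?G ?D ?a" if c: "c \<in> carrier (cocycles1 ?G ?D ?a)" for c
  proof -
    have cD: "c g \<in> carrier ?D" if "g \<in> H" for g using c that by (auto simp: cocycles1_def)
    have cext: "c \<in> extensional H" using c by (auto simp: cocycles1_def PiE_def)
    have cadd: "c g (y \<otimes>\<^bsub>F\<^esub> y') = c g y + c g y'"
      if "g \<in> H" "y \<in> carrier F" "y' \<in> carrier F" for g y y'
      using cD[OF that(1)] that(2,3) by (auto simp: dual_lattice_simps hom_integer_iff)
    have coc: "c (g \<otimes>\<^bsub>G\<^esub> h) y = c g y + c h (actF (inv\<^bsub>G\<^esub> g) y)"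
      if "g \<in> H" "h \<in> H" "y \<in> carrier F" for g h y
    proof -
      have "c (g \<otimes>\<^bsub>G\<^esub> h) = c g \<otimes>\<^bsub>?D\<^esub> ?a g (c h)" using c that
        by (simp add: cocycles1_def)
      then show ?thesis using that(3) by (simp add: dual_lattice_simps dual_act_def)
    qed
    define C where "C g l = c g (q (frag_of l))" for g l
    have qf: "q (frag_of l) \<in> carrier F" if "l \<in> R" for l using that by (intro q_closed) simp
    have cq: "c g (q x) = dualpair (C g) x" if g: "g \<in> H" and x: "Poly_Mapping.keys x \<subseteq> R"
      for g x
    proof -
      have hom: "group_hom (free_Abelian_group R) integer_group (c g \<circ> q)"
        using cD[OF g] q.group_hom_axioms
        by (intro group_hom.intro group_hom_axioms.intro)
           (auto simp: dual_lattice_simps intro: hom_compose[OF q.homh])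
      interpret cg: group_hom "free_Abelian_group R" integer_group "c g \<circ> q" by (rule hom)
      have kS: "Poly_Mapping.keys (\<Sum>l\<in>S. frag_cmul (Poly_Mapping.lookup x l) (frag_of l)) \<subseteq> S" for S
        using keys_sum[of "\<lambda>l. frag_cmul (Poly_Mapping.lookup x l) (frag_of l)" S]
        by (fastforce simp: keys_cmul_iff)
      have one: "c g (q (frag_cmul k (frag_of l))) = k * C g l" if "l \<in> R" for k l
        using cg.hom_int_pow[of "frag_of l" k] that by (simp add: C_def mult.commute)
      have "c g (q (\<Sum>l\<in>S. frag_cmul (Poly_Mapping.lookup x l) (frag_of l))) = (\<Sum>l\<in>S. C g l * Poly_Mapping.lookup x l)"
        if "finite S" "S \<subseteq> R" for S
        using that
      proof (induction S)
        case empty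
        then show ?case using cg.hom_one by simp
      next
        case (insert l S)
        have k1: "Poly_Mapping.keys (frag_cmul (Poly_Mapping.lookup x l) (frag_of l)) \<subseteq> R"
          using insert.prems keys_cmul[of "Poly_Mapping.lookup x l" "frag_of l"] by auto
        have "c g (q (frag_cmul (Poly_Mapping.lookup x l) (frag_of l) + (\<Sum>l\<in>S. frag_cmul (Poly_Mapping.lookup x l) (frag_of l))))
            = c g (q (frag_cmul (Poly_Mapping.lookup x l) (frag_of l))) + c g (q (\<Sum>l\<in>S. frag_cmul (Poly_Mapping.lookup x l) (frag_of l)))"
          using cg.hom_mult[of "frag_cmul (Poly_Mapping.lookup x l) (frag_of l)" "\<Sum>l\<in>S. frag_cmul (Poly_Mapping.lookup x l) (frag_of l)"]
            k1 order_trans[OF kS, of S R] insert.prems by simp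
        then show ?case using insert one by simp
      qed
      from this[OF R order_refl]
      have "c g (q (\<Sum>l\<in>R. frag_cmul (Poly_Mapping.lookup x l) (frag_of l))) = dualpair (C g) x"
        by (simp add: dualpair_def)
      moreover have "(\<Sum>l\<in>R. frag_cmul (Poly_Mapping.lookup x l) (frag_of l)) = x"
        using frag_expansion[of x] x R unfolding frag_extend_def
        by (subst sum.mono_neutral_right[of R "Poly_Mapping.keys x"]) (auto simp: in_keys_iff)
      ultimately show ?thesis by simp
    qed
    have Ccoc: "C (g \<otimes>\<^bsub>G\<^esub> h) l = C g l + C h (\<sigma> (inv\<^bsub>G\<^esub> g) l)"
      if "g \<in> H" "h \<in> H" "l \<in> R" for g h l
    proof -
      have "actF (inv\<^bsub>G\<^esub> g) (q (frag_of l)) = q (frag_of (\<sigma> (inv\<^bsub>G\<^esub> g) l))"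
        using equivariant[of "inv\<^bsub>G\<^esub> g" "frag_of l"] that HG by auto
      then show ?thesis using coc[OF that(1,2) qf[OF that(3)]] by (simp add: C_def)
    qed
    \<comment> \<open>Averaging solves the equation over the rationals. As \<open>C g l\<close> is an integer, the values of
      \<open>b0\<close> along an orbit agree modulo 1, so that rounding down does not change their differences.\<close>
    define N where "N = real (card H)"
    have finH: "finite H" using HG G(2) finite_subset by blast
    have N: "N > 0" using finH subgroup.one_closed[OF H] by (auto simp: N_def card_gt_0_iff)
    define b0 where "b0 l = - (\<Sum>h\<in>H. real_of_int (C h l)) / N" for l
    have b0: "b0 (\<sigma> (inv\<^bsub>G\<^esub> g) l) - b0 l = C g l" if g: "g \<in> H"
      and l: "l \<in> R" for g l
    proof -
      have "bij_betw (\<lambda>h. g \<otimes>\<^bsub>G\<^esub> h) H H"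
        using g HG invH subgroup.m_closed[OF H]
        by (intro bij_betwI[of _ _ _ "\<lambda>h. inv\<^bsub>G\<^esub> g \<otimes>\<^bsub>G\<^esub> h"]) (auto simp: G.m_assoc[symmetric] subset_iff)
      then have "(\<Sum>h\<in>H. real_of_int (C h l)) = (\<Sum>h\<in>H. real_of_int (C (g \<otimes>\<^bsub>G\<^esub> h) l))"
        by (rule sum.reindex_bij_betw[symmetric])
      also have "\<dots> = (\<Sum>h\<in>H. real_of_int (C g l) + real_of_int (C h (\<sigma> (inv\<^bsub>G\<^esub> g) l)))"
        using Ccoc[OF g _ l] by (intro sum.cong) auto
      also have "\<dots> = N * real_of_int (C g l) + (\<Sum>h\<in>H. real_of_int (C h (\<sigma> (inv\<^bsub>G\<^esub> g) l)))"
        by (simp add: sum.distrib N_def)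
      finally show ?thesis using N by (simp add: b0_def field_simps)
    qed
    define b where "b l = \<lfloor>b0 l\<rfloor>" for l
    have b: "b (\<sigma> (inv\<^bsub>G\<^esub> g) l) - b l = C g l" if "g \<in> H" "l \<in> R" for g l
    proof -
      have "b0 (\<sigma> (inv\<^bsub>G\<^esub> g) l) = b0 l + of_int (C g l)" using b0[OF that] by simp
      then show ?thesis by (simp add: b_def)
    qed
    have bC: "dualpair (\<lambda>l. b (\<sigma> (inv\<^bsub>G\<^esub> g) l)) x - dualpair b x = dualpair (C g) x" if "g \<in> H" for g x
      unfolding dualpair_diff_left[symmetric] unfolding dualpair_def
      using b[OF that] by (intro sum.cong) auto
    have "\<exists>a. (\<forall>g\<in>H. \<forall>l\<in>R. a (\<sigma> g l) = a l) \<and> (\<forall>x\<in>kernel (free_Abelian_group R) F q. dualpair a x = dualpair b x)"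
    proof (rule lift)
      fix g x assume g: "g \<in> H" and x: "x \<in> kernel (free_Abelian_group R) F q"
      have kx: "Poly_Mapping.keys x \<subseteq> R" "q x = \<one>\<^bsub>F\<^esub>" using x
        by (auto simp: kernel_def)
      have "c (inv\<^bsub>G\<^esub> g) \<one>\<^bsub>F\<^esub> = 0"
        using cadd[OF invH[OF g], of "\<one>\<^bsub>F\<^esub>" "\<one>\<^bsub>F\<^esub>"] by simp
      then have "dualpair (C (inv\<^bsub>G\<^esub> g)) x = 0" using cq[OF invH[OF g] kx(1)] kx(2) by simp
      then show "dualpair (\<lambda>l. b (\<sigma> g l)) x = dualpair b x"
        using bC[OF invH[OF g], of x] g HG by (auto simp: subset_iff)
    qed
    then obtain a where a: "\<And>g l. g \<in> H \<Longrightarrow> l \<in> R \<Longrightarrow> a (\<sigma> g l) = a l"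
      "\<And>x. x \<in> kernel (free_Abelian_group R) F q \<Longrightarrow> dualpair a x = dualpair b x"
        by blast
    define d where "d l = b l - a l" for l
    have dd: "dualpair d x = dualpair b x - dualpair a x" for x
      by (simp add: d_def dualpair_def left_diff_distrib sum_subtractf)
    define f where "f = (\<lambda>y\<in>carrier F. dualpair d (SOME x. Poly_Mapping.keys x \<subseteq> R \<and> q x = y))"
    have fq: "f (q x) = dualpair d x" if x: "Poly_Mapping.keys x \<subseteq> R" for x
    proof -
      let ?x = "SOME x'. Poly_Mapping.keys x' \<subseteq> R \<and> q x' = q x"
      have x': "Poly_Mapping.keys ?x \<subseteq> R \<and> q ?x = q x" by (rule someI[of _ x]) (use x in simp)
      have kd: "Poly_Mapping.keys (?x - x) \<subseteq> R" using keys_diff[of ?x x] x x' by blast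
      have "q ((?x - x) + x) = q (?x - x) \<otimes>\<^bsub>F\<^esub> q x" by (rule q_add[OF kd x])
      then have "q (?x - x) = \<one>\<^bsub>F\<^esub>"
        using x' q_closed[OF x] q_closed[OF kd] by (simp add: F.r_cancel_one')
      then have "?x - x \<in> kernel (free_Abelian_group R) F q" using kd by (simp add: kernel_def)
      then have "dualpair d (?x - x) = 0" using a(2) by (simp add: dd)
      then show ?thesis using q_closed[OF x] by (simp add: f_def dualpair_diff)
    qed
    have fD: "f \<in> carrier ?D"
      unfolding dual_lattice_simps hom_integer_iff
    proof (intro conjI ballI)
      show "f \<in> extensional (carrier F)" by (simp add: f_def)
      fix y y' assume "y \<in> carrier F" "y' \<in> carrier F"
      then obtain x x' where x: "Poly_Mapping.keys x \<subseteq> R" "q x = y" "Poly_Mapping.keys x' \<subseteq> R" "q x' = y'"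
        using q_surj by metis
      moreover have "Poly_Mapping.keys (x + x') \<subseteq> R" using keys_add[of x x'] x by blast
      ultimately show "f (y \<otimes>\<^bsub>F\<^esub> y') = f y + f y'"
        using fq q_add[OF x(1,3)] dualpair_add by metis
    qed
    have "c = (\<lambda>g\<in>carrier ?G. ?a g f \<otimes>\<^bsub>?D\<^esub> inv\<^bsub>?D\<^esub> f)"
    proof (rule extensionalityI[of _ H])
      fix g assume g: "g \<in> H"
      have "c g = ?a g f \<otimes>\<^bsub>?D\<^esub> inv\<^bsub>?D\<^esub> f"
      proof (rule extensionalityI[of _ "carrier F"])
        fix y assume y: "y \<in> carrier F"
        then obtain x where x: "Poly_Mapping.keys x \<subseteq> R" "q x = y" using q_surj by blast
        have gi: "inv\<^bsub>G\<^esub> g \<in> carrier G" using g HG by auto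
        have "f (actF (inv\<^bsub>G\<^esub> g) y) = dualpair d (act (inv\<^bsub>G\<^esub> g) x)"
          using equivariant[OF gi x(1)] x(2) fq[OF keys_act[OF gi x(1)]] by simp
        also have "\<dots> = dualpair (\<lambda>l. b (\<sigma> (inv\<^bsub>G\<^esub> g) l) - a l) x"
          unfolding dualpair_act[OF gi] unfolding dualpair_def d_def using a(1)[OF invH[OF g]]
          by (intro sum.cong) auto
        finally have "f (actF (inv\<^bsub>G\<^esub> g) y) - f y = dualpair (C g) x"
          using fq[OF x(1)] x(2) bC[OF g, of x] by (simp add: dd dualpair_diff_left)
        then show "c g y = (?a g f \<otimes>\<^bsub>?D\<^esub> inv\<^bsub>?D\<^esub> f) y"
          using y cq[OF g x(1)] x(2) by (simp add: inv_dual[OF F fD] dual_lattice_simps dual_act_def)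
      qed (use cD[OF g] in \<open>auto simp: dual_lattice_simps\<close>)
      then show "c g = (\<lambda>g\<in>carrier ?G. ?a g f \<otimes>\<^bsub>?D\<^esub> inv\<^bsub>?D\<^esub> f) g" using g by simp
    qed (use cext in auto)
    then show ?thesis using fD unfolding coboundaries1_def by blast
  qed
  moreover have "c \<in> carrier (cocycles1 ?G ?D ?a)" if cb: "c \<in> coboundaries1 ?G ?D ?a" for c
  proof -
    obtain f where f: "f \<in> carrier ?D" "c = (\<lambda>g\<in>H. ?a g f \<otimes>\<^bsub>?D\<^esub> inv\<^bsub>?D\<^esub> f)"
      using cb unfolding coboundaries1_def by auto
    have val: "c g = (\<lambda>y\<in>carrier F. f (actF (inv\<^bsub>G\<^esub> g) y) - f y)" if "g \<in> H"
      for g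
      using that f by (auto simp: inv_dual[OF F f(1)] dual_lattice_simps dual_act_def)
    have "c g \<in> carrier ?D" if g: "g \<in> H" for g
    proof -
      have gi: "inv\<^bsub>G\<^esub> g \<in> carrier G" using g HG by auto
      show ?thesis
        unfolding val[OF g] using f(1) actc[OF gi] actm[OF gi]
        by (auto simp: dual_lattice_simps hom_integer_iff)
    qed
    moreover have "c (g \<otimes>\<^bsub>G\<^esub> h) = c g \<otimes>\<^bsub>?D\<^esub> ?a g (c h)"
      if g: "g \<in> H" "h \<in> H" for g h
    proof -
      have gi: "inv\<^bsub>G\<^esub> g \<in> carrier G" "inv\<^bsub>G\<^esub> h \<in> carrier G"
        using g HG by auto
      have "actF (inv\<^bsub>G\<^esub> (g \<otimes>\<^bsub>G\<^esub> h)) y = actF (inv\<^bsub>G\<^esub> h) (actF (inv\<^bsub>G\<^esub> g) y)" if "y \<in> carrier F" for y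
        using lat gi that g HG unfolding G_lattice_def by (auto simp: G.inv_mult_group subset_iff)
      then show ?thesis
        unfolding val[OF subgroup.m_closed[OF H g]] val[OF g(1)] val[OF g(2)]
        using actc[OF gi(1)] by (auto simp: dual_lattice_simps dual_act_def)
    qed
    ultimately show ?thesis using f(2) by (auto simp: cocycles1_def)
  qed
  ultimately have "coboundaries1 ?G ?D ?a = carrier (cocycles1 ?G ?D ?a)" by blast
  then show ?thesis unfolding H1_def using trivial_Mod_self[OF Z] by simp
qed

end

section \<open>The flasque resolution of the root lattice\<close>

context smooth_fan
begin

text \<open>
  Every divisor is equivalent to exactly one without components in the rays of the cone \<open>i\<close>,
  since there is exactly one character with prescribed pairings with these rays.
\<close>

lemma Z_basis_Pic:
  assumes i: "i \<in> I"
  shows "Z_basis (Pic X) ((\<lambda>l. cls (frag_of l)) ` (R - e i ` J))"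
proof (rule Z_basis_of_iso[OF comm_group_Pic])
  let ?T = "R - e i ` J"
  show "finite ?T" using finite_R by simp
  show "cls \<in> hom (free_Abelian_group ?T) (Pic X)"
  proof (rule homI)
    fix a b assume "a \<in> carrier (free_Abelian_group ?T)" "b \<in> carrier (free_Abelian_group ?T)"
    then have "a \<in> carrier (free_Abelian_group R)" "b \<in> carrier (free_Abelian_group R)" by auto
    then show "cls (a \<otimes>\<^bsub>free_Abelian_group ?T\<^esub> b) = cls a \<otimes>\<^bsub>Pic X\<^esub> cls b"
      using hom_mult[OF cls_hom, of a b] by simp
  next
    fix a assume "a \<in> carrier (free_Abelian_group ?T)"
    then have "a \<in> carrier (free_Abelian_group R)" by auto
    then show "cls a \<in> carrier (Pic X)" using hom_in_carrier[OF cls_hom] by blast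
  qed
  interpret P: comm_group "Pic X" by (rule comm_group_Pic)
  have cl_add: "cls (a + b) = cls a \<otimes>\<^bsub>Pic X\<^esub> cls b"
    if "Poly_Mapping.keys a \<subseteq> R" "Poly_Mapping.keys b \<subseteq> R" for a b
    using hom_mult[OF cls_hom, of a b] that by simp
  have cl_in: "cls a \<in> carrier (Pic X)" if "Poly_Mapping.keys a \<subseteq> R" for a
    using hom_in_carrier[OF cls_hom, of a] that by simp
  show "bij_betw cls (carrier (free_Abelian_group ?T)) (carrier (Pic X))"
    unfolding bij_betw_def
  proof (intro conjI equalityI subsetI inj_onI)
    fix a b assume ab: "a \<in> carrier (free_Abelian_group ?T)" "b \<in> carrier (free_Abelian_group ?T)" "cls a = cls b"
    have k: "Poly_Mapping.keys a \<subseteq> R" "Poly_Mapping.keys b \<subseteq> R" using ab by auto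
    have kd: "Poly_Mapping.keys (a - b) \<subseteq> R" using keys_diff[of a b] k by blast
    have "cls a = cls (a - b) \<otimes>\<^bsub>Pic X\<^esub> cls b" using cl_add[OF kd k(2)] by simp
    then have "cls (a - b) = \<one>\<^bsub>Pic X\<^esub>" using ab(3) cl_in[OF kd] cl_in[OF k(2)]
      by (simp add: P.r_cancel_one')
    then obtain m where m: "m \<in> M" "a - b = ray_div m" using cls_eq_one_iff[OF kd] by blast
    have "m \<bullet> e i j = 0" if j: "j \<in> J" for j
    proof -
      have "Poly_Mapping.lookup a (e i j) = 0" "Poly_Mapping.lookup b (e i j) = 0"
        using ab(1,2) j by (auto simp: in_keys_iff subset_iff)
      then have "Poly_Mapping.lookup (ray_div m) (e i j) = 0" using m(2) by (metis diff_self lookup_minus)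
      then show ?thesis using M_R_int[OF m(1) e_in_R[OF i j]] e_in_R[OF i j] by (simp add: lookup_div)
    qed
    then have "m = 0" using coordinates(1)[OF i m(1)] by simp
    then have "a - b = 0" using m(2) by (simp add: ray_div_def)
    then show "a = b" by simp
  next
    fix y assume "y \<in> cls ` carrier (free_Abelian_group ?T)"
    then obtain a where "Poly_Mapping.keys a \<subseteq> ?T" "y = cls a" by auto
    then show "y \<in> carrier (Pic X)" using cl_in[of a] by blast
  next
    fix y assume "y \<in> carrier (Pic X)"
    then have "y \<in> cls ` carrier (free_Abelian_group R)" using cls_epi by (simp add: epi_def)
    then obtain a where a: "Poly_Mapping.keys a \<subseteq> R" "y = cls a" by auto
    \<comment> \<open>Subtracting the divisor of the character of \<open>a\<close> on the cone \<open>i\<close> removes the rays of this cone.\<close>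
    let ?d = "ray_div (local_char i a)"
    have kd: "Poly_Mapping.keys (a - ?d) \<subseteq> R" using keys_diff[of a ?d] keys_div a(1) by blast
    have "Poly_Mapping.lookup (a - ?d) (e i j) = 0" if j: "j \<in> J" for j
      using char_e[OF i j, of a] e_in_R[OF i j] by (simp add: lookup_minus lookup_div)
    then have "Poly_Mapping.keys (a - ?d) \<subseteq> ?T" using kd by (auto simp: in_keys_iff)
    moreover have "cls ?d = \<one>\<^bsub>Pic X\<^esub>" using cls_eq_one_iff[OF keys_div] char_in_M[OF i]
      by blast
    then have "y = cls (a - ?d)" using cl_add[OF kd keys_div, of "local_char i a"] cl_in[OF kd] a(2) by simp
    ultimately show "y \<in> cls ` carrier (free_Abelian_group ?T)" by auto
  qed
qed

end

context root_data
begin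

lemma smooth_fan_chambers:
  "smooth_fan M Aut J (\<lambda>h j. h (\<alpha> j)) (\<lambda>h j. coact h (\<omega> j)) (root_toric_variety \<Phi> n \<alpha> :: ('a, 'k::field) group_algebra fract set set)"
proof
  show "finite J" by simp
  show "Aut \<noteq> {}" using Aut_id by blast
  show "finite (\<Union>h\<in>Aut. (\<lambda>j. coact h (\<omega> j)) ` J)" using finite_Aut by simp
  show "h (\<alpha> j) \<bullet> coact h (\<omega> k) = (if j = k then 1 else 0)"
    if "h \<in> Aut" "j \<in> J" "k \<in> J" for h j k
    using frame_dual that .
  show "M = {\<Sum>j\<in>J. of_int (a j) *\<^sub>R h (\<alpha> j) | a. True}" if "h \<in> Aut" for h
    using root_lattice_frame that .
  show "coact h' (\<omega> k) \<in> (\<lambda>j. coact h (\<omega> j)) ` J"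
    if "h \<in> Aut" "h' \<in> Aut" "k \<in> J" "\<And>j. j \<in> J \<Longrightarrow> 0 \<le> h (\<alpha> j) \<bullet> coact h' (\<omega> k)" for h h' k
    using ray_in_chamber that .
qed (rule root_toric_variety_charts)

lemma comm_group_root_lattice: "comm_group (root_lattice_group \<Phi>)"
proof (rule comm_groupI)
  have add: "x + y \<in> M" if xy: "x \<in> M" "y \<in> M" for x y
  proof -
    obtain a b where ab: "x = (\<Sum>j\<in>J. of_int (a j) *\<^sub>R \<alpha> j)" "y = (\<Sum>j\<in>J. of_int (b j) *\<^sub>R \<alpha> j)"
      using xy unfolding root_lattice_simple by blast
    have "x + y = (\<Sum>j\<in>J. of_int (a j + b j) *\<^sub>R \<alpha> j)"
      by (simp add: ab scaleR_left_distrib sum.distrib)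
    then show ?thesis unfolding root_lattice_simple by (intro CollectI exI[of _ "\<lambda>j. a j + b j"]) simp
  qed
  show "x \<otimes>\<^bsub>root_lattice_group \<Phi>\<^esub> y \<in> carrier (root_lattice_group \<Phi>)"
    if "x \<in> carrier (root_lattice_group \<Phi>)" "y \<in> carrier (root_lattice_group \<Phi>)" for x y
    using add that by (simp add: root_lattice_group_def)
  show "\<one>\<^bsub>root_lattice_group \<Phi>\<^esub> \<in> carrier (root_lattice_group \<Phi>)"
    unfolding root_lattice_group_def root_lattice_simple by (auto intro!: exI[of _ "\<lambda>_. 0"])
  fix x assume "x \<in> carrier (root_lattice_group \<Phi>)"
  then obtain a where a: "x = (\<Sum>j\<in>J. of_int (a j) *\<^sub>R \<alpha> j)"
    unfolding root_lattice_group_def root_lattice_simple by auto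
  have "- x = (\<Sum>j\<in>J. of_int (- a j) *\<^sub>R \<alpha> j)" by (simp add: a sum_negf)
  then have "- x \<in> M" unfolding root_lattice_simple by (intro CollectI exI[of _ "\<lambda>j. - a j"]) simp
  then show "\<exists>y\<in>carrier (root_lattice_group \<Phi>). y \<otimes>\<^bsub>root_lattice_group \<Phi>\<^esub> x = \<one>\<^bsub>root_lattice_group \<Phi>\<^esub>"
    by (intro bexI[of _ "- x"]) (simp_all add: root_lattice_group_def)
qed (simp_all add: root_lattice_group_def add.assoc add.commute)

lemma Z_basis_root_lattice: "\<exists>B. Z_basis (root_lattice_group \<Phi>) B"
proof -
  let ?h = "\<lambda>a :: nat \<Rightarrow>\<^sub>0 int. \<Sum>j\<in>J. of_int (Poly_Mapping.lookup a j) *\<^sub>R \<alpha> j"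
  have "?h \<in> hom (free_Abelian_group J) (root_lattice_group \<Phi>)"
  proof (rule homI)
    fix a b
    show "?h a \<in> carrier (root_lattice_group \<Phi>)"
      unfolding root_lattice_group_def root_lattice_simple by auto
    show "?h (a \<otimes>\<^bsub>free_Abelian_group J\<^esub> b) = ?h a \<otimes>\<^bsub>root_lattice_group \<Phi>\<^esub> ?h b"
      by (simp add: root_lattice_group_def lookup_add scaleR_left_distrib sum.distrib)
  qed
  moreover have "bij_betw ?h (carrier (free_Abelian_group J)) (carrier (root_lattice_group \<Phi>))"
    unfolding bij_betw_def
  proof (intro conjI inj_onI equalityI subsetI)
    fix a b assume ab: "a \<in> carrier (free_Abelian_group J)" "b \<in> carrier (free_Abelian_group J)" "?h a = ?h b"
    show "a = b"
    proof (rule poly_mapping_eqI)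
      fix k show "Poly_Mapping.lookup a k = Poly_Mapping.lookup b k"
      proof (cases "k \<in> J")
        case True
        then have "real_of_int (Poly_Mapping.lookup a k) = real_of_int (Poly_Mapping.lookup b k)"
          using combination_coeff[OF True, of "\<lambda>j. of_int (Poly_Mapping.lookup a j)"]
            combination_coeff[OF True, of "\<lambda>j. of_int (Poly_Mapping.lookup b j)"] ab(3) by simp
        then show ?thesis by simp
      next
        case False
        then have "k \<notin> Poly_Mapping.keys a" "k \<notin> Poly_Mapping.keys b" using ab(1,2) by auto
        then show ?thesis by (simp add: in_keys_iff)
      qed
    qed
  next
    fix x assume "x \<in> ?h ` carrier (free_Abelian_group J)"
    then show "x \<in> carrier (root_lattice_group \<Phi>)"
      unfolding root_lattice_group_def root_lattice_simple by auto
  next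
    fix x assume "x \<in> carrier (root_lattice_group \<Phi>)"
    then obtain a where a: "x = (\<Sum>j\<in>J. of_int (a j) *\<^sub>R \<alpha> j)"
      unfolding root_lattice_group_def root_lattice_simple by auto
    let ?a = "\<Sum>j\<in>J. frag_cmul (a j) (frag_of j)"
    have look: "Poly_Mapping.lookup ?a k = (if k \<in> J then a k else 0)" for k
      by (rule lookup_sum_frag_of) simp
    have "x = ?h ?a" unfolding a by (intro sum.cong) (auto simp: look)
    moreover have "?a \<in> carrier (free_Abelian_group J)"
      by (simp add: subset_iff in_keys_iff look)
    ultimately show "x \<in> ?h ` carrier (free_Abelian_group J)" by blast
  qed
  ultimately show ?thesis
    using Z_basis_of_iso[OF comm_group_root_lattice finite_J] by blast
qed

lemma G_lattice_root_lattice: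
  assumes "group ((Aut_roots \<Phi>)\<lparr>carrier := G\<rparr>)" "G \<subseteq> Aut"
  shows "G_lattice ((Aut_roots \<Phi>)\<lparr>carrier := G\<rparr>) (root_lattice_group \<Phi>) (\<lambda>g. g)"
  unfolding G_lattice_def
proof (intro conjI ballI)
  fix g assume "g \<in> carrier ((Aut_roots \<Phi>)\<lparr>carrier := G\<rparr>)"
  then have g: "g \<in> Aut" using assms(2) by auto
  then show "g \<in> hom (root_lattice_group \<Phi>) (root_lattice_group \<Phi>)"
    using Aut_M[OF g] by (intro homI) (auto simp: root_lattice_group_def Aut_iff linear_add)
qed (use assms comm_group_root_lattice Z_basis_root_lattice in \<open>simp_all add: Aut_roots_def\<close>)

context
  fixes X :: "('a, 'k::field) group_algebra fract set set"
  assumes X: "X = root_toric_variety \<Phi> n \<alpha>"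
begin

interpretation fan: smooth_fan M Aut J "\<lambda>h j. h (\<alpha> j)" "\<lambda>h j. coact h (\<omega> j)" X
  unfolding X by (rule smooth_fan_chambers)

lemma fan_R: "fan.R = rays"
  by (simp add: fan.R_def rays_def)

lemma Aut_frames:
  assumes g: "g \<in> Aut" and h: "h \<in> Aut"
  shows "\<exists>h0\<in>Aut. \<forall>j\<in>J. h (\<alpha> j) = g (h0 (\<alpha> j)) \<and> coact h (\<omega> j) = coact g (coact h0 (\<omega> j))"
proof (intro bexI ballI)
  let ?h0 = "inv_into UNIV g \<circ> h"
  show h0: "?h0 \<in> Aut" using Aut_comp[OF Aut_inv_into[OF g] h] .
  have gh: "g \<circ> ?h0 = h" using Aut_inv_cancel(2)[OF g] by (simp add: comp_assoc[symmetric])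
  fix j
  show "h (\<alpha> j) = g (?h0 (\<alpha> j)) \<and> coact h (\<omega> j) = coact g (coact ?h0 (\<omega> j))"
    using coact_comp[OF g h0] gh by (metis comp_apply)
qed

lemma coact_rays: "g \<in> Aut \<Longrightarrow> coact g ` fan.R = fan.R"
  using fan.gd_R[of g "coact g"] inj_coact[of g] Aut_frames[of g] by (simp add: Aut_iff)

lemma pic_act_class:
  assumes g: "g \<in> Aut" and a: "Poly_Mapping.keys a \<subseteq> fan.R"
  shows "pic_act X (fract_act g) (fan.cls a) = fan.cls (frag_extend (\<lambda>l. frag_of (coact g l)) a)"
  using g by (intro fan.pic_act_cls[OF _ _ inj_coact[OF g] Aut_frames[OF g] a]) (simp_all add: Aut_iff)

lemma ray_div_add: "m \<in> M \<Longrightarrow> m' \<in> M \<Longrightarrow> fan.ray_div (m + m') = fan.ray_div m + fan.ray_div m'"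
proof (rule poly_mapping_eqI)
  fix l assume m: "m \<in> M" "m' \<in> M"
  show "Poly_Mapping.lookup (fan.ray_div (m + m')) l = Poly_Mapping.lookup (fan.ray_div m + fan.ray_div m') l"
  proof (cases "l \<in> fan.R")
    case True
    have "real_of_int \<lfloor>(m + m') \<bullet> l\<rfloor> = real_of_int (\<lfloor>m \<bullet> l\<rfloor> + \<lfloor>m' \<bullet> l\<rfloor>)"
      unfolding of_int_add fan.M_R_int[OF m(1) True] fan.M_R_int[OF m(2) True] fan.M_R_int[OF fan.M_add[OF m] True]
      by (rule inner_add_left)
    then show ?thesis using True by (simp only: fan.lookup_div lookup_add of_int_eq_iff if_True)
  qed (simp add: fan.lookup_div lookup_add)
qed

lemma ray_div_inj: "inj_on fan.ray_div M"
proof (rule inj_onI)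
  fix m m' assume m: "m \<in> M" "m' \<in> M" "fan.ray_div m = fan.ray_div m'"
  have "m = fan.local_char id (fan.ray_div m)" using fan.char_div[OF Aut_id m(1)] by simp
  also have "\<dots> = m'" using fan.char_div[OF Aut_id m(2)] m(3) by simp
  finally show "m = m'" .
qed

lemma ray_div_equivariant:
  assumes g: "g \<in> Aut"
  shows "fan.ray_div (g m) = frag_extend (\<lambda>l. frag_of (coact g l)) (fan.ray_div m)"
proof (rule poly_mapping_eqI)
  fix l
  have "l = coact g (coact (inv_into UNIV g) l)" using coact_inv(2)[OF g] by simp
  then obtain l' where l: "l = coact g l'" by blast
  have "l \<in> fan.R \<longleftrightarrow> l' \<in> fan.R"
    using coact_rays[OF g] inj_image_mem_iff[OF inj_coact[OF g], of l' fan.R] unfolding l by simp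
  then show "Poly_Mapping.lookup (fan.ray_div (g m)) l =
      Poly_Mapping.lookup (frag_extend (\<lambda>l. frag_of (coact g l)) (fan.ray_div m)) l"
    unfolding l lookup_frag_extend_inj[OF inj_coact[OF g]] by (simp add: fan.lookup_div coact_Aut[OF g])
qed

lemma permutation_quotient_Pic:
  assumes G: "subgroup G (Aut_roots \<Phi>)"
  shows "permutation_quotient ((Aut_roots \<Phi>)\<lparr>carrier := G\<rparr>) fan.R coact (Pic X) (\<lambda>g. pic_act X (fract_act g)) fan.cls"
proof (rule permutation_quotient.intro)
  have GA: "G \<subseteq> Aut" using G by (rule subgroup.subset)
  show "group ((Aut_roots \<Phi>)\<lparr>carrier := G\<rparr>)"
    using subgroup.subgroup_is_group[OF G group_Aut] .
  show "finite (carrier ((Aut_roots \<Phi>)\<lparr>carrier := G\<rparr>))"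
    using finite_subset[OF GA finite_Aut] by simp
  show "finite fan.R" by (rule fan.finite_R)
  fix g assume "g \<in> carrier ((Aut_roots \<Phi>)\<lparr>carrier := G\<rparr>)"
  then have g: "g \<in> Aut" using GA by auto
  show "inj (coact g)" using inj_coact[OF g] .
  show "coact g ` fan.R = fan.R" using coact_rays[OF g] .
  show "fan.cls (frag_extend (\<lambda>l. frag_of (coact g l)) a) = pic_act X (fract_act g) (fan.cls a)"
    if "Poly_Mapping.keys a \<subseteq> fan.R" for a
    using pic_act_class[OF g that] by simp
  fix h l assume "h \<in> carrier ((Aut_roots \<Phi>)\<lparr>carrier := G\<rparr>)"
  then have h: "h \<in> Aut" using GA by auto
  show "coact (g \<otimes>\<^bsub>(Aut_roots \<Phi>)\<lparr>carrier := G\<rparr>\<^esub> h) l = coact g (coact h l)"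
    using coact_comp[OF g h] by (simp add: Aut_simps)
next
  show "coact \<one>\<^bsub>(Aut_roots \<Phi>)\<lparr>carrier := G\<rparr>\<^esub> l = l" for l
    by (simp add: Aut_simps coact_id)
  show "comm_group (Pic X)" by (rule fan.comm_group_Pic)
  show "fan.cls \<in> epi (free_Abelian_group fan.R) (Pic X)" by (rule fan.cls_epi)
qed

text \<open>
  A function \<open>b\<close> on the rays defines the functional \<open>m \<mapsto> m \<bullet> lam\<close> on principal divisors, where
  \<open>lam\<close> is the sum of the vectors \<open>b l *\<^sub>R l\<close>. If the functional is \<open>H\<close>-invariant then so is the
  vector \<open>lam\<close>, to which \<open>invariant_lift\<close> applies.
\<close>

lemma flasque_Pic:
  assumes G: "subgroup G (Aut_roots \<Phi>)"
  shows "flasque ((Aut_roots \<Phi>)\<lparr>carrier := G\<rparr>) (Pic X) (\<lambda>g. pic_act X (fract_act g))"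
proof -
  let ?G = "(Aut_roots \<Phi>)\<lparr>carrier := G\<rparr>"
  interpret pq: permutation_quotient ?G fan.R coact "Pic X" "\<lambda>g. pic_act X (fract_act g)" fan.cls
    by (rule permutation_quotient_Pic[OF G])
  have GA: "G \<subseteq> Aut" using G by (rule subgroup.subset)
  have lat: "G_lattice ?G (Pic X) (\<lambda>g. pic_act X (fract_act g))"
    using pq.G_lattice_quotient[OF fan.Z_basis_Pic[OF Aut_id]] .
  have "trivial_group (H1 (?G\<lparr>carrier := H\<rparr>) (dual_lattice (Pic X)) (dual_act ?G (Pic X) (\<lambda>g. pic_act X (fract_act g))))"
    if H: "subgroup H ?G" for H
  proof (rule pq.H1_dual_trivial[OF H lat])
    fix b :: "'a \<Rightarrow> int"
    assume inv: "\<And>g x. g \<in> H \<Longrightarrow> x \<in> kernel (free_Abelian_group fan.R) (Pic X) fan.cls \<Longrightarrow>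
      pq.dualpair (\<lambda>l. b (coact g l)) x = pq.dualpair b x"
    have HA: "H \<subseteq> Aut" using subgroup.subset[OF H] GA by auto
    have Hinv: "inv_into UNIV g \<in> H" if g: "g \<in> H" for g
    proof -
      have "inv\<^bsub>?G\<^esub> g = inv\<^bsub>Aut_roots \<Phi>\<^esub> g"
        using group.m_inv_consistent[OF group_Aut G] subgroup.subset[OF H] g by auto
      then show ?thesis using subgroup.m_inv_closed[OF H g] Aut_inv g HA by auto
    qed
    have pair: "of_int (pq.dualpair c (fan.ray_div m)) = (\<Sum>l\<in>fan.R. of_int (c l) * (m \<bullet> l))" if "m \<in> M" for c m
      unfolding pq.dualpair_def of_int_sum using fan.M_R_int[OF that]
      by (intro sum.cong) (auto simp: fan.lookup_div)
    define lam where "lam = (\<Sum>l\<in>fan.R. of_int (b l) *\<^sub>R l)"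
    have mlam: "m \<bullet> lam = (\<Sum>l\<in>fan.R. of_int (b l) * (m \<bullet> l))" for m
      by (simp add: lam_def inner_sum_right)
    have \<alpha>M: "\<alpha> i \<in> M" if "i \<in> J" for i using fan.b_in_M[OF Aut_id that] by simp
    have int: "\<alpha> i \<bullet> lam \<in> \<int>" if "i \<in> J" for i
      unfolding mlam using fan.M_R_int[OF \<alpha>M[OF that]]
      by (intro Ints_sum Ints_mult) (metis Ints_of_int)+
    have fix_lam: "coact g lam = lam" if g: "g \<in> H" for g
    proof (rule eq_of_\<alpha>)
      fix i assume i: "i \<in> J"
      let ?k = "inv_into UNIV g"
      have gA: "g \<in> Aut" and kA: "?k \<in> Aut" using g Hinv HA by auto
      have "\<alpha> i \<bullet> coact g lam = (\<Sum>l\<in>fan.R. of_int (b l) * (\<alpha> i \<bullet> coact g l))"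
        by (simp add: lam_def linear_sum[OF linear_coact[OF gA]] linear_cmul[OF linear_coact[OF gA]] inner_sum_right)
      also have "\<dots> = (\<Sum>l\<in>fan.R. of_int (b (coact ?k l)) * (\<alpha> i \<bullet> l))"
        using coact_rays[OF gA] coact_rays[OF kA] coact_inv[OF gA]
        by (intro sum.reindex_bij_witness[of _ "coact ?k" "coact g"]) auto
      also have "\<dots> = of_int (pq.dualpair (\<lambda>l. b (coact ?k l)) (fan.ray_div (\<alpha> i)))"
        using pair[OF \<alpha>M[OF i]] by simp
      also have "pq.dualpair (\<lambda>l. b (coact ?k l)) (fan.ray_div (\<alpha> i)) = pq.dualpair b (fan.ray_div (\<alpha> i))"
        using inv[OF Hinv[OF g]] \<alpha>M[OF i] unfolding fan.cls_kernel by blast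
      also have "of_int \<dots> = \<alpha> i \<bullet> lam" unfolding mlam using pair[OF \<alpha>M[OF i]] .
      finally show "\<alpha> i \<bullet> coact g lam = \<alpha> i \<bullet> lam" .
    qed
    obtain a where a: "\<And>g x. g \<in> H \<Longrightarrow> a (coact g x) = a x" "\<And>m. m \<bullet> lam = (\<Sum>x\<in>rays. of_int (a x) * (m \<bullet> x))"
      using invariant_lift[OF int HA Hinv fix_lam] by metis
    have "pq.dualpair a x = pq.dualpair b x"
      if x: "x \<in> kernel (free_Abelian_group fan.R) (Pic X) fan.cls" for x
    proof -
      obtain m where m: "m \<in> M" "x = fan.ray_div m" using x unfolding fan.cls_kernel by blast
      have "real_of_int (pq.dualpair a x) = real_of_int (pq.dualpair b x)"
        unfolding m(2) pair[OF m(1)] using a(2)[of m] mlam[of m] by (simp add: fan_R)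
      then show ?thesis by simp
    qed
    then show "\<exists>a. (\<forall>g\<in>H. \<forall>l\<in>fan.R. a (coact g l) = a l) \<and>
        (\<forall>x\<in>kernel (free_Abelian_group fan.R) (Pic X) fan.cls. pq.dualpair a x = pq.dualpair b x)"
      using a(1) by blast
  qed
  then show ?thesis using lat by (simp add: flasque_def)
qed

theorem flasque_resolution_root_lattice:
  assumes G: "subgroup G (Aut_roots \<Phi>)"
  shows "flasque_resolution ((Aut_roots \<Phi>)\<lparr>carrier := G\<rparr>)
           (root_lattice_group \<Phi>) (\<lambda>g. g) (Div_roots \<Phi> n \<alpha>) Div_act
           (Pic X) (\<lambda>g. pic_act X (fract_act g)) (div_map \<Phi> n \<alpha>) (divisor_class X (ray_divisor_point M))"
proof -
  let ?G = "(Aut_roots \<Phi>)\<lparr>carrier := G\<rparr>"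
  interpret pq: permutation_quotient ?G fan.R coact "Pic X" "\<lambda>g. pic_act X (fract_act g)" fan.cls
    by (rule permutation_quotient_Pic[OF G])
  have GA: "G \<subseteq> Aut" using G by (rule subgroup.subset)
  have Div: "Div_roots \<Phi> n \<alpha> = free_Abelian_group fan.R"
    by (simp add: Div_roots_def ray_generators_rays fan_R)
  have act: "Div_act = (\<lambda>g. frag_extend (\<lambda>l. frag_of (coact g l)))"
    by (intro ext) (simp add: Div_act_def)
  have div: "div_map \<Phi> n \<alpha> = fan.ray_div"
    by (intro ext) (simp add: div_map_def fan.ray_div_def pairing_def ray_generators_rays fan_R)
  have cls: "divisor_class X (ray_divisor_point M) = fan.cls"
    by (intro ext) (simp add: fan.cls_def)
  have Mcar: "carrier (root_lattice_group \<Phi>) = M" by (simp add: root_lattice_group_def)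
  have "fan.ray_div \<in> mon (root_lattice_group \<Phi>) (free_Abelian_group fan.R)"
    unfolding mon_def
  proof (intro CollectI conjI homI)
    show "inj_on fan.ray_div (carrier (root_lattice_group \<Phi>))" unfolding Mcar by (rule ray_div_inj)
    show "fan.ray_div m \<in> carrier (free_Abelian_group fan.R)" for m using fan.keys_div by simp
    show "fan.ray_div (x \<otimes>\<^bsub>root_lattice_group \<Phi>\<^esub> y) = fan.ray_div x \<otimes>\<^bsub>free_Abelian_group fan.R\<^esub> fan.ray_div y"
      if "x \<in> carrier (root_lattice_group \<Phi>)" "y \<in> carrier (root_lattice_group \<Phi>)" for x y
      using ray_div_add that by (simp add: root_lattice_group_def)
  qed
  then show ?thesis
    unfolding flasque_resolution_def Div act div cls Mcar
    using G_lattice_root_lattice[OF pq.G(1) GA] pq.permutation_lattice_Div flasque_Pic[OF G] fan.cls_epi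
      fan.cls_kernel ray_div_equivariant pic_act_class GA
    by auto
qed

end

lemma div_map_orbits:
  "div_map \<Phi> n \<alpha> m = (\<Sum>j=1..n. \<Sum>l\<in>coweight_orbit \<Phi> n \<alpha> j. frag_cmul (pairing m l) (frag_of l))"
  unfolding div_map_def ray_generators_def
proof (rule sum.UNION_disjoint)
  show "\<forall>j\<in>{1..n}. finite (coweight_orbit \<Phi> n \<alpha> j)"
  proof
    fix j assume "j \<in> {1..n}"
    then have "coweight_orbit \<Phi> n \<alpha> j \<subseteq> rays"
      unfolding ray_generators_rays[symmetric] ray_generators_def by blast
    then show "finite (coweight_orbit \<Phi> n \<alpha> j)" using finite_rays finite_subset by blast
  qed
  show "\<forall>i\<in>{1..n}. \<forall>j\<in>{1..n}. i \<noteq> j \<longrightarrow> coweight_orbit \<Phi> n \<alpha> i \<inter> coweight_orbit \<Phi> n \<alpha> j = {}"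
    using coweight_orbits_disjoint unfolding J_def by blast
qed simp

end

theorem proposition6p1:
  fixes \<Phi> :: "'a::euclidean_space set"
    and n :: nat and \<alpha> :: "nat \<Rightarrow> 'a"
    and G :: "('a \<Rightarrow> 'a) set"
    and X :: "('a, 'k::field) group_algebra fract set set"
  assumes "X = root_toric_variety \<Phi> n \<alpha>"
    and "irreducible_root_system \<Phi>"
    and "simple_roots \<Phi> n \<alpha>"
    and "subgroup G (Aut_roots \<Phi>)"
  shows "flasque_resolution ((Aut_roots \<Phi>)\<lparr>carrier := G\<rparr>)
           (root_lattice_group \<Phi>) (\<lambda>g. g)
           (Div_roots \<Phi> n \<alpha>) Div_act
           (Pic X) (\<lambda>g. pic_act X (fract_act g))
           (div_map \<Phi> n \<alpha>)
           (divisor_class X (ray_divisor_point (root_lattice \<Phi>)))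
       \<and> (\<forall>i\<in>{1..n}. div_map \<Phi> n \<alpha> (\<alpha> i) =
             (\<Sum>j=1..n. \<Sum>l\<in>coweight_orbit \<Phi> n \<alpha> j. frag_cmul (pairing (\<alpha> i) l) (frag_of l)))"
proof -
  interpret root_data \<Phi> n \<alpha>
    using assms(2,3) by unfold_locales (simp_all add: irreducible_root_system_def)
  show ?thesis
    using flasque_resolution_root_lattice[OF assms(1,4)] div_map_orbits by blast
qed

end
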